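(* Let $\gamma$ be a real analytic null curve in $\mathbb E_1^3$ defined on (an open interval $(a,b)$ containing) a closed bounded interval $I$, let $\Omega_1\subset\mathbb C$ and $\Omega_2\subset\mathbb R^2$ be bounded domains containing $I$ (identified with $I\times\{0\}$) as described in the context, and let $X_{max}=X_{max,\gamma,0}:\overline{\Omega_1}\to\mathbb E_1^3$ be a maxface on $\Omega_1$ and $X_{min}=X_{min,\gamma,0}:\overline{\Omega_2}\to\mathbb E_1^3$ be a minface on $\Omega_2$, both having a folded singularity along $\gamma$. Then there exists a sequence $(L_n)_{n\ge 1}$ of null vector fields such that each pair $\{\gamma,L_n\}$ is singular Björling data for both constructions, and the surfaces $X_{max,\gamma,L,n}:=X_{max,\gamma,L_n}$ (on $\Omega_1$) and $X_{min,\gamma,L,n}:=X_{min,\gamma,L_n}$ (on $\Omega_2$) are, for every $n$, respectively a maxface and a minface, such that: (1) on the trace of $\gamma$, $X_{max,\gamma,L,n}$ and $X_{min,\gamma,L,n}$ have cuspidal crosscaps at the same points, in increasing number: for each $n$ the set of $u\in I$ such that $X_{max,\gamma,L,n}$ has a cuspidal crosscap at $(u,0)$ is finite and equals the set of $u\in I$ such that $X_{min,\gamma,L,n}$ has a cuspidal crosscap at $(u,0)$, and its cardinality is strictly increasing in $n$; (2) $\|X_{max,\gamma,L,n}-X_{max}\|_{\Omega_1}\to 0$ and $\|X_{min,\gamma,L,n}-X_{min}\|_{\Omega_2}\to 0$ as $n\to\infty$.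
   Context: $\mathbb E_1^3$ is $\mathbb R^3$ with the Lorentzian metric $\langle\cdot,\cdot\rangle=dx^2+dy^2-dz^2$. A vector is null if $\langle x,x\rangle=0$; a curve $\gamma$ is null if $\langle\gamma',\gamma'\rangle\equiv0$; a vector field $L$ is null if $\langle L,L\rangle\equiv0$ (zero vectors are allowed). Singular Björling data. A pair $\{\gamma,L\}$ with $\gamma$ a null curve and $L$ a null vector field along the same interval, both real analytic, with $\langle\gamma',L\rangle\equiv0$ and ($\gamma'\not\equiv0$ or $L\not\equiv0$). Maximal surface of the data. Let $W\subset\mathbb C$ be a simply connected open set, symmetric under complex conjugation, containing $I$, to which $\gamma$ and $L$ extend holomorphically. Let $g$ be the analytic extension of $(\gamma_1'+i\gamma_2')/\gamma_3'$ (if $\gamma_3'\not\equiv0$) or of $(L_1+iL_2)/L_3$ (if $L_3\not\equiv 0$), and assume $|g|\not\equiv1$. Then $$X_{max,\gamma,L}(u+iv)=\tfrac12\big(\gamma(u+iv)+\gamma(u-iv)\big)-\tfrac i2\int_{u-iv}^{u+iv}L(w)\,dw$$ is a generalized maximal (space-like zero mean curvature) surface with $X(u,0)=\gamma(u)$ and $X_v(u,0)=L(u)$. Time-like minimal surface of the data. If moreover $\gamma'\not\equiv\pm L$, then on $\Diamond_{a,b}=\{(u,v)\in\mathbb R^2: a<u+v<b,\ a<u-v<b\}$, where $(a,b)$ is the interval on which the data are defined, $$X_{min,\gamma,L}(u,v)=\tfrac12\big(\gamma(u+v)+\gamma(u-v)\big)+\tfrac12\int_{u-v}^{u+v}L(s)\,ds$$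 is a generalized time-like minimal surface with $X(u,0)=\gamma(u)$ and $X_v(u,0)=L(u)$. Domains. $\Omega_1$ is a bounded simply connected domain containing $I$, symmetric under conjugation, with $\overline{\Omega_1}\subset W$ for some simply connected open set $W\subset\mathbb C$, symmetric under complex conjugation, containing $I$, to which the given $\gamma$ extends holomorphically; $\Omega_2$ is a bounded simply connected domain containing $I\times\{0\}$ with $\overline{\Omega_2}\subset\Diamond_{a,b}$. The fields $L_n$ are to be defined on $(a,b)$ and to extend holomorphically to $W$. Maxface: a generalized maximal surface $X$ (locally $X=\mathrm{Re}\int(\tfrac12(1+g^2),\tfrac i2(1-g^2),-g)\,\omega$ with $g$ meromorphic, $\omega$ a holomorphic 1-form and $|g|\not\equiv1$) for which the holomorphic $\mathbb C^3$-valued 1-form $\partial X$ vanishes nowhere. Its singular points are those where $|g|=1$. Minface: a smooth map $X$ into $\mathbb E_1^3$ which near each point can be written, in suitable local coordinates $(t,s)$, as $X=\alpha(t)+\beta(s)$ with $\alpha,\beta$ null curves with nowhere vanishing derivative, and which is an immersion on an open dense set. Folded singularity: $X_{max,\gamma,L}$ (resp. $X_{min,\gamma,L}$) has a folded singularity along $\gamma$ if $L=0$ and $\gamma$ is non-degenerate, i.e. for every $u\in I$, $\gamma_2'\gamma_3''-\gamma_3'\gamma_2''\ne0$ or $\gamma_1'\gamma_2''-\gamma_2'\gamma_1''\neq0$ at $u$. Cuspidal crosscap: a smooth map $f$ from a surface to $\mathbb R^3$ has a cuspidal crosscap at $p$ if its germ at $p$ is equivalent, up to local diffeomorphisms of the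 source and of the target, to the germ at $0$ of $(x,y)\mapsto(x,y^2,xy^3)$. Norm: for a bounded simply connected domain $\Omega$ and $X\in C(\overline\Omega,\mathbb R^3)$, $\|X\|_\Omega=\sup_{z\in\overline\Omega}\max\{|X_1(z)|,|X_2(z)|,|X_3(z)|\}$. *)

theory Defs
  imports "HOL-Complex_Analysis.Complex_Analysis"
begin

section \<open>Smooth maps and map germs\<close>

text \<open>
  On an open set this is the class of \<open>n\<close> times continuously differentiable maps: all iterated
  directional derivatives are continuous.
\<close>

primrec Ck_on :: "nat \<Rightarrow> ('a::euclidean_space \<Rightarrow> 'b::euclidean_space) \<Rightarrow> 'a set \<Rightarrow> bool" where
  "Ck_on 0 f S \<longleftrightarrow> continuous_on S f"
| "Ck_on (Suc n) f S \<longleftrightarrow> (\<forall>x\<in>S. f differentiable (at x)) \<and>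
     (\<forall>v. Ck_on n (\<lambda>x. frechet_derivative f (at x) v) S)"

definition smooth_on :: "('a::euclidean_space \<Rightarrow> 'b::euclidean_space) \<Rightarrow> 'a set \<Rightarrow> bool" where
  "smooth_on f S \<longleftrightarrow> open S \<and> (\<forall>n. Ck_on n f S)"

definition diffeo_between ::
    "('a::euclidean_space \<Rightarrow> 'b::euclidean_space) \<Rightarrow> 'a set \<Rightarrow> 'b set \<Rightarrow> bool" where
  "diffeo_between f U V \<longleftrightarrow>
     bij_betw f U V \<and> smooth_on f U \<and> smooth_on (inv_into U f) V"

definition cuspidal_crosscap_model :: "real \<times> real \<Rightarrow> real ^ 3" where
  "cuspidal_crosscap_model = (\<lambda>(x, y). vector [x, y ^ 2, x * y ^ 3])"

definition cuspidal_crosscap_at :: "('a::euclidean_space \<Rightarrow> real ^ 3) \<Rightarrow> 'a \<Rightarrow> bool" where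
  "cuspidal_crosscap_at f p \<longleftrightarrow>
     (\<exists>U U' \<phi> V V' \<psi>.
        diffeo_between \<phi> U U' \<and> p \<in> U \<and> \<phi> p = (0 :: real \<times> real) \<and>
        diffeo_between \<psi> V V' \<and> f p \<in> V \<and> \<psi> (f p) = (0 :: real ^ 3) \<and>
        (\<forall>q\<in>U. f q \<in> V \<and> \<psi> (f q) = cuspidal_crosscap_model (\<phi> q)))"


section \<open>Curves in Lorentz-Minkowski space\<close>

definition lorentz :: "real ^ 3 \<Rightarrow> real ^ 3 \<Rightarrow> real" where
  "lorentz x y = x $ 1 * y $ 1 + x $ 2 * y $ 2 - x $ 3 * y $ 3"

definition null_vector :: "real ^ 3 \<Rightarrow> bool" where
  "null_vector x \<longleftrightarrow> lorentz x x = 0"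

definition real_analytic_on :: "(real \<Rightarrow> real ^ 3) \<Rightarrow> real set \<Rightarrow> bool" where
  "real_analytic_on f J \<longleftrightarrow>
     (\<forall>t\<in>J. \<exists>r>0. \<exists>c :: nat \<Rightarrow> real ^ 3. \<forall>s\<in>J. \<bar>s - t\<bar> < r \<longrightarrow>
        (\<lambda>n. (s - t) ^ n *\<^sub>R c n) sums f s)"

abbreviation velocity :: "(real \<Rightarrow> real ^ 3) \<Rightarrow> real \<Rightarrow> real ^ 3" where
  "velocity \<gamma> t \<equiv> vector_derivative \<gamma> (at t)"

definition null_curve_on :: "(real \<Rightarrow> real ^ 3) \<Rightarrow> real set \<Rightarrow> bool" where
  "null_curve_on \<gamma> J \<longleftrightarrow> (\<forall>t\<in>J. null_vector (velocity \<gamma> t))"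

definition null_field_on :: "(real \<Rightarrow> real ^ 3) \<Rightarrow> real set \<Rightarrow> bool" where
  "null_field_on L J \<longleftrightarrow> (\<forall>t\<in>J. null_vector (L t))"

definition nondegenerate_on :: "(real \<Rightarrow> real ^ 3) \<Rightarrow> real set \<Rightarrow> bool" where
  "nondegenerate_on \<gamma> I \<longleftrightarrow>
     (\<forall>u\<in>I. let d1 = velocity \<gamma> u; d2 = velocity (velocity \<gamma>) u in
        d1 $ 2 * d2 $ 3 - d1 $ 3 * d2 $ 2 \<noteq> 0 \<or> d1 $ 1 * d2 $ 2 - d1 $ 2 * d2 $ 1 \<noteq> 0)"

text \<open>
  The condition is the same for the maximal and the time-like minimal surface of
  the data \<open>\<gamma>\<close>, \<open>L\<close> given on \<open>J\<close>.
\<close>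

definition folded_singularity_along ::
    "real set \<Rightarrow> real set \<Rightarrow> (real \<Rightarrow> real ^ 3) \<Rightarrow> (real \<Rightarrow> real ^ 3) \<Rightarrow> bool" where
  "folded_singularity_along I J \<gamma> L \<longleftrightarrow> (\<forall>t\<in>J. L t = 0) \<and> nondegenerate_on \<gamma> I"


section \<open>Singular Bjoerling data\<close>

text \<open>
  Throughout, \<open>J\<close> is the open interval on which the data are given and \<open>I \<subseteq> J\<close> is the compact
  interval of interest.
\<close>

definition singular_bjorling_data ::
    "real set \<Rightarrow> (real \<Rightarrow> real ^ 3) \<Rightarrow> (real \<Rightarrow> real ^ 3) \<Rightarrow> bool" where
  "singular_bjorling_data J \<gamma> L \<longleftrightarrow>
     real_analytic_on \<gamma> J \<and> real_analytic_on L J \<and>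
     null_curve_on \<gamma> J \<and> null_field_on L J \<and>
     (\<forall>t\<in>J. lorentz (velocity \<gamma> t) (L t) = 0) \<and>
     ((\<exists>t\<in>J. velocity \<gamma> t \<noteq> 0) \<or> (\<exists>t\<in>J. L t \<noteq> 0))"

definition symmetric_sc_domain :: "real set \<Rightarrow> complex set \<Rightarrow> bool" where
  "symmetric_sc_domain I W \<longleftrightarrow>
     open W \<and> simply_connected W \<and> cnj ` W = W \<and> complex_of_real ` I \<subseteq> W"

definition hol_extension ::
    "real set \<Rightarrow> complex set \<Rightarrow> (real \<Rightarrow> real ^ 3) \<Rightarrow> (complex \<Rightarrow> complex ^ 3) \<Rightarrow> bool" where
  "hol_extension J W f F \<longleftrightarrow>
     (\<forall>k. (\<lambda>z. F z $ k) holomorphic_on W) \<and>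
     (\<forall>t\<in>J. complex_of_real t \<in> W \<longrightarrow> (\<forall>k. F (complex_of_real t) $ k = complex_of_real (f t $ k)))"

definition extends_hol :: "real set \<Rightarrow> complex set \<Rightarrow> (real \<Rightarrow> real ^ 3) \<Rightarrow> bool" where
  "extends_hol J W f \<longleftrightarrow> (\<exists>F. hol_extension J W f F)"

text \<open>
  If \<open>W\<close> is a domain meeting the open interval \<open>J\<close>, the values on \<open>W\<close> of the extension chosen here
  are unique by the identity theorem.
\<close>

definition complexify :: "real set \<Rightarrow> complex set \<Rightarrow> (real \<Rightarrow> real ^ 3) \<Rightarrow> complex \<Rightarrow> complex ^ 3" where
  "complexify J W f = (SOME F. hol_extension J W f F)"

text \<open>
  A meromorphic function in the sense of the library may take arbitrary values on a
  discrete set, so that the values of \<open>g\<close> are only meaningful where \<open>g\<close> is analytic. If both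
  quotients make sense they coincide, because orthogonal null vectors are proportional.
\<close>

definition bjorling_gauss_map ::
    "real set \<Rightarrow> complex set \<Rightarrow> (real \<Rightarrow> real ^ 3) \<Rightarrow> (real \<Rightarrow> real ^ 3) \<Rightarrow> (complex \<Rightarrow> complex) \<Rightarrow> bool" where
  "bjorling_gauss_map J W \<gamma> L g \<longleftrightarrow>
     g meromorphic_on W \<and>
     (\<forall>t\<in>J. complex_of_real t \<in> W \<and> velocity \<gamma> t $ 3 \<noteq> 0 \<longrightarrow>
        g (complex_of_real t) = Complex (velocity \<gamma> t $ 1) (velocity \<gamma> t $ 2) / complex_of_real (velocity \<gamma> t $ 3)) \<and>
     (\<forall>t\<in>J. complex_of_real t \<in> W \<and> L t $ 3 \<noteq> 0 \<longrightarrow>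
        g (complex_of_real t) = Complex (L t $ 1) (L t $ 2) / complex_of_real (L t $ 3))"

definition not_unimodular_on :: "(complex \<Rightarrow> complex) \<Rightarrow> complex set \<Rightarrow> bool" where
  "not_unimodular_on g W \<longleftrightarrow> (\<exists>z\<in>W. g analytic_on {z} \<and> cmod (g z) \<noteq> 1)"

definition bjorling_data_max ::
    "real set \<Rightarrow> real set \<Rightarrow> complex set \<Rightarrow> (real \<Rightarrow> real ^ 3) \<Rightarrow> (real \<Rightarrow> real ^ 3) \<Rightarrow> bool" where
  "bjorling_data_max I J W \<gamma> L \<longleftrightarrow>
     singular_bjorling_data J \<gamma> L \<and> symmetric_sc_domain I W \<and>
     extends_hol J W \<gamma> \<and> extends_hol J W L \<and>
     (\<exists>g. bjorling_gauss_map J W \<gamma> L g \<and> not_unimodular_on g W)"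

definition bjorling_data_min ::
    "real set \<Rightarrow> (real \<Rightarrow> real ^ 3) \<Rightarrow> (real \<Rightarrow> real ^ 3) \<Rightarrow> bool" where
  "bjorling_data_min J \<gamma> L \<longleftrightarrow>
     singular_bjorling_data J \<gamma> L \<and>
     (\<exists>t\<in>J. velocity \<gamma> t \<noteq> L t) \<and> (\<exists>t\<in>J. velocity \<gamma> t \<noteq> - L t)"


section \<open>The surfaces of the data\<close>

text \<open>
  For holomorphic \<open>h\<close> and simply connected \<open>W\<close> the integral does not depend on
  the path chosen.
\<close>

definition integral_in ::
    "complex set \<Rightarrow> complex \<Rightarrow> complex \<Rightarrow> (complex \<Rightarrow> complex) \<Rightarrow> complex" where
  "integral_in W z1 z2 h =
     contour_integral
       (SOME p. valid_path p \<and> path_image p \<subseteq> W \<and> pathstart p = z1 \<and> pathfinish p = z2) h"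

text \<open>
  The complex vector in the definition is already real, because the extensions commute with complex
  conjugation on the symmetric domain \<open>W\<close>; \<open>Re\<close> only adjusts the type.
\<close>

definition X_max ::
    "real set \<Rightarrow> complex set \<Rightarrow> (real \<Rightarrow> real ^ 3) \<Rightarrow> (real \<Rightarrow> real ^ 3) \<Rightarrow> complex \<Rightarrow> real ^ 3" where
  "X_max J W \<gamma> L z =
     (\<chi> k. Re ((complexify J W \<gamma> z $ k + complexify J W \<gamma> (cnj z) $ k) / 2
               - \<i> / 2 * integral_in W (cnj z) z (\<lambda>w. complexify J W L w $ k)))"

definition diamond :: "real set \<Rightarrow> (real \<times> real) set" where
  "diamond J = {(u, v). u + v \<in> J \<and> u - v \<in> J}"

definition X_min ::
    "(real \<Rightarrow> real ^ 3) \<Rightarrow> (real \<Rightarrow> real ^ 3) \<Rightarrow> real \<times> real \<Rightarrow> real ^ 3" where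
  "X_min \<gamma> L = (\<lambda>(u, v).
     (1 / 2) *\<^sub>R (\<gamma> (u + v) + \<gamma> (u - v)) + (1 / 2) *\<^sub>R (LBINT s=ereal (u - v)..ereal (u + v). L s))"


section \<open>Maxfaces and minfaces\<close>

definition weierstrass_density :: "complex \<Rightarrow> complex \<Rightarrow> complex ^ 3" where
  "weierstrass_density g w =
     vector [(1 + g ^ 2) / 2 * w, \<i> / 2 * (1 - g ^ 2) * w, - g * w]"

text \<open>
  Locally \<open>X = Re F\<close> for a holomorphic primitive \<open>F\<close> of the Weierstrass form with
  \<open>\<omega> = f dz\<close>. The neighbourhood \<open>U\<close> is connected, so that \<open>|g|\<close> is not identically 1 near the
  given point.
\<close>

definition generalized_maximal_surface :: "(complex \<Rightarrow> real ^ 3) \<Rightarrow> complex set \<Rightarrow> bool" where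
  "generalized_maximal_surface X \<Omega> \<longleftrightarrow> open \<Omega> \<and>
     (\<forall>p\<in>\<Omega>. \<exists>U g f (F :: complex \<Rightarrow> complex ^ 3).
        open U \<and> connected U \<and> p \<in> U \<and> U \<subseteq> \<Omega> \<and>
        g meromorphic_on U \<and> f holomorphic_on U \<and> not_unimodular_on g U \<and>
        (\<forall>k. (\<lambda>z. F z $ k) holomorphic_on U) \<and>
        (\<forall>z\<in>U. g analytic_on {z} \<longrightarrow>
           (\<forall>k. deriv (\<lambda>w. F w $ k) z = weierstrass_density (g z) (f z) $ k)) \<and>
        (\<forall>z\<in>U. \<forall>k. X z $ k = Re (F z $ k)))"

text \<open>The coefficient of \<open>dz\<close> in the form \<open>\<partial>X\<close>.\<close>

definition wirtinger :: "(complex \<Rightarrow> real ^ 3) \<Rightarrow> complex \<Rightarrow> complex ^ 3" where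
  "wirtinger X z =
     (\<chi> k. (complex_of_real (frechet_derivative X (at z) 1 $ k)
            - \<i> * complex_of_real (frechet_derivative X (at z) \<i> $ k)) / 2)"

definition maxface :: "(complex \<Rightarrow> real ^ 3) \<Rightarrow> complex set \<Rightarrow> bool" where
  "maxface X \<Omega> \<longleftrightarrow> generalized_maximal_surface X \<Omega> \<and> (\<forall>z\<in>\<Omega>. wirtinger X z \<noteq> 0)"

definition regular_null_curve_on :: "(real \<Rightarrow> real ^ 3) \<Rightarrow> real set \<Rightarrow> bool" where
  "regular_null_curve_on \<alpha> A \<longleftrightarrow>
     is_interval A \<and> smooth_on \<alpha> A \<and> null_curve_on \<alpha> A \<and> (\<forall>t\<in>A. velocity \<alpha> t \<noteq> 0)"

definition minface :: "(real \<times> real \<Rightarrow> real ^ 3) \<Rightarrow> (real \<times> real) set \<Rightarrow> bool" where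
  "minface X \<Omega> \<longleftrightarrow> smooth_on X \<Omega> \<and>
     (\<forall>p\<in>\<Omega>. \<exists>U \<phi> A B \<alpha> \<beta>.
        p \<in> U \<and> U \<subseteq> \<Omega> \<and> diffeo_between \<phi> U (A \<times> B) \<and>
        regular_null_curve_on \<alpha> A \<and> regular_null_curve_on \<beta> B \<and>
        (\<forall>q\<in>U. X q = \<alpha> (fst (\<phi> q)) + \<beta> (snd (\<phi> q)))) \<and>
     (\<exists>D\<subseteq>\<Omega>. open D \<and> \<Omega> \<subseteq> closure D \<and> (\<forall>p\<in>D. inj (frechet_derivative X (at p))))"


section \<open>The uniform norm\<close>

definition sup_norm_on :: "'a::topological_space set \<Rightarrow> ('a \<Rightarrow> real ^ 3) \<Rightarrow> real" where
  "sup_norm_on \<Omega> X =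
     (SUP z\<in>closure \<Omega>. max \<bar>X z $ 1\<bar> (max \<bar>X z $ 2\<bar> \<bar>X z $ 3\<bar>))"

end

theory Submission
  imports Defs
begin

text \<open>
  Take \<open>L\<^sub>n = \<epsilon>\<^sub>n p\<^sub>n \<gamma>'\<close> with \<open>p\<^sub>n\<close> a polynomial having exactly \<open>n\<close> simple zeros in \<open>I\<close> and \<open>\<epsilon>\<^sub>n\<close>
  tending to \<open>0\<close> so fast that both surfaces converge uniformly. Multiplying the velocity by a small function does
  not affect regularity, and the surfaces remain a maxface and a minface. Along \<open>\<gamma>\<close> both surfaces are restrictions of the
  holomorphic map \<open>(\<gamma>(u + \<kappa> v) + \<gamma>(u - \<kappa> v)) / 2 + (\<Lambda>(u + \<kappa> v) - \<Lambda>(u - \<kappa> v)) / (2 \<kappa>)\<close>, where \<open>\<Lambda>' = L\<close> and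
  \<open>\<kappa> = \<i>\<close> for the maximal and \<open>\<kappa> = 1\<close> for the time-like minimal surface, so that a single normal form argument
  decides the type of the singularity: where \<open>L\<close> has a simple zero the germ is a cuspidal crosscap, and where \<open>L\<close> does
  not vanish the surface is injective nearby, unlike a cuspidal crosscap.
\<close>

section \<open>Smooth maps\<close>

text \<open>Two obstacles shape the proof. A cuspidal crosscap asks for smooth coordinate changes of
  source and target, and building them among smooth maps would need division with parameters and
  Whitney's theorem on even functions. As the data are real analytic, everything is done with germs
  of holomorphic functions of two complex variables that commute with conjugation: division and the
  splitting into even and odd parts become explicit Cauchy integrals, inverses come from the inverse
  function theorem, and the real restrictions are smooth automatically. The second obstacle is that
  a minface has some characteristic coordinates near each point, not necessarily u + v and u - v;
  that the velocity is nonzero at u + v and u - v must be derived before it may be rescaled.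
  Bounding the factor of the field by 1 serves both surfaces: \<open>1 + \<epsilon> p\<close> and
  \<open>1 - \<epsilon> p\<close> as well as \<open>1 - \<i> \<epsilon> P\<close> stay nonzero. The
  zeros of \<open>p\<close> enter through a single coefficient of the normal form, which along the
  curve is a nonvanishing multiple of the factor.\<close>

lemma Ck_on_cong:
  assumes "open S" "\<And>x. x \<in> S \<Longrightarrow> f x = g x"
  shows "Ck_on n f S \<longleftrightarrow> Ck_on n g S"
  using assms(2)
proof (induction n arbitrary: f g)
  case 0
  then show ?case unfolding Ck_on.simps by (intro continuous_on_cong) auto
next
  case (Suc n)
  have ev: "(f has_derivative D) (at x) \<longleftrightarrow> (g has_derivative D) (at x)" if "x \<in> S" for x D
    using has_derivative_transform_within_open[OF _ assms(1) that, of f D UNIV g]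
      has_derivative_transform_within_open[OF _ assms(1) that, of g D UNIV f] Suc.prems by auto
  have 1: "f differentiable (at x) \<longleftrightarrow> g differentiable (at x)" if "x \<in> S" for x
    unfolding differentiable_def using ev[OF that] by simp
  have 2: "frechet_derivative f (at x) = frechet_derivative g (at x)" if "x \<in> S" for x
    unfolding frechet_derivative_def using ev[OF that] by simp
  have "Ck_on n (\<lambda>x. frechet_derivative f (at x) v) S = Ck_on n (\<lambda>x. frechet_derivative g (at x) v) S" for v
    by (rule Suc.IH) (simp add: 2)
  then show ?case
    unfolding Ck_on.simps using 1 by blast
qed

text \<open>Lets a derivative computed by hand replace the chosen \<open>frechet_derivative\<close>
  in the recursion; the smoothness inductions below run through this rule.\<close>

lemma Ck_on_derivative:
  assumes "open S" "\<And>x. x \<in> S \<Longrightarrow> (f has_derivative f' x) (at x)"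
    "\<And>v. Ck_on n (\<lambda>x. f' x v) S"
  shows "Ck_on (Suc n) f S"
proof -
  have "frechet_derivative f (at x) = f' x" if "x \<in> S" for x
    using assms(2)[OF that] frechet_derivative_at by metis
  then have "Ck_on n (\<lambda>x. frechet_derivative f (at x) v) S" for v
    using assms(3)[of v]
      Ck_on_cong[OF assms(1), of "\<lambda>x. frechet_derivative f (at x) v" "\<lambda>x. f' x v" n] by simp
  then show ?thesis
    using assms(2) by (auto simp: differentiable_def)
qed

lemma Ck_on_SucD:
  assumes "Ck_on (Suc n) f S" "x \<in> S"
  shows "(f has_derivative frechet_derivative f (at x)) (at x)"
  using assms by (simp add: frechet_derivative_works[symmetric])

lemma Ck_on_subset: "Ck_on n f S \<Longrightarrow> T \<subseteq> S \<Longrightarrow> Ck_on n f T"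
proof (induction n arbitrary: f)
  case 0
  then show ?case by (simp add: continuous_on_subset)
next
  case (Suc n)
  then show ?case unfolding Ck_on.simps by blast
qed

lemma Ck_on_local:
  assumes "\<And>x. x \<in> S \<Longrightarrow> \<exists>T. open T \<and> x \<in> T \<and> Ck_on n f T"
  shows "Ck_on n f S"
  using assms
proof (induction n arbitrary: f)
  case 0
  have "continuous (at x within S) f" if "x \<in> S" for x
    using 0[OF that] unfolding Ck_on.simps
    by (metis continuous_on_eq_continuous_at continuous_at_imp_continuous_within)
  then show ?case by (simp add: continuous_on_eq_continuous_within)
next
  case (Suc n)
  show ?case
    unfolding Ck_on.simps
  proof (intro conjI ballI allI)
    show "f differentiable (at x)" if "x \<in> S" for x
      using Suc.prems[OF that] by auto
    show "Ck_on n (\<lambda>x. frechet_derivative f (at x) v) S" for v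
    proof (rule Suc.IH)
      show "\<exists>T. open T \<and> x \<in> T \<and> Ck_on n (\<lambda>x. frechet_derivative f (at x) v) T" if "x \<in> S" for x
        using Suc.prems[OF that] unfolding Ck_on.simps by blast
    qed
  qed
qed

lemma Ck_on_add:
  assumes "open S"
  shows "Ck_on n f S \<Longrightarrow> Ck_on n g S \<Longrightarrow> Ck_on n (\<lambda>x. f x + g x) S"
proof (induction n arbitrary: f g)
  case 0
  then show ?case by (simp add: continuous_on_add)
next
  case (Suc n)
  show ?case
  proof (rule Ck_on_derivative[OF assms])
    show "((\<lambda>x. f x + g x) has_derivative
        (\<lambda>v. frechet_derivative f (at x) v + frechet_derivative g (at x) v)) (at x)" if "x \<in> S" for x
      using Suc.prems that by (intro has_derivative_add Ck_on_SucD)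
    show "Ck_on n (\<lambda>x. frechet_derivative f (at x) v + frechet_derivative g (at x) v) S" for v
      by (rule Suc.IH) (use Suc.prems in simp_all)
  qed
qed

lemma Ck_on_const: "open S \<Longrightarrow> Ck_on n (\<lambda>_. c) S"
proof (induction n arbitrary: c)
  case (Suc n)
  show ?case
    by (rule Ck_on_derivative[OF Suc.prems has_derivative_const]) (rule Suc.IH[OF Suc.prems])
qed simp

lemma Ck_on_bounded_linear_comp:
  assumes "open S" "bounded_linear T"
  shows "Ck_on n f S \<Longrightarrow> Ck_on n (\<lambda>x. T (f x)) S"
proof (induction n arbitrary: f)
  case 0
  then show ?case by (simp add: bounded_linear.continuous_on[OF assms(2)])
next
  case (Suc n)
  show ?case
  proof (rule Ck_on_derivative[OF assms(1)])
    show "((\<lambda>x. T (f x)) has_derivative (\<lambda>v. T (frechet_derivative f (at x) v))) (at x)" if "x \<in> S" for x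
      using Suc.prems that by (intro bounded_linear.has_derivative[OF assms(2)] Ck_on_SucD)
    show "Ck_on n (\<lambda>x. T (frechet_derivative f (at x) v)) S" for v
      by (rule Suc.IH) (use Suc.prems in simp_all)
  qed
qed

lemma Ck_on_sum:
  assumes "open S" "finite A" "\<And>i. i \<in> A \<Longrightarrow> Ck_on n (f i) S"
  shows "Ck_on n (\<lambda>x. \<Sum>i\<in>A. f i x) S"
  using assms(2,3) by (induction A rule: finite_induct) (auto intro: Ck_on_const Ck_on_add assms(1))

lemma Ck_on_componentwise:
  fixes f :: "'a::euclidean_space \<Rightarrow> 'b::euclidean_space"
  assumes "open S" "\<And>b. b \<in> Basis \<Longrightarrow> Ck_on n (\<lambda>x. f x \<bullet> b) S"
  shows "Ck_on n f S"
proof -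
  have "Ck_on n (\<lambda>x. \<Sum>b\<in>Basis. (f x \<bullet> b) *\<^sub>R b) S"
    by (intro Ck_on_sum Ck_on_bounded_linear_comp[where T = "\<lambda>x. x *\<^sub>R b" for b] assms
        bounded_linear_intros) auto
  then show ?thesis by (simp add: euclidean_representation)
qed

text \<open>For an affine inner map the inner derivative \<open>l v\<close> does not depend on the
  point, so each derivative again has the form of the claim and the induction closes. Nonlinear
  changes of coordinates are composed on the holomorphic side instead.\<close>

lemma Ck_on_affine_precomp:
  assumes "open T" "bounded_linear l" "\<And>x. x \<in> T \<Longrightarrow> c + l x \<in> S"
  shows "Ck_on n f S \<Longrightarrow> Ck_on n (\<lambda>x. f (c + l x)) T"
proof (induction n arbitrary: f)
  case 0
  have "continuous_on T (\<lambda>x. c + l x)"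
    by (intro continuous_intros bounded_linear.continuous_on[OF assms(2)])
  then show ?case
    using 0 assms(3) by (auto intro!: continuous_on_compose2[of S f T "\<lambda>x. c + l x"])
next
  case (Suc n)
  have "((\<lambda>x. f (c + l x)) has_derivative (\<lambda>v. frechet_derivative f (at (c + l x)) (l v))) (at x)"
    if "x \<in> T" for x
  proof (rule has_derivative_compose[where g = f])
    show "((\<lambda>x. c + l x) has_derivative l) (at x)"
      by (auto intro!: derivative_eq_intros bounded_linear.has_derivative[OF assms(2)])
    show "(f has_derivative frechet_derivative f (at (c + l x))) (at (c + l x))"
      using Suc.prems assms(3)[OF that] by (rule Ck_on_SucD)
  qed
  then show ?case
  proof (rule Ck_on_derivative[OF assms(1)])
    show "Ck_on n (\<lambda>x. frechet_derivative f (at (c + l x)) (l v)) T" for v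
      by (rule Suc.IH) (use Suc.prems in simp_all)
  qed
qed

lemma smooth_on_cong:
  assumes "\<And>x. x \<in> S \<Longrightarrow> f x = g x"
  shows "smooth_on f S \<longleftrightarrow> smooth_on g S"
  unfolding smooth_on_def using Ck_on_cong[of S f g, OF _ assms] by blast

lemma smooth_on_subset: "smooth_on f S \<Longrightarrow> open T \<Longrightarrow> T \<subseteq> S \<Longrightarrow> smooth_on f T"
  unfolding smooth_on_def using Ck_on_subset by blast

lemma smooth_on_local:
  assumes "\<And>x. x \<in> S \<Longrightarrow> \<exists>T. x \<in> T \<and> smooth_on f T" "open S"
  shows "smooth_on f S"
  unfolding smooth_on_def
proof (intro conjI allI)
  show "Ck_on n f S" for n
  proof (rule Ck_on_local)
    show "\<exists>T. open T \<and> x \<in> T \<and> Ck_on n f T" if "x \<in> S" for x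
      using assms(1)[OF that] unfolding smooth_on_def by blast
  qed
qed fact

lemma smooth_on_add: "smooth_on f S \<Longrightarrow> smooth_on g S \<Longrightarrow> smooth_on (\<lambda>x. f x + g x) S"
  unfolding smooth_on_def by (blast intro: Ck_on_add)

lemma smooth_on_const: "open S \<Longrightarrow> smooth_on (\<lambda>_. c) S"
  unfolding smooth_on_def by (blast intro: Ck_on_const)

lemma smooth_on_bounded_linear_comp:
  "bounded_linear T \<Longrightarrow> smooth_on f S \<Longrightarrow> smooth_on (\<lambda>x. T (f x)) S"
  unfolding smooth_on_def using Ck_on_bounded_linear_comp by blast

lemma smooth_on_componentwise:
  assumes "open S" "\<And>b. b \<in> Basis \<Longrightarrow> smooth_on (\<lambda>x. f x \<bullet> b) S"
  shows "smooth_on f S"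
  using assms unfolding smooth_on_def by (simp add: Ck_on_componentwise)

lemma smooth_on_affine_precomp:
  assumes "open T" "bounded_linear l" "\<And>x. x \<in> T \<Longrightarrow> c + l x \<in> S" "smooth_on f S"
  shows "smooth_on (\<lambda>x. f (c + l x)) T"
  using assms(1,4) Ck_on_affine_precomp[OF assms(1-3)] unfolding smooth_on_def by blast

lemma continuous_on_smooth: "smooth_on f S \<Longrightarrow> continuous_on S f"
  unfolding smooth_on_def by (metis Ck_on.simps(1))

lemma Ck_on_id: "open S \<Longrightarrow> Ck_on n (\<lambda>x. x) S"
  by (cases n) (simp_all add: Ck_on_derivative[OF _ has_derivative_ident] Ck_on_const del: Ck_on.simps(2))

lemma smooth_on_affine: "open S \<Longrightarrow> bounded_linear l \<Longrightarrow> smooth_on (\<lambda>x. c + l x) S"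
  unfolding smooth_on_def
  by (auto intro!: Ck_on_add Ck_on_const Ck_on_bounded_linear_comp[where T = l] Ck_on_id)

section \<open>Diffeomorphisms, their germs, and the cuspidal crosscap under affine changes\<close>

lemma diffeo_betweenI:
  assumes "smooth_on f U" "smooth_on g V"
    "\<And>x. x \<in> U \<Longrightarrow> f x \<in> V \<and> g (f x) = x" "\<And>y. y \<in> V \<Longrightarrow> g y \<in> U \<and> f (g y) = y"
  shows "diffeo_between f U V"
proof -
  have b: "bij_betw f U V"
    by (rule bij_betwI[where g = g]) (use assms in auto)
  have "inv_into U f y = g y" if "y \<in> V" for y
    using that assms b by (metis bij_betw_inv_into_left)
  then show ?thesis
    using b assms(1,2) smooth_on_cong[of V "inv_into U f" g] by (simp add: diffeo_between_def)
qed

lemma diffeo_betweenE: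
  assumes "diffeo_between f U V"
  obtains g where "smooth_on f U" "smooth_on g V"
    "\<And>x. x \<in> U \<Longrightarrow> f x \<in> V \<and> g (f x) = x" "\<And>y. y \<in> V \<Longrightarrow> g y \<in> U \<and> f (g y) = y"
proof
  show "smooth_on f U" "smooth_on (inv_into U f) V"
    using assms by (auto simp: diffeo_between_def)
  show "f x \<in> V \<and> inv_into U f (f x) = x" if "x \<in> U" for x
    using that assms unfolding diffeo_between_def by (metis bij_betw_inv_into_left bij_betwE)
  show "inv_into U f y \<in> U \<and> f (inv_into U f y) = y" if "y \<in> V" for y
    using that assms unfolding diffeo_between_def
    by (metis bij_betw_inv_into_right bij_betw_inv_into bij_betwE)
qed

lemma diffeo_between_affine:
  fixes f :: "'b::euclidean_space \<Rightarrow> 'c::euclidean_space" and l :: "'a::euclidean_space \<Rightarrow> 'b"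
  assumes "diffeo_between f U V" "bounded_linear l" "bounded_linear l'"
    "\<And>x. l' (l x) = x" "\<And>x. l (l' x) = x"
  shows "diffeo_between (\<lambda>x. f (c + l x)) {x. c + l x \<in> U} V"
proof -
  obtain g where g: "smooth_on f U" "smooth_on g V"
    "\<And>x. x \<in> U \<Longrightarrow> f x \<in> V \<and> g (f x) = x" "\<And>y. y \<in> V \<Longrightarrow> g y \<in> U \<and> f (g y) = y"
    using assms(1) by (rule diffeo_betweenE) blast
  have op: "open {x. c + l x \<in> U}"
  proof -
    have "continuous_on UNIV (\<lambda>x. c + l x)"
      by (intro continuous_intros bounded_linear.continuous_on[OF assms(2)])
    then have "open ((\<lambda>x. c + l x) -` U)"
      using g(1) by (auto simp: smooth_on_def intro: open_vimage)
    then show ?thesis by (simp add: vimage_def)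
  qed
  have oV: "open V" using g by (auto simp: smooth_on_def)
  show ?thesis
  proof (rule diffeo_betweenI[where g = "\<lambda>y. - l' c + l' (g y)"])
    show "smooth_on (\<lambda>x. f (c + l x)) {x. c + l x \<in> U}"
      by (rule smooth_on_affine_precomp[OF op assms(2) _ g(1)]) auto
    show "smooth_on (\<lambda>y. - l' c + l' (g y)) V"
      by (rule smooth_on_add[OF smooth_on_const[OF oV] smooth_on_bounded_linear_comp[OF assms(3) g(2)]])
    interpret l: bounded_linear l by fact
    interpret l': bounded_linear l' by fact
    show "f (c + l x) \<in> V \<and> - l' c + l' (g (f (c + l x))) = x" if "x \<in> {x. c + l x \<in> U}" for x
      using that g(3)[of "c + l x"] assms(4) by (simp add: l'.add)
    show "- l' c + l' (g y) \<in> {x. c + l x \<in> U} \<and> f (c + l (- l' c + l' (g y))) = y" if "y \<in> V" for y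
      using that g(4)[of y] by (simp add: l.add l.diff assms)
  qed
qed

text \<open>An invertible germ has a diffeomorphic representative: shrink to \<open>N\<close> and
  \<open>M\<close>, where the inversion identities hold, and then to the part of \<open>N\<close>
  sent into \<open>M\<close> and the part of \<open>M\<close> sent back into \<open>N\<close>;
  \<open>f\<close> and \<open>g\<close> exchange these two open sets. The extra property
  \<open>P\<close> rides along so that a further germ identity can be secured on the same
  set.\<close>

lemma diffeo_between_germ:
  assumes f: "smooth_on f S" "p \<in> S" and g: "smooth_on g T" "f p \<in> T"
    and gf: "\<forall>\<^sub>F x in nhds p. g (f x) = x" and fg: "\<forall>\<^sub>F y in nhds (f p). f (g y) = y"
    and P: "\<forall>\<^sub>F x in nhds p. P x"
  obtains U V where "diffeo_between f U V" "p \<in> U" "\<And>x. x \<in> U \<Longrightarrow> P x"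
proof -
  obtain A where A: "open A" "p \<in> A" "\<And>x. x \<in> A \<Longrightarrow> g (f x) = x \<and> P x"
    using eventually_conj[OF gf P] unfolding eventually_nhds by auto
  obtain B where B: "open B" "f p \<in> B" "\<And>y. y \<in> B \<Longrightarrow> f (g y) = y"
    using fg unfolding eventually_nhds by auto
  define N where "N = S \<inter> A"
  define M where "M = T \<inter> B"
  have o: "open S" "open T" using f g by (auto simp: smooth_on_def)
  then have NM: "open N" "open M" using A B by (auto simp: N_def M_def)
  have sf: "smooth_on f N" and sg: "smooth_on g M"
    using smooth_on_subset[OF f(1) NM(1)] smooth_on_subset[OF g(1) NM(2)] by (auto simp: N_def M_def)
  define U where "U = N \<inter> f -` M"
  define V where "V = M \<inter> g -` N"
  have "open U" "open V"
    unfolding U_def V_def using NM continuous_on_smooth[OF sf] continuous_on_smooth[OF sg]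
    by (simp_all add: continuous_on_open_vimage Int_commute)
  then have "smooth_on f U" "smooth_on g V"
    using smooth_on_subset[OF sf, of U] smooth_on_subset[OF sg, of V] unfolding U_def V_def by simp_all
  then have "diffeo_between f U V"
    
  proof (rule diffeo_betweenI)
    show "f x \<in> V \<and> g (f x) = x" if "x \<in> U" for x
      using that A(3)[of x] unfolding U_def V_def N_def by simp
    show "g y \<in> U \<and> f (g y) = y" if "y \<in> V" for y
      using that B(3)[of y] unfolding U_def V_def M_def by simp
  qed
  moreover have "p \<in> U" using A(2) B(2) f(2) g(2) unfolding U_def N_def M_def by simp
  moreover have "P x" if "x \<in> U" for x using that A(3) unfolding U_def N_def by simp
  ultimately show thesis by (rule that)
qed

lemma cuspidal_crosscap_precomp:
  fixes f :: "'b::euclidean_space \<Rightarrow> real^3" and l :: "'a::euclidean_space \<Rightarrow> 'b"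
  assumes "bounded_linear l" "bounded_linear l'" "\<And>x. l' (l x) = x" "\<And>x. l (l' x) = x"
    and cc: "cuspidal_crosscap_at f (c + l p)"
  shows "cuspidal_crosscap_at (\<lambda>x. f (c + l x)) p"
proof -
  obtain U U' \<phi> V V' \<psi> where *:
    "diffeo_between \<phi> U U'" "c + l p \<in> U" "\<phi> (c + l p) = (0 :: real \<times> real)"
    "diffeo_between \<psi> V V'" "f (c + l p) \<in> V" "\<psi> (f (c + l p)) = (0 :: real ^ 3)"
    "\<forall>q\<in>U. f q \<in> V \<and> \<psi> (f q) = cuspidal_crosscap_model (\<phi> q)"
    using cc unfolding cuspidal_crosscap_at_def by blast
  show ?thesis
    unfolding cuspidal_crosscap_at_def
    using * diffeo_between_affine[OF *(1) assms(1-4), of c]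
    by (intro exI[of _ "{x. c + l x \<in> U}"] exI[of _ U'] exI[of _ "\<lambda>x. \<phi> (c + l x)"]
        exI[of _ V] exI[of _ V'] exI[of _ \<psi>]) auto
qed

text \<open>Stated backwards because a surface is brought to normal form only after an affine change
  of the target; that change is absorbed into the target diffeomorphism
  \<open>\<psi>\<close>.\<close>

lemma cuspidal_crosscap_postcomp:
  fixes f :: "'b::euclidean_space \<Rightarrow> real^3"
  assumes "bounded_linear T" "bounded_linear T'" "\<And>x. T' (T x) = x" "\<And>x. T (T' x) = x"
    and cc: "cuspidal_crosscap_at (\<lambda>x. c + T (f x)) p"
  shows "cuspidal_crosscap_at f p"
proof -
  obtain U U' \<phi> V V' \<psi> where *:
    "diffeo_between \<phi> U U'" "p \<in> U" "\<phi> p = (0 :: real \<times> real)"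
    "diffeo_between \<psi> V V'" "c + T (f p) \<in> V" "\<psi> (c + T (f p)) = (0 :: real ^ 3)"
    "\<forall>q\<in>U. c + T (f q) \<in> V \<and> \<psi> (c + T (f q)) = cuspidal_crosscap_model (\<phi> q)"
    using cc unfolding cuspidal_crosscap_at_def by blast
  show ?thesis
    unfolding cuspidal_crosscap_at_def
    using * diffeo_between_affine[OF *(4) assms(1-4), of c]
    by (intro exI[of _ U] exI[of _ U'] exI[of _ \<phi>]
        exI[of _ "{x. c + T x \<in> V}"] exI[of _ V'] exI[of _ "\<lambda>x. \<psi> (c + T x)"]) auto
qed

text \<open>The model identifies \<open>(0, y)\<close> with \<open>(0, - y)\<close>.\<close>

lemma cuspidal_crosscap_not_locally_injective:
  assumes "cuspidal_crosscap_at f p" "open N" "p \<in> N"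
  shows "\<not> inj_on f N"
proof
  assume inj: "inj_on f N"
  obtain U U' \<phi> V V' \<psi> where *:
    "diffeo_between \<phi> U U'" "p \<in> U" "\<phi> p = (0 :: real \<times> real)"
    "diffeo_between \<psi> V V'" "f p \<in> V" "\<psi> (f p) = (0 :: real ^ 3)"
    "\<forall>q\<in>U. f q \<in> V \<and> \<psi> (f q) = cuspidal_crosscap_model (\<phi> q)"
    using assms(1) unfolding cuspidal_crosscap_at_def by blast
  obtain \<theta> where \<theta>: "smooth_on \<phi> U" "smooth_on \<theta> U'"
    "\<And>x. x \<in> U \<Longrightarrow> \<phi> x \<in> U' \<and> \<theta> (\<phi> x) = x" "\<And>y. y \<in> U' \<Longrightarrow> \<theta> y \<in> U \<and> \<phi> (\<theta> y) = y"
    using *(1) by (rule diffeo_betweenE) blast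
  have "open U'" using \<theta> by (auto simp: smooth_on_def)
  then have "open (U' \<inter> \<theta> -` N)" 
    using continuous_on_smooth[OF \<theta>(2)] assms(2) by (simp add: continuous_on_open_vimage Int_commute)
  moreover have "0 \<in> U' \<inter> \<theta> -` N" using \<theta>(3)[OF *(2)] *(3) assms(3) by simp
  ultimately obtain e where e: "e > 0" "ball 0 e \<subseteq> U' \<inter> \<theta> -` N"
    by (meson open_contains_ball)
  define y where "y = e / 2"
  have yb: "(0, y) \<in> ball 0 e" "(0, -y) \<in> ball 0 e" "y \<noteq> 0"
    using e(1) by (auto simp: y_def dist_Pair_Pair zero_prod_def)
  have "cuspidal_crosscap_model (0, y) = cuspidal_crosscap_model (0, -y)"
    by (simp add: cuspidal_crosscap_model_def)
  moreover have m: "\<phi> (\<theta> p) = p \<and> \<theta> p \<in> U \<and> \<theta> p \<in> N" if "p \<in> ball 0 e" for p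
    using subsetD[OF e(2) that] \<theta>(4) by auto
  ultimately have "\<psi> (f (\<theta> (0, y))) = \<psi> (f (\<theta> (0, -y)))"
    using *(7) m[OF yb(1)] m[OF yb(2)] by simp
  moreover have "inj_on \<psi> V" using *(4) by (auto simp: diffeo_between_def dest: bij_betw_imp_inj_on)
  ultimately have "f (\<theta> (0, y)) = f (\<theta> (0, -y))"
    using *(7) m[OF yb(1)] m[OF yb(2)] by (metis inj_onD)
  then have "\<theta> (0, y) = \<theta> (0, -y)"
    using inj m[OF yb(1)] m[OF yb(2)] by (simp add: inj_on_eq_iff)
  then have "(0 :: real, y) = (0, -y)"
    using m[OF yb(1)] m[OF yb(2)] by metis
  then show False using yb by simp
qed

section \<open>Holomorphic functions of two variables\<close>

text \<open>Complex differentiability in two variables: the real derivative must be complex linear,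
  that is, a combination of the two components with complex coefficients.\<close>

definition cdiff2 :: "(complex \<times> complex \<Rightarrow> complex) \<Rightarrow> complex \<times> complex \<Rightarrow> bool" where
  "cdiff2 f p \<longleftrightarrow> (\<exists>a b. (f has_derivative (\<lambda>h. a * fst h + b * snd h)) (at p))"

definition pd1 :: "(complex \<times> complex \<Rightarrow> complex) \<Rightarrow> complex \<times> complex \<Rightarrow> complex" where
  "pd1 f p = deriv (\<lambda>z. f (z, snd p)) (fst p)"

definition pd2 :: "(complex \<times> complex \<Rightarrow> complex) \<Rightarrow> complex \<times> complex \<Rightarrow> complex" where
  "pd2 f p = deriv (\<lambda>z. f (fst p, z)) (snd p)"

lemma has_derivative_chain2:
  fixes f :: "complex \<times> complex \<Rightarrow> complex"
  assumes "(f has_derivative (\<lambda>h. a * fst h + b * snd h)) (at (g t, k t))"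
    "(g has_field_derivative g') (at t)" "(k has_field_derivative k') (at t)"
  shows "((\<lambda>z. f (g z, k z)) has_field_derivative a * g' + b * k') (at t)"
proof -
  have "((\<lambda>z. (g z, k z)) has_derivative (\<lambda>h. (g' * h, k' * h))) (at t)"
    using assms(2,3) by (intro has_derivative_Pair) (auto simp: has_field_derivative_def)
  from has_derivative_compose[OF this assms(1)]
  have "((\<lambda>z. f (g z, k z)) has_derivative (\<lambda>h. a * (g' * h) + b * (k' * h))) (at t)"
    by simp
  then show ?thesis
    unfolding has_field_derivative_def by (rule has_derivative_eq_rhs) (simp add: fun_eq_iff algebra_simps)
qed

lemma cdiff2_has_derivative:
  assumes "cdiff2 f p"
  shows "(f has_derivative (\<lambda>h. pd1 f p * fst h + pd2 f p * snd h)) (at p)"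
proof -
  obtain a b where ab: "(f has_derivative (\<lambda>h. a * fst h + b * snd h)) (at (fst p, snd p))"
    using assms unfolding cdiff2_def by auto
  have "((\<lambda>z. f (z, snd p)) has_field_derivative a * 1 + b * 0) (at (fst p))"
    by (rule has_derivative_chain2) (use ab in auto)
  then have "pd1 f p = a" unfolding pd1_def by (simp add: DERIV_imp_deriv)
  moreover have "((\<lambda>z. f (fst p, z)) has_field_derivative a * 0 + b * 1) (at (snd p))"
    by (rule has_derivative_chain2) (use ab in auto)
  then have "pd2 f p = b" unfolding pd2_def by (simp add: DERIV_imp_deriv)
  ultimately show ?thesis using ab by simp
qed

lemma cdiff2_chain:
  assumes "cdiff2 f (g t, k t)"
    "(g has_field_derivative g') (at t)" "(k has_field_derivative k') (at t)"
  shows "((\<lambda>z. f (g z, k z)) has_field_derivative pd1 f (g t, k t) * g' + pd2 f (g t, k t) * k') (at t)"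
  by (rule has_derivative_chain2[OF cdiff2_has_derivative[OF assms(1)] assms(2,3)])

lemma cdiff2_slice1: "cdiff2 f (u, v) \<Longrightarrow> ((\<lambda>z. f (z, v)) has_field_derivative pd1 f (u, v)) (at u)"
  using cdiff2_chain[of f "\<lambda>z. z" u "\<lambda>_. v" 1 0] by simp

lemma cdiff2_slice2: "cdiff2 f (u, v) \<Longrightarrow> ((\<lambda>z. f (u, z)) has_field_derivative pd2 f (u, v)) (at v)"
  using cdiff2_chain[of f "\<lambda>_. u" v "\<lambda>z. z" 0 1] by simp

lemma pd1_eqI: "((\<lambda>z. f (z, v)) has_field_derivative d) (at u) \<Longrightarrow> pd1 f (u, v) = d"
  by (simp add: pd1_def DERIV_imp_deriv)

lemma pd2_eqI: "((\<lambda>z. f (u, z)) has_field_derivative d) (at v) \<Longrightarrow> pd2 f (u, v) = d"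
  by (simp add: pd2_def DERIV_imp_deriv)

lemma cdiff2_isCont: "cdiff2 f p \<Longrightarrow> isCont f p"
  unfolding cdiff2_def using has_derivative_continuous by blast

lemma cdiff2I: "(f has_derivative (\<lambda>h. a * fst h + b * snd h)) (at p) \<Longrightarrow> cdiff2 f p"
  unfolding cdiff2_def by blast

lemma cdiff2_const [simp, intro]: "cdiff2 (\<lambda>_. c) p"
  by (rule cdiff2I[of _ 0 0]) simp

lemma cdiff2_fst [simp, intro]: "cdiff2 fst p"
  by (rule cdiff2I[of _ 1 0]) (auto intro!: derivative_eq_intros)

lemma cdiff2_snd [simp, intro]: "cdiff2 snd p"
  by (rule cdiff2I[of _ 0 1]) (auto intro!: derivative_eq_intros)

lemma cdiff2_add [intro]:
  assumes "cdiff2 f p" "cdiff2 g p"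
  shows "cdiff2 (\<lambda>q. f q + g q) p"
proof -
  obtain a b a' b' where "(f has_derivative (\<lambda>h. a * fst h + b * snd h)) (at p)"
    "(g has_derivative (\<lambda>h. a' * fst h + b' * snd h)) (at p)"
    using assms unfolding cdiff2_def by blast
  from has_derivative_add[OF this] show ?thesis
    by (intro cdiff2I[of _ "a + a'" "b + b'"]) (simp add: algebra_simps)
qed

lemma cdiff2_compose1:
  assumes "(\<phi> has_field_derivative d) (at (f p))" "cdiff2 f p"
  shows "cdiff2 (\<lambda>q. \<phi> (f q)) p"
proof -
  obtain a b where "(f has_derivative (\<lambda>h. a * fst h + b * snd h)) (at p)"
    using assms unfolding cdiff2_def by blast
  from has_derivative_compose[OF this assms(1)[unfolded has_field_derivative_def]]
  have "((\<lambda>q. \<phi> (f q)) has_derivative (\<lambda>h. d * (a * fst h + b * snd h))) (at p)" .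
  then show ?thesis
    by (intro cdiff2I[of _ "d * a" "d * b"]) (simp add: algebra_simps)
qed

lemma cdiff2_mult [intro]:
  assumes "cdiff2 f p" "cdiff2 g p"
  shows "cdiff2 (\<lambda>q. f q * g q) p"
proof -
  obtain a b a' b' where "(f has_derivative (\<lambda>h. a * fst h + b * snd h)) (at p)"
    "(g has_derivative (\<lambda>h. a' * fst h + b' * snd h)) (at p)"
    using assms unfolding cdiff2_def by blast
  from has_derivative_mult[OF this] show ?thesis
    by (intro cdiff2I[of _ "f p * a' + a * g p" "f p * b' + b * g p"]) (simp add: algebra_simps)
qed

lemma cdiff2_uminus [intro]: "cdiff2 f p \<Longrightarrow> cdiff2 (\<lambda>q. - f q) p"
  using cdiff2_mult[OF cdiff2_const[of "-1"]] by simp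

lemma cdiff2_diff [intro]: "cdiff2 f p \<Longrightarrow> cdiff2 g p \<Longrightarrow> cdiff2 (\<lambda>q. f q - g q) p"
  using cdiff2_add[OF _ cdiff2_uminus, of f p g] by simp

lemma cdiff2_power [intro]: "cdiff2 f p \<Longrightarrow> cdiff2 (\<lambda>q. f q ^ n) p"
  by (induction n) auto

lemma cdiff2_compose2:
  assumes "cdiff2 f (g p, k p)" "cdiff2 g p" "cdiff2 k p"
  shows "cdiff2 (\<lambda>q. f (g q, k q)) p"
proof -
  obtain a b a' b' where "(g has_derivative (\<lambda>h. a * fst h + b * snd h)) (at p)"
    "(k has_derivative (\<lambda>h. a' * fst h + b' * snd h)) (at p)"
    using assms unfolding cdiff2_def by blast
  note has_derivative_Pair[OF this]
  moreover obtain c d where "(f has_derivative (\<lambda>h. c * fst h + d * snd h)) (at (g p, k p))"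
    using assms unfolding cdiff2_def by blast
  ultimately have "((\<lambda>q. f (g q, k q)) has_derivative
      (\<lambda>h. c * fst (a * fst h + b * snd h, a' * fst h + b' * snd h) +
           d * snd (a * fst h + b * snd h, a' * fst h + b' * snd h))) (at p)"
    by (rule has_derivative_compose)
  then show ?thesis
    by (intro cdiff2I[of _ "c * a + d * a'" "c * b + d * b'"]) (simp add: algebra_simps)
qed

definition hol2_on :: "(complex \<times> complex \<Rightarrow> complex) \<Rightarrow> (complex \<times> complex) set \<Rightarrow> bool" where
  "hol2_on f S \<longleftrightarrow> open S \<and> (\<forall>p\<in>S. cdiff2 f p)"

lemma hol2_on_continuous: "hol2_on f S \<Longrightarrow> continuous_on S f"
  by (simp add: hol2_on_def cdiff2_isCont continuous_at_imp_continuous_on)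

lemma open_contains_polydisc:
  fixes S :: "(complex \<times> complex) set"
  assumes "open S" "(u, v) \<in> S"
  obtains r where "r > 0" "cball u r \<times> cball v r \<subseteq> S"
proof -
  obtain A B where AB: "open A" "open B" "(u, v) \<in> A \<times> B" "A \<times> B \<subseteq> S"
    using open_prod_elim[OF assms] by metis
  obtain r1 where 1: "r1 > 0" "cball u r1 \<subseteq> A"
    using AB(1,3) open_contains_cball by (metis mem_Sigma_iff)
  obtain r2 where 2: "r2 > 0" "cball v r2 \<subseteq> B"
    using AB(2,3) open_contains_cball by (metis mem_Sigma_iff)
  have "cball u (min r1 r2) \<times> cball v (min r1 r2) \<subseteq> A \<times> B"
    using 1(2) 2(2) by (intro Sigma_mono) auto
  then show thesis using AB(4) 1(1) 2(1)
    by (intro that[of "min r1 r2"]) auto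
qed

section \<open>Cauchy integrals with parameters and Osgood's lemma\<close>

lemma continuous_on_circle_integral:
  fixes G :: "'a::topological_space \<Rightarrow> complex \<Rightarrow> complex"
  assumes "continuous_on (X \<times> sphere z r) (\<lambda>(x, \<zeta>). G x \<zeta>)" "r > 0"
  shows "continuous_on X (\<lambda>x. contour_integral (circlepath z r) (G x))"
proof -
  have cp: "continuous_on (X \<times> cbox 0 1) (\<lambda>p. circlepath z r (snd p))"
    by (simp add: circlepath_def part_circlepath_def linepath_def) (intro continuous_intros)
  have im: "(\<lambda>p. (fst p, circlepath z r (snd p))) ` (X \<times> cbox 0 1) \<subseteq> X \<times> sphere z r"
    using assms(2) path_image_circlepath_nonneg[of r z] by (auto simp: path_image_def image_subset_iff)
  have "continuous_on (X \<times> cbox 0 1) (\<lambda>p. (fst p, circlepath z r (snd p)))"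
    by (intro continuous_on_Pair continuous_on_fst continuous_on_id cp)
  then have "continuous_on (X \<times> cbox 0 1) (\<lambda>p. G (fst p) (circlepath z r (snd p)))"
    using continuous_on_compose2[OF assms(1) _ im] by (simp add: case_prod_unfold)
  then have "continuous_on (X \<times> cbox 0 1) (\<lambda>(x, t). G x (circlepath z r t) *
      (2 * pi * \<i> * r * exp (2 * of_real pi * \<i> * t)))"
    by (simp add: case_prod_unfold) (intro continuous_intros)
  from integral_continuous_on_param[OF this] show ?thesis
    by (simp add: contour_integral_integral vector_derivative_circlepath)
qed

text \<open>Parametrising the circle turns this into the Leibniz rule for an integral over
  \<open>[0, 1]\<close>; convexity of \<open>U\<close> is what that rule asks for.\<close>

lemma has_field_derivative_circle_integral:
  assumes G: "\<And>x \<zeta>. x \<in> U \<Longrightarrow> \<zeta> \<in> sphere z r \<Longrightarrow> ((\<lambda>x. G x \<zeta>) has_field_derivative G' x \<zeta>) (at x)"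
    and cG: "continuous_on (U \<times> sphere z r) (\<lambda>(x, \<zeta>). G x \<zeta>)"
    and cG': "continuous_on (U \<times> sphere z r) (\<lambda>(x, \<zeta>). G' x \<zeta>)"
    and r: "r > 0" and U: "open U" "convex U" "x0 \<in> U"
  shows "((\<lambda>x. contour_integral (circlepath z r) (G x)) has_field_derivative
     contour_integral (circlepath z r) (G' x0)) (at x0)"
proof -
  have on: "circlepath z r t \<in> sphere z r" if "t \<in> cbox 0 1" for t
    using r that path_image_circlepath_nonneg[of r z] by (auto simp: path_image_def)
  have comp: "continuous_on (U \<times> cbox 0 1) (\<lambda>p. H (fst p) (circlepath z r (snd p)) *
      (2 * pi * \<i> * r * exp (2 * of_real pi * \<i> * of_real (snd p))))"
    if "continuous_on (U \<times> sphere z r) (\<lambda>(x, \<zeta>). H x \<zeta>)" for H :: "complex \<Rightarrow> complex \<Rightarrow> complex"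
  proof -
    have cp: "continuous_on (U \<times> cbox 0 1) (\<lambda>p. circlepath z r (snd p))"
      by (simp add: circlepath_def part_circlepath_def linepath_def) (intro continuous_intros)
    have im: "(\<lambda>p. (fst p, circlepath z r (snd p))) ` (U \<times> cbox 0 1) \<subseteq> U \<times> sphere z r"
      using on by auto
    have "continuous_on (U \<times> cbox 0 1) (\<lambda>p. (fst p, circlepath z r (snd p)))"
      by (intro continuous_on_Pair continuous_on_fst continuous_on_id cp)
    then have "continuous_on (U \<times> cbox 0 1) (\<lambda>p. H (fst p) (circlepath z r (snd p)))"
      using continuous_on_compose2[OF that _ im] by (simp add: case_prod_unfold)
    then show ?thesis by (intro continuous_intros)
  qed
  let ?e = "\<lambda>t. 2 * pi * \<i> * r * exp (2 * of_real pi * \<i> * t)"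
  have "((\<lambda>x. integral (cbox 0 1) (\<lambda>t. G x (circlepath z r t) * ?e t)) has_field_derivative
     integral (cbox 0 1) (\<lambda>t. G' x0 (circlepath z r t) * ?e t)) (at x0 within U)"
  proof (rule leibniz_rule_field_derivative[OF _ _ _ U(3,2)])
    show "((\<lambda>x. G x (circlepath z r t) * ?e t) has_field_derivative G' x (circlepath z r t) * ?e t) (at x within U)"
      if "x \<in> U" "t \<in> cbox 0 1" for x t
      using DERIV_cmult_right[OF G[OF that(1) on[OF that(2)]], of "?e t"]
      by (rule has_field_derivative_at_within)
    show "continuous_on (U \<times> cbox 0 1) (\<lambda>(x, t). G' x (circlepath z r t) * ?e t)"
      using comp[OF cG'] by (simp add: case_prod_unfold)
    show "(\<lambda>t. G x (circlepath z r t) * ?e t) integrable_on cbox 0 1" if "x \<in> U" for x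
    proof (rule integrable_continuous)
      have "continuous_on (cbox 0 1) (\<lambda>t::real. (x, t))" by (intro continuous_intros)
      from continuous_on_compose2[OF comp[OF cG] this] that
      show "continuous_on (cbox 0 1) (\<lambda>t. G x (circlepath z r t) * ?e t)" by auto
    qed
  qed
  then show ?thesis
    using at_within_open[OF U(3,1)] by (simp add: contour_integral_integral vector_derivative_circlepath)
qed

text \<open>Cauchy's formula over a circle that stays fixed while \<open>(u, v)\<close> moves in a
  polydisc expresses \<open>pd2 f\<close> through values of \<open>f\<close> alone, so continuity of
  \<open>f\<close> is inherited by its partial derivative.\<close>

lemma continuous_on_pd2:
  assumes S: "open S" and c: "continuous_on S f"
    and d: "\<And>u v. (u, v) \<in> S \<Longrightarrow> (\<lambda>z. f (u, z)) field_differentiable at v"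
  shows "continuous_on S (pd2 f)"
    and pd2_Cauchy: "\<And>u0 v0 r u v. r > 0 \<Longrightarrow> cball u0 r \<times> cball v0 r \<subseteq> S \<Longrightarrow> u \<in> ball u0 r \<Longrightarrow> v \<in> ball v0 r \<Longrightarrow>
      pd2 f (u, v) = contour_integral (circlepath v0 r) (\<lambda>\<zeta>. f (u, \<zeta>) / (\<zeta> - v)\<^sup>2) / (2 * pi * \<i>)"
proof -
  show C: "pd2 f (u, v) = contour_integral (circlepath v0 r) (\<lambda>\<zeta>. f (u, \<zeta>) / (\<zeta> - v)\<^sup>2) / (2 * pi * \<i>)"
    if "r > 0" and sub: "cball u0 r \<times> cball v0 r \<subseteq> S" and uv: "u \<in> ball u0 r" "v \<in> ball v0 r" for u0 v0 r u v
  proof -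
    have in_S: "(u, z) \<in> S" if "z \<in> cball v0 r" for z using sub uv that by auto
    have "continuous_on (cball v0 r) (\<lambda>\<zeta>. f (u, \<zeta>))"
      by (rule continuous_on_compose2[OF c]) (use in_S in \<open>auto intro!: continuous_intros\<close>)
    moreover have "(\<lambda>\<zeta>. f (u, \<zeta>)) holomorphic_on ball v0 r"
      unfolding holomorphic_on_def by (auto intro!: field_differentiable_at_within d in_S)
    ultimately have "((\<lambda>\<zeta>. f (u, \<zeta>)) has_field_derivative
       (1 / (2 * of_real pi * \<i>) * contour_integral (circlepath v0 r) (\<lambda>\<zeta>. f (u, \<zeta>) / (\<zeta> - v)\<^sup>2))) (at v)"
      using uv(2) by (rule Cauchy_derivative_integral_circlepath(2))
    from pd2_eqI[OF this] show ?thesis by simp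
  qed
  show "continuous_on S (pd2 f)"
  proof (rule continuous_at_imp_continuous_on, rule ballI)
    fix p assume "p \<in> S"
    then obtain u0 v0 where p: "p = (u0, v0)" "(u0, v0) \<in> S" by (cases p) auto
    obtain r where r: "r > 0" "cball u0 r \<times> cball v0 r \<subseteq> S"
      using open_contains_polydisc[OF S p(2)] by blast
    let ?B = "ball u0 r \<times> ball v0 r"
    have "continuous_on ?B (\<lambda>p. contour_integral (circlepath v0 r) (\<lambda>\<zeta>. f (fst p, \<zeta>) / (\<zeta> - snd p)\<^sup>2))"
    proof (rule continuous_on_circle_integral[OF _ r(1)])
      have "continuous_on (?B \<times> sphere v0 r) (\<lambda>q. f (fst (fst q), snd q))"
        by (rule continuous_on_compose2[OF c]) (use r(2) in \<open>auto intro!: continuous_intros\<close>)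
      then show "continuous_on (?B \<times> sphere v0 r) (\<lambda>(x, \<zeta>). f (fst x, \<zeta>) / (\<zeta> - snd x)\<^sup>2)"
        unfolding case_prod_unfold by (intro continuous_intros) auto
    qed
    then have "continuous_on ?B (\<lambda>p. contour_integral (circlepath v0 r) (\<lambda>\<zeta>. f (fst p, \<zeta>) / (\<zeta> - snd p)\<^sup>2) / (2 * pi * \<i>))"
      by (intro continuous_intros) auto
    then have "continuous_on ?B (pd2 f)"
      by (rule continuous_on_eq) (auto simp: C[OF r])
    moreover have "open ?B" "(u0, v0) \<in> ?B" using r(1) by (auto intro: open_Times)
    ultimately show "isCont (pd2 f) p"
      unfolding p(1) by (metis continuous_on_eq_continuous_at)
  qed
qed

text \<open>Osgood's lemma. Total differentiability follows from partial differentiability once one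
  of the partial derivatives is continuous, and Cauchy's formula has already provided this for the
  second one.\<close>

lemma Osgood:
  assumes S: "open S" and c: "continuous_on S f"
    and d1: "\<And>u v. (u, v) \<in> S \<Longrightarrow> (\<lambda>z. f (z, v)) field_differentiable at u"
    and d2: "\<And>u v. (u, v) \<in> S \<Longrightarrow> (\<lambda>z. f (u, z)) field_differentiable at v"
  shows "hol2_on f S"
  unfolding hol2_on_def
proof (intro conjI ballI S)
  fix p assume "p \<in> S"
  then obtain u v where p: "p = (u, v)" "(u, v) \<in> S" by (cases p) auto
  have cp: "continuous_on S (pd2 f)" by (rule continuous_on_pd2(1)[OF S c]) (rule d2)
  obtain r where r: "r > 0" "cball u r \<times> cball v r \<subseteq> S"
    using open_contains_polydisc[OF S p(2)] by blast
  have in_S: "(x, y) \<in> S" if "x \<in> ball u r" "y \<in> ball v r" for x y using r(2) that by auto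
  have B: "open (ball u r \<times> ball v r)" "(u, v) \<in> ball u r \<times> ball v r"
    using r(1) by (auto intro: open_Times)
  have "((\<lambda>(x, y). f (x, y)) has_derivative
     (\<lambda>(tx, ty). deriv (\<lambda>z. f (z, v)) u * tx + blinfun_mult_right (pd2 f (u, v)) ty))
     (at (u, v) within ball u r \<times> ball v r)"
  proof (rule has_derivative_partialsI)
    show "((\<lambda>x. f (x, v)) has_derivative (*) (deriv (\<lambda>z. f (z, v)) u)) (at u within ball u r)"
      using d1[OF p(2)] field_differentiable_derivI has_field_derivative_at_within
      unfolding has_field_derivative_def[symmetric] by blast
    show "((\<lambda>y. f (x, y)) has_derivative blinfun_mult_right (pd2 f (x, y))) (at y within ball v r)"
      if "x \<in> ball u r" "y \<in> ball v r" for x y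
    proof -
      have "((\<lambda>z. f (x, z)) has_field_derivative pd2 f (x, y)) (at y within ball v r)"
        using d2[OF in_S[OF that]] unfolding pd2_def
        by (simp add: field_differentiable_derivI has_field_derivative_at_within)
      then show ?thesis by (simp add: has_field_derivative_def blinfun_mult_right.rep_eq)
    qed
    have "continuous_on (ball u r \<times> ball v r) (\<lambda>p. blinfun_mult_right (pd2 f p))"
      by (intro bounded_linear.continuous_on[OF bounded_linear_blinfun_mult_right]
          continuous_on_subset[OF cp]) (use in_S in auto)
    then show "continuous (at (u, v) within ball u r \<times> ball v r) (\<lambda>(x, y). blinfun_mult_right (pd2 f (x, y)))"
      using B(2) by (simp add: continuous_on_eq_continuous_within case_prod_unfold)
  qed (use r(1) in auto)
  then have "(f has_derivative (\<lambda>h. deriv (\<lambda>z. f (z, v)) u * fst h + pd2 f (u, v) * snd h)) (at (u, v))"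
    using at_within_open[OF B(2,1)] by (simp add: case_prod_unfold blinfun_mult_right.rep_eq)
  then show "cdiff2 f p" unfolding p(1) by (rule cdiff2I)
qed

lemma hol2_on_slices:
  assumes "hol2_on f S" "(u, v) \<in> S"
  shows "(\<lambda>z. f (z, v)) field_differentiable at u" "(\<lambda>z. f (u, z)) field_differentiable at v"
  using assms cdiff2_slice1 cdiff2_slice2 unfolding hol2_on_def field_differentiable_def by blast+

lemma hol2_on_swap:
  assumes "hol2_on f S"
  shows "hol2_on (\<lambda>p. f (snd p, fst p)) (prod.swap -` S)"
  unfolding hol2_on_def
proof (intro conjI ballI)
  have "continuous_on UNIV (prod.swap :: complex \<times> complex \<Rightarrow> _)"
    unfolding prod.swap_def by (intro continuous_intros)
  then show "open (prod.swap -` S)"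
    using assms unfolding hol2_on_def by (auto intro: open_vimage)
  show "cdiff2 (\<lambda>p. f (snd p, fst p)) p" if "p \<in> prod.swap -` S" for p
    using that assms unfolding hol2_on_def by (intro cdiff2_compose2) (auto simp: prod.swap_def)
qed

lemma pd1_swap: "pd1 f (u, v) = pd2 (\<lambda>p. f (snd p, fst p)) (v, u)"
  by (simp add: pd1_def pd2_def)

lemma pd2_swap: "pd2 f (u, v) = pd1 (\<lambda>p. f (snd p, fst p)) (v, u)"
  by (simp add: pd1_def pd2_def)

lemma continuous_on_pd1:
  assumes "hol2_on f S"
  shows "continuous_on S (pd1 f)"
proof -
  note sw = hol2_on_swap[OF assms]
  have "continuous_on (prod.swap -` S) (pd2 (\<lambda>p. f (snd p, fst p)))"
    by (rule continuous_on_pd2) (use sw hol2_on_slices[OF sw] hol2_on_continuous[OF sw] in \<open>auto simp: hol2_on_def\<close>)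
  then have "continuous_on S (\<lambda>p. pd2 (\<lambda>p. f (snd p, fst p)) (snd p, fst p))"
    by (rule continuous_on_compose2) (auto intro!: continuous_intros)
  then show ?thesis by (rule continuous_on_eq) (auto simp: pd1_swap)
qed

text \<open>Osgood's lemma once more: in the second variable \<open>pd2 f\<close> is the derivative
  of a holomorphic function, in the first one Cauchy's integral is differentiated under the integral
  sign.\<close>

lemma hol2_on_pd2:
  assumes f: "hol2_on f S"
  shows "hol2_on (pd2 f) S"
proof (rule Osgood)
  show S: "open S" using f by (simp add: hol2_on_def)
  note cont = hol2_on_continuous[OF f] and sl = hol2_on_slices[OF f]
  show "continuous_on S (pd2 f)" by (rule continuous_on_pd2[OF S cont sl(2)])
  fix u0 v0 assume uv: "(u0, v0) \<in> S"
  obtain r where r: "r > 0" "cball u0 r \<times> cball v0 r \<subseteq> S"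
    using open_contains_polydisc[OF S uv] by blast
  have in_S: "(u, v) \<in> S" if "u \<in> ball u0 r" "v \<in> cball v0 r" for u v using r(2) that by auto
  have hol: "(\<lambda>z. f (u0, z)) holomorphic_on ball v0 r"
    unfolding holomorphic_on_def using r(1) by (auto intro!: field_differentiable_at_within sl(2) in_S)
  then have "deriv (\<lambda>z. f (u0, z)) holomorphic_on ball v0 r"
    by (rule holomorphic_deriv) auto
  then show "(\<lambda>z. pd2 f (u0, z)) field_differentiable at v0"
    using r(1) by (auto simp: pd2_def holomorphic_on_open field_differentiable_def)
  have "((\<lambda>u. contour_integral (circlepath v0 r) (\<lambda>\<zeta>. f (u, \<zeta>) / (\<zeta> - v0)\<^sup>2)) has_field_derivative
      contour_integral (circlepath v0 r) (\<lambda>\<zeta>. pd1 f (u0, \<zeta>) / (\<zeta> - v0)\<^sup>2)) (at u0)"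
  proof (rule has_field_derivative_circle_integral[where U = "ball u0 r"])
    show "((\<lambda>u. f (u, \<zeta>) / (\<zeta> - v0)\<^sup>2) has_field_derivative pd1 f (u, \<zeta>) / (\<zeta> - v0)\<^sup>2) (at u)"
      if "u \<in> ball u0 r" "\<zeta> \<in> sphere v0 r" for u \<zeta>
    proof -
      have "cdiff2 f (u, \<zeta>)" using in_S that f by (auto simp: hol2_on_def)
      from DERIV_cdivide[OF cdiff2_slice1[OF this]] show ?thesis .
    qed
    have "continuous_on (ball u0 r \<times> sphere v0 r) (\<lambda>q. g (fst q, snd q) / (snd q - v0)\<^sup>2)"
      if "continuous_on S g" for g
    proof -
      have "continuous_on (ball u0 r \<times> sphere v0 r) (\<lambda>q. g (fst q, snd q))"
        by (rule continuous_on_compose2[OF that]) (use r(2) in \<open>auto intro!: continuous_intros\<close>)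
      then show ?thesis by (intro continuous_intros) (use r(1) in auto)
    qed
    from this[OF cont] this[OF continuous_on_pd1[OF f]]
    show "continuous_on (ball u0 r \<times> sphere v0 r) (\<lambda>(x, \<zeta>). f (x, \<zeta>) / (\<zeta> - v0)\<^sup>2)"
      "continuous_on (ball u0 r \<times> sphere v0 r) (\<lambda>(x, \<zeta>). pd1 f (x, \<zeta>) / (\<zeta> - v0)\<^sup>2)"
      by (simp_all add: case_prod_unfold)
  qed (use r in auto)
  then have "((\<lambda>u. contour_integral (circlepath v0 r) (\<lambda>\<zeta>. f (u, \<zeta>) / (\<zeta> - v0)\<^sup>2) / (2 * pi * \<i>)) has_field_derivative
      contour_integral (circlepath v0 r) (\<lambda>\<zeta>. pd1 f (u0, \<zeta>) / (\<zeta> - v0)\<^sup>2) / (2 * pi * \<i>)) (at u0)"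
    by (rule DERIV_cdivide)
  then have "((\<lambda>u. pd2 f (u, v0)) has_field_derivative
      contour_integral (circlepath v0 r) (\<lambda>\<zeta>. pd1 f (u0, \<zeta>) / (\<zeta> - v0)\<^sup>2) / (2 * pi * \<i>)) (at u0)"
    by (rule has_field_derivative_transform_within_open[where S = "ball u0 r"])
      (use r pd2_Cauchy[OF S cont sl(2) r] in auto)
  then show "(\<lambda>z. pd2 f (z, v0)) field_differentiable at u0"
    by (auto simp: field_differentiable_def)
qed

lemma hol2_on_cong:
  assumes "hol2_on f S" "\<And>p. p \<in> S \<Longrightarrow> f p = g p"
  shows "hol2_on g S"
  unfolding hol2_on_def
proof (intro conjI ballI)
  show "open S" using assms by (simp add: hol2_on_def)
  fix p assume "p \<in> S"
  then obtain a b where "(f has_derivative (\<lambda>h. a * fst h + b * snd h)) (at p)"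
    using assms unfolding hol2_on_def cdiff2_def by blast
  then have "(g has_derivative (\<lambda>h. a * fst h + b * snd h)) (at p)"
    using \<open>open S\<close> \<open>p \<in> S\<close> assms(2) by (rule has_derivative_transform_within_open)
  then show "cdiff2 g p" by (rule cdiff2I)
qed

lemma hol2_on_pd1:
  assumes f: "hol2_on f S"
  shows "hol2_on (pd1 f) S"
proof -
  have "hol2_on (\<lambda>q. pd2 (\<lambda>p. f (snd p, fst p)) (snd q, fst q)) (prod.swap -` (prod.swap -` S))"
    by (intro hol2_on_swap hol2_on_pd2 f)
  then have "hol2_on (\<lambda>q. pd2 (\<lambda>p. f (snd p, fst p)) (snd q, fst q)) S"
    by (simp add: vimage_def)
  then show ?thesis by (rule hol2_on_cong) (auto simp: pd1_swap)
qed

text \<open>A directional derivative of the real part of a holomorphic function is the real part of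
  a combination of \<open>pd1 f\<close> and \<open>pd2 f\<close> with constant coefficients, hence
  of a holomorphic function again; smoothness of every order follows by induction.\<close>

lemma Ck_on_hol2:
  fixes l :: "'a::euclidean_space \<Rightarrow> complex \<times> complex"
  assumes T: "open T" "bounded_linear l" "\<And>x. x \<in> T \<Longrightarrow> c + l x \<in> S"
  shows "hol2_on f S \<Longrightarrow> Ck_on n (\<lambda>x. Re (f (c + l x))) T"
proof (induction n arbitrary: f)
  case 0
  have "continuous_on T (\<lambda>x. c + l x)"
    by (intro continuous_intros bounded_linear.continuous_on[OF T(2)])
  then have "continuous_on T (\<lambda>x. f (c + l x))"
    by (rule continuous_on_compose2[OF hol2_on_continuous[OF 0]]) (use T(3) in auto)
  then show ?case unfolding Ck_on.simps by (intro continuous_intros)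
next
  case (Suc n)
  show ?case
  proof (rule Ck_on_derivative[OF T(1)])
    fix x assume x: "x \<in> T"
    have "((\<lambda>x. c + l x) has_derivative l) (at x)"
      by (auto intro!: derivative_eq_intros bounded_linear.has_derivative[OF T(2)])
    moreover have "(f has_derivative (\<lambda>h. pd1 f (c + l x) * fst h + pd2 f (c + l x) * snd h)) (at (c + l x))"
      using Suc.prems T(3)[OF x] by (intro cdiff2_has_derivative) (simp add: hol2_on_def)
    ultimately have "((\<lambda>x. f (c + l x)) has_derivative
       (\<lambda>v. pd1 f (c + l x) * fst (l v) + pd2 f (c + l x) * snd (l v))) (at x)"
      by (rule has_derivative_compose)
    then show "((\<lambda>x. Re (f (c + l x))) has_derivative
       (\<lambda>v. Re (pd1 f (c + l x) * fst (l v) + pd2 f (c + l x) * snd (l v)))) (at x)"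
      by (rule bounded_linear.has_derivative[OF bounded_linear_Re])
  next
    fix v
    have "hol2_on (\<lambda>p. pd1 f p * fst (l v) + pd2 f p * snd (l v)) S"
      using hol2_on_pd1[OF Suc.prems] hol2_on_pd2[OF Suc.prems] unfolding hol2_on_def
      by (auto intro!: cdiff2_add cdiff2_mult)
    then show "Ck_on n (\<lambda>x. Re (pd1 f (c + l x) * fst (l v) + pd2 f (c + l x) * snd (l v))) T"
      by (rule Suc.IH)
  qed
qed

lemma smooth_on_hol2:
  fixes l :: "'a::euclidean_space \<Rightarrow> complex \<times> complex"
  assumes "open T" "bounded_linear l" "\<And>x. x \<in> T \<Longrightarrow> c + l x \<in> S" "hol2_on f S"
  shows "smooth_on (\<lambda>x. Re (f (c + l x))) T"
  unfolding smooth_on_def using assms(1) Ck_on_hol2[OF assms] by blast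

section \<open>Germs of holomorphic functions that are real on the reals\<close>

definition circ :: "real \<Rightarrow> (complex \<Rightarrow> complex) \<Rightarrow> complex" where
  "circ r G = contour_integral (circlepath 0 r) G / (2 * pi * \<i>)"

lemma circ_cong: "r > 0 \<Longrightarrow> (\<And>\<zeta>. \<zeta> \<in> sphere 0 r \<Longrightarrow> G \<zeta> = H \<zeta>) \<Longrightarrow> circ r G = circ r H"
  unfolding circ_def using contour_integral_cong[OF refl, of "circlepath 0 r" G H] by simp

text \<open>Conjugation reverses the orientation of the circle and changes the sign of
  \<open>2 * pi * \<i>\<close>; the two signs cancel, which is why the normalised integral preserves
  symmetry under conjugation.\<close>

lemma cnj_circ: "cnj (circ r G) = circ r (\<lambda>\<zeta>. cnj (G (cnj \<zeta>)))"
proof -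
  have "reversepath (circlepath 0 r) = cnj \<circ> circlepath 0 r"
  proof
    fix x
    have "2 * of_real pi * \<i> * of_real (1 - x) = 2 * of_real pi * \<i> + (- (2 * of_real pi * \<i> * of_real x))"
      by (simp add: algebra_simps)
    then have "exp (2 * of_real pi * \<i> * of_real (1 - x)) = exp (2 * of_real pi * \<i>) * exp (- (2 * of_real pi * \<i> * of_real x))"
      by (simp only: exp_add)
    then show "reversepath (circlepath 0 r) x = (cnj \<circ> circlepath 0 r) x"
      by (simp add: reversepath_def circlepath exp_cnj)
  qed
  then have "contour_integral (cnj \<circ> circlepath 0 r) (\<lambda>\<zeta>. cnj (G (cnj \<zeta>))) =
      - contour_integral (circlepath 0 r) (\<lambda>\<zeta>. cnj (G (cnj \<zeta>)))"
    by (metis contour_integral_reversepath valid_path_circlepath)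
  then have "cnj (contour_integral (circlepath 0 r) G) = - contour_integral (circlepath 0 r) (\<lambda>\<zeta>. cnj (G (cnj \<zeta>)))"
    using contour_integral_cnj[OF valid_path_circlepath, of 0 r "\<lambda>\<zeta>. cnj (G (cnj \<zeta>))"] by (simp add: o_def)
  then show ?thesis by (simp add: circ_def)
qed

lemma circ_integrable:
  assumes "r > 0" "continuous_on (sphere 0 r) G"
  shows "G contour_integrable_on circlepath 0 r"
  by (rule contour_integrable_continuous_circlepath) (use assms in simp)

lemma circ_add:
  assumes "r > 0" "continuous_on (sphere 0 r) G" "continuous_on (sphere 0 r) H"
  shows "circ r (\<lambda>\<zeta>. G \<zeta> + H \<zeta>) = circ r G + circ r H"
  unfolding circ_def
  using contour_integral_add[OF circ_integrable[OF assms(1,2)] circ_integrable[OF assms(1,3)]]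
  by (simp add: add_divide_distrib)

lemma circ_lmul:
  assumes "r > 0" "continuous_on (sphere 0 r) G"
  shows "circ r (\<lambda>\<zeta>. c * G \<zeta>) = c * circ r G"
  unfolding circ_def using contour_integral_lmul[OF circ_integrable[OF assms], of c] by simp

lemma circ_Cauchy:
  assumes "f holomorphic_on ball 0 R" "r < R" "norm v < r"
  shows "circ r (\<lambda>\<zeta>. f \<zeta> / (\<zeta> - v)) = f v"
proof -
  have "((\<lambda>u. f u / (u - v)) has_contour_integral 2 * of_real pi * \<i> * f v) (circlepath 0 r)"
  proof (rule Cauchy_integral_circlepath)
    have "cball (0 :: complex) r \<subseteq> ball 0 R" using assms(2) by auto
    then have h: "f holomorphic_on cball 0 r" by (rule holomorphic_on_subset[OF assms(1)])
    show "continuous_on (cball (0 :: complex) r) f" by (rule holomorphic_on_imp_continuous_on[OF h])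
    show "f holomorphic_on ball 0 r" by (rule holomorphic_on_subset[OF h ball_subset_cball])
  qed (use assms(3) in simp)
  then show ?thesis by (simp add: circ_def contour_integral_unique)
qed

text \<open>One continuity statement for all the kernels that follow. The selectors \<open>s\<close>
  and \<open>t\<close> pick out of the parameter what enters \<open>g\<close> and the denominator;
  the exponent is 1 for the kernel and 2 for its derivative in the second variable.\<close>

lemma continuous_on_circ_integrand:
  fixes X :: "'a::topological_space set" and g :: "complex \<times> complex \<Rightarrow> complex"
  assumes c: "continuous_on (sphere 0 r) c" and q: "continuous_on (sphere 0 r) q"
    and qT: "\<And>w \<zeta>. w \<in> T \<Longrightarrow> \<zeta> \<in> sphere 0 r \<Longrightarrow> q \<zeta> \<noteq> w" and B: "sphere 0 r \<subseteq> B"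
    and s: "continuous_on X s" "s ` X \<subseteq> A" and t: "continuous_on X t" "t ` X \<subseteq> T"
    and g: "continuous_on (A \<times> B) g"
  shows "continuous_on (X \<times> sphere 0 r) (\<lambda>p. g (s (fst p), snd p) * c (snd p) / (q (snd p) - t (fst p)) ^ n)"
proof -
  have 1: "continuous_on (X \<times> sphere 0 r) (\<lambda>p. s (fst p))" "continuous_on (X \<times> sphere 0 r) (\<lambda>p. t (fst p))"
    by (rule continuous_on_compose2[OF s(1)] continuous_on_compose2[OF t(1)];
        auto intro: continuous_on_fst continuous_on_id)+
  have 2: "continuous_on (X \<times> sphere 0 r) (\<lambda>p. c (snd p))" "continuous_on (X \<times> sphere 0 r) (\<lambda>p. q (snd p))"
    by (rule continuous_on_compose2[OF c] continuous_on_compose2[OF q];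
        auto intro: continuous_on_snd continuous_on_id)+
  have "continuous_on (X \<times> sphere 0 r) (\<lambda>p. (s (fst p), snd p))"
    by (intro continuous_on_Pair 1 continuous_on_snd continuous_on_id)
  from continuous_on_compose2[OF g this]
  have "continuous_on (X \<times> sphere 0 r) (\<lambda>p. g (s (fst p), snd p))"
    using s(2) B by (fastforce simp: image_subset_iff)
  moreover have "q (snd p) - t (fst p) \<noteq> 0" if "p \<in> X \<times> sphere 0 r" for p
    using qT[of "t (fst p)" "snd p"] t(2) that by auto
  ultimately show ?thesis
    using 1 2 by (intro continuous_intros) auto
qed

text \<open>The denominator does not vanish for parameters in \<open>T\<close>, so the integral can
  be differentiated in either variable and Osgood's lemma joins the two. The later choices
  \<open>q \<zeta> = \<zeta>\<close> and \<open>q \<zeta> = \<zeta>\<^sup>2\<close> give division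
  and the splitting by parity.\<close>

lemma hol2_on_circ:
  assumes k: "hol2_on k (A \<times> B)" and A: "open A" and B: "sphere 0 r \<subseteq> B" and T: "open T"
    and c: "continuous_on (sphere 0 r) c" and q: "continuous_on (sphere 0 r) q"
    and qT: "\<And>w \<zeta>. w \<in> T \<Longrightarrow> \<zeta> \<in> sphere 0 r \<Longrightarrow> q \<zeta> \<noteq> w" and r: "r > 0"
  shows "hol2_on (\<lambda>p. circ r (\<lambda>\<zeta>. k (fst p, \<zeta>) * c \<zeta> / (q \<zeta> - snd p))) (A \<times> T)"
proof (rule Osgood)
  show "open (A \<times> T)" using A T by (rule open_Times)
  note cont = continuous_on_circ_integrand[OF c q qT B]
  have "continuous_on (A \<times> T) (\<lambda>p. contour_integral (circlepath 0 r) (\<lambda>\<zeta>. k (fst p, \<zeta>) * c \<zeta> / (q \<zeta> - snd p)))"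
  proof (rule continuous_on_circle_integral[OF _ r])
    have "continuous_on ((A \<times> T) \<times> sphere 0 r) (\<lambda>p. k (fst (fst p), snd p) * c (snd p) / (q (snd p) - snd (fst p)) ^ 1)"
      by (rule cont[where s = fst and t = snd and g = k and n = 1])
        (auto intro: continuous_on_fst continuous_on_snd continuous_on_id hol2_on_continuous[OF k])
    then show "continuous_on ((A \<times> T) \<times> sphere 0 r) (\<lambda>(x, \<zeta>). k (fst x, \<zeta>) * c \<zeta> / (q \<zeta> - snd x))"
      by (simp add: case_prod_unfold)
  qed
  then show "continuous_on (A \<times> T) (\<lambda>p. circ r (\<lambda>\<zeta>. k (fst p, \<zeta>) * c \<zeta> / (q \<zeta> - snd p)))"
    unfolding circ_def by (intro continuous_intros) auto
  fix u v assume uv: "(u, v) \<in> A \<times> T"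
  obtain e where e: "e > 0" "ball u e \<subseteq> A" using A uv by (meson mem_Sigma_iff open_contains_ball)
  obtain d where d: "d > 0" "ball v d \<subseteq> T" using T uv by (meson mem_Sigma_iff open_contains_ball)
  have "((\<lambda>z. contour_integral (circlepath 0 r) (\<lambda>\<zeta>. k (z, \<zeta>) * c \<zeta> / (q \<zeta> - v))) has_field_derivative
    contour_integral (circlepath 0 r) (\<lambda>\<zeta>. pd1 k (u, \<zeta>) * c \<zeta> / (q \<zeta> - v))) (at u)"
  proof (rule has_field_derivative_circle_integral[where U = "ball u e"])
    show "((\<lambda>z. k (z, \<zeta>) * c \<zeta> / (q \<zeta> - v)) has_field_derivative pd1 k (z, \<zeta>) * c \<zeta> / (q \<zeta> - v)) (at z)"
      if "z \<in> ball u e" "\<zeta> \<in> sphere 0 r" for z \<zeta>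
    proof -
      have "(z, \<zeta>) \<in> A \<times> B" using that subsetD[OF e(2)] subsetD[OF B] by blast
      then have "cdiff2 k (z, \<zeta>)" using k unfolding hol2_on_def by blast
      from DERIV_cdivide[OF DERIV_cmult_right[OF cdiff2_slice1[OF this]]] show ?thesis .
    qed
    have "continuous_on (ball u e \<times> sphere 0 r) (\<lambda>p. g (fst p, snd p) * c (snd p) / (q (snd p) - v) ^ 1)"
      if "continuous_on (A \<times> B) g" for g
      by (rule cont[where s = "\<lambda>z. z" and t = "\<lambda>_. v" and g = g and n = 1])
        (use that e uv in \<open>auto intro: continuous_on_id\<close>)
    from this[OF hol2_on_continuous[OF k]] this[OF continuous_on_pd1[OF k]]
    show "continuous_on (ball u e \<times> sphere 0 r) (\<lambda>(z, \<zeta>). k (z, \<zeta>) * c \<zeta> / (q \<zeta> - v))"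
      "continuous_on (ball u e \<times> sphere 0 r) (\<lambda>(z, \<zeta>). pd1 k (z, \<zeta>) * c \<zeta> / (q \<zeta> - v))"
      by (simp_all add: case_prod_unfold)
  qed (use r e in auto)
  from DERIV_cdivide[OF this]
  show "(\<lambda>z. circ r (\<lambda>\<zeta>. k (fst (z, v), \<zeta>) * c \<zeta> / (q \<zeta> - snd (z, v)))) field_differentiable at u"
    unfolding circ_def field_differentiable_def by auto
  have "((\<lambda>z. contour_integral (circlepath 0 r) (\<lambda>\<zeta>. k (u, \<zeta>) * c \<zeta> / (q \<zeta> - z))) has_field_derivative
    contour_integral (circlepath 0 r) (\<lambda>\<zeta>. k (u, \<zeta>) * c \<zeta> / (q \<zeta> - v)\<^sup>2)) (at v)"
  proof (rule has_field_derivative_circle_integral[where U = "ball v d"])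
    show "((\<lambda>z. k (u, \<zeta>) * c \<zeta> / (q \<zeta> - z)) has_field_derivative k (u, \<zeta>) * c \<zeta> / (q \<zeta> - z)\<^sup>2) (at z)"
      if "z \<in> ball v d" "\<zeta> \<in> sphere 0 r" for z \<zeta>
      using qT[OF subsetD[OF d(2) that(1)] that(2)]
      by (auto intro!: derivative_eq_intros simp: power2_eq_square)
    have "continuous_on (ball v d \<times> sphere 0 r) (\<lambda>p. k (u, snd p) * c (snd p) / (q (snd p) - fst p) ^ n)" for n
      by (rule cont[where s = "\<lambda>_. u" and t = "\<lambda>z. z" and g = k and n = n])
        (use d uv hol2_on_continuous[OF k] in \<open>auto intro: continuous_on_id\<close>)
    from this[of 1] this[of 2]
    show "continuous_on (ball v d \<times> sphere 0 r) (\<lambda>(z, \<zeta>). k (u, \<zeta>) * c \<zeta> / (q \<zeta> - z))"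
      "continuous_on (ball v d \<times> sphere 0 r) (\<lambda>(z, \<zeta>). k (u, \<zeta>) * c \<zeta> / (q \<zeta> - z)\<^sup>2)"
      by (simp_all add: case_prod_unfold)
  qed (use r d in auto)
  from DERIV_cdivide[OF this]
  show "(\<lambda>z. circ r (\<lambda>\<zeta>. k (fst (u, z), \<zeta>) * c \<zeta> / (q \<zeta> - snd (u, z)))) field_differentiable at v"
    unfolding circ_def field_differentiable_def by auto
qed

section \<open>Real holomorphic germs at the origin: division, parity, composition,
  inversion\<close>

definition cnj2 :: "complex \<times> complex \<Rightarrow> complex \<times> complex" where
  "cnj2 p = (cnj (fst p), cnj (snd p))"

text \<open>Being real at real points is encoded as symmetry under conjugation on a full complex
  neighbourhood, a form that passes through composition, Cauchy integrals and inversion.\<close>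

definition rgerm :: "(complex \<times> complex \<Rightarrow> complex) \<Rightarrow> bool" where
  "rgerm f \<longleftrightarrow> (\<forall>\<^sub>F p in nhds 0. cdiff2 f p \<and> f (cnj2 p) = cnj (f p))"

lemma cnj2_simps [simp]: "fst (cnj2 p) = cnj (fst p)" "snd (cnj2 p) = cnj (snd p)" "cnj2 (cnj2 p) = p"
  "cnj2 (u, v) = (cnj u, cnj v)" "cnj2 0 = 0"
  by (auto simp: cnj2_def zero_prod_def)

lemma continuous_cnj2: "continuous_on S cnj2"
  unfolding cnj2_def by (intro continuous_intros)

lemma eventually_polydisc:
  fixes P :: "complex \<times> complex \<Rightarrow> bool"
  shows "eventually P (nhds 0) \<longleftrightarrow> (\<exists>R>0. \<forall>u\<in>ball 0 R. \<forall>v\<in>ball 0 R. P (u, v))"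
proof
  assume "eventually P (nhds 0)"
  then obtain S where S: "open S" "(0, 0) \<in> S" "\<And>p. p \<in> S \<Longrightarrow> P p"
    unfolding eventually_nhds zero_prod_def by blast
  obtain r where r: "r > 0" "cball 0 r \<times> cball 0 r \<subseteq> S"
    using open_contains_polydisc[OF S(1,2)] by blast
  then show "\<exists>R>0. \<forall>u\<in>ball 0 R. \<forall>v\<in>ball 0 R. P (u, v)"
    by (intro exI[of _ r]) (auto intro!: S(3))
next
  assume "\<exists>R>0. \<forall>u\<in>ball 0 R. \<forall>v\<in>ball 0 R. P (u, v)"
  then obtain R where R: "R > 0" "\<forall>u\<in>ball 0 R. \<forall>v\<in>ball 0 R. P (u, v)" by blast
  have "0 \<in> ball (0::complex) R \<times> ball (0::complex) R"
    unfolding zero_prod_def mem_Sigma_iff using R(1) by simp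
  moreover have "open (ball (0::complex) R \<times> ball (0::complex) R)" by (intro open_Times open_ball)
  moreover have "\<forall>p\<in>ball 0 R \<times> ball 0 R. P p"
    using R(2) by (simp only: mem_Times_iff split_paired_Ball_Sigma)
  ultimately show "eventually P (nhds 0)"
    unfolding eventually_nhds by (intro exI[of _ "ball 0 R \<times> ball 0 R"] conjI)
qed

lemma rgermE:
  assumes "rgerm f"
  obtains R where "R > 0" "hol2_on f (ball 0 R \<times> ball 0 R)"
    "\<And>u v. u \<in> ball 0 R \<Longrightarrow> v \<in> ball 0 R \<Longrightarrow> f (cnj u, cnj v) = cnj (f (u, v))"
proof -
  obtain R where R: "R > 0" "\<forall>u\<in>ball 0 R. \<forall>v\<in>ball 0 R. cdiff2 f (u, v) \<and> f (cnj2 (u, v)) = cnj (f (u, v))"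
    using assms unfolding rgerm_def eventually_polydisc by metis
  show thesis
  proof (rule that[OF R(1)])
    show "hol2_on f (ball 0 R \<times> ball 0 R)"
      unfolding hol2_on_def using R(2) by (auto intro: open_Times)
    show "f (cnj u, cnj v) = cnj (f (u, v))" if "u \<in> ball 0 R" "v \<in> ball 0 R" for u v
      using bspec[OF bspec[OF R(2) that(1)] that(2)] by (simp only: cnj2_simps)
  qed
qed

lemma rgermI:
  assumes "R > 0" "hol2_on f (ball 0 R \<times> ball 0 R)"
    "\<And>u v. u \<in> ball 0 R \<Longrightarrow> v \<in> ball 0 R \<Longrightarrow> f (cnj u, cnj v) = cnj (f (u, v))"
  shows "rgerm f"
  unfolding rgerm_def eventually_polydisc
proof (intro exI[of _ R] conjI ballI)
  show "cdiff2 f (u, v)" if "u \<in> ball 0 R" "v \<in> ball 0 R" for u v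
    using assms(2) that unfolding hol2_on_def by blast
  show "f (cnj2 (u, v)) = cnj (f (u, v))" if "u \<in> ball 0 R" "v \<in> ball 0 R" for u v
    unfolding cnj2_simps using assms(3) that .
qed (fact assms(1))

text \<open>The bound \<open>\<delta>\<close> keeps the kernel free of poles for second arguments of
  modulus below \<open>\<delta>\<close>. Symmetry holds because conjugating the integral amounts to
  conjugating the integration variable, under which \<open>k\<close>, \<open>c\<close> and
  \<open>q\<close> are all symmetric.\<close>

lemma rgerm_circ:
  assumes k: "hol2_on k (ball 0 R \<times> ball 0 R)"
    and sym: "\<And>u v. u \<in> ball 0 R \<Longrightarrow> v \<in> ball 0 R \<Longrightarrow> k (cnj u, cnj v) = cnj (k (u, v))"
    and r: "0 < r" "r < R" and c: "continuous_on (sphere 0 r) c" and q: "continuous_on (sphere 0 r) q"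
    and cq: "\<And>\<zeta>. c (cnj \<zeta>) = cnj (c \<zeta>)" "\<And>\<zeta>. q (cnj \<zeta>) = cnj (q \<zeta>)"
    and \<delta>: "0 < \<delta>" "\<And>\<zeta>. \<zeta> \<in> sphere 0 r \<Longrightarrow> \<delta> \<le> norm (q \<zeta>)"
  shows "rgerm (\<lambda>p. circ r (\<lambda>\<zeta>. k (fst p, \<zeta>) * c \<zeta> / (q \<zeta> - snd p)))"
proof (rule rgermI)
  show "0 < min R \<delta>" using r \<delta> by auto
  have "hol2_on (\<lambda>p. circ r (\<lambda>\<zeta>. k (fst p, \<zeta>) * c \<zeta> / (q \<zeta> - snd p))) (ball 0 R \<times> ball 0 \<delta>)"
  proof (rule hol2_on_circ[OF k _ _ _ c q _ r(1)])
    show "q \<zeta> \<noteq> w" if "w \<in> ball 0 \<delta>" "\<zeta> \<in> sphere 0 r" for w \<zeta>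
      using \<delta>(2)[OF that(2)] that(1) by auto
  qed (use r in auto)
  then show "hol2_on (\<lambda>p. circ r (\<lambda>\<zeta>. k (fst p, \<zeta>) * c \<zeta> / (q \<zeta> - snd p))) (ball 0 (min R \<delta>) \<times> ball 0 (min R \<delta>))"
    unfolding hol2_on_def by (auto simp: open_Times)
  fix u v :: complex assume uv: "u \<in> ball 0 (min R \<delta>)" "v \<in> ball 0 (min R \<delta>)"
  have "cnj (k (u, cnj \<zeta>)) = k (cnj u, \<zeta>)" if "\<zeta> \<in> sphere 0 r" for \<zeta>
  proof -
    have "u \<in> ball 0 R" "cnj \<zeta> \<in> ball 0 R" using uv that r(2) by auto
    from sym[OF this] show ?thesis by simp
  qed
  note ck = this
  show "circ r (\<lambda>\<zeta>. k (fst (cnj u, cnj v), \<zeta>) * c \<zeta> / (q \<zeta> - snd (cnj u, cnj v))) =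
       cnj (circ r (\<lambda>\<zeta>. k (fst (u, v), \<zeta>) * c \<zeta> / (q \<zeta> - snd (u, v))))"
    unfolding cnj_circ by (intro circ_cong[OF r(1)]) (simp only: ck fst_conv snd_conv cq complex_cnj_mult complex_cnj_divide complex_cnj_diff complex_cnj_cnj)
qed

lemma hol2_on_slice_holomorphic:
  assumes "hol2_on k (A \<times> B)" "u \<in> A"
  shows "(\<lambda>\<zeta>. k (u, \<zeta>)) holomorphic_on B"
  unfolding holomorphic_on_def
proof
  fix v assume "v \<in> B"
  then show "(\<lambda>\<zeta>. k (u, \<zeta>)) field_differentiable at v within B"
    using assms(2) by (auto intro: hol2_on_slices(2)[OF assms(1), THEN field_differentiable_at_within])
qed

text \<open>Hadamard's division with a parameter, made explicit: integrating \<open>1 / (\<zeta> -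
  v) - 1 / \<zeta> = v / (\<zeta> * (\<zeta> - v))\<close> against \<open>h (u, \<zeta>)\<close>
  gives \<open>h (u, v) - h (u, 0)\<close> on the left and \<open>v\<close> times a holomorphic germ
  on the right.\<close>

lemma rgerm_division:
  assumes "rgerm h" "\<forall>\<^sub>F u in nhds 0. h (u, 0) = 0"
  obtains g where "rgerm g" "\<forall>\<^sub>F p in nhds 0. h p = snd p * g p"
proof -
  obtain R where R: "R > 0" and hol: "hol2_on h (ball 0 R \<times> ball 0 R)"
    and sym: "\<And>u v. u \<in> ball 0 R \<Longrightarrow> v \<in> ball 0 R \<Longrightarrow> h (cnj u, cnj v) = cnj (h (u, v))"
    using assms(1) by (rule rgermE) blast
  define r where "r = R / 2"
  have r: "0 < r" "r < R" using R by (auto simp: r_def)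
  let ?g = "\<lambda>p. circ r (\<lambda>\<zeta>. h (fst p, \<zeta>) * (1 / \<zeta>) / (\<zeta> - snd p))"
  obtain e where e: "e > 0" "\<And>u. u \<in> ball 0 e \<Longrightarrow> h (u, 0) = 0"
    using assms(2) unfolding eventually_nhds_metric by (auto simp: dist_commute)
  have c: "continuous_on (sphere 0 r) (\<lambda>\<zeta>::complex. 1 / \<zeta>)"
    by (intro continuous_intros) (use r(1) in auto)
  have "rgerm ?g"
    by (rule rgerm_circ[OF hol sym r c continuous_on_id, where \<delta> = r]) (use r(1) in simp_all)
  moreover have "\<forall>\<^sub>F p in nhds 0. h p = snd p * ?g p"
    unfolding eventually_polydisc
  proof (intro exI[of _ "min e r"] conjI ballI)
    fix u v :: complex assume uv: "u \<in> ball 0 (min e r)" "v \<in> ball 0 (min e r)"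
    have hu: "(\<lambda>\<zeta>. h (u, \<zeta>)) holomorphic_on ball 0 R"
      by (rule hol2_on_slice_holomorphic[OF hol]) (use uv r in auto)
    then have cu: "continuous_on (sphere 0 r) (\<lambda>\<zeta>. h (u, \<zeta>))"
      by (intro holomorphic_on_imp_continuous_on holomorphic_on_subset[OF hu]) (use r in auto)
    have ne: "\<zeta> \<noteq> 0" "\<zeta> - v \<noteq> 0" if "\<zeta> \<in> sphere 0 r" for \<zeta> using that uv r(1) by auto
    have c0: "continuous_on (sphere 0 r) (\<lambda>\<zeta>. h (u, \<zeta>) / (\<zeta> - 0))"
      by (intro continuous_intros cu) (use ne in auto)
    have c1: "continuous_on (sphere 0 r) (\<lambda>\<zeta>. h (u, \<zeta>) * (1 / \<zeta>) / (\<zeta> - v))"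
      by (intro continuous_intros cu) (use ne in auto)
    have "h (u, v) = h (u, v) - h (u, 0)" using e(2)[of u] uv by simp
    also have "\<dots> = circ r (\<lambda>\<zeta>. h (u, \<zeta>) / (\<zeta> - v)) - circ r (\<lambda>\<zeta>. h (u, \<zeta>) / (\<zeta> - 0))"
      using circ_Cauchy[OF hu r(2), of v] circ_Cauchy[OF hu r(2), of 0] uv r(1) by simp
    also have "circ r (\<lambda>\<zeta>. h (u, \<zeta>) / (\<zeta> - v)) =
        circ r (\<lambda>\<zeta>. h (u, \<zeta>) / (\<zeta> - 0) + v * (h (u, \<zeta>) * (1 / \<zeta>) / (\<zeta> - v)))"
    proof (rule circ_cong[OF r(1)])
      fix \<zeta> :: complex assume "\<zeta> \<in> sphere 0 r"
      then have "\<zeta> \<noteq> 0" "\<zeta> - v \<noteq> 0" using ne by blast+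
      then show "h (u, \<zeta>) / (\<zeta> - v) = h (u, \<zeta>) / (\<zeta> - 0) + v * (h (u, \<zeta>) * (1 / \<zeta>) / (\<zeta> - v))"
        by (simp add: divide_simps) (simp add: algebra_simps)
    qed
    also have "\<dots> = circ r (\<lambda>\<zeta>. h (u, \<zeta>) / (\<zeta> - 0)) + v * circ r (\<lambda>\<zeta>. h (u, \<zeta>) * (1 / \<zeta>) / (\<zeta> - v))"
      using circ_add[OF r(1) c0 continuous_on_mult_left[OF c1], of v] circ_lmul[OF r(1) c1, of v] by simp
    finally show "h (u, v) = snd (u, v) * ?g (u, v)" by simp
  next
    show "0 < min e r" using e(1) r(1) by simp
  qed
  ultimately show thesis by (rule that[of ?g])
qed

text \<open>Write the Cauchy kernel as \<open>1 / (\<zeta> - v) = (\<zeta> + v) / (\<zeta>\<^sup>2 -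
  v\<^sup>2)\<close>. The numerator separates the even from the odd part, and what remains depends
  on \<open>v\<close> only through its square, so both parts are holomorphic in
  \<open>v\<^sup>2\<close>. This takes the place of Whitney's theorem on even functions.\<close>

lemma rgerm_even_odd:
  assumes "rgerm k"
  obtains a b where "rgerm a" "rgerm b"
    "\<forall>\<^sub>F p in nhds 0. k p = a (fst p, (snd p)\<^sup>2) + snd p * b (fst p, (snd p)\<^sup>2)"
proof -
  obtain R where R: "R > 0" and hol: "hol2_on k (ball 0 R \<times> ball 0 R)"
    and sym: "\<And>u v. u \<in> ball 0 R \<Longrightarrow> v \<in> ball 0 R \<Longrightarrow> k (cnj u, cnj v) = cnj (k (u, v))"
    using assms(1) by (rule rgermE) blast
  define r where "r = R / 2"
  have r: "0 < r" "r < R" using R by (auto simp: r_def)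
  let ?a = "\<lambda>p. circ r (\<lambda>\<zeta>. k (fst p, \<zeta>) * \<zeta> / (\<zeta>\<^sup>2 - snd p))"
  let ?b = "\<lambda>p. circ r (\<lambda>\<zeta>. k (fst p, \<zeta>) * 1 / (\<zeta>\<^sup>2 - snd p))"
  have "rgerm ?a" "rgerm ?b"
    by (rule rgerm_circ[OF hol sym r, where \<delta> = "r\<^sup>2" and c = "\<lambda>\<zeta>. \<zeta>" and q = "\<lambda>\<zeta>. \<zeta>\<^sup>2"]
        rgerm_circ[OF hol sym r, where \<delta> = "r\<^sup>2" and c = "\<lambda>_. 1" and q = "\<lambda>\<zeta>. \<zeta>\<^sup>2"];
        use r(1) in \<open>simp add: continuous_on_power norm_power\<close>)+
  moreover have "\<forall>\<^sub>F p in nhds 0. k p = ?a (fst p, (snd p)\<^sup>2) + snd p * ?b (fst p, (snd p)\<^sup>2)"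
    unfolding eventually_polydisc
  proof (intro exI[of _ r] conjI ballI)
    fix u v :: complex assume uv: "u \<in> ball 0 r" "v \<in> ball 0 r"
    have ne: "\<zeta>\<^sup>2 - v\<^sup>2 \<noteq> 0" if "\<zeta> \<in> sphere 0 r" for \<zeta>
      using that uv by (auto simp: power2_eq_iff)
    have hu: "(\<lambda>\<zeta>. k (u, \<zeta>)) holomorphic_on ball 0 R"
      by (rule hol2_on_slice_holomorphic[OF hol]) (use uv r in auto)
    then have cu: "continuous_on (sphere 0 r) (\<lambda>\<zeta>. k (u, \<zeta>))"
      by (intro holomorphic_on_imp_continuous_on holomorphic_on_subset[OF hu]) (use r in auto)
    have c1: "continuous_on (sphere 0 r) (\<lambda>\<zeta>. k (u, \<zeta>) * \<zeta> / (\<zeta>\<^sup>2 - v\<^sup>2))"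
      "continuous_on (sphere 0 r) (\<lambda>\<zeta>. k (u, \<zeta>) * 1 / (\<zeta>\<^sup>2 - v\<^sup>2))"
      by (intro continuous_intros cu; use ne in auto)+
    have "k (u, v) = circ r (\<lambda>\<zeta>. k (u, \<zeta>) / (\<zeta> - v))"
      using circ_Cauchy[OF hu r(2), of v] uv by auto
    also have "\<dots> = circ r (\<lambda>\<zeta>. k (u, \<zeta>) * \<zeta> / (\<zeta>\<^sup>2 - v\<^sup>2) + v * (k (u, \<zeta>) * 1 / (\<zeta>\<^sup>2 - v\<^sup>2)))"
    proof (rule circ_cong[OF r(1)])
      fix \<zeta> :: complex assume z: "\<zeta> \<in> sphere 0 r"
      have f: "\<zeta>\<^sup>2 - v\<^sup>2 = (\<zeta> - v) * (\<zeta> + v)" by (simp add: power2_eq_square algebra_simps)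
      then have "\<zeta> - v \<noteq> 0" "\<zeta> + v \<noteq> 0" using ne[OF z] by auto
      then show "k (u, \<zeta>) / (\<zeta> - v) = k (u, \<zeta>) * \<zeta> / (\<zeta>\<^sup>2 - v\<^sup>2) + v * (k (u, \<zeta>) * 1 / (\<zeta>\<^sup>2 - v\<^sup>2))"
        unfolding f by (simp add: divide_simps) (simp add: algebra_simps)
    qed
    also have "\<dots> = ?a (u, v\<^sup>2) + v * ?b (u, v\<^sup>2)"
      using circ_add[OF r(1) c1(1) continuous_on_mult_left[OF c1(2)], of v] circ_lmul[OF r(1) c1(2), of v] by simp
    finally show "k (u, v) = ?a (fst (u, v), (snd (u, v))\<^sup>2) + snd (u, v) * ?b (fst (u, v), (snd (u, v))\<^sup>2)"
      by simp
  next
    show "0 < r" by (rule r(1))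
  qed
  ultimately show thesis by (rule that[of ?a ?b])
qed

lemma rgerm_cdiff2: "rgerm f \<Longrightarrow> \<forall>\<^sub>F p in nhds 0. cdiff2 f p"
  unfolding rgerm_def by (elim eventually_mono) auto

lemma rgerm_sym: "rgerm f \<Longrightarrow> \<forall>\<^sub>F p in nhds 0. f (cnj2 p) = cnj (f p)"
  unfolding rgerm_def by (elim eventually_mono) auto

lemma rgerm_isCont: "rgerm f \<Longrightarrow> isCont f 0"
  using rgerm_cdiff2 eventually_nhds_x_imp_x cdiff2_isCont by blast

lemma isCont_eventually:
  fixes f :: "'a::t2_space \<Rightarrow> 'b::topological_space"
  assumes "isCont f a" "\<forall>\<^sub>F y in nhds (f a). P y"
  shows "\<forall>\<^sub>F x in nhds a. P (f x)"
  using eventually_compose_filterlim[OF assms(2)] assms(1)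
  by (simp add: isCont_def tendsto_at_iff_tendsto_nhds)

lemma eventually_germ:
  assumes "\<forall>\<^sub>F z in nhds 0. P z" "isCont f a" "f a = 0"
  shows "\<forall>\<^sub>F x in nhds a. P (f x)"
  using isCont_eventually[OF assms(2), of P] assms(1,3) by simp

text \<open>The rule by which germ identities are substituted into one another: inner germs that
  vanish at the origin stay in the neighbourhood where the outer identity holds.\<close>

lemma eventually_germ2:
  fixes P :: "complex \<times> complex \<Rightarrow> bool"
  assumes "\<forall>\<^sub>F p in nhds 0. P p" "rgerm g" "rgerm k" "g 0 = 0" "k 0 = 0"
  shows "\<forall>\<^sub>F p in nhds 0. P (g p, k p)"
  by (rule eventually_germ[OF assms(1)])
     (use assms rgerm_isCont in \<open>auto simp: zero_prod_def intro!: isCont_Pair\<close>)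

lemma rgerm_const [simp]: "cnj c = c \<Longrightarrow> rgerm (\<lambda>_. c)"
  unfolding rgerm_def by simp

lemma rgerm_fst [simp]: "rgerm fst" and rgerm_snd [simp]: "rgerm snd"
  unfolding rgerm_def by simp_all

lemma rgerm_add:
  assumes "rgerm f" "rgerm g"
  shows "rgerm (\<lambda>p. f p + g p)"
  using assms unfolding rgerm_def by eventually_elim auto

lemma rgerm_diff:
  assumes "rgerm f" "rgerm g"
  shows "rgerm (\<lambda>p. f p - g p)"
  using assms unfolding rgerm_def by eventually_elim auto

lemma rgerm_mult:
  assumes "rgerm f" "rgerm g"
  shows "rgerm (\<lambda>p. f p * g p)"
  using assms unfolding rgerm_def by eventually_elim auto

lemma rgerm_power: "rgerm f \<Longrightarrow> rgerm (\<lambda>p. f p ^ n)"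
  unfolding rgerm_def by (elim eventually_mono) auto

lemma rgerm_compose1:
  assumes "\<forall>\<^sub>F z in nhds (f 0). \<phi> field_differentiable at z \<and> \<phi> (cnj z) = cnj (\<phi> z)" "rgerm f"
  shows "rgerm (\<lambda>p. \<phi> (f p))"
proof -
  have "\<forall>\<^sub>F p in nhds 0. \<phi> field_differentiable at (f p) \<and> \<phi> (cnj (f p)) = cnj (\<phi> (f p))"
    using isCont_eventually[OF rgerm_isCont[OF assms(2)] assms(1)] .
  then show ?thesis
    using assms(2) unfolding rgerm_def
    by eventually_elim (auto simp: field_differentiable_def intro: cdiff2_compose1)
qed

lemma rgerm_compose2:
  assumes "rgerm f" "rgerm g" "rgerm k" "g 0 = 0" "k 0 = 0"
  shows "rgerm (\<lambda>p. f (g p, k p))"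
proof -
  have "\<forall>\<^sub>F p in nhds 0. cdiff2 f (g p, k p) \<and> f (cnj2 (g p, k p)) = cnj (f (g p, k p))"
    by (rule eventually_germ2[OF assms(1)[unfolded rgerm_def] assms(2-5)])
  then show ?thesis
    using assms(2,3) unfolding rgerm_def
    by eventually_elim (auto intro: cdiff2_compose2)
qed

text \<open>The inverse function theorem for \<open>(u, v)\<close> sent to
  \<open>(f (u, v), v)\<close>, whose derivative is invertible because \<open>pd1 f\<close> is
  nonzero at the origin. The second coordinate is kept, so the inverse is determined by its first
  component \<open>g\<close>.\<close>

lemma rgerm_implicit1:
  assumes f: "rgerm f" "f 0 = 0" and nz: "pd1 f 0 \<noteq> 0"
  obtains g where "rgerm g" "g 0 = 0" "\<forall>\<^sub>F p in nhds 0. f (g p, snd p) = fst p"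
    "\<forall>\<^sub>F p in nhds 0. g (f p, snd p) = fst p"
proof -
  obtain R where R: "R > 0" and hol: "hol2_on f (ball 0 R \<times> ball 0 R)"
    and sym: "\<And>u v. u \<in> ball 0 R \<Longrightarrow> v \<in> ball 0 R \<Longrightarrow> f (cnj u, cnj v) = cnj (f (u, v))"
    using f(1) by (rule rgermE) blast
  define D where "D = ball (0::complex) R \<times> ball (0::complex) R"
  have D: "open D" "0 \<in> D" unfolding D_def zero_prod_def using R by (simp_all add: open_Times)
  define \<Phi> where "\<Phi> = (\<lambda>p. (f p, snd p))"
  define A where "A = (\<lambda>p. Blinfun (\<lambda>h. (pd1 f p * fst h + pd2 f p * snd h, snd h)))"
  have A: "blinfun_apply (A p) = (\<lambda>h. (pd1 f p * fst h + pd2 f p * snd h, snd h))" for p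
    unfolding A_def by (rule bounded_linear_Blinfun_apply)
      (intro bounded_linear_Pair bounded_linear_add bounded_linear_const_mult bounded_linear_fst bounded_linear_snd)
  define B where "B = Blinfun (\<lambda>h. ((1 / pd1 f 0) * fst h + (- pd2 f 0 / pd1 f 0) * snd h, snd h))"
  have B: "blinfun_apply B = (\<lambda>h. ((1 / pd1 f 0) * fst h + (- pd2 f 0 / pd1 f 0) * snd h, snd h))"
    unfolding B_def by (rule bounded_linear_Blinfun_apply)
      (intro bounded_linear_Pair bounded_linear_add bounded_linear_const_mult bounded_linear_fst bounded_linear_snd)
  have d\<Phi>: "(\<Phi> has_derivative blinfun_apply (A p)) (at p)" if "p \<in> D" for p
    unfolding \<Phi>_def A using that hol
    by (intro has_derivative_Pair cdiff2_has_derivative has_derivative_snd has_derivative_ident)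
      (auto simp: hol2_on_def D_def)
  have c1: "continuous_on D (pd1 f)" "continuous_on D (pd2 f)"
    using hol2_on_continuous[OF hol2_on_pd1[OF hol]] hol2_on_continuous[OF hol2_on_pd2[OF hol]]
    by (simp_all add: D_def)
  have cA: "continuous_on D A"
    by (rule continuous_on_blinfun_componentwise) (simp add: A, intro continuous_intros c1)
  have inv: "B o\<^sub>L A 0 = id_blinfun"
    by (rule blinfun_eqI) (use nz in \<open>auto simp: A B prod_eq_iff field_simps\<close>)
  obtain U V g g' where UV: "open U" "U \<subseteq> D" "0 \<in> U" "open V" "\<Phi> 0 \<in> V" "homeomorphism U V \<Phi> g"
    and g': "\<And>y. y \<in> V \<Longrightarrow> (g has_derivative (g' y)) (at y)"
      "\<And>y. y \<in> V \<Longrightarrow> g' y = inv (blinfun_apply (A (g y)))"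
      "\<And>y. y \<in> V \<Longrightarrow> bij (blinfun_apply (A (g y)))"
    by (rule inverse_function_theorem[OF D(1) d\<Phi> cA D(2) inv]) blast+
  have \<Phi>0: "\<Phi> 0 = 0" using f(2) by (simp add: \<Phi>_def zero_prod_def)
  have V0: "0 \<in> V" using UV(5) \<Phi>0 by simp
  have g\<Phi>: "g (\<Phi> p) = p" if "p \<in> U" for p using UV(6) that by (simp add: homeomorphism_def)
  have \<Phi>g: "\<Phi> (g y) = y" "g y \<in> U" if "y \<in> V" for y using UV(6) that by (auto simp: homeomorphism_def)
  have g0: "g 0 = 0" using g\<Phi>[OF UV(3)] \<Phi>0 by simp
  define G where "G = (\<lambda>y. fst (g y))"
  have g_eq: "g y = (G y, snd y)" if "y \<in> V" for y
    using \<Phi>g(1)[OF that] unfolding \<Phi>_def G_def by (auto simp: prod_eq_iff)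
  have "cdiff2 G y" if y: "y \<in> V" for y
  proof -
    let ?a = "pd1 f (g y)" and ?b = "pd2 f (g y)"
    have "?a \<noteq> 0"
    proof
      assume "?a = 0"
      then have "blinfun_apply (A (g y)) (1, 0) = blinfun_apply (A (g y)) (0, 0)" by (simp add: A)
      then show False using g'(3)[OF y] by (metis bij_is_inj injD prod.inject zero_neq_one)
    qed
    \<comment> \<open>The theorem only yields a real derivative; writing the inverse out shows that
      it is complex linear.\<close>
    then have "g' y = (\<lambda>h. ((1 / ?a) * fst h + (- ?b / ?a) * snd h, snd h))"
      unfolding g'(2)[OF y] by (intro inv_equality) (auto simp: A prod_eq_iff field_simps)
    then have "(G has_derivative (\<lambda>h. (1 / ?a) * fst h + (- ?b / ?a) * snd h)) (at y)"
      unfolding G_def using has_derivative_fst[OF g'(1)[OF y]] by simp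
    then show ?thesis by (rule cdiff2I)
  qed
  then have ev1: "\<forall>\<^sub>F y in nhds 0. cdiff2 G y"
    unfolding eventually_nhds using UV(4) V0 by blast
  have cg: "isCont g 0" using g'(1)[OF V0] has_derivative_continuous by blast
  have "isCont cnj2 0" using continuous_cnj2[of UNIV] continuous_on_eq_continuous_at[OF open_UNIV] by blast
  moreover have "\<forall>\<^sub>F p in nhds 0. p \<in> U" using UV(1,3) by (rule eventually_nhds_in_open)
  ultimately have "\<forall>\<^sub>F p in nhds 0. cnj2 p \<in> U \<and> f (cnj2 p) = cnj (f p)"
    using eventually_germ[where P = "\<lambda>p. p \<in> U" and f = cnj2 and a = 0] rgerm_sym[OF f(1)] by (simp add: eventually_conj)
  then have "\<forall>\<^sub>F y in nhds 0. cnj2 (g y) \<in> U \<and> f (cnj2 (g y)) = cnj (f (g y))"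
    using eventually_germ[OF _ cg g0, where P = "\<lambda>p. cnj2 p \<in> U \<and> f (cnj2 p) = cnj (f p)"] by blast
  moreover have evV: "\<forall>\<^sub>F y in nhds 0. y \<in> V" using UV(4) V0 by (rule eventually_nhds_in_open)
  \<comment> \<open>The conjugate of \<open>g y\<close> lies in \<open>U\<close> and is mapped to
    the conjugate of \<open>y\<close>; uniqueness of preimages in \<open>U\<close> makes the inverse
    symmetric.\<close>
  ultimately have ev2: "\<forall>\<^sub>F y in nhds 0. G (cnj2 y) = cnj (G y)"
  proof eventually_elim
    case (elim y)
    have "f (g y) = fst y" "snd (g y) = snd y" using \<Phi>g(1)[OF elim(2)] unfolding \<Phi>_def by (metis fst_conv, metis snd_conv)
    then have "\<Phi> (cnj2 (g y)) = cnj2 y" using elim(1) by (simp add: \<Phi>_def cnj2_def)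
    then have "g (cnj2 y) = cnj2 (g y)" using g\<Phi> elim(1) by metis
    then show ?case by (simp add: G_def)
  qed
  show thesis
  proof (rule that[of G])
    show "rgerm G" unfolding rgerm_def using ev1 ev2 by (rule eventually_conj)
    show "G 0 = 0" by (simp add: G_def g0)
    show "\<forall>\<^sub>F p in nhds 0. f (G p, snd p) = fst p"
      using evV
    proof eventually_elim
      case (elim y)
      then show ?case using \<Phi>g(1)[OF elim] g_eq[OF elim] by (simp add: \<Phi>_def prod_eq_iff)
    qed
    show "\<forall>\<^sub>F p in nhds 0. G (f p, snd p) = fst p"
      using eventually_nhds_in_open[OF UV(1,3)]
    proof eventually_elim
      case (elim y)
      then show ?case using g\<Phi>[OF elim] by (simp add: \<Phi>_def G_def)
    qed
  qed
qed

lemma rgerm_implicit2: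
  assumes f: "rgerm f" "f 0 = 0" and nz: "pd2 f 0 \<noteq> 0"
  obtains g where "rgerm g" "g 0 = 0" "\<forall>\<^sub>F p in nhds 0. f (fst p, g p) = snd p"
    "\<forall>\<^sub>F p in nhds 0. g (fst p, f p) = snd p"
proof -
  have "rgerm (\<lambda>p. f (snd p, fst p))" "f (snd 0, fst 0) = 0" "pd1 (\<lambda>p. f (snd p, fst p)) 0 \<noteq> 0"
    using f nz pd2_swap[of f 0 0] by (auto intro!: rgerm_compose2 simp: zero_prod_def)
  then obtain g where g: "rgerm g" "g 0 = 0"
    "\<forall>\<^sub>F p in nhds 0. f (snd p, g p) = fst p"
    "\<forall>\<^sub>F p in nhds 0. g (f (snd p, fst p), snd p) = fst p"
    by (rule rgerm_implicit1) auto
  note sw = eventually_germ2[OF _ rgerm_snd rgerm_fst]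
  show thesis
  proof (rule that[of "\<lambda>p. g (snd p, fst p)"])
    show "rgerm (\<lambda>p. g (snd p, fst p))" by (intro rgerm_compose2 g) auto
    show "g (snd 0, fst 0) = 0" using g(2) by (simp add: zero_prod_def)
    show "\<forall>\<^sub>F p in nhds 0. f (fst p, g (snd p, fst p)) = snd p" using sw[OF g(3)] by simp
    show "\<forall>\<^sub>F p in nhds 0. g (snd (fst p, f p), fst (fst p, f p)) = snd p" using sw[OF g(4)] by simp
  qed
qed

section \<open>Normal form of the surface germs\<close>

lemma rgerm_pd_cdiff2:
  assumes "rgerm f"
  shows "\<forall>\<^sub>F p in nhds 0. cdiff2 (pd1 f) p \<and> cdiff2 (pd2 f) p"
proof -
  obtain R where R: "R > 0" "hol2_on f (ball 0 R \<times> ball 0 R)"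
    using assms by (rule rgermE) blast
  have "0 \<in> ball (0::complex) R \<times> ball (0::complex) R"
    unfolding zero_prod_def mem_Sigma_iff using R(1) by simp
  then show ?thesis
    using hol2_on_pd1[OF R(2)] hol2_on_pd2[OF R(2)] unfolding hol2_on_def eventually_nhds
    by (intro exI[of _ "ball 0 R \<times> ball 0 R"]) simp
qed

text \<open>At a zero of \<open>T\<close> the difference quotient of the product is that of
  \<open>T\<close> times \<open>W\<close>, so mere continuity of \<open>W\<close> suffices. It
  spares differentiating the cofactors in all the leading-coefficient computations below.\<close>

lemma DERIV_mult_at_zero:
  fixes T :: "complex \<Rightarrow> complex"
  assumes "(T has_field_derivative t) (at a)" "T a = 0" "isCont W a"
  shows "((\<lambda>z. T z * W z) has_field_derivative t * W a) (at a)"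
proof -
  have "((\<lambda>z. T z / (z - a)) \<longlongrightarrow> t) (at a)" "(W \<longlongrightarrow> W a) (at a)"
    using assms(1,3) unfolding has_field_derivative_iff isCont_def assms(2) by simp_all
  from tendsto_mult[OF this] show ?thesis
    unfolding has_field_derivative_iff assms(2) by simp
qed

lemma DERIV_transfer:
  assumes "(f has_field_derivative D) (at a)" "\<forall>\<^sub>F z in nhds a. f z = g z"
  shows "(g has_field_derivative D) (at a)"
  using DERIV_cong_ev[OF refl assms(2) refl] assms(1) by blast

text \<open>Cancelling the factor gives \<open>E = 0\<close> only on a punctured neighbourhood;
  continuity supplies the value at 0.\<close>

lemma DERIV_zero_of_mult:
  fixes E :: "complex \<Rightarrow> complex"
  assumes "(E has_field_derivative D) (at 0)" "\<forall>\<^sub>F z in nhds 0. z * E z = 0"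
  shows "D = 0"
proof -
  have ev: "\<forall>\<^sub>F z in at 0. E z = 0"
    using assms(2) unfolding eventually_at_filter by eventually_elim auto
  have "(E \<longlongrightarrow> E 0) (at 0)" using DERIV_isCont[OF assms(1)] by (simp add: isCont_def)
  moreover have "(E \<longlongrightarrow> 0) (at 0)" using ev by (simp add: tendsto_eventually)
  ultimately have E0: "E 0 = 0" by (rule tendsto_unique[rotated]) simp
  have "((\<lambda>z. (E z - E 0) / (z - 0)) \<longlongrightarrow> D) (at 0)"
    using assms(1) by (simp add: has_field_derivative_iff)
  moreover have "((\<lambda>z. (E z - E 0) / (z - 0)) \<longlongrightarrow> 0) (at 0)"
    by (rule tendsto_eventually) (use ev in eventually_elim, simp add: E0)
  ultimately show ?thesis by (rule tendsto_unique[rotated]) simp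
qed

text \<open>
  The surface \<open>f k (u, v) = P k (u + \<kappa> v) + Q k (u - \<kappa> v)\<close> built from the null curve with velocity
  \<open>\<rho> (1, \<tau>, \<tau>\<^sup>2)\<close> and the field \<open>lam\<close> times this velocity; \<open>\<kappa> = \<i>\<close> gives the maximal and
  \<open>\<kappa> = 1\<close> the minimal surface.
\<close>

locale null_germ =
  fixes \<kappa> :: complex and P Q :: "nat \<Rightarrow> complex \<Rightarrow> complex" and \<rho> \<tau> lam :: "complex \<Rightarrow> complex"
  assumes \<kappa>: "\<kappa> \<noteq> 0"
    and P: "\<forall>\<^sub>F z in nhds 0. \<forall>k<3. (P k has_field_derivative (1 + lam z / \<kappa>) / 2 * \<rho> z * \<tau> z ^ k) (at z)"
    and Q: "\<forall>\<^sub>F z in nhds 0. \<forall>k<3. (Q k has_field_derivative (1 - lam z / \<kappa>) / 2 * \<rho> z * \<tau> z ^ k) (at z)"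
    and diff: "\<forall>\<^sub>F z in nhds 0. \<rho> field_differentiable at z \<and> \<tau> field_differentiable at z \<and> lam field_differentiable at z"
    and \<rho>0: "\<rho> 0 \<noteq> 0" and \<tau>0: "deriv \<tau> 0 \<noteq> 0"
    and pos: "Re (deriv \<tau> 0 * \<rho> 0 * (\<kappa>\<^sup>2 - (lam 0)\<^sup>2)) > 0"
    and real: "\<And>k. k < 3 \<Longrightarrow> rgerm (\<lambda>p. P k (fst p + \<kappa> * snd p) + Q k (fst p - \<kappa> * snd p))"
    and zero: "\<And>k. k < 3 \<Longrightarrow> P k 0 + Q k 0 = 0"
begin

definition f :: "nat \<Rightarrow> complex \<times> complex \<Rightarrow> complex" where
  "f k p = P k (fst p + \<kappa> * snd p) + Q k (fst p - \<kappa> * snd p)"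

lemma f_rgerm: "k < 3 \<Longrightarrow> rgerm (f k)"
  using real unfolding f_def by simp

lemma f_zero: "k < 3 \<Longrightarrow> f k 0 = 0"
  using zero by (simp add: f_def)

lemma f0: "f 0 0 = 0"
  by (rule f_zero) simp

definition good :: "complex \<Rightarrow> bool" where
  "good z \<longleftrightarrow> (\<forall>k<3. (P k has_field_derivative (1 + lam z / \<kappa>) / 2 * \<rho> z * \<tau> z ^ k) (at z)) \<and>
     (\<forall>k<3. (Q k has_field_derivative (1 - lam z / \<kappa>) / 2 * \<rho> z * \<tau> z ^ k) (at z)) \<and>
     \<rho> field_differentiable at z \<and> \<tau> field_differentiable at z \<and> lam field_differentiable at z"

lemma good_near: "\<forall>\<^sub>F z in nhds 0. good z"
  using P Q diff unfolding good_def by eventually_elim blast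

lemma curve_derivative:
  assumes w: "(w has_field_derivative w') (at t)" and V: "(V has_field_derivative V') (at t)"
    and g: "good (w t + \<kappa> * V t)" "good (w t - \<kappa> * V t)" and k: "k < 3"
  shows "((\<lambda>z. f k (w z, V z)) has_field_derivative
    (1 + lam (w t + \<kappa> * V t) / \<kappa>) / 2 * \<rho> (w t + \<kappa> * V t) * (w' + \<kappa> * V') * \<tau> (w t + \<kappa> * V t) ^ k +
    (1 - lam (w t - \<kappa> * V t) / \<kappa>) / 2 * \<rho> (w t - \<kappa> * V t) * (w' - \<kappa> * V') * \<tau> (w t - \<kappa> * V t) ^ k) (at t)"
proof -
  have 1: "((\<lambda>z. w z + \<kappa> * V z) has_field_derivative w' + \<kappa> * V') (at t)"
    by (intro DERIV_add w DERIV_cmult V)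
  have 2: "((\<lambda>z. w z - \<kappa> * V z) has_field_derivative w' - \<kappa> * V') (at t)"
    by (intro DERIV_diff w DERIV_cmult V)
  have "((\<lambda>z. P k (w z + \<kappa> * V z)) has_field_derivative
      (1 + lam (w t + \<kappa> * V t) / \<kappa>) / 2 * \<rho> (w t + \<kappa> * V t) * \<tau> (w t + \<kappa> * V t) ^ k * (w' + \<kappa> * V')) (at t)"
    by (rule DERIV_chain2[OF _ 1]) (use g(1) k in \<open>simp add: good_def\<close>)
  moreover have "((\<lambda>z. Q k (w z - \<kappa> * V z)) has_field_derivative
      (1 - lam (w t - \<kappa> * V t) / \<kappa>) / 2 * \<rho> (w t - \<kappa> * V t) * \<tau> (w t - \<kappa> * V t) ^ k * (w' - \<kappa> * V')) (at t)"
    by (rule DERIV_chain2[OF _ 2]) (use g(2) k in \<open>simp add: good_def\<close>)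
  ultimately have "((\<lambda>z. P k (w z + \<kappa> * V z) + Q k (w z - \<kappa> * V z)) has_field_derivative
      (1 + lam (w t + \<kappa> * V t) / \<kappa>) / 2 * \<rho> (w t + \<kappa> * V t) * \<tau> (w t + \<kappa> * V t) ^ k * (w' + \<kappa> * V') +
      (1 - lam (w t - \<kappa> * V t) / \<kappa>) / 2 * \<rho> (w t - \<kappa> * V t) * \<tau> (w t - \<kappa> * V t) ^ k * (w' - \<kappa> * V')) (at t)"
    by (rule DERIV_add)
  then show ?thesis
    unfolding f_def fst_conv snd_conv by (rule DERIV_cong) (simp only: mult_ac)
qed

text \<open>Along a curve in a level set of the first coordinate the two null directions balance.\<close>

lemma level_curve:
  assumes w: "(w has_field_derivative w') (at t)" and V: "(V has_field_derivative V') (at t)"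
    and g: "good (w t + \<kappa> * V t)" "good (w t - \<kappa> * V t)"
    and const: "\<forall>\<^sub>F z in nhds t. f 0 (w z, V z) = s"
  shows "(1 - lam (w t - \<kappa> * V t) / \<kappa>) / 2 * \<rho> (w t - \<kappa> * V t) * (w' - \<kappa> * V') =
      - ((1 + lam (w t + \<kappa> * V t) / \<kappa>) / 2 * \<rho> (w t + \<kappa> * V t) * (w' + \<kappa> * V'))" (is "?B = - ?A")
    and "k < 3 \<Longrightarrow> ((\<lambda>z. f k (w z, V z)) has_field_derivative
      (1 + lam (w t + \<kappa> * V t) / \<kappa>) / 2 * \<rho> (w t + \<kappa> * V t) * (w' + \<kappa> * V') *
      (\<tau> (w t + \<kappa> * V t) ^ k - \<tau> (w t - \<kappa> * V t) ^ k)) (at t)"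
proof -
  note D = curve_derivative[OF w V g]
  have "((\<lambda>z. f 0 (w z, V z)) has_field_derivative 0) (at t)"
    using DERIV_cong_ev[OF refl const refl, of 0] by simp
  then have "?A * \<tau> (w t + \<kappa> * V t) ^ 0 + ?B * \<tau> (w t - \<kappa> * V t) ^ 0 = 0"
    using DERIV_unique[OF D[of 0, OF zero_less_numeral]] by blast
  then show eq: "?B = - ?A"
    by (simp only: power_0 mult_1_right add_eq_0_iff)
  show "((\<lambda>z. f k (w z, V z)) has_field_derivative ?A *
      (\<tau> (w t + \<kappa> * V t) ^ k - \<tau> (w t - \<kappa> * V t) ^ k)) (at t)" if k: "k < 3"
    by (rule DERIV_cong[OF D[OF k]], subst eq)
      (simp only: mult_minus_left right_diff_distrib add_uminus_conv_diff)
qed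

text \<open>Where \<open>V\<close> vanishes both null directions are multiples of the same vector,
  so fixing the first coordinate makes all coordinates stationary: this is the singularity along the
  curve. The balance equation also shows that the level curve leaves the axis with slope
  \<open>- lam\<close>.\<close>

lemma level_curve_diagonal:
  assumes w: "(w has_field_derivative w') (at t)" and V: "(V has_field_derivative V') (at t)" "V t = 0"
    and g: "good (w t)" "\<rho> (w t) \<noteq> 0"
    and const: "\<forall>\<^sub>F z in nhds t. f 0 (w z, V z) = s"
  shows "w' = - lam (w t) * V'"
    and "k < 3 \<Longrightarrow> ((\<lambda>z. f k (w z, V z)) has_field_derivative 0) (at t)"
proof -
  define m where "m = lam (w t) / \<kappa>"
  have "(1 - m) / 2 * \<rho> (w t) * (w' - \<kappa> * V') = - ((1 + m) / 2 * \<rho> (w t) * (w' + \<kappa> * V'))"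
    using level_curve(1)[OF w V(1) _ _ const] g V(2) by (simp add: m_def)
  then have "(1 - m) * \<rho> (w t) * (w' - \<kappa> * V') = - ((1 + m) * \<rho> (w t) * (w' + \<kappa> * V'))"
    by simp
  then have "2 * \<rho> (w t) * (w' + \<kappa> * m * V') = 0" by algebra
  then have "w' + \<kappa> * m * V' = 0" using g(2) by simp
  then show "w' = - lam (w t) * V'" using \<kappa> by (simp add: m_def add_eq_0_iff2)
  show "k < 3 \<Longrightarrow> ((\<lambda>z. f k (w z, V z)) has_field_derivative 0) (at t)"
    using level_curve(2)[OF w V(1) _ _ const, of k] g(1) V(2) by simp
qed


lemma isCont_slice2: "cdiff2 g (u, v) \<Longrightarrow> isCont (\<lambda>z. g (u, z)) v"
  using DERIV_isCont[OF cdiff2_slice2] .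

lemma isCont_slice1: "cdiff2 g (u, v) \<Longrightarrow> isCont (\<lambda>z. g (z, v)) u"
  using DERIV_isCont[OF cdiff2_slice1] .

text \<open>At the origin the contributions of \<open>lam\<close> to \<open>pd1 (f 0)\<close> cancel
  and leave \<open>\<rho> 0\<close>, so the first coordinate of the surface together with
  \<open>v\<close> is a coordinate system; \<open>U\<close> recovers \<open>u\<close> from
  it.\<close>

lemma level_coordinate:
  obtains U where "rgerm U" "U 0 = 0" "\<forall>\<^sub>F p in nhds 0. f 0 (U p, snd p) = fst p"
    "\<forall>\<^sub>F p in nhds 0. U (f 0 p, snd p) = fst p"
    "\<forall>\<^sub>F p in nhds 0. good (U p + \<kappa> * snd p) \<and> good (U p - \<kappa> * snd p) \<and> cdiff2 U p"
proof -
  have g0: "good 0" using good_near by (rule eventually_nhds_x_imp_x)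
  have "((\<lambda>z. f 0 (z, 0)) has_field_derivative
    (1 + lam (0 + \<kappa> * 0) / \<kappa>) / 2 * \<rho> (0 + \<kappa> * 0) * (1 + \<kappa> * 0) * \<tau> (0 + \<kappa> * 0) ^ 0 +
    (1 - lam (0 - \<kappa> * 0) / \<kappa>) / 2 * \<rho> (0 - \<kappa> * 0) * (1 - \<kappa> * 0) * \<tau> (0 - \<kappa> * 0) ^ 0) (at 0)"
    by (rule curve_derivative[OF DERIV_ident DERIV_const]) (use g0 in simp_all)
  then have "pd1 (f 0) 0 = (1 + lam 0 / \<kappa>) / 2 * \<rho> 0 + (1 - lam 0 / \<kappa>) / 2 * \<rho> 0"
    unfolding zero_prod_def by (intro pd1_eqI) simp
  also have "\<dots> = \<rho> 0" by (simp add: field_simps)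
  finally have "pd1 (f 0) 0 \<noteq> 0" using \<rho>0 by simp
  then obtain U where U: "rgerm U" "U 0 = 0" "\<forall>\<^sub>F p in nhds 0. f 0 (U p, snd p) = fst p"
    "\<forall>\<^sub>F p in nhds 0. U (f 0 p, snd p) = fst p"
    using rgerm_implicit1[OF f_rgerm f0] by auto
  have c: "isCont U 0" using U(1) by (rule rgerm_isCont)
  have "isCont (\<lambda>p. U p + \<kappa> * snd p) 0" "isCont (\<lambda>p. U p - \<kappa> * snd p) 0"
    by (intro continuous_intros c)+
  then have "\<forall>\<^sub>F p in nhds 0. good (U p + \<kappa> * snd p)" "\<forall>\<^sub>F p in nhds 0. good (U p - \<kappa> * snd p)"
    using eventually_germ[OF good_near, where f = "\<lambda>p. U p + \<kappa> * snd p" and a = 0]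
      eventually_germ[OF good_near, where f = "\<lambda>p. U p - \<kappa> * snd p" and a = 0] U(2) by simp_all
  then have "\<forall>\<^sub>F p in nhds 0. good (U p + \<kappa> * snd p) \<and> good (U p - \<kappa> * snd p) \<and> cdiff2 U p"
    using rgerm_cdiff2[OF U(1)] by eventually_elim auto
  then show thesis by (rule that[OF U])
qed

text \<open>
  In the coordinates \<open>(s, v)\<close> with \<open>s\<close> the first coordinate of the surface, the second one is
  \<open>k2 (s, v) = k2 (s, 0) + (v \<surd>r)\<^sup>2\<close>.
\<close>

lemma fold_coordinate:
  assumes U: "rgerm U" "U 0 = 0" "\<forall>\<^sub>F p in nhds 0. f 0 (U p, snd p) = fst p"
    "\<forall>\<^sub>F p in nhds 0. good (U p + \<kappa> * snd p) \<and> good (U p - \<kappa> * snd p) \<and> cdiff2 U p"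
  obtains y where "rgerm y" "\<forall>\<^sub>F s in nhds 0. y (s, 0) = 0" "pd2 y 0 \<noteq> 0"
    "\<forall>\<^sub>F p in nhds 0. f 1 (U p, snd p) = f 1 (U (fst p, 0), 0) + (y p)\<^sup>2"
proof -
  define h where "h = (\<lambda>p. f 1 (U p, snd p) - f 1 (U (fst p, 0), 0))"
  have gh: "rgerm h"
    unfolding h_def using U(1,2) by (intro rgerm_diff rgerm_compose2[OF f_rgerm] rgerm_compose2[OF U(1)])
      (auto simp: zero_prod_def)
  obtain h1 where h1: "rgerm h1" "\<forall>\<^sub>F p in nhds 0. h p = snd p * h1 p"
    by (rule rgerm_division[OF gh]) (auto simp: h_def)
  have \<rho>near: "\<forall>\<^sub>F z in nhds 0. \<rho> z \<noteq> 0"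
  proof -
    have "isCont \<rho> 0" using diff[THEN eventually_nhds_x_imp_x] field_differentiable_imp_continuous_at by blast
    then show ?thesis using \<rho>0 by (intro isCont_eventually[where f = \<rho> and P = "\<lambda>x. x \<noteq> 0"] t1_space_nhds)
  qed
  have "\<forall>\<^sub>F p in nhds 0. \<rho> (U p) \<noteq> 0"
    by (rule eventually_germ[OF \<rho>near rgerm_isCont[OF U(1)] U(2)])
  then have "\<forall>\<^sub>F p in nhds 0. f 0 (U p, snd p) = fst p \<and> good (U p + \<kappa> * snd p) \<and> good (U p - \<kappa> * snd p) \<and>
      cdiff2 U p \<and> \<rho> (U p) \<noteq> 0 \<and> h p = snd p * h1 p \<and> cdiff2 h1 p"
    using U(3,4) h1(2) rgerm_cdiff2[OF h1(1)] by eventually_elim blast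
  then obtain e where e: "e > 0" and E: "\<And>s v. s \<in> ball 0 e \<Longrightarrow> v \<in> ball 0 e \<Longrightarrow>
      f 0 (U (s, v), v) = s \<and> good (U (s, v) + \<kappa> * v) \<and> good (U (s, v) - \<kappa> * v) \<and>
      cdiff2 U (s, v) \<and> \<rho> (U (s, v)) \<noteq> 0 \<and> h (s, v) = v * h1 (s, v) \<and> cdiff2 h1 (s, v)"
    unfolding eventually_polydisc by auto
  have ball_ev: "\<forall>\<^sub>F z in nhds v. z \<in> ball 0 e" if "v \<in> ball 0 e" for v :: complex
    using that by (intro eventually_nhds_in_open) auto
  have lev: "\<forall>\<^sub>F z in nhds v. f 0 (U (s, z), z) = s" if "s \<in> ball 0 e" "v \<in> ball 0 e" for s v
    using ball_ev[OF that(2)] by eventually_elim (use E that in blast)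
  \<comment> \<open>Along the axis the second coordinate is stationary on level curves, so
    \<open>h\<close> is divisible by \<open>v\<close> a second time.\<close>
  have h10: "h1 (s, 0) = 0" if s: "s \<in> ball 0 e" for s
  proof -
    have z: "0 \<in> ball (0::complex) e" using e by simp
    note E0 = E[OF s z]
    have "((\<lambda>z. f 1 (U (s, z), z)) has_field_derivative 0) (at 0)"
      by (rule level_curve_diagonal(2)[OF cdiff2_slice2 DERIV_ident _ _ _ lev[OF s z]])
        (use E0 in auto)
    then have "((\<lambda>z. h (s, z)) has_field_derivative 0 - 0) (at 0)"
      unfolding h_def fst_conv snd_conv by (intro DERIV_diff DERIV_const)
    moreover have "\<forall>\<^sub>F z in nhds 0. h (s, z) = z * h1 (s, z)"
      using ball_ev[OF z] by eventually_elim (use E[OF s] in blast)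
    ultimately have "((\<lambda>z. z * h1 (s, z)) has_field_derivative 0 - 0) (at 0)"
      by (rule DERIV_transfer)
    moreover have "((\<lambda>z. z * h1 (s, z)) has_field_derivative 1 * h1 (s, 0)) (at 0)"
      by (rule DERIV_mult_at_zero[OF DERIV_ident refl isCont_slice2]) (use E0 in blast)
    ultimately show ?thesis using DERIV_unique by fastforce
  qed
  obtain r where r: "rgerm r" "\<forall>\<^sub>F p in nhds 0. h1 p = snd p * r p"
  proof (rule rgerm_division[OF h1(1)])
    show "\<forall>\<^sub>F u in nhds 0. h1 (u, 0) = 0"
      using ball_ev[of 0] e by (auto elim!: eventually_mono intro: h10)
  qed
  have hr: "\<forall>\<^sub>F p in nhds 0. h p = (snd p)\<^sup>2 * r p"
    using h1(2) r(2) by eventually_elim (simp add: power2_eq_square)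
  \<comment> \<open>The leading coefficient is read off from the derivative of \<open>h\<close> in
    \<open>v\<close>, computed once from \<open>h = v\<^sup>2 r\<close> and once along the level
    curve. Both expressions vanish at 0, so it is their derivatives there that are compared.\<close>
  have r0: "r 0 = deriv \<tau> 0 * \<rho> 0 * (\<kappa>\<^sup>2 - (lam 0)\<^sup>2) / 2"
  proof -
    have "\<forall>\<^sub>F p in nhds 0. cdiff2 r p \<and> cdiff2 (pd2 r) p \<and> h p = (snd p)\<^sup>2 * r p \<and> cdiff2 (pd2 U) p"
      using rgerm_cdiff2[OF r(1)] rgerm_pd_cdiff2[OF r(1)] rgerm_pd_cdiff2[OF U(1)] hr by eventually_elim blast
    then obtain d where d: "d > 0" and D: "\<And>s v. s \<in> ball 0 d \<Longrightarrow> v \<in> ball 0 d \<Longrightarrow>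
        cdiff2 r (s, v) \<and> cdiff2 (pd2 r) (s, v) \<and> h (s, v) = v\<^sup>2 * r (s, v) \<and> cdiff2 (pd2 U) (s, v)"
      unfolding eventually_polydisc by auto
    define x where "x = (\<lambda>v. U (0, v) + \<kappa> * v)"
    define x' where "x' = (\<lambda>v. U (0, v) - \<kappa> * v)"
    define A where "A = (\<lambda>v. (1 + lam (x v) / \<kappa>) / 2 * \<rho> (x v) * (pd2 U (0, v) + \<kappa>))"
    have z: "0 \<in> ball (0::complex) e" "0 \<in> ball (0::complex) d" using e d by simp_all
    have U00: "U (0, 0) = 0" using U(2) by (simp add: zero_prod_def)
    have x0: "x 0 = 0" "x' 0 = 0" by (simp_all add: x_def x'_def U00)
    have main: "v * (2 * r (0, v) + v * pd2 r (0, v)) = (\<tau> (x v) - \<tau> (x' v)) * A v"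
      if v: "v \<in> ball 0 (min e d)" for v
    proof -
      have vb: "v \<in> ball 0 e" "v \<in> ball 0 d" using v by auto
      note Ev = E[OF z(1) vb(1)]
      have "((\<lambda>z. f 1 (U (0, z), z)) has_field_derivative
        (1 + lam (U (0, v) + \<kappa> * v) / \<kappa>) / 2 * \<rho> (U (0, v) + \<kappa> * v) * (pd2 U (0, v) + \<kappa> * 1) *
        (\<tau> (U (0, v) + \<kappa> * v) ^ 1 - \<tau> (U (0, v) - \<kappa> * v) ^ 1)) (at v)"
        by (rule level_curve(2)[OF cdiff2_slice2 DERIV_ident _ _ lev[OF z(1) vb(1)]]) (use Ev in auto)
      then have "((\<lambda>z. h (0, z)) has_field_derivative
        (1 + lam (U (0, v) + \<kappa> * v) / \<kappa>) / 2 * \<rho> (U (0, v) + \<kappa> * v) * (pd2 U (0, v) + \<kappa> * 1) *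
        (\<tau> (U (0, v) + \<kappa> * v) ^ 1 - \<tau> (U (0, v) - \<kappa> * v) ^ 1) - 0) (at v)"
        unfolding h_def fst_conv snd_conv by (intro DERIV_diff DERIV_const)
      moreover have "\<forall>\<^sub>F z in nhds v. h (0, z) = z\<^sup>2 * r (0, z)"
        using eventually_nhds_in_open[OF open_ball vb(2)] by eventually_elim (use D[OF z(2)] in blast)
      ultimately have "((\<lambda>z. z\<^sup>2 * r (0, z)) has_field_derivative
        (1 + lam (U (0, v) + \<kappa> * v) / \<kappa>) / 2 * \<rho> (U (0, v) + \<kappa> * v) * (pd2 U (0, v) + \<kappa> * 1) *
        (\<tau> (U (0, v) + \<kappa> * v) ^ 1 - \<tau> (U (0, v) - \<kappa> * v) ^ 1) - 0) (at v)"
        by (rule DERIV_transfer)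
      then have "((\<lambda>z. z\<^sup>2 * r (0, z)) has_field_derivative (\<tau> (x v) - \<tau> (x' v)) * A v) (at v)"
        by (rule DERIV_cong) (simp add: x_def x'_def A_def mult_ac)
      moreover have "((\<lambda>z. z\<^sup>2 * r (0, z)) has_field_derivative v * (2 * r (0, v) + v * pd2 r (0, v))) (at v)"
        by (rule derivative_eq_intros cdiff2_slice2 refl)+
          (use D[OF z(2) vb(2)] in \<open>auto simp: power2_eq_square algebra_simps\<close>)
      ultimately show ?thesis using DERIV_unique by blast
    qed
    have dU: "((\<lambda>v. U (0, v)) has_field_derivative pd2 U (0, 0)) (at 0)"
      by (rule cdiff2_slice2) (use E[OF z(1) z(1)] in blast)
    have dx: "(x has_field_derivative pd2 U (0, 0) + \<kappa>) (at 0)" "(x' has_field_derivative pd2 U (0, 0) - \<kappa>) (at 0)"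
      unfolding x_def x'_def using dU by (auto intro!: derivative_eq_intros)
    have d0: "\<rho> field_differentiable at 0" "\<tau> field_differentiable at 0" "lam field_differentiable at 0"
      using diff[THEN eventually_nhds_x_imp_x] by auto
    then have c0: "isCont \<rho> (x 0)" "isCont lam (x 0)"
      by (simp_all add: x0 field_differentiable_imp_continuous_at)
    have d\<tau>: "(\<tau> has_field_derivative deriv \<tau> 0) (at (x 0))" "(\<tau> has_field_derivative deriv \<tau> 0) (at (x' 0))"
      using d0(2) by (simp_all add: x0 field_differentiable_derivI)
    have "((\<lambda>v. (\<tau> (x v) - \<tau> (x' v)) * A v) has_field_derivative
        (deriv \<tau> 0 * (pd2 U (0, 0) + \<kappa>) - deriv \<tau> 0 * (pd2 U (0, 0) - \<kappa>)) * A 0) (at 0)"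
    proof (rule DERIV_mult_at_zero)
      show "((\<lambda>v. \<tau> (x v) - \<tau> (x' v)) has_field_derivative
        deriv \<tau> 0 * (pd2 U (0, 0) + \<kappa>) - deriv \<tau> 0 * (pd2 U (0, 0) - \<kappa>)) (at 0)"
        by (intro DERIV_diff DERIV_chain2[OF d\<tau>(1) dx(1)] DERIV_chain2[OF d\<tau>(2) dx(2)])
      have "isCont (\<lambda>v. pd2 U (0, v)) 0"
        by (rule isCont_slice2) (use D[OF z(2) z(2)] in blast)
      then show "isCont A 0"
        unfolding A_def using \<kappa>
        by (intro continuous_intros isCont_o2[OF DERIV_isCont[OF dx(1)] c0(1)]
            isCont_o2[OF DERIV_isCont[OF dx(1)] c0(2)]) auto
    qed (simp add: x0)
    moreover have "\<forall>\<^sub>F v in nhds 0. (\<tau> (x v) - \<tau> (x' v)) * A v = v * (2 * r (0, v) + v * pd2 r (0, v))"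
      using eventually_nhds_in_open[OF open_ball, of 0 0 "min e d"] e d
      by (auto elim!: eventually_mono simp: main)
    ultimately have "((\<lambda>v. v * (2 * r (0, v) + v * pd2 r (0, v))) has_field_derivative
        (deriv \<tau> 0 * (pd2 U (0, 0) + \<kappa>) - deriv \<tau> 0 * (pd2 U (0, 0) - \<kappa>)) * A 0) (at 0)"
      by (rule DERIV_transfer)
    moreover have "((\<lambda>v. v * (2 * r (0, v) + v * pd2 r (0, v))) has_field_derivative
        1 * (2 * r (0, 0) + 0 * pd2 r (0, 0))) (at 0)"
      by (rule DERIV_mult_at_zero[OF DERIV_ident refl])
        (intro continuous_intros isCont_slice2; use D[OF z(2) z(2)] in blast)
    ultimately have "2 * r (0, 0) = 2 * \<kappa> * deriv \<tau> 0 * A 0"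
      using DERIV_unique by (fastforce simp: algebra_simps)
    moreover have "pd2 U (0, 0) = - lam (U (0, 0)) * 1"
      by (rule level_curve_diagonal(1)[OF cdiff2_slice2 DERIV_ident refl _ _ lev[OF z(1) z(1)]])
        (use E[OF z(1) z(1)] in auto)
    ultimately have 1: "2 * r (0, 0) = deriv \<tau> 0 * (2 * (\<kappa> * A 0))" and 2: "pd2 U (0, 0) = - lam 0"
      by (simp_all add: U00)
    \<comment> \<open>The slope \<open>- lam 0\<close> of the level curve turns the remaining factor
      into the difference of squares.\<close>
    have 3: "2 * (\<kappa> * A 0) = (\<kappa> + lam 0) * \<rho> 0 * (\<kappa> - lam 0)"
      using \<kappa> by (simp add: A_def x0 2 field_simps)
    show ?thesis
      using 1 unfolding 3 zero_prod_def by (simp add: field_simps power2_eq_square)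
  qed
  \<comment> \<open>The purpose of the sign condition \<open>pos\<close>: near \<open>r 0\<close>
    the principal square root is holomorphic and commutes with conjugation, so \<open>v\<close>
    times the root of \<open>r\<close> is a real germ and the fold has the form
    \<open>+ y\<^sup>2\<close>.\<close>
  have pos_r: "Re (r 0) > 0" using pos by (simp add: r0)
  have sq: "rgerm (\<lambda>p. csqrt (r p))"
  proof (rule rgerm_compose1[OF _ r(1)])
    have "open {z. Re z > 0}" by (rule open_halfspace_Re_gt)
    then have "\<forall>\<^sub>F z in nhds (r 0). z \<in> {z. Re z > 0}" using pos_r by (intro eventually_nhds_in_open) auto
    then show "\<forall>\<^sub>F z in nhds (r 0). csqrt field_differentiable at z \<and> csqrt (cnj z) = cnj (csqrt z)"
    proof eventually_elim
      case (elim z)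
      then have "z \<notin> \<real>\<^sub>\<le>\<^sub>0" by (auto simp: complex_nonpos_Reals_iff)
      then show ?case using field_differentiable_at_csqrt by (auto simp: cnj_csqrt)
    qed
  qed
  define y where "y = (\<lambda>p. snd p * csqrt (r p))"
  show thesis
  proof (rule that[of y])
    show "rgerm y" unfolding y_def by (intro rgerm_mult sq) simp
    show "\<forall>\<^sub>F s in nhds 0. y (s, 0) = 0" by (simp add: y_def)
    have "((\<lambda>z. y (0, z)) has_field_derivative 1 * csqrt (r (0, 0))) (at 0)"
      unfolding y_def fst_conv snd_conv
      by (rule DERIV_mult_at_zero[OF DERIV_ident refl isCont_slice2])
        (use rgerm_cdiff2[OF sq, THEN eventually_nhds_x_imp_x] in \<open>simp add: zero_prod_def\<close>)
    then have "pd2 y 0 = csqrt (r 0)" using pd2_eqI by (fastforce simp: zero_prod_def)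
    then show "pd2 y 0 \<noteq> 0" using pos_r by auto
    show "\<forall>\<^sub>F p in nhds 0. f 1 (U p, snd p) = f 1 (U (fst p, 0), 0) + (y p)\<^sup>2"
      using hr by eventually_elim (simp add: h_def y_def power_mult_distrib algebra_simps)
  qed
qed

end

context null_germ
begin

text \<open>In the coordinates \<open>(s, y)\<close> the surface becomes \<open>s\<close>,
  \<open>c s + y\<^sup>2\<close>, \<open>a (s, y\<^sup>2) + y\<^sup>3 b (s, y\<^sup>2)\<close>. On a
  level curve of the first coordinate the derivatives of the other two are proportional to
  \<open>\<tau> x - \<tau> x'\<close> and \<open>(\<tau> x)\<^sup>2 - (\<tau> x')\<^sup>2\<close>,
  so the third is the second times \<open>\<tau> x + \<tau> x'\<close>. Expanding this relation at
  \<open>y = 0\<close> shows that \<open>b (s, 0)\<close> is \<open>lam\<close> times a factor that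
  is nonzero at the origin: \<open>b\<close> vanishes exactly when the field does, and a simple zero
  of \<open>lam\<close> becomes a simple zero of \<open>b\<close>.\<close>

lemma normal_form:
  obtains U y V a b where "rgerm U" "rgerm y" "rgerm V" "rgerm a" "rgerm b"
    "U 0 = 0" "y 0 = 0" "V 0 = 0"
    "\<forall>\<^sub>F p in nhds 0. f 0 (U p, snd p) = fst p" "\<forall>\<^sub>F p in nhds 0. U (f 0 p, snd p) = fst p"
    "\<forall>\<^sub>F p in nhds 0. y (fst p, V p) = snd p" "\<forall>\<^sub>F p in nhds 0. V (fst p, y p) = snd p"
    "\<forall>\<^sub>F p in nhds 0. f 1 (U p, snd p) = f 1 (U (fst p, 0), 0) + (y p)\<^sup>2"
    "\<forall>\<^sub>F p in nhds 0. f 2 (U (fst p, V p), V p) = a (fst p, (snd p)\<^sup>2) + (snd p) ^ 3 * b (fst p, (snd p)\<^sup>2)"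
    "lam 0 \<noteq> 0 \<longrightarrow> b 0 \<noteq> 0"
    "lam 0 = 0 \<and> deriv lam 0 \<noteq> 0 \<longrightarrow> b 0 = 0 \<and> pd1 b 0 \<noteq> 0"
proof -
  obtain U where U: "rgerm U" "U 0 = 0" "\<forall>\<^sub>F p in nhds 0. f 0 (U p, snd p) = fst p"
    "\<forall>\<^sub>F p in nhds 0. U (f 0 p, snd p) = fst p"
    "\<forall>\<^sub>F p in nhds 0. good (U p + \<kappa> * snd p) \<and> good (U p - \<kappa> * snd p) \<and> cdiff2 U p"
    by (rule level_coordinate)
  obtain y where y: "rgerm y" "\<forall>\<^sub>F s in nhds 0. y (s, 0) = 0" "pd2 y 0 \<noteq> 0"
    "\<forall>\<^sub>F p in nhds 0. f 1 (U p, snd p) = f 1 (U (fst p, 0), 0) + (y p)\<^sup>2"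
    by (rule fold_coordinate[OF U(1,2,3,5)])
  have y0: "y 0 = 0" using eventually_nhds_x_imp_x[OF y(2)] by (simp add: zero_prod_def)
  obtain V where V: "rgerm V" "V 0 = 0" "\<forall>\<^sub>F p in nhds 0. y (fst p, V p) = snd p"
    "\<forall>\<^sub>F p in nhds 0. V (fst p, y p) = snd p"
    by (rule rgerm_implicit2[OF y(1) y0 y(3)])
  have isC0: "isCont (\<lambda>s::complex. (s, 0::complex)) 0" by (intro isCont_Pair) auto
  have V0: "\<forall>\<^sub>F s in nhds 0. V (s, 0) = 0"
  proof -
    have "\<forall>\<^sub>F s in nhds 0. V (s, y (s, 0)) = 0"
      using eventually_germ[OF V(4) isC0] by (simp add: zero_prod_def)
    then show ?thesis using y(2) by eventually_elim simp
  qed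
  define K where "K = (\<lambda>p. f 2 (U (fst p, V p), V p))"
  have gUV: "rgerm (\<lambda>p. U (fst p, V p))" by (rule rgerm_compose2[OF U(1) rgerm_fst V(1) _ V(2)]) simp
  have UV0: "U (fst 0, V 0) = 0" using U(2) V(2) by (simp add: zero_prod_def)
  have gK: "rgerm K" unfolding K_def by (rule rgerm_compose2[OF f_rgerm gUV V(1) UV0 V(2)]) simp
  \<comment> \<open>The even part in \<open>y\<close> can be removed by a change of the target, as
    \<open>y\<^sup>2\<close> is a function of the first two coordinates; only the odd part carries
    the type of the singularity.\<close>
  obtain a b0 where ab0: "rgerm a" "rgerm b0"
    "\<forall>\<^sub>F p in nhds 0. K p = a (fst p, (snd p)\<^sup>2) + snd p * b0 (fst p, (snd p)\<^sup>2)"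
    by (rule rgerm_even_odd[OF gK])
  have gsq: "rgerm (\<lambda>p. (snd p)\<^sup>2)" by (rule rgerm_power) simp
  note sq = eventually_germ2[OF _ rgerm_fst gsq]
  note sq' = sq[simplified]
  have \<rho>near: "\<forall>\<^sub>F z in nhds 0. \<rho> z \<noteq> 0"
  proof -
    have "isCont \<rho> 0" using diff[THEN eventually_nhds_x_imp_x] field_differentiable_imp_continuous_at by blast
    then show ?thesis using \<rho>0 by (intro isCont_eventually[where f = \<rho> and P = "\<lambda>x. x \<noteq> 0"] t1_space_nhds)
  qed
  have "\<forall>\<^sub>F p in nhds 0. f 0 (U (fst p, V p), V p) = fst p"
    "\<forall>\<^sub>F p in nhds 0. good (U (fst p, V p) + \<kappa> * V p) \<and> good (U (fst p, V p) - \<kappa> * V p) \<and> cdiff2 U (fst p, V p)"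
    "\<forall>\<^sub>F p in nhds 0. f 1 (U (fst p, V p), V p) = f 1 (U (fst p, 0), 0) + (y (fst p, V p))\<^sup>2"
    using eventually_germ2[OF U(3) rgerm_fst V(1) _ V(2)] eventually_germ2[OF U(5) rgerm_fst V(1) _ V(2)]
      eventually_germ2[OF y(4) rgerm_fst V(1) _ V(2)] by simp_all
  moreover have "\<forall>\<^sub>F p in nhds (0 :: complex \<times> complex). \<rho> (U (fst p, 0)) \<noteq> 0 \<and> V (fst p, 0) = 0"
  proof -
    have "\<forall>\<^sub>F s in nhds 0. \<rho> (U (s, 0)) \<noteq> 0"
      by (rule eventually_germ[OF \<rho>near])
        (use isCont_slice1 eventually_nhds_x_imp_x[OF rgerm_cdiff2[OF U(1)]] U(2) in \<open>auto simp: zero_prod_def\<close>)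
    then have "\<forall>\<^sub>F s in nhds 0. \<rho> (U (s, 0)) \<noteq> 0 \<and> V (s, 0) = 0"
      using V0 by (rule eventually_conj)
    from eventually_germ[OF this, where f = "fst :: complex \<times> complex \<Rightarrow> complex" and a = 0] show ?thesis by (simp add: isCont_fst)
  qed
  ultimately have "\<forall>\<^sub>F p in nhds 0. f 0 (U (fst p, V p), V p) = fst p \<and>
      (good (U (fst p, V p) + \<kappa> * V p) \<and> good (U (fst p, V p) - \<kappa> * V p) \<and> cdiff2 U (fst p, V p)) \<and>
      f 1 (U (fst p, V p), V p) = f 1 (U (fst p, 0), 0) + (snd p)\<^sup>2 \<and>
      (\<rho> (U (fst p, 0)) \<noteq> 0 \<and> V (fst p, 0) = 0) \<and> cdiff2 V p \<and>
      K p = a (fst p, (snd p)\<^sup>2) + snd p * b0 (fst p, (snd p)\<^sup>2) \<and>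
      cdiff2 a (fst p, (snd p)\<^sup>2) \<and> cdiff2 b0 (fst p, (snd p)\<^sup>2)"
    using V(3) rgerm_cdiff2[OF V(1)] ab0(3) sq'[OF rgerm_cdiff2[OF ab0(1)]] sq'[OF rgerm_cdiff2[OF ab0(2)]]
    by eventually_elim simp
  then obtain e where e: "e > 0" and E: "\<And>s z. s \<in> ball 0 e \<Longrightarrow> z \<in> ball 0 e \<Longrightarrow>
      f 0 (U (s, V (s, z)), V (s, z)) = s \<and>
      (good (U (s, V (s, z)) + \<kappa> * V (s, z)) \<and> good (U (s, V (s, z)) - \<kappa> * V (s, z)) \<and> cdiff2 U (s, V (s, z))) \<and>
      f 1 (U (s, V (s, z)), V (s, z)) = f 1 (U (s, 0), 0) + z\<^sup>2 \<and>
      (\<rho> (U (s, 0)) \<noteq> 0 \<and> V (s, 0) = 0) \<and> cdiff2 V (s, z) \<and>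
      K (s, z) = a (s, z\<^sup>2) + z * b0 (s, z\<^sup>2) \<and> cdiff2 a (s, z\<^sup>2) \<and> cdiff2 b0 (s, z\<^sup>2)"
    unfolding eventually_polydisc by auto
  have z0: "0 \<in> ball (0::complex) e" using e by simp
  have ball_ev: "\<forall>\<^sub>F z in nhds v. z \<in> ball 0 e" if "v \<in> ball 0 e" for v :: complex
    using that by (intro eventually_nhds_in_open) auto
  \<comment> \<open>The zero summand is what the chain rule leaves for the constant argument
    \<open>s\<close>.\<close>
  define w' where "w' = (\<lambda>s z. pd1 U (s, V (s, z)) * 0 + pd2 U (s, V (s, z)) * pd2 V (s, z))"
  have dV: "((\<lambda>z. V (s, z)) has_field_derivative pd2 V (s, z)) (at z)" if "s \<in> ball 0 e" "z \<in> ball 0 e" for s z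
    by (rule cdiff2_slice2) (use E[OF that] in blast)
  have dw: "((\<lambda>z. U (s, V (s, z))) has_field_derivative w' s z) (at z)" if "s \<in> ball 0 e" "z \<in> ball 0 e" for s z
    unfolding w'_def by (rule cdiff2_chain[OF _ DERIV_const dV[OF that]]) (use E[OF that] in blast)
  have lev: "\<forall>\<^sub>F x in nhds z. f 0 (U (s, V (s, x)), V (s, x)) = s" if "s \<in> ball 0 e" "z \<in> ball 0 e" for s z
    using ball_ev[OF that(2)] by eventually_elim (use E that in blast)
  have dsq: "((\<lambda>x. g (s, x\<^sup>2)) has_field_derivative pd2 g (s, z\<^sup>2) * (2 * z)) (at z)"
    if "cdiff2 g (s, z\<^sup>2)" for g s z
  proof -
    have "((\<lambda>x. x\<^sup>2) has_field_derivative 2 * z) (at z)" by (auto intro!: derivative_eq_intros)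
    from cdiff2_chain[OF that DERIV_const this] show ?thesis by simp
  qed
  have K_diag: "((\<lambda>z. K (s, z)) has_field_derivative 0) (at 0)" "w' s 0 = - lam (U (s, 0)) * pd2 V (s, 0)"
    if s: "s \<in> ball 0 e" for s
  proof -
    note E0 = E[OF s z0]
    have Vs: "V (s, 0) = 0" using E0 by blast
    have g: "good (U (s, V (s, 0)))" "\<rho> (U (s, V (s, 0))) \<noteq> 0" using E0 by (simp_all add: Vs)
    note L = level_curve_diagonal[OF dw[OF s z0] dV[OF s z0] Vs g lev[OF s z0]]
    show "((\<lambda>z. K (s, z)) has_field_derivative 0) (at 0)"
      unfolding K_def fst_conv snd_conv by (rule L(2)) simp
    show "w' s 0 = - lam (U (s, 0)) * pd2 V (s, 0)" using L(1) by (simp add: Vs)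
  qed
  \<comment> \<open>The coefficient of \<open>y\<close> to the first power is the derivative of
    \<open>K\<close> on the axis, which vanishes there; the odd part therefore starts with the
    cube.\<close>
  have b00: "b0 (s, 0) = 0" if s: "s \<in> ball 0 e" for s
  proof -
    have c: "cdiff2 a (s, 0\<^sup>2)" "cdiff2 b0 (s, 0\<^sup>2)" using E[OF s z0] by simp_all
    have "((\<lambda>z. a (s, z\<^sup>2) + z * b0 (s, z\<^sup>2)) has_field_derivative
        pd2 a (s, 0\<^sup>2) * (2 * 0) + 1 * b0 (s, 0\<^sup>2)) (at 0)"
      by (intro DERIV_add dsq c DERIV_mult_at_zero DERIV_ident refl DERIV_isCont[OF dsq[OF c(2)]])
    moreover have "\<forall>\<^sub>F z in nhds 0. K (s, z) = a (s, z\<^sup>2) + z * b0 (s, z\<^sup>2)"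
      using ball_ev[OF z0] by eventually_elim (use E[OF s] in blast)
    ultimately show ?thesis
      using DERIV_unique[OF DERIV_transfer[OF K_diag(1)[OF s]]] by fastforce
  qed
  obtain b where b: "rgerm b" "\<forall>\<^sub>F p in nhds 0. b0 p = snd p * b p"
  proof (rule rgerm_division[OF ab0(2)])
    show "\<forall>\<^sub>F u in nhds 0. b0 (u, 0) = 0"
      using ball_ev[OF z0] by eventually_elim (rule b00)
  qed
  have Kab: "\<forall>\<^sub>F p in nhds 0. K p = a (fst p, (snd p)\<^sup>2) + (snd p) ^ 3 * b (fst p, (snd p)\<^sup>2)"
    using ab0(3) sq'[OF b(2)] by eventually_elim (simp add: power3_eq_cube power2_eq_square)
  have b_formula: "\<forall>\<^sub>F s in nhds 0. b (s, 0) = lam (U (s, 0)) * (- (4 / 3) * deriv \<tau> (U (s, 0)) * pd2 V (s, 0))"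
  proof -
    have "\<forall>\<^sub>F p in nhds 0. K p = a (fst p, (snd p)\<^sup>2) + (snd p) ^ 3 * b (fst p, (snd p)\<^sup>2) \<and>
        cdiff2 b (fst p, (snd p)\<^sup>2) \<and> (cdiff2 (pd1 a) (fst p, (snd p)\<^sup>2) \<and> cdiff2 (pd2 a) (fst p, (snd p)\<^sup>2)) \<and>
        (cdiff2 (pd1 b) (fst p, (snd p)\<^sup>2) \<and> cdiff2 (pd2 b) (fst p, (snd p)\<^sup>2))"
      using Kab sq'[OF rgerm_cdiff2[OF b(1)]] sq'[OF rgerm_pd_cdiff2[OF ab0(1)]] sq'[OF rgerm_pd_cdiff2[OF b(1)]]
      by eventually_elim blast
    then obtain d where d: "d > 0" and D: "\<And>s z. s \<in> ball 0 d \<Longrightarrow> z \<in> ball 0 d \<Longrightarrow>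
        K (s, z) = a (s, z\<^sup>2) + z ^ 3 * b (s, z\<^sup>2) \<and> cdiff2 b (s, z\<^sup>2) \<and>
        (cdiff2 (pd1 a) (s, z\<^sup>2) \<and> cdiff2 (pd2 a) (s, z\<^sup>2)) \<and> (cdiff2 (pd1 b) (s, z\<^sup>2) \<and> cdiff2 (pd2 b) (s, z\<^sup>2))"
      unfolding eventually_polydisc by auto
    have zd: "0 \<in> ball (0::complex) d" using d by simp
    have min_ev: "\<forall>\<^sub>F z in nhds (0::complex). z \<in> ball 0 (min e d)"
      using e d by (intro eventually_nhds_in_open) auto
    have "b (s, 0) = lam (U (s, 0)) * (- (4 / 3) * deriv \<tau> (U (s, 0)) * pd2 V (s, 0))"
      if "s \<in> ball 0 (min e d)" for s
    proof -
      have s: "s \<in> ball 0 e" and sd: "s \<in> ball 0 d" using that by auto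
      note E0 = E[OF s z0] and D0 = D[OF sd zd]
      have Vs: "V (s, 0) = 0" using E0 by blast
      define x where "x = (\<lambda>z. U (s, V (s, z)) + \<kappa> * V (s, z))"
      define x' where "x' = (\<lambda>z. U (s, V (s, z)) - \<kappa> * V (s, z))"
      \<comment> \<open>The derivative of the second coordinate is \<open>2 * z\<close>; that of the
        third must equal \<open>2 * z\<close> times \<open>\<tau> x + \<tau> x'\<close>.
        \<open>G\<close> is the difference of the two sides after division by
        \<open>2 * z\<close>.\<close>
      define G where "G = (\<lambda>z. \<tau> (x z) + \<tau> (x' z) - (pd2 a (s, z\<^sup>2) + z * (3 / 2 * b (s, z\<^sup>2) + z\<^sup>2 * pd2 b (s, z\<^sup>2))))"
      have "z * G z = 0" if "z \<in> ball 0 (min e d)" for z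
      proof -
        have z: "z \<in> ball 0 e" and zd: "z \<in> ball 0 d" using that by auto
        note Ez = E[OF s z] and Dz = D[OF sd zd]
        define A where "A = (1 + lam (x z) / \<kappa>) / 2 * \<rho> (x z) * (w' s z + \<kappa> * pd2 V (s, z))"
        have L: "((\<lambda>z. f k (U (s, V (s, z)), V (s, z))) has_field_derivative A * (\<tau> (x z) ^ k - \<tau> (x' z) ^ k)) (at z)"
          if "k < 3" for k
          unfolding A_def x_def x'_def
          by (rule level_curve(2)[OF dw[OF s z] dV[OF s z] _ _ lev[OF s z] that]) (use Ez in blast)+
        have "\<forall>\<^sub>F z in nhds z. f 1 (U (s, V (s, z)), V (s, z)) = f 1 (U (s, 0), 0) + z\<^sup>2"
          using ball_ev[OF z] by eventually_elim (use E[OF s] in blast)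
        then have "((\<lambda>z. f 1 (U (s, 0), 0) + z\<^sup>2) has_field_derivative A * (\<tau> (x z) ^ 1 - \<tau> (x' z) ^ 1)) (at z)"
          by (rule DERIV_transfer[OF L[of 1, OF _], rotated]) simp
        moreover have "((\<lambda>z. f 1 (U (s, 0), 0) + z\<^sup>2) has_field_derivative 2 * z) (at z)"
          by (auto intro!: derivative_eq_intros)
        ultimately have 1: "A * (\<tau> (x z) - \<tau> (x' z)) = 2 * z"
          using DERIV_unique by fastforce
        have "\<forall>\<^sub>F z in nhds z. K (s, z) = a (s, z\<^sup>2) + z ^ 3 * b (s, z\<^sup>2)"
          using eventually_nhds_in_open[OF open_ball zd] by eventually_elim (use D[OF sd] in blast)
        then have "((\<lambda>z. a (s, z\<^sup>2) + z ^ 3 * b (s, z\<^sup>2)) has_field_derivative A * (\<tau> (x z) ^ 2 - \<tau> (x' z) ^ 2)) (at z)"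
        proof (rule DERIV_transfer[rotated])
          show "((\<lambda>z. K (s, z)) has_field_derivative A * (\<tau> (x z) ^ 2 - \<tau> (x' z) ^ 2)) (at z)"
            unfolding K_def fst_conv snd_conv by (rule L) simp
        qed
        moreover have "((\<lambda>z. a (s, z\<^sup>2) + z ^ 3 * b (s, z\<^sup>2)) has_field_derivative
          pd2 a (s, z\<^sup>2) * (2 * z) + (3 * z\<^sup>2 * b (s, z\<^sup>2) + (pd2 b (s, z\<^sup>2) * (2 * z)) * z ^ 3)) (at z)"
        proof (rule DERIV_add[OF dsq DERIV_mult[OF _ dsq]])
          show "((\<lambda>z. z ^ 3) has_field_derivative 3 * z\<^sup>2) (at z)"
            by (auto intro!: derivative_eq_intros)
        qed (use Ez Dz in blast)+
        ultimately have 2: "A * (\<tau> (x z) ^ 2 - \<tau> (x' z) ^ 2) =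
            pd2 a (s, z\<^sup>2) * (2 * z) + (3 * z\<^sup>2 * b (s, z\<^sup>2) + (pd2 b (s, z\<^sup>2) * (2 * z)) * z ^ 3)"
          using DERIV_unique by blast
        have "A * (\<tau> (x z) ^ 2 - \<tau> (x' z) ^ 2) = A * (\<tau> (x z) - \<tau> (x' z)) * (\<tau> (x z) + \<tau> (x' z))"
          by (simp add: power2_eq_square algebra_simps)
        then have "2 * (z * G z) = 0"
          unfolding 1 2 G_def by (simp add: power2_eq_square power3_eq_cube algebra_simps)
        then show ?thesis by simp
      qed
      then have G_ev: "\<forall>\<^sub>F z in nhds 0. z * G z = 0"
        by (rule eventually_mono[OF min_ev])
      have x0: "x 0 = U (s, 0)" "x' 0 = U (s, 0)" by (simp_all add: x_def x'_def Vs)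
      have dx: "(x has_field_derivative w' s 0 + \<kappa> * pd2 V (s, 0)) (at 0)" "(x' has_field_derivative w' s 0 - \<kappa> * pd2 V (s, 0)) (at 0)"
        unfolding x_def x'_def by (intro DERIV_add DERIV_diff DERIV_cmult dw[OF s z0] dV[OF s z0])+
      have "good (U (s, 0))" using E0 by (simp add: Vs)
      then have d\<tau>: "(\<tau> has_field_derivative deriv \<tau> (U (s, 0))) (at (x 0))" "(\<tau> has_field_derivative deriv \<tau> (U (s, 0))) (at (x' 0))"
        by (simp_all add: x0 good_def field_differentiable_derivI)
      have c: "cdiff2 (pd2 a) (s, 0\<^sup>2)" "cdiff2 b (s, 0\<^sup>2)" "cdiff2 (pd2 b) (s, 0\<^sup>2)" using D0 by blast+
      have "isCont (\<lambda>z. 3 / 2 * b (s, z\<^sup>2) + z\<^sup>2 * pd2 b (s, z\<^sup>2)) 0"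
        by (intro continuous_intros DERIV_isCont[OF dsq] c)
      from DERIV_mult_at_zero[OF DERIV_ident refl this]
      have 3: "((\<lambda>z. z * (3 / 2 * b (s, z\<^sup>2) + z\<^sup>2 * pd2 b (s, z\<^sup>2))) has_field_derivative 3 / 2 * b (s, 0)) (at 0)"
        by simp
      \<comment> \<open>The terms with \<open>\<kappa>\<close> cancel and
        \<open>pd2 a (s, z\<^sup>2)\<close> is stationary at 0, so only \<open>w'\<close> and
        \<open>b (s, 0)\<close> survive; as \<open>w' = - lam\<close> times \<open>pd2 V\<close>,
        this is the source of the constant \<open>- 4 / 3\<close>.\<close>
      have "(G has_field_derivative deriv \<tau> (U (s, 0)) * (w' s 0 + \<kappa> * pd2 V (s, 0)) + deriv \<tau> (U (s, 0)) * (w' s 0 - \<kappa> * pd2 V (s, 0)) -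
          (pd2 (pd2 a) (s, 0\<^sup>2) * (2 * 0) + 3 / 2 * b (s, 0))) (at 0)"
        unfolding G_def by (intro DERIV_diff DERIV_add 3 dsq c DERIV_chain2[OF d\<tau>(1) dx(1)] DERIV_chain2[OF d\<tau>(2) dx(2)])
      from DERIV_zero_of_mult[OF this G_ev] have "3 / 2 * b (s, 0) = 2 * (deriv \<tau> (U (s, 0)) * w' s 0)"
        by (simp add: algebra_simps)
      then have "b (s, 0) = 4 / 3 * (deriv \<tau> (U (s, 0)) * w' s 0)" by (simp add: field_simps)
      then show ?thesis unfolding K_diag(2)[OF s] by (simp add: algebra_simps)
    qed
    then show ?thesis by (rule eventually_mono[OF min_ev])
  qed
  have pdV: "pd2 V 0 \<noteq> 0"
  proof -
    have "isCont (\<lambda>v::complex. (0::complex, v)) 0" by (intro isCont_Pair) auto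
    from eventually_germ[OF V(4) this] have "\<forall>\<^sub>F v in nhds 0. V (0, y (0, v)) = v" by (simp add: zero_prod_def)
    moreover have "((\<lambda>v. V (0, y (0, v))) has_field_derivative pd1 V (0, y (0, 0)) * 0 + pd2 V (0, y (0, 0)) * pd2 y (0, 0)) (at 0)"
      by (rule cdiff2_chain[OF _ DERIV_const cdiff2_slice2])
        (use eventually_nhds_x_imp_x[OF rgerm_cdiff2[OF V(1)]] eventually_nhds_x_imp_x[OF rgerm_cdiff2[OF y(1)]] y0
          in \<open>simp_all add: zero_prod_def\<close>)
    ultimately have "pd2 V (0, y (0, 0)) * pd2 y (0, 0) = 1"
      using DERIV_unique[OF DERIV_transfer DERIV_ident] by fastforce
    then show ?thesis using y0 by (auto simp: zero_prod_def)
  qed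
  have pdU: "pd1 U 0 \<noteq> 0"
  proof -
    from eventually_germ[OF U(4) isC0] have "\<forall>\<^sub>F u in nhds 0. U (f 0 (u, 0), 0) = u" by (simp add: zero_prod_def)
    moreover have "((\<lambda>u. U (f 0 (u, 0), 0)) has_field_derivative pd1 U (f 0 (0, 0), 0) * pd1 (f 0) (0, 0) + pd2 U (f 0 (0, 0), 0) * 0) (at 0)"
      by (rule cdiff2_chain[OF _ cdiff2_slice1 DERIV_const])
        (use eventually_nhds_x_imp_x[OF rgerm_cdiff2[OF U(1)]] eventually_nhds_x_imp_x[OF rgerm_cdiff2[OF f_rgerm[of 0]]] f0
          in \<open>simp_all add: zero_prod_def\<close>)
    ultimately have "pd1 U (f 0 (0, 0), 0) * pd1 (f 0) (0, 0) = 1"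
      using DERIV_unique[OF DERIV_transfer DERIV_ident] by fastforce
    then show ?thesis using f0 by (auto simp: zero_prod_def)
  qed
  have b0eq: "b 0 = lam 0 * (- (4 / 3) * deriv \<tau> 0 * pd2 V 0)"
    using eventually_nhds_x_imp_x[OF b_formula] U(2) by (simp add: zero_prod_def)
  show thesis
  proof (rule that[of U y V a b])
    show "lam 0 \<noteq> 0 \<longrightarrow> b 0 \<noteq> 0" using b0eq pdV \<tau>0 by simp
    show "lam 0 = 0 \<and> deriv lam 0 \<noteq> 0 \<longrightarrow> b 0 = 0 \<and> pd1 b 0 \<noteq> 0"
    proof
    assume "lam 0 = 0 \<and> deriv lam 0 \<noteq> 0"
    then have lam0: "lam 0 = 0" and dlam: "deriv lam 0 \<noteq> 0" by simp_all
    have U00: "U (0, 0) = 0" using U(2) by (simp add: zero_prod_def)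
    have dU: "((\<lambda>s. U (s, 0)) has_field_derivative pd1 U (0, 0)) (at 0)"
      by (rule cdiff2_slice1) (use eventually_nhds_x_imp_x[OF rgerm_cdiff2[OF U(1)]] in \<open>simp add: zero_prod_def\<close>)
    have "(lam has_field_derivative deriv lam 0) (at (U (0, 0)))"
      using diff[THEN eventually_nhds_x_imp_x] by (simp add: U00 field_differentiable_derivI)
    from DERIV_chain2[OF this dU]
    have dl: "((\<lambda>s. lam (U (s, 0))) has_field_derivative deriv lam 0 * pd1 U (0, 0)) (at 0)" .
    \<comment> \<open>At a zero of \<open>lam\<close> continuity of the cofactor is enough to
      differentiate the formula for \<open>b (s, 0)\<close>.\<close>
    have c\<tau>: "isCont (deriv \<tau>) (U (0, 0))"
    proof -
      obtain S where S: "open S" "0 \<in> S" "\<And>z. z \<in> S \<Longrightarrow> \<tau> field_differentiable at z"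
        using diff unfolding eventually_nhds by blast
      then have "\<tau> holomorphic_on S" by (simp add: holomorphic_on_open field_differentiable_def)
      from holomorphic_on_imp_continuous_on[OF holomorphic_deriv[OF this S(1)]] S(1,2)
      show ?thesis by (simp add: U00 continuous_on_eq_continuous_at)
    qed
    have "isCont (\<lambda>s. pd2 V (s, 0)) 0"
      by (rule isCont_slice1) (use eventually_nhds_x_imp_x[OF rgerm_pd_cdiff2[OF V(1)]] in \<open>simp add: zero_prod_def\<close>)
    then have "isCont (\<lambda>s. - (4 / 3) * deriv \<tau> (U (s, 0)) * pd2 V (s, 0)) 0"
      by (intro continuous_intros isCont_o2[OF DERIV_isCont[OF dU] c\<tau>])
    from DERIV_mult_at_zero[OF dl _ this] lam0
    have "((\<lambda>s. lam (U (s, 0)) * (- (4 / 3) * deriv \<tau> (U (s, 0)) * pd2 V (s, 0))) has_field_derivative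
      deriv lam 0 * pd1 U (0, 0) * (- (4 / 3) * deriv \<tau> (U (0, 0)) * pd2 V (0, 0))) (at 0)"
      by (simp add: U00)
    moreover have "\<forall>\<^sub>F s in nhds 0. lam (U (s, 0)) * (- (4 / 3) * deriv \<tau> (U (s, 0)) * pd2 V (s, 0)) = b (s, 0)"
      using b_formula by eventually_elim simp
    ultimately have "pd1 b (0, 0) = deriv lam 0 * pd1 U (0, 0) * (- (4 / 3) * deriv \<tau> (U (0, 0)) * pd2 V (0, 0))"
      by (rule pd1_eqI[OF DERIV_transfer])
    then show "b 0 = 0 \<and> pd1 b 0 \<noteq> 0"
      using b0eq lam0 dlam pdU pdV \<tau>0 by (simp add: zero_prod_def U00)
    qed
  qed (fact U y V ab0 b y0 Kab[unfolded K_def])+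
qed

end

section \<open>Restriction of germs to the real plane and the type of the real surface germ\<close>

definition emb :: "real \<times> real \<Rightarrow> complex \<times> complex" where
  "emb q = (of_real (fst q), of_real (snd q))"

lemma bounded_linear_emb: "bounded_linear emb"
  unfolding emb_def
  by (intro bounded_linear_Pair bounded_linear_compose[OF bounded_linear_of_real bounded_linear_fst]
      bounded_linear_compose[OF bounded_linear_of_real bounded_linear_snd])

lemma emb_0: "emb 0 = 0"
  by (simp add: emb_def zero_prod_def[symmetric])

lemma cnj2_emb [simp]: "cnj2 (emb q) = emb q"
  by (simp add: emb_def)

lemma isCont_bounded_linear: "bounded_linear l \<Longrightarrow> isCont l x"
  by (simp add: linear_continuous_at)

lemma rgerm_Re:
  assumes "rgerm g"
  shows "\<forall>\<^sub>F p in nhds 0. cnj2 p = p \<longrightarrow> complex_of_real (Re (g p)) = g p"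
  using rgerm_sym[OF assms]
proof eventually_elim
  case (elim p)
  then show ?case by (auto simp: complex_eq_iff)
qed

lemma eventually_linear_germ:
  fixes P :: "complex \<times> complex \<Rightarrow> bool"
  assumes "\<forall>\<^sub>F p in nhds 0. P p" "bounded_linear l"
  shows "\<forall>\<^sub>F x in nhds 0. P (l x)"
  using eventually_germ[OF assms(1) isCont_bounded_linear[OF assms(2)]] linear_0[OF bounded_linear.linear[OF assms(2)]]
  by blast

text \<open>Stated for any linear map into complex pairs because it serves both the source plane,
  through \<open>emb\<close>, and the target space, through its first two coordinates.\<close>

lemma smooth_rgerm:
  fixes l :: "'a::euclidean_space \<Rightarrow> complex \<times> complex"
  assumes "rgerm g" "bounded_linear l"
  obtains S where "0 \<in> S" "smooth_on (\<lambda>x. Re (g (l x))) S"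
proof -
  obtain R where R: "R > 0" "hol2_on g (ball 0 R \<times> ball 0 R)"
    using assms(1) by (rule rgermE) blast
  define S where "S = l -` (ball 0 R \<times> ball 0 R)"
  have "open S"
    unfolding S_def by (intro open_vimage open_Times open_ball linear_continuous_on assms(2))
  then have "smooth_on (\<lambda>x. Re (g (0 + l x))) S"
    by (rule smooth_on_hol2[OF _ assms(2) _ R(2)]) (simp add: S_def)
  moreover have "0 \<in> S"
    using R(1) linear_0[OF bounded_linear.linear[OF assms(2)]] unfolding S_def vimage_def zero_prod_def by simp
  ultimately show thesis using that by simp
qed

lemma smooth_on_vec3:
  fixes F :: "'a::euclidean_space \<Rightarrow> real ^ 3"
  assumes "\<And>i. 0 \<in> S i" "\<And>i. smooth_on (\<lambda>x. F x $ i) (S i)"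
  obtains T where "0 \<in> T" "smooth_on F T"
proof -
  define T where "T = S 1 \<inter> S 2 \<inter> S 3"
  have o: "open (S i)" for i using assms(2)[of i] by (simp add: smooth_on_def)
  then have "open T" by (auto simp: T_def)
  moreover have "T \<subseteq> S i" for i
    using exhaust_3[of i] unfolding T_def by auto
  ultimately have sm: "smooth_on (\<lambda>x. F x $ i) T" for i
    using smooth_on_subset[OF assms(2)[of i]] by blast
  have "smooth_on F T"
  proof (rule smooth_on_componentwise[OF \<open>open T\<close>])
    fix b :: "real ^ 3" assume "b \<in> Basis"
    then obtain i where "b = axis i 1" by (auto simp: Basis_vec_def)
    then show "smooth_on (\<lambda>x. F x \<bullet> b) T" using sm[of i] by (simp add: inner_axis)
  qed
  moreover have "0 \<in> T" using assms(1) by (simp add: T_def)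
  ultimately show thesis by (rule that[rotated])
qed

lemma smooth_rgerm_pair:
  fixes l :: "'a::euclidean_space \<Rightarrow> complex \<times> complex"
  assumes "rgerm g" "rgerm k" "bounded_linear l"
  obtains S where "0 \<in> S" "smooth_on (\<lambda>x. (Re (g (l x)), Re (k (l x)))) S"
proof -
  obtain S where S: "0 \<in> S" "smooth_on (\<lambda>x. Re (g (l x))) S" by (rule smooth_rgerm[OF assms(1,3)])
  obtain T where T: "0 \<in> T" "smooth_on (\<lambda>x. Re (k (l x))) T" by (rule smooth_rgerm[OF assms(2,3)])
  have o: "open (S \<inter> T)" using S T by (auto simp: smooth_on_def)
  note s = smooth_on_subset[OF S(2) o Int_lower1] smooth_on_subset[OF T(2) o Int_lower2]
  have "smooth_on (\<lambda>x. (Re (g (l x)), Re (k (l x)))) (S \<inter> T)"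
  proof (rule smooth_on_componentwise[OF o])
    fix b :: "real \<times> real" assume "b \<in> Basis"
    then have "b = (1, 0) \<or> b = (0, 1)" by (auto simp: Basis_prod_def)
    then show "smooth_on (\<lambda>x. (Re (g (l x)), Re (k (l x))) \<bullet> b) (S \<inter> T)"
      using s by (elim disjE) simp_all
  qed
  then show thesis using S(1) T(1) by (intro that[of "S \<inter> T"]) auto
qed

text \<open>Symmetric germs send real points to real points, so holomorphic germs inverse to each
  other restrict to real maps inverse to each other; smoothness comes with holomorphy.\<close>

lemma rgerm_diffeo:
  assumes g: "rgerm \<Phi>1" "rgerm \<Phi>2" "rgerm \<Psi>1" "rgerm \<Psi>2"
    and z: "\<Phi>1 0 = 0" "\<Phi>2 0 = 0"
    and inv1: "\<forall>\<^sub>F p in nhds 0. \<Psi>1 (\<Phi>1 p, \<Phi>2 p) = fst p" "\<forall>\<^sub>F p in nhds 0. \<Psi>2 (\<Phi>1 p, \<Phi>2 p) = snd p"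
    and inv2: "\<forall>\<^sub>F p in nhds 0. \<Phi>1 (\<Psi>1 p, \<Psi>2 p) = fst p" "\<forall>\<^sub>F p in nhds 0. \<Phi>2 (\<Psi>1 p, \<Psi>2 p) = snd p"
    and P: "\<forall>\<^sub>F q in nhds 0. P q"
  obtains U V where "diffeo_between (\<lambda>q. (Re (\<Phi>1 (emb q)), Re (\<Phi>2 (emb q)))) U V" "0 \<in> U" "\<And>q. q \<in> U \<Longrightarrow> P q"
proof -
  let ?f = "\<lambda>q. (Re (\<Phi>1 (emb q)), Re (\<Phi>2 (emb q)))" and ?g = "\<lambda>q. (Re (\<Psi>1 (emb q)), Re (\<Psi>2 (emb q)))"
  obtain S where S: "0 \<in> S" "smooth_on ?f S" by (rule smooth_rgerm_pair[OF g(1,2) bounded_linear_emb])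
  obtain T where T: "0 \<in> T" "smooth_on ?g T" by (rule smooth_rgerm_pair[OF g(3,4) bounded_linear_emb])
  note ev = eventually_linear_germ[OF _ bounded_linear_emb]
  have f0: "?f 0 = 0" using z by (simp add: emb_0 zero_prod_def[symmetric])
  have gf: "\<forall>\<^sub>F q in nhds 0. ?g (?f q) = q"
    using ev[OF inv1(1)] ev[OF inv1(2)] ev[OF rgerm_Re[OF g(1)]] ev[OF rgerm_Re[OF g(2)]]
  proof eventually_elim
    case (elim q)
    then have "emb (?f q) = (\<Phi>1 (emb q), \<Phi>2 (emb q))" by (simp add: emb_def)
    then show ?case using elim by (simp add: emb_def)
  qed
  have fg: "\<forall>\<^sub>F q in nhds 0. ?f (?g q) = q"
    using ev[OF inv2(1)] ev[OF inv2(2)] ev[OF rgerm_Re[OF g(3)]] ev[OF rgerm_Re[OF g(4)]]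
  proof eventually_elim
    case (elim q)
    then have "emb (?g q) = (\<Psi>1 (emb q), \<Psi>2 (emb q))" by (simp add: emb_def)
    then show ?case using elim by (simp add: emb_def)
  qed
  show thesis
    by (rule diffeo_between_germ[OF S(2,1) T(2) _ gf _ P]) (use f0 T(1) fg that in auto)
qed

context null_germ
begin

text \<open>A point can be recovered from its image: the first coordinate gives \<open>s\<close>,
  the second then gives \<open>\<eta>\<^sup>2\<close>, and the third gives
  \<open>\<eta>\<^sup>3\<close> because \<open>b\<close> does not vanish; square and cube together
  determine \<open>\<eta>\<close>. Injectivity is all that is needed to exclude a cuspidal crosscap,
  so the germ is not identified further.\<close>

lemma surface_germ_locally_injective:
  fixes X :: "real \<times> real \<Rightarrow> real ^ 3"
  assumes X: "\<forall>\<^sub>F q in nhds 0. X q $ 1 = Re (f 0 (emb q)) \<and> X q $ 2 = Re (f 1 (emb q)) \<and> X q $ 3 = Re (f 2 (emb q))"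
    and lam0: "lam 0 \<noteq> 0"
  obtains N where "open N" "0 \<in> N" "inj_on X N"
proof -
  obtain U y V a b where g: "rgerm U" "rgerm y" "rgerm V" "rgerm a" "rgerm b"
    and z: "U 0 = 0" "y 0 = 0" "V 0 = 0"
    and U: "\<forall>\<^sub>F p in nhds 0. f 0 (U p, snd p) = fst p" "\<forall>\<^sub>F p in nhds 0. U (f 0 p, snd p) = fst p"
    and V: "\<forall>\<^sub>F p in nhds 0. y (fst p, V p) = snd p" "\<forall>\<^sub>F p in nhds 0. V (fst p, y p) = snd p"
    and f1: "\<forall>\<^sub>F p in nhds 0. f 1 (U p, snd p) = f 1 (U (fst p, 0), 0) + (y p)\<^sup>2"
    and f2: "\<forall>\<^sub>F p in nhds 0. f 2 (U (fst p, V p), V p) = a (fst p, (snd p)\<^sup>2) + (snd p) ^ 3 * b (fst p, (snd p)\<^sup>2)"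
    and b: "lam 0 \<noteq> 0 \<longrightarrow> b 0 \<noteq> 0"
    and "lam 0 = 0 \<and> deriv lam 0 \<noteq> 0 \<longrightarrow> b 0 = 0 \<and> pd1 b 0 \<noteq> 0"
    by (rule normal_form)
  define \<eta> where "\<eta> = (\<lambda>p. y (f 0 p, snd p))"
  have gf: "rgerm (f 0)" by (rule f_rgerm) simp
  have g\<eta>: "rgerm \<eta>" unfolding \<eta>_def by (rule rgerm_compose2[OF g(2) gf rgerm_snd f0]) simp
  have \<eta>0: "\<eta> 0 = 0" using z(2) f0 by (simp add: \<eta>_def zero_prod_def[symmetric])
  have bn: "\<forall>\<^sub>F p in nhds 0. b p \<noteq> 0"
    by (intro isCont_eventually[where f = b and P = "\<lambda>x. x \<noteq> 0"] t1_space_nhds rgerm_isCont g)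
      (use b lam0 in simp)
  have g\<eta>2: "rgerm (\<lambda>p. (\<eta> p)\<^sup>2)" by (rule rgerm_power[OF g\<eta>])
  have \<eta>20: "(\<eta> 0)\<^sup>2 = 0" by (simp add: \<eta>0)
  have sz: "snd 0 = 0" by simp
  note fs = eventually_germ2[OF _ gf rgerm_snd f0 sz] and f\<eta> = eventually_germ2[OF _ gf g\<eta> f0 \<eta>0]
  have V\<eta>: "\<forall>\<^sub>F p in nhds 0. V (f 0 p, \<eta> p) = snd p"
    using fs[OF V(2)] by (simp add: \<eta>_def)
  have f1\<eta>: "\<forall>\<^sub>F p in nhds 0. f 1 p = f 1 (U (f 0 p, 0), 0) + (\<eta> p)\<^sup>2"
    using fs[OF f1] U(2) by eventually_elim (simp add: \<eta>_def)
  have f2\<eta>: "\<forall>\<^sub>F p in nhds 0. f 2 p = a (f 0 p, (\<eta> p)\<^sup>2) + (\<eta> p) ^ 3 * b (f 0 p, (\<eta> p)\<^sup>2)"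
    using f\<eta>[OF f2] V\<eta> U(2) by eventually_elim simp
  have all: "\<forall>\<^sub>F p in nhds 0. U (f 0 p, snd p) = fst p \<and> V (f 0 p, \<eta> p) = snd p \<and>
      f 1 p = f 1 (U (f 0 p, 0), 0) + (\<eta> p)\<^sup>2 \<and>
      f 2 p = a (f 0 p, (\<eta> p)\<^sup>2) + (\<eta> p) ^ 3 * b (f 0 p, (\<eta> p)\<^sup>2) \<and> b (f 0 p, (\<eta> p)\<^sup>2) \<noteq> 0"
    using U(2) V\<eta> f1\<eta> f2\<eta> eventually_germ2[OF bn gf g\<eta>2 f0 \<eta>20] by eventually_elim blast
  note ev = eventually_linear_germ[OF _ bounded_linear_emb]
  have "\<forall>\<^sub>F q in nhds 0. (X q $ 1 = Re (f 0 (emb q)) \<and> X q $ 2 = Re (f 1 (emb q)) \<and> X q $ 3 = Re (f 2 (emb q))) \<and>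
      (\<forall>k<3. complex_of_real (Re (f k (emb q))) = f k (emb q)) \<and>
      U (f 0 (emb q), snd (emb q)) = fst (emb q) \<and> V (f 0 (emb q), \<eta> (emb q)) = snd (emb q) \<and>
      f 1 (emb q) = f 1 (U (f 0 (emb q), 0), 0) + (\<eta> (emb q))\<^sup>2 \<and>
      f 2 (emb q) = a (f 0 (emb q), (\<eta> (emb q))\<^sup>2) + (\<eta> (emb q)) ^ 3 * b (f 0 (emb q), (\<eta> (emb q))\<^sup>2) \<and>
      b (f 0 (emb q), (\<eta> (emb q))\<^sup>2) \<noteq> 0"
  proof -
    have "\<forall>\<^sub>F q in nhds 0. \<forall>k\<in>{..<3}. complex_of_real (Re (f k (emb q))) = f k (emb q)"
      by (rule eventually_ball_finite) (use ev[OF rgerm_Re[OF f_rgerm]] in auto)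
    then show ?thesis using X ev[OF all] by eventually_elim auto
  qed
  then obtain N where N: "open N" "0 \<in> N" and E: "\<And>q. q \<in> N \<Longrightarrow>
      (X q $ 1 = Re (f 0 (emb q)) \<and> X q $ 2 = Re (f 1 (emb q)) \<and> X q $ 3 = Re (f 2 (emb q))) \<and>
      (\<forall>k<3. complex_of_real (Re (f k (emb q))) = f k (emb q)) \<and>
      U (f 0 (emb q), snd (emb q)) = fst (emb q) \<and> V (f 0 (emb q), \<eta> (emb q)) = snd (emb q) \<and>
      f 1 (emb q) = f 1 (U (f 0 (emb q), 0), 0) + (\<eta> (emb q))\<^sup>2 \<and>
      f 2 (emb q) = a (f 0 (emb q), (\<eta> (emb q))\<^sup>2) + (\<eta> (emb q)) ^ 3 * b (f 0 (emb q), (\<eta> (emb q))\<^sup>2) \<and>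
      b (f 0 (emb q), (\<eta> (emb q))\<^sup>2) \<noteq> 0"
    unfolding eventually_nhds by blast
  have "inj_on X N"
  proof (rule inj_onI)
    fix q q' assume q: "q \<in> N" "q' \<in> N" and eq: "X q = X q'"
    note E1 = E[OF q(1)] and E2 = E[OF q(2)]
    have r: "complex_of_real (Re (f k (emb q))) = f k (emb q)" "complex_of_real (Re (f k (emb q'))) = f k (emb q')"
      if "k < 3" for k using E1 E2 that by blast+
    have e: "f k (emb q) = f k (emb q')" if "Re (f k (emb q)) = Re (f k (emb q'))" "k < 3" for k
      using r[OF that(2)] that(1) by metis
    have e0: "f 0 (emb q) = f 0 (emb q')" by (rule e) (use E1 E2 eq in auto)
    have e1: "f 1 (emb q) = f 1 (emb q')" by (rule e) (use E1 E2 eq in auto)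
    have e2: "f 2 (emb q) = f 2 (emb q')" by (rule e) (use E1 E2 eq in auto)
    have "f 1 (U (f 0 (emb q), 0), 0) + (\<eta> (emb q))\<^sup>2 = f 1 (U (f 0 (emb q), 0), 0) + (\<eta> (emb q'))\<^sup>2"
      using E1 E2 e0 e1 by metis
    then have s: "(\<eta> (emb q))\<^sup>2 = (\<eta> (emb q'))\<^sup>2" by simp
    have "a (f 0 (emb q), (\<eta> (emb q))\<^sup>2) + (\<eta> (emb q)) ^ 3 * b (f 0 (emb q), (\<eta> (emb q))\<^sup>2) =
        a (f 0 (emb q), (\<eta> (emb q))\<^sup>2) + (\<eta> (emb q')) ^ 3 * b (f 0 (emb q), (\<eta> (emb q))\<^sup>2)"
      using E1 E2 e0 e2 s by metis
    then have c: "(\<eta> (emb q)) ^ 3 = (\<eta> (emb q')) ^ 3" using E1 by simp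
    have "\<eta> (emb q) = \<eta> (emb q')"
    proof (cases "\<eta> (emb q) = - \<eta> (emb q')")
      case True
      then have "2 * (\<eta> (emb q')) ^ 3 = 0" using c by simp
      then show ?thesis using True by simp
    next
      case False
      then show ?thesis using s by (simp add: power2_eq_iff)
    qed
    then have v: "snd (emb q) = snd (emb q')" using E1 E2 e0 by metis
    then have "fst (emb q) = fst (emb q')" using E1 E2 e0 by metis
    with v show "q = q'" by (simp add: emb_def prod_eq_iff)
  qed
  with N show thesis by (rule that)
qed

text \<open>As \<open>pd1 b\<close> is nonzero, \<open>\<beta> = b (s, \<eta>\<^sup>2)\<close> can
  replace \<open>s\<close> as a coordinate next to \<open>\<eta>\<close>. In the target,
  \<open>\<eta>\<^sup>2\<close> is the second coordinate minus \<open>c s\<close>; hence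
  \<open>\<beta>\<close> and the even part \<open>a\<close> are functions of the first two target
  coordinates. Replacing the first coordinate by \<open>\<beta>\<close> and subtracting
  \<open>a\<close> from the third yields
  \<open>(\<beta>, \<eta>\<^sup>2, \<beta> \<eta>\<^sup>3)\<close>, the model.\<close>

lemma surface_germ_crosscap:
  fixes X :: "real \<times> real \<Rightarrow> real ^ 3"
  assumes X: "\<forall>\<^sub>F q in nhds 0. X q $ 1 = Re (f 0 (emb q)) \<and> X q $ 2 = Re (f 1 (emb q)) \<and> X q $ 3 = Re (f 2 (emb q))"
    and lam0: "lam 0 = 0" and dlam: "deriv lam 0 \<noteq> 0"
  shows "cuspidal_crosscap_at X 0"
proof -
  obtain U y V a b where g: "rgerm U" "rgerm y" "rgerm V" "rgerm a" "rgerm b"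
    and z: "U 0 = 0" "y 0 = 0" "V 0 = 0"
    and U: "\<forall>\<^sub>F p in nhds 0. f 0 (U p, snd p) = fst p" "\<forall>\<^sub>F p in nhds 0. U (f 0 p, snd p) = fst p"
    and V: "\<forall>\<^sub>F p in nhds 0. y (fst p, V p) = snd p" "\<forall>\<^sub>F p in nhds 0. V (fst p, y p) = snd p"
    and f1: "\<forall>\<^sub>F p in nhds 0. f 1 (U p, snd p) = f 1 (U (fst p, 0), 0) + (y p)\<^sup>2"
    and f2: "\<forall>\<^sub>F p in nhds 0. f 2 (U (fst p, V p), V p) = a (fst p, (snd p)\<^sup>2) + (snd p) ^ 3 * b (fst p, (snd p)\<^sup>2)"
    and "lam 0 \<noteq> 0 \<longrightarrow> b 0 \<noteq> 0"
    and b: "lam 0 = 0 \<and> deriv lam 0 \<noteq> 0 \<longrightarrow> b 0 = 0 \<and> pd1 b 0 \<noteq> 0"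
    by (rule normal_form)
  have b0: "b 0 = 0" and db: "pd1 b 0 \<noteq> 0" using b lam0 dlam by auto
  obtain B where B: "rgerm B" "B 0 = 0" "\<forall>\<^sub>F p in nhds 0. b (B p, snd p) = fst p"
    "\<forall>\<^sub>F p in nhds 0. B (b p, snd p) = fst p"
    by (rule rgerm_implicit1[OF g(5) b0 db])
  have gf0: "rgerm (f 0)" and gf1: "rgerm (f 1)" by (rule f_rgerm; simp)+
  have sz: "snd 0 = 0" "fst 0 = 0" by simp_all

  define \<eta> where "\<eta> = (\<lambda>p. y (f 0 p, snd p))"
  have g\<eta>: "rgerm \<eta>" unfolding \<eta>_def by (rule rgerm_compose2[OF g(2) gf0 rgerm_snd f0 sz(1)])
  have \<eta>0: "\<eta> 0 = 0" using z(2) f0 by (simp add: \<eta>_def zero_prod_def[symmetric])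
  have g\<eta>2: "rgerm (\<lambda>p. (\<eta> p)\<^sup>2)" by (rule rgerm_power[OF g\<eta>])
  have \<eta>20: "(\<eta> 0)\<^sup>2 = 0" by (simp add: \<eta>0)
  define \<beta> where "\<beta> = (\<lambda>p. b (f 0 p, (\<eta> p)\<^sup>2))"
  have g\<beta>: "rgerm \<beta>" unfolding \<beta>_def by (rule rgerm_compose2[OF g(5) gf0 g\<eta>2 f0 \<eta>20])
  have \<beta>0: "\<beta> 0 = 0" using b0 f0 by (simp add: \<beta>_def \<eta>0 zero_prod_def[symmetric])
  note fs = eventually_germ2[OF _ gf0 rgerm_snd f0 sz(1)] and f\<eta> = eventually_germ2[OF _ gf0 g\<eta> f0 \<eta>0]
    and f\<eta>2 = eventually_germ2[OF _ gf0 g\<eta>2 f0 \<eta>20]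
  have V\<eta>: "\<forall>\<^sub>F p in nhds 0. V (f 0 p, \<eta> p) = snd p"
    using fs[OF V(2)] by (simp add: \<eta>_def)

  have gsq: "rgerm (\<lambda>p. (snd p)\<^sup>2)" and sq0: "(snd (0 :: complex \<times> complex))\<^sup>2 = 0" by (rule rgerm_power) simp_all
  \<comment> \<open>The inverse of \<open>(\<beta>, \<eta>)\<close> in three stages:
    \<open>S\<close> recovers the first surface coordinate by solving for the first argument of
    \<open>b\<close>, \<open>V'\<close> recovers \<open>v\<close>, and \<open>U'\<close> recovers
    \<open>u\<close>.\<close>
  define S where "S = (\<lambda>p. B (fst p, (snd p)\<^sup>2))"
  have gS: "rgerm S" unfolding S_def by (rule rgerm_compose2[OF B(1) rgerm_fst gsq sz(2) sq0])
  have S0: "S 0 = 0" using B(2) by (simp add: S_def zero_prod_def[symmetric])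
  define V' where "V' = (\<lambda>p. V (S p, snd p))"
  have gV': "rgerm V'" unfolding V'_def by (rule rgerm_compose2[OF g(3) gS rgerm_snd S0 sz(1)])
  have V'0: "V' 0 = 0" using z(3) S0 by (simp add: V'_def zero_prod_def[symmetric])
  define U' where "U' = (\<lambda>p. U (S p, V' p))"
  have gU': "rgerm U'" unfolding U'_def by (rule rgerm_compose2[OF g(1) gS gV' S0 V'0])

  have S\<beta>: "\<forall>\<^sub>F p in nhds 0. S (\<beta> p, \<eta> p) = f 0 p"
    using f\<eta>2[OF B(4)] by (simp add: S_def \<beta>_def)
  have inv1b: "\<forall>\<^sub>F p in nhds 0. V' (\<beta> p, \<eta> p) = snd p"
    using S\<beta> V\<eta> by eventually_elim (simp add: V'_def)
  have inv1a: "\<forall>\<^sub>F p in nhds 0. U' (\<beta> p, \<eta> p) = fst p"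
    using S\<beta> inv1b U(2) by eventually_elim (simp add: U'_def)
  have f0': "\<forall>\<^sub>F p in nhds 0. f 0 (U' p, V' p) = S p"
    using eventually_germ2[OF U(1) gS gV' S0 V'0] by (simp add: U'_def)
  have \<eta>': "\<forall>\<^sub>F p in nhds 0. \<eta> (U' p, V' p) = snd p"
    using f0' eventually_germ2[OF V(1) gS rgerm_snd S0 sz(1)] by eventually_elim (simp add: \<eta>_def V'_def)
  have \<beta>': "\<forall>\<^sub>F p in nhds 0. \<beta> (U' p, V' p) = fst p"
    using f0' \<eta>' eventually_germ2[OF B(3) rgerm_fst gsq sz(2) sq0] by eventually_elim (simp add: \<beta>_def S_def)

  define c where "c = (\<lambda>p :: complex \<times> complex. f 1 (U (fst p, 0), 0))"
  have gU0: "rgerm (\<lambda>p. U (fst p, 0))" by (rule rgerm_compose2[OF g(1) rgerm_fst _ sz(2)]) simp_all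
  have U00: "U (fst 0, 0) = 0" using z(1) by (simp add: zero_prod_def[symmetric])
  have gc: "rgerm c" unfolding c_def by (rule rgerm_compose2[OF gf1 gU0 _ U00]) simp_all
  have f10: "f 1 0 = 0" by (rule f_zero) simp
  have c0: "c 0 = 0" using f10 z(1) by (simp add: c_def zero_prod_def[symmetric])
  \<comment> \<open>From here on the variables are the first two coordinates of the target;
    \<open>Y\<close> equals \<open>\<eta>\<^sup>2\<close> on the surface. \<open>I2\<close> and
    \<open>I3\<close> undo the change once \<open>B\<close> has recovered the first
    coordinate.\<close>
  define Y where "Y = (\<lambda>p. snd p - c p)"
  have gY: "rgerm Y" unfolding Y_def by (intro rgerm_diff gc) simp
  have Y0: "Y 0 = 0" by (simp add: Y_def c0)
  define T1 where "T1 = (\<lambda>p. b (fst p, Y p))"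
  define T3 where "T3 = (\<lambda>p. a (fst p, Y p))"
  have gT1: "rgerm T1" unfolding T1_def by (rule rgerm_compose2[OF g(5) rgerm_fst gY sz(2) Y0])
  have gT3: "rgerm T3" unfolding T3_def by (rule rgerm_compose2[OF g(4) rgerm_fst gY sz(2) Y0])
  have T10: "T1 0 = 0" using b0 by (simp add: T1_def Y0 zero_prod_def[symmetric])
  define I2 where "I2 = (\<lambda>p. snd p + c (B p, 0))"
  have gcB: "rgerm (\<lambda>p. c (B p, 0))" by (rule rgerm_compose2[OF gc B(1) _ B(2)]) simp_all
  have gI2: "rgerm I2" unfolding I2_def by (intro rgerm_add gcB) simp
  define I3 where "I3 = (\<lambda>p. a (B p, snd p))"
  have gI3: "rgerm I3" unfolding I3_def by (rule rgerm_compose2[OF g(4) B(1) rgerm_snd B(2) sz(1)])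
  have a0: "a 0 = 0"
  proof -
    have f20: "f 2 0 = 0" by (rule f_zero) simp
    then show ?thesis using eventually_nhds_x_imp_x[OF f2] z by (simp add: zero_prod_def[symmetric])
  qed
  have YI: "Y (B p, I2 p) = snd p" for p by (simp add: Y_def I2_def c_def)
  have BT: "\<forall>\<^sub>F p in nhds 0. B (T1 p, Y p) = fst p"
    using eventually_germ2[OF B(4) rgerm_fst gY sz(2) Y0] by (simp add: T1_def)
  have I2T: "\<forall>\<^sub>F p in nhds 0. I2 (T1 p, Y p) = snd p"
    using BT by eventually_elim (auto simp: I2_def Y_def c_def)

  \<comment> \<open>The third target coordinate is only shifted by a function of the first two, so
    two complex variables suffice for the change of the target.\<close>
  define l where "l = (\<lambda>x :: real ^ 3. (complex_of_real (x $ 1), complex_of_real (x $ 2)))"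
  have bl: "bounded_linear l"
    unfolding l_def by (intro bounded_linear_Pair bounded_linear_compose[OF bounded_linear_of_real bounded_linear_vec_nth])
  have cl: "cnj2 (l x) = l x" for x by (simp add: l_def)
  have l0: "l 0 = 0" by (simp add: l_def zero_prod_def[symmetric])
  define \<psi> where "\<psi> = (\<lambda>x :: real ^ 3. vector [Re (T1 (l x)), Re (Y (l x)), x $ 3 - Re (T3 (l x))] :: real ^ 3)"
  define \<psi>' where "\<psi>' = (\<lambda>x :: real ^ 3. vector [Re (B (l x)), Re (I2 (l x)), x $ 3 + Re (I3 (l x))] :: real ^ 3)"
  have \<psi>0: "\<psi> 0 = 0"
    unfolding vec_eq_iff forall_3 by (simp add: \<psi>_def l0 T10 Y0 T3_def a0 zero_prod_def[symmetric])
  have sm: "\<exists>T. 0 \<in> T \<and> smooth_on (\<lambda>x. vector [Re (h1 (l x)), Re (h2 (l x)), x $ 3 + Re (h3 (l x))] :: real ^ 3) T"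
    if h: "rgerm h1" "rgerm h2" "rgerm h3" for h1 h2 h3
  proof -
    obtain S1 where S1: "0 \<in> S1" "smooth_on (\<lambda>x. Re (h1 (l x))) S1" by (rule smooth_rgerm[OF h(1) bl])
    obtain S2 where S2: "0 \<in> S2" "smooth_on (\<lambda>x. Re (h2 (l x))) S2" by (rule smooth_rgerm[OF h(2) bl])
    obtain S3 where S3: "0 \<in> S3" "smooth_on (\<lambda>x. Re (h3 (l x))) S3" by (rule smooth_rgerm[OF h(3) bl])
    have "open S3" using S3(2) by (simp add: smooth_on_def)
    then have "smooth_on (\<lambda>x :: real ^ 3. 0 + x $ 3) S3"
      by (rule smooth_on_affine) (rule bounded_linear_vec_nth)
    from smooth_on_add[OF this S3(2)] have S3': "smooth_on (\<lambda>x. x $ 3 + Re (h3 (l x))) S3" by simp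
    define SS where "SS = (\<lambda>i :: 3. if i = 1 then S1 else if i = 2 then S2 else S3)"
    have "0 \<in> SS i" for i using S1 S2 S3 by (simp add: SS_def)
    moreover have "smooth_on (\<lambda>x. (vector [Re (h1 (l x)), Re (h2 (l x)), x $ 3 + Re (h3 (l x))] :: real ^ 3) $ i) (SS i)" for i
      using exhaust_3[of i] S1 S2 S3' by (auto simp: SS_def)
    ultimately show ?thesis by (rule smooth_on_vec3) blast
  qed
  have "rgerm (\<lambda>p. 0 - T3 p)" by (intro rgerm_diff gT3) simp
  from sm[OF gT1 gY this] obtain A where A: "0 \<in> A" "smooth_on \<psi> A" by (auto simp: \<psi>_def)
  from sm[OF B(1) gI2 gI3] obtain A' where A': "0 \<in> A'" "smooth_on \<psi>' A'" by (auto simp: \<psi>'_def)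
  note evl = eventually_linear_germ[OF _ bl]
  have i1: "\<forall>\<^sub>F x in nhds 0. \<psi>' (\<psi> x) = x"
    using evl[OF BT] evl[OF I2T] evl[OF rgerm_Re[OF gT1]] evl[OF rgerm_Re[OF gY]]
  proof eventually_elim
    case (elim x)
    then have lp: "l (\<psi> x) = (T1 (l x), Y (l x))" by (simp add: l_def \<psi>_def)
    have "I3 (T1 (l x), Y (l x)) = T3 (l x)" using elim(1) by (simp add: I3_def T3_def)
    then show ?case
      unfolding vec_eq_iff forall_3 using elim lp by (simp add: \<psi>'_def) (simp add: \<psi>_def l_def)
  qed
  have i2: "\<forall>\<^sub>F x in nhds 0. \<psi> (\<psi>' x) = x"
    using evl[OF B(3)] evl[OF rgerm_Re[OF B(1)]] evl[OF rgerm_Re[OF gI2]]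
  proof eventually_elim
    case (elim x)
    then have lp: "l (\<psi>' x) = (B (l x), I2 (l x))" by (simp add: l_def \<psi>'_def)
    have "T1 (B (l x), I2 (l x)) = fst (l x)" using elim(1) by (simp add: T1_def YI)
    moreover have "T3 (B (l x), I2 (l x)) = I3 (l x)" by (simp add: I3_def T3_def YI)
    ultimately show ?case
      unfolding vec_eq_iff forall_3 using lp by (simp add: \<psi>_def YI) (simp add: \<psi>'_def l_def)
  qed
  have "\<psi> 0 \<in> A'" "\<forall>\<^sub>F y in nhds (\<psi> 0). \<psi> (\<psi>' y) = y" using A'(1) i2 by (simp_all add: \<psi>0)
  then obtain W W' where W: "diffeo_between \<psi> W W'" "0 \<in> W"
    by (rule diffeo_between_germ[OF A(2,1) A'(2) _ i1, of "\<lambda>_. True"]) auto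
  have oW: "open W" using W(1) by (auto simp: diffeo_between_def smooth_on_def)

  note ev = eventually_linear_germ[OF _ bounded_linear_emb]
  have gf2: "rgerm (f 2)" by (rule f_rgerm) simp
  have X0: "X 0 = 0"
    using eventually_nhds_x_imp_x[OF X] f_zero[of 0] f_zero[of 1] f_zero[of 2]
    unfolding vec_eq_iff forall_3 by (simp add: emb_0)
  have "isCont X 0"
  proof -
    have c: "isCont (\<lambda>q. Re (h (emb q))) 0" if "rgerm h" for h
      by (intro continuous_intros isCont_o2[OF isCont_bounded_linear[OF bounded_linear_emb]])
        (simp add: emb_0 rgerm_isCont that)
    have "isCont (\<lambda>q. vector [Re (f 0 (emb q)), Re (f 1 (emb q)), Re (f 2 (emb q))] :: real ^ 3) 0"
      unfolding isCont_def
    proof (rule vec_tendstoI)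
      fix i :: 3
      show "((\<lambda>q. (vector [Re (f 0 (emb q)), Re (f 1 (emb q)), Re (f 2 (emb q))] :: real ^ 3) $ i) \<longlongrightarrow>
         (vector [Re (f 0 (emb 0)), Re (f 1 (emb 0)), Re (f 2 (emb 0))] :: real ^ 3) $ i) (at 0)"
        using exhaust_3[of i] c[OF gf0] c[OF gf1] c[OF gf2] by (auto simp: isCont_def)
    qed
    moreover have "\<forall>\<^sub>F q in nhds 0. X q = vector [Re (f 0 (emb q)), Re (f 1 (emb q)), Re (f 2 (emb q))]"
      using X by eventually_elim (simp add: vec_eq_iff forall_3)
    ultimately show ?thesis using isCont_cong[of X _ 0] by simp
  qed
  \<comment> \<open>The model identity must hold on a source neighbourhood that \<open>X\<close>
    maps into the domain of \<open>\<psi>\<close>.\<close>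
  then have XW: "\<forall>\<^sub>F q in nhds 0. X q \<in> W"
    using oW W(2) X0 isCont_eventually[where f = X and P = "\<lambda>x. x \<in> W" and a = 0] eventually_nhds_in_open by auto

  have Yf: "\<forall>\<^sub>F p in nhds 0. Y (f 0 p, f 1 p) = (\<eta> p)\<^sup>2"
    using fs[OF f1] U(2) by eventually_elim (simp add: Y_def c_def \<eta>_def)
  have f2\<eta>: "\<forall>\<^sub>F p in nhds 0. f 2 p = a (f 0 p, (\<eta> p)\<^sup>2) + (\<eta> p) ^ 3 * \<beta> p"
    using f\<eta>[OF f2] V\<eta> U(2) by eventually_elim (simp add: \<beta>_def)
  have model: "\<forall>\<^sub>F q in nhds 0. X q \<in> W \<and> \<psi> (X q) = cuspidal_crosscap_model (Re (\<beta> (emb q)), Re (\<eta> (emb q)))"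
    using X XW ev[OF Yf] ev[OF f2\<eta>] ev[OF rgerm_Re[OF gf0]] ev[OF rgerm_Re[OF gf1]]
      ev[OF rgerm_Re[OF g\<beta>]] ev[OF rgerm_Re[OF g\<eta>]]
  proof eventually_elim
    case (elim q)
    let ?p = "emb q"
    obtain \<beta>r \<eta>r where r: "\<beta> ?p = complex_of_real \<beta>r" "\<eta> ?p = complex_of_real \<eta>r"
      using elim(7,8) by (metis cnj2_emb)
    have lX: "l (X q) = (f 0 ?p, f 1 ?p)" using elim by (simp add: l_def)
    have "T1 (l (X q)) = \<beta> ?p" "Y (l (X q)) = (\<eta> ?p)\<^sup>2" "T3 (l (X q)) = a (f 0 ?p, (\<eta> ?p)\<^sup>2)"
      using elim(3) by (simp_all add: lX T1_def T3_def \<beta>_def)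
    moreover have "X q $ 3 - Re (a (f 0 ?p, (\<eta> ?p)\<^sup>2)) = \<eta>r ^ 3 * \<beta>r"
      using elim(1,4) by (simp add: r of_real_power[symmetric] of_real_mult[symmetric] del: of_real_power of_real_mult)
    ultimately show ?case
      using elim(2) unfolding \<psi>_def cuspidal_crosscap_model_def
      by (simp add: r mult.commute of_real_power[symmetric] del: of_real_power)
  qed
  obtain N N' where N: "diffeo_between (\<lambda>q. (Re (\<beta> (emb q)), Re (\<eta> (emb q)))) N N'" "0 \<in> N"
    "\<And>q. q \<in> N \<Longrightarrow> X q \<in> W \<and> \<psi> (X q) = cuspidal_crosscap_model (Re (\<beta> (emb q)), Re (\<eta> (emb q)))"
    by (rule rgerm_diffeo[OF g\<beta> g\<eta> gU' gV' \<beta>0 \<eta>0 inv1a inv1b \<beta>' \<eta>' model]) blast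
  show ?thesis
    unfolding cuspidal_crosscap_at_def
    by (intro exI[of _ N] exI[of _ N'] exI[of _ "\<lambda>q. (Re (\<beta> (emb q)), Re (\<eta> (emb q)))"]
        exI[of _ W] exI[of _ W'] exI[of _ \<psi>])
      (use N W X0 \<psi>0 \<beta>0 \<eta>0 in \<open>simp add: emb_0 zero_prod_def[symmetric]\<close>)
qed

end

text \<open>For \<open>\<kappa> = 1\<close> conjugation respects each of the arguments
  \<open>u + v\<close> and \<open>u - v\<close>. For \<open>\<kappa> = \<i>\<close> it interchanges
  the two, and the sign change of \<open>1 / \<kappa>\<close> matches the opposite signs of
  \<open>B\<close>, so the sum is symmetric in both cases.\<close>

lemma rgerm_null_surface:
  fixes A B :: "complex \<Rightarrow> complex"
  assumes \<kappa>: "\<kappa> = 1 \<or> \<kappa> = \<i>"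
    and A: "\<forall>\<^sub>F z in nhds 0. A field_differentiable at z \<and> A (cnj z) = cnj (A z)"
    and B: "\<forall>\<^sub>F z in nhds 0. B field_differentiable at z \<and> B (cnj z) = cnj (B z)"
    and C: "cnj C = C"
  shows "rgerm (\<lambda>p. ((A (fst p + \<kappa> * snd p) + B (fst p + \<kappa> * snd p) / \<kappa>) / 2 - C) +
      ((A (fst p - \<kappa> * snd p) - B (fst p - \<kappa> * snd p) / \<kappa>) / 2 - C))"
proof -
  have "isCont (\<lambda>p :: complex \<times> complex. fst p + \<kappa> * snd p) 0" "isCont (\<lambda>p :: complex \<times> complex. fst p - \<kappa> * snd p) 0"
    by (intro continuous_intros)+
  then have ev: "\<forall>\<^sub>F p in nhds 0. R (fst p + \<kappa> * snd p) \<and> R (fst p - \<kappa> * snd p)"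
    if "\<forall>\<^sub>F z in nhds 0. R z" for R
    using eventually_germ[OF that, where f = "\<lambda>p :: complex \<times> complex. fst p + \<kappa> * snd p" and a = 0]
      eventually_germ[OF that, where f = "\<lambda>p :: complex \<times> complex. fst p - \<kappa> * snd p" and a = 0]
    by (simp add: eventually_conj)
  show ?thesis
    unfolding rgerm_def cnj2_simps using ev[OF A] ev[OF B]
  proof eventually_elim
    case (elim p)
    have l: "cdiff2 (\<lambda>p. fst p + \<kappa> * snd p) p" "cdiff2 (\<lambda>p. fst p - \<kappa> * snd p) p"
      by (intro cdiff2_add cdiff2_diff cdiff2_mult cdiff2_fst cdiff2_snd cdiff2_const)+
    have c: "cdiff2 (\<lambda>p. A (fst p + \<kappa> * snd p)) p" "cdiff2 (\<lambda>p. A (fst p - \<kappa> * snd p)) p"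
      "cdiff2 (\<lambda>p. B (fst p + \<kappa> * snd p)) p" "cdiff2 (\<lambda>p. B (fst p - \<kappa> * snd p)) p"
      using elim l cdiff2_compose1 unfolding field_differentiable_def by metis+
    have "cdiff2 (\<lambda>p. ((A (fst p + \<kappa> * snd p) + (1 / \<kappa>) * B (fst p + \<kappa> * snd p)) * (1 / 2) - C) +
      ((A (fst p - \<kappa> * snd p) - (1 / \<kappa>) * B (fst p - \<kappa> * snd p)) * (1 / 2) - C)) p"
      by (intro cdiff2_add cdiff2_diff cdiff2_mult cdiff2_const c)
    then have "cdiff2 (\<lambda>p. ((A (fst p + \<kappa> * snd p) + B (fst p + \<kappa> * snd p) / \<kappa>) / 2 - C) +
      ((A (fst p - \<kappa> * snd p) - B (fst p - \<kappa> * snd p) / \<kappa>) / 2 - C)) p"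
      by (simp only: times_divide_eq_left times_divide_eq_right mult_1_left mult_1_right)
    moreover have "((A (cnj (fst p) + \<kappa> * cnj (snd p)) + B (cnj (fst p) + \<kappa> * cnj (snd p)) / \<kappa>) / 2 - C) +
        ((A (cnj (fst p) - \<kappa> * cnj (snd p)) - B (cnj (fst p) - \<kappa> * cnj (snd p)) / \<kappa>) / 2 - C) =
        cnj (((A (fst p + \<kappa> * snd p) + B (fst p + \<kappa> * snd p) / \<kappa>) / 2 - C) +
      ((A (fst p - \<kappa> * snd p) - B (fst p - \<kappa> * snd p) / \<kappa>) / 2 - C))"
      using \<kappa>
    proof
      assume "\<kappa> = 1"
      then show ?thesis using elim C by simp
    next
      assume k: "\<kappa> = \<i>"
      have e: "A (cnj (fst p) + \<i> * cnj (snd p)) = cnj (A (fst p - \<i> * snd p))"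
        "A (cnj (fst p) - \<i> * cnj (snd p)) = cnj (A (fst p + \<i> * snd p))"
        "B (cnj (fst p) + \<i> * cnj (snd p)) = cnj (B (fst p - \<i> * snd p))"
        "B (cnj (fst p) - \<i> * cnj (snd p)) = cnj (B (fst p + \<i> * snd p))"
        using elim by (simp_all add: k)
      show ?thesis unfolding k e
        by (simp only: complex_cnj_add complex_cnj_diff complex_cnj_divide complex_cnj_i complex_cnj_numeral C
            minus_divide_right[symmetric] diff_minus_eq_add add_uminus_conv_diff add.commute)
    qed
    ultimately show ?case by (rule conjI)
  qed
qed

text \<open>When \<open>(c, s)\<close> is a unit vector: a rotation about the time axis that turns
  the direction \<open>(c, s)\<close> into the first axis, followed by light-cone coordinates. In
  these the null cone reads \<open>y\<^sub>1 y\<^sub>3 = y\<^sub>2\<^sup>2\<close>, so that null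
  vectors with nonzero first entry are multiples of \<open>(1, \<tau>, \<tau>\<^sup>2)\<close>. The
  sign \<open>\<sigma>\<close> allows a reflection.\<close>

definition rot :: "real \<Rightarrow> real \<Rightarrow> real \<Rightarrow> real ^ 3 \<Rightarrow> real ^ 3" where
  "rot c s \<sigma> x = vector [x $ 3 + (c * x $ 1 + s * x $ 2), \<sigma> * (c * x $ 2 - s * x $ 1), x $ 3 - (c * x $ 1 + s * x $ 2)]"

definition rot' :: "real \<Rightarrow> real \<Rightarrow> real \<Rightarrow> real ^ 3 \<Rightarrow> real ^ 3" where
  "rot' c s \<sigma> x = vector [c * ((x $ 1 - x $ 3) / 2) - s * (\<sigma> * x $ 2), s * ((x $ 1 - x $ 3) / 2) + c * (\<sigma> * x $ 2), (x $ 1 + x $ 3) / 2]"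

lemma bounded_linear_vec3:
  fixes f :: "real ^ 3 \<Rightarrow> real ^ 3"
  assumes "\<And>x y. f (x + y) = f x + f y" "\<And>r x. f (r *\<^sub>R x) = r *\<^sub>R f x"
  shows "bounded_linear f"
  using linearI[of f, OF assms] by (simp add: linear_conv_bounded_linear)

lemma bounded_linear_rot: "bounded_linear (rot c s \<sigma>)" "bounded_linear (rot' c s \<sigma>)"
proof -
  have a: "x = a \<Longrightarrow> y = b \<Longrightarrow> z = d \<Longrightarrow> vector [x, y, z] = (vector [a, b, d] :: real ^ 3)" for x y z a b d :: real
    by simp
  have v: "vector [x, y, z] + vector [a, b, d] = (vector [x + a, y + b, z + d] :: real ^ 3)"
    "r *\<^sub>R vector [x, y, z] = (vector [r * x, r * y, r * z] :: real ^ 3)" for x y z a b d r :: real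
    by (simp_all add: vec_eq_iff forall_3)
  show "bounded_linear (rot c s \<sigma>)"
    by (rule bounded_linear_vec3; unfold rot_def v vector_add_component vector_scaleR_component; rule a; simp add: algebra_simps)
  show "bounded_linear (rot' c s \<sigma>)"
    by (rule bounded_linear_vec3; unfold rot'_def v vector_add_component vector_scaleR_component; rule a; simp add: field_simps)
qed

lemma rot_inverse:
  assumes "c\<^sup>2 + s\<^sup>2 = 1" "\<sigma>\<^sup>2 = 1"
  shows "rot' c s \<sigma> (rot c s \<sigma> x) = x" "rot c s \<sigma> (rot' c s \<sigma> x) = x"
proof -
  have 1: "c * (c * a) + s * (s * a) = a" "\<sigma> * (\<sigma> * a) = a" for a
    using assms by (metis distrib_right mult.assoc mult_1 power2_eq_square)+
  have 2: "c * (c * a + s * b) - s * (\<sigma> * (\<sigma> * (c * b - s * a))) = a"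
    "s * (c * a + s * b) + c * (\<sigma> * (\<sigma> * (c * b - s * a))) = b" for a b
    using 1(1)[of a] 1(1)[of b] unfolding 1(2) by (simp_all add: algebra_simps)
  have h: "((a + b) - (a - b)) / 2 = b" "((a + b) + (a - b)) / 2 = a" for a b :: real by simp_all
  show "rot' c s \<sigma> (rot c s \<sigma> x) = x"
    unfolding vec_eq_iff forall_3 by (simp only: rot_def rot'_def vector_3 h 2 simp_thms)
  have 3: "c * (c * a - s * b) + s * (s * a + c * b) = a" "c * (s * a + c * b) - s * (c * a - s * b) = b" for a b
    using 1(1)[of a] 1(1)[of b] by (simp_all add: algebra_simps)
  show "rot c s \<sigma> (rot' c s \<sigma> x) = x"
    unfolding vec_eq_iff forall_3
    using 3[of "(x $ 1 - x $ 3) / 2" "\<sigma> * x $ 2"] 1(2)[of "x $ 2"] by (simp add: rot_def rot'_def field_simps)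
qed

text \<open>
  Holomorphic data on a conjugation invariant domain: the curve \<open>F\<close>, the factor \<open>lam\<close> of the field
  \<open>lam F'\<close> and its primitive \<open>H\<close>.
\<close>

locale bjorling_hol =
  fixes W :: "complex set" and F H :: "complex \<Rightarrow> complex ^ 3" and lam :: "complex \<Rightarrow> complex"
  assumes W: "open W" "cnj ` W = W"
    and F: "\<And>k. (\<lambda>z. F z $ k) holomorphic_on W"
    and H: "\<And>k z. z \<in> W \<Longrightarrow> ((\<lambda>z. H z $ k) has_field_derivative lam z * deriv (\<lambda>z. F z $ k) z) (at z)"
    and lam: "lam holomorphic_on W"
    and F_cnj: "\<And>k z. z \<in> W \<Longrightarrow> F (cnj z) $ k = cnj (F z $ k)"
    and H_cnj: "\<And>k z. z \<in> W \<Longrightarrow> H (cnj z) $ k = cnj (H z $ k)"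
    and null: "\<And>z. z \<in> W \<Longrightarrow> (deriv (\<lambda>z. F z $ 1) z)\<^sup>2 + (deriv (\<lambda>z. F z $ 2) z)\<^sup>2 = (deriv (\<lambda>z. F z $ 3) z)\<^sup>2"
begin

abbreviation "D k \<equiv> deriv (\<lambda>z. F z $ k)"

lemma D_hol: "D k holomorphic_on W"
  by (rule holomorphic_deriv[OF F W(1)])

lemma F_deriv: "z \<in> W \<Longrightarrow> ((\<lambda>z. F z $ k) has_field_derivative D k z) (at z)"
  by (rule holomorphic_derivI[OF F W(1)])

lemma D_deriv: "z \<in> W \<Longrightarrow> (D k has_field_derivative deriv (D k) z) (at z)"
  by (rule holomorphic_derivI[OF D_hol W(1)])

text \<open>After moving \<open>t0\<close> to 0 and passing to light-cone coordinates adapted to the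
  velocity at \<open>t0\<close>, the data form a \<open>null_germ\<close> with
  \<open>\<tau> 0 = 0\<close>. Nondegeneracy of the curve is exactly
  \<open>deriv \<tau> 0 \<noteq> 0\<close>, and the sign condition is met by the choice of
  \<open>\<sigma>\<close>. Both conclusions are then carried back through the affine change of the
  target.\<close>

lemma germ_classification:
  fixes X :: "real \<times> real \<Rightarrow> real ^ 3" and t0 l0 :: real and v w :: "real ^ 3"
  assumes \<kappa>: "\<kappa> = 1 \<or> \<kappa> = \<i>" and t0: "of_real t0 \<in> W"
    and v: "\<And>k. D k (of_real t0) = of_real (v $ k)" and w: "\<And>k. deriv (D k) (of_real t0) = of_real (w $ k)"
    and v3: "v $ 3 \<noteq> 0" and nondeg: "v $ 1 * w $ 2 - v $ 2 * w $ 1 \<noteq> 0"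
    and l0: "lam (of_real t0) = of_real l0" "Re (\<kappa>\<^sup>2) - l0\<^sup>2 \<noteq> 0"
    and X: "\<forall>\<^sub>F q in nhds 0. \<forall>k. of_real (X q $ k) =
      (F (of_real t0 + fst (emb q) + \<kappa> * snd (emb q)) $ k + F (of_real t0 + fst (emb q) - \<kappa> * snd (emb q)) $ k) / 2 +
      (H (of_real t0 + fst (emb q) + \<kappa> * snd (emb q)) $ k - H (of_real t0 + fst (emb q) - \<kappa> * snd (emb q)) $ k) / (2 * \<kappa>)"
  shows "l0 \<noteq> 0 \<Longrightarrow> \<exists>N. open N \<and> 0 \<in> N \<and> inj_on X N"
    and "l0 = 0 \<Longrightarrow> deriv lam (of_real t0) \<noteq> 0 \<Longrightarrow> cuspidal_crosscap_at X 0"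
proof -
  define T where "T = complex_of_real t0"
  have TW: "T \<in> W" using t0 by (simp add: T_def)
  define c where "c = v $ 1 / v $ 3"
  define s where "s = v $ 2 / v $ 3"
  define \<Delta> where "\<Delta> = (v $ 1 * w $ 2 - v $ 2 * w $ 1) / v $ 3 * (Re (\<kappa>\<^sup>2) - l0\<^sup>2)"
  \<comment> \<open>\<open>\<Delta>\<close> is the quantity that has to be positive up to the sign
    \<open>\<sigma>\<close>. Its sign depends on the sense in which the curve turns and on
    \<open>\<kappa>\<^sup>2 - l0\<^sup>2\<close>, which is negative for
    \<open>\<kappa> = \<i>\<close>; a reflection of the target corrects it.\<close>
  define \<sigma> where "\<sigma> = sgn \<Delta>"
  have \<Delta>: "\<Delta> \<noteq> 0" using v3 nondeg l0 by (simp add: \<Delta>_def)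
  have \<sigma>: "\<sigma>\<^sup>2 = 1" "\<sigma> * \<Delta> > 0" using \<Delta> by (simp_all add: \<sigma>_def sgn_if power2_eq_square)
  have "(of_real (v $ 1))\<^sup>2 + (of_real (v $ 2))\<^sup>2 = (complex_of_real (v $ 3))\<^sup>2"
    using null[OF t0] by (simp add: v)
  then have vnull: "(v $ 1)\<^sup>2 + (v $ 2)\<^sup>2 = (v $ 3)\<^sup>2"
    by (simp flip: of_real_power of_real_add)
  have cs: "c\<^sup>2 + s\<^sup>2 = 1"
    using vnull v3 by (simp add: c_def s_def power_divide add_divide_distrib[symmetric])
  \<comment> \<open>The complexification of \<open>rot c s \<sigma>\<close>, with components
    numbered from 0 so that the index is the exponent of \<open>\<tau>\<close>.\<close>
  define comb where "comb = (\<lambda>(k::nat) (x :: complex ^ 3).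
    if k = 0 then x $ 3 + (of_real c * x $ 1 + of_real s * x $ 2)
    else if k = 1 then of_real \<sigma> * (of_real c * x $ 2 - of_real s * x $ 1)
    else x $ 3 - (of_real c * x $ 1 + of_real s * x $ 2))"
  define A where "A = (\<lambda>k z. comb k (F (T + z)))"
  define B where "B = (\<lambda>k z. comb k (H (T + z)))"
  define dA where "dA = (\<lambda>k z. comb k (\<chi> j. D j (T + z)))"
  define \<rho> where "\<rho> = dA 0"
  define \<tau> where "\<tau> = (\<lambda>z. dA 1 z / dA 0 z)"
  define lam0 where "lam0 = (\<lambda>z. lam (T + z))"
  have Tcnj: "cnj T = T" by (simp add: T_def)
  have isT: "isCont (\<lambda>z. T + z) 0" by (intro continuous_intros)
  have nearW: "\<forall>\<^sub>F z in nhds 0. T + z \<in> W"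
    by (rule isCont_eventually[OF isT]) (use W(1) TW in \<open>simp add: eventually_nhds_in_open\<close>)
  have chain: "((\<lambda>z. g (T + z)) has_field_derivative g') (at z)" if "(g has_field_derivative g') (at (T + z))" for g g' z
    using that DERIV_shift[of g g' z T] by (simp add: add.commute)
  have dAk: "(A k has_field_derivative dA k z) (at z)" if "T + z \<in> W" for k z
  proof -
    have d: "((\<lambda>z. F (T + z) $ j) has_field_derivative D j (T + z)) (at z)" for j
      by (rule chain[OF F_deriv[OF that]])
    show ?thesis unfolding A_def dA_def comb_def
      by (cases "k = 0"; cases "k = 1"; simp; intro DERIV_add DERIV_diff DERIV_cmult d)
  qed
  have dBk: "(B k has_field_derivative lam0 z * dA k z) (at z)" if "T + z \<in> W" for k z
  proof -
    have d: "((\<lambda>z. H (T + z) $ j) has_field_derivative lam (T + z) * D j (T + z)) (at z)" for j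
      by (rule chain[OF H[OF that]])
    have "(B k has_field_derivative comb k (\<chi> j. lam (T + z) * D j (T + z))) (at z)"
      unfolding B_def comb_def
      by (cases "k = 0"; cases "k = 1"; simp; intro DERIV_add DERIV_diff DERIV_cmult d)
    then show ?thesis by (rule DERIV_cong) (simp add: comb_def dA_def lam0_def algebra_simps)
  qed
  have ddA: "(dA k has_field_derivative comb k (\<chi> j. deriv (D j) (T + z))) (at z)" if "T + z \<in> W" for k z
  proof -
    have d: "((\<lambda>z. D j (T + z)) has_field_derivative deriv (D j) (T + z)) (at z)" for j
      by (rule chain[OF D_deriv[OF that]])
    show ?thesis unfolding dA_def comb_def
      by (cases "k = 0"; cases "k = 1"; simp; intro DERIV_add DERIV_diff DERIV_cmult d)
  qed
  have comb_cnj: "comb k (\<chi> j. cnj (x $ j)) = cnj (comb k x)" for k x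
    by (simp add: comb_def)
  have A_cnj: "A k (cnj z) = cnj (A k z)" and B_cnj: "B k (cnj z) = cnj (B k z)" if "T + z \<in> W" for k z
  proof -
    have "T + cnj z = cnj (T + z)" by (simp add: Tcnj)
    then show "A k (cnj z) = cnj (A k z)" "B k (cnj z) = cnj (B k z)"
      unfolding A_def B_def using F_cnj[OF that] H_cnj[OF that] comb_cnj[of k, symmetric] by (simp_all add: comb_def)
  qed
  have vals: "dA 0 0 = of_real (2 * v $ 3)" "dA 1 0 = 0"
  proof -
    have "c * v $ 1 + s * v $ 2 = v $ 3"
      using vnull v3 by (simp add: c_def s_def field_simps power2_eq_square)
    then have "complex_of_real c * of_real (v $ 1) + of_real s * of_real (v $ 2) = of_real (v $ 3)"
      by (simp flip: of_real_mult of_real_add)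
    then show "dA 0 0 = of_real (2 * v $ 3)" using v by (simp add: dA_def comb_def T_def)
    have "c * v $ 2 - s * v $ 1 = 0" by (simp add: c_def s_def)
    then have "complex_of_real c * of_real (v $ 2) - of_real s * of_real (v $ 1) = 0"
      by (simp flip: of_real_mult of_real_diff)
    then show "dA 1 0 = 0" using v by (simp add: dA_def comb_def T_def)
  qed
  have \<rho>0: "\<rho> 0 \<noteq> 0" using v3 vals by (simp add: \<rho>_def)
  have near\<rho>: "\<forall>\<^sub>F z in nhds 0. dA 0 z \<noteq> 0"
  proof (rule isCont_eventually[where P = "\<lambda>x. x \<noteq> 0"])
    show "isCont (dA 0) 0" using DERIV_isCont[OF ddA[of 0 0]] TW by simp
  qed (use \<rho>0 in \<open>auto intro!: t1_space_nhds simp: \<rho>_def\<close>)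
  \<comment> \<open>Nullity in light-cone coordinates; it makes the velocity \<open>\<rho>\<close>
    times the powers of \<open>\<tau>\<close>.\<close>
  have cone: "dA 0 z * dA 2 z = (dA 1 z)\<^sup>2" if "T + z \<in> W" for z
  proof -
    have e: "(complex_of_real c)\<^sup>2 + (of_real s)\<^sup>2 = 1" "(complex_of_real \<sigma>)\<^sup>2 = 1"
      using cs \<sigma>(1) by (simp_all flip: of_real_power of_real_add)
    have "(a3 + (cc * a1 + ss * a2)) * (a3 - (cc * a1 + ss * a2)) = (sg * (cc * a2 - ss * a1))\<^sup>2"
      if "a1\<^sup>2 + a2\<^sup>2 = a3\<^sup>2" "cc\<^sup>2 + ss\<^sup>2 = 1" "sg\<^sup>2 = 1" for a1 a2 a3 cc ss sg :: complex
      using that by algebra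
    from this[OF null[OF that] e] show ?thesis by (simp add: dA_def comb_def)
  qed
  have pw: "dA k z = \<rho> z * \<tau> z ^ k" if "T + z \<in> W" "dA 0 z \<noteq> 0" "k < 3" for k z
  proof -
    have "k = 0 \<or> k = 1 \<or> k = 2" using that(3) by auto
    then show ?thesis
      using cone[OF that(1)] that(2) by (auto simp: \<rho>_def \<tau>_def field_simps power2_eq_square)
  qed
  \<comment> \<open>Half of the base point is subtracted from each half of the surface, so that the
    germ starts at the origin.\<close>
  define C where "C = (\<lambda>k. A k 0 / 2)"
  define P where "P = (\<lambda>k z. (A k z + B k z / \<kappa>) / 2 - C k)"
  define Q where "Q = (\<lambda>k z. (A k z - B k z / \<kappa>) / 2 - C k)"
  have \<kappa>0: "\<kappa> \<noteq> 0" using \<kappa> by auto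
  have dtau: "(\<tau> has_field_derivative (comb 1 (\<chi> j. deriv (D j) T)) / dA 0 0) (at 0)"
  proof -
    have "dA 0 0 \<noteq> 0" using \<rho>0 by (simp add: \<rho>_def)
    from DERIV_divide[OF ddA[of 0 1] ddA[of 0 0] this] TW
    have "(\<tau> has_field_derivative (comb 1 (\<chi> j. deriv (D j) T) * dA 0 0 - dA 1 0 * comb 0 (\<chi> j. deriv (D j) T)) /
       (dA 0 0 * dA 0 0)) (at 0)"
      by (simp only: \<tau>_def add_0_right)
    then show ?thesis
      by (rule DERIV_cong) (simp only: vals(2) mult_zero_left diff_zero mult_divide_mult_cancel_right \<open>dA 0 0 \<noteq> 0\<close>, simp add: \<open>dA 0 0 \<noteq> 0\<close>)
  qed
  have "comb 1 (\<chi> j. deriv (D j) T) = of_real (\<sigma> * ((v $ 1 * w $ 2 - v $ 2 * w $ 1) / v $ 3))"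
    using w v3 by (simp add: comb_def T_def c_def s_def field_simps)
  \<comment> \<open>As \<open>dA 1\<close> vanishes at 0, the product is the derivative of
    \<open>dA 1\<close> there; up to sign it is the minor from the nondegeneracy condition divided
    by the time component.\<close>
  then have d\<tau>: "deriv \<tau> 0 * \<rho> 0 = of_real (\<sigma> * ((v $ 1 * w $ 2 - v $ 2 * w $ 1) / v $ 3))"
    using \<rho>0 DERIV_imp_deriv[OF dtau] by (simp add: \<rho>_def)
  have ng: "null_germ \<kappa> P Q \<rho> \<tau> lam0"
  proof
    show "\<kappa> \<noteq> 0" by (rule \<kappa>0)
    show "\<forall>\<^sub>F z in nhds 0. \<forall>k<3. (P k has_field_derivative (1 + lam0 z / \<kappa>) / 2 * \<rho> z * \<tau> z ^ k) (at z)"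
      using nearW near\<rho>
    proof eventually_elim
      case (elim z)
      have "(P k has_field_derivative (dA k z + lam0 z * dA k z / \<kappa>) / 2 - 0) (at z)" for k
        unfolding P_def by (intro DERIV_diff DERIV_cdivide DERIV_add dAk dBk elim DERIV_const)
      note d = this
      show ?case
        by (intro allI impI, rule DERIV_cong[OF d]) (simp add: pw[OF elim] add_divide_distrib diff_divide_distrib algebra_simps)
    qed
    show "\<forall>\<^sub>F z in nhds 0. \<forall>k<3. (Q k has_field_derivative (1 - lam0 z / \<kappa>) / 2 * \<rho> z * \<tau> z ^ k) (at z)"
      using nearW near\<rho>
    proof eventually_elim
      case (elim z)
      have "(Q k has_field_derivative (dA k z - lam0 z * dA k z / \<kappa>) / 2 - 0) (at z)" for k
        unfolding Q_def by (intro DERIV_diff DERIV_cdivide DERIV_add dAk dBk elim DERIV_const)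
      note d = this
      show ?case
        by (intro allI impI, rule DERIV_cong[OF d]) (simp add: pw[OF elim] add_divide_distrib diff_divide_distrib algebra_simps)
    qed
    show "\<forall>\<^sub>F z in nhds 0. \<rho> field_differentiable at z \<and> \<tau> field_differentiable at z \<and> lam0 field_differentiable at z"
      using nearW near\<rho>
    proof eventually_elim
      case (elim z)
      have "\<rho> field_differentiable at z" unfolding \<rho>_def field_differentiable_def using ddA[OF elim(1)] by blast
      moreover have "\<tau> field_differentiable at z"
        unfolding \<tau>_def field_differentiable_def using DERIV_divide[OF ddA[OF elim(1)] ddA[OF elim(1)] elim(2)] by blast
      moreover have "lam0 field_differentiable at z"
        unfolding lam0_def field_differentiable_def using chain[OF holomorphic_derivI[OF lam W(1) elim(1)]] by blast
      ultimately show ?case by simp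
    qed
    show "\<rho> 0 \<noteq> 0" by (rule \<rho>0)
    have nz: "deriv \<tau> 0 * \<rho> 0 \<noteq> 0" unfolding d\<tau> of_real_eq_0_iff using nondeg v3 \<sigma> by auto
    then show "deriv \<tau> 0 \<noteq> 0" by auto
    have "\<kappa>\<^sup>2 - (lam0 0)\<^sup>2 = of_real (Re (\<kappa>\<^sup>2) - l0\<^sup>2)"
      using \<kappa> l0(1) by (auto simp: lam0_def T_def)
    then have "deriv \<tau> 0 * \<rho> 0 * (\<kappa>\<^sup>2 - (lam0 0)\<^sup>2) = of_real (\<sigma> * \<Delta>)"
      unfolding d\<tau> by (simp add: \<Delta>_def mult.assoc)
    then show "0 < Re (deriv \<tau> 0 * \<rho> 0 * (\<kappa>\<^sup>2 - (lam0 0)\<^sup>2))" using \<sigma>(2) by simp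
    show "rgerm (\<lambda>p. P k (fst p + \<kappa> * snd p) + Q k (fst p - \<kappa> * snd p))" if "k < 3" for k
      unfolding P_def Q_def
    proof (rule rgerm_null_surface[OF \<kappa>])
      show "\<forall>\<^sub>F z in nhds 0. A k field_differentiable at z \<and> A k (cnj z) = cnj (A k z)"
        using nearW by eventually_elim (use dAk A_cnj in \<open>auto simp: field_differentiable_def\<close>)
      show "\<forall>\<^sub>F z in nhds 0. B k field_differentiable at z \<and> B k (cnj z) = cnj (B k z)"
        using nearW by eventually_elim (use dBk B_cnj in \<open>auto simp: field_differentiable_def\<close>)
      show "cnj (C k) = C k" using A_cnj[of 0 k] TW by (simp add: C_def)
    qed
    show "P k 0 + Q k 0 = 0" for k by (simp add: P_def Q_def C_def field_simps)
  qed
  interpret ng: null_germ \<kappa> P Q \<rho> \<tau> lam0 by (rule ng)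
  define X0 where "X0 = (\<chi> k. Re (F T $ k))"
  \<comment> \<open>The real surface in adapted coordinates, shifted to the origin; the normal form
    is applied to it and not to \<open>X\<close> itself.\<close>
  define Y where "Y = (\<lambda>q. - rot c s \<sigma> X0 + rot c s \<sigma> (X q))"
  have FT: "of_real (Re (F T $ k)) = F T $ k" for k
    using F_cnj[OF TW, of k] by (simp add: Tcnj complex_eq_iff)
  have Yf: "\<forall>\<^sub>F q in nhds 0. Y q $ 1 = Re (ng.f 0 (emb q)) \<and> Y q $ 2 = Re (ng.f 1 (emb q)) \<and> Y q $ 3 = Re (ng.f 2 (emb q))"
    using X
  proof eventually_elim
    case (elim q)
    let ?x = "fst (emb q) + \<kappa> * snd (emb q)" and ?y = "fst (emb q) - \<kappa> * snd (emb q)"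
    have Xk: "complex_of_real (X q $ k) = (F (T + ?x) $ k + F (T + ?y) $ k) / 2 + (H (T + ?x) $ k - H (T + ?y) $ k) / (2 * \<kappa>)" for k
      using elim[rule_format, of k] by (simp add: T_def algebra_simps)
    have f: "ng.f k (emb q) = comb k (\<chi> j. of_real (X q $ j)) - comb k (\<chi> j. of_real (X0 $ j))" for k
    proof -
      have lin: "comb k (\<chi> j. (a $ j + b $ j) / 2 + (c' $ j - d $ j) / (2 * \<kappa>)) =
          (comb k a + comb k b) / 2 + (comb k c' - comb k d) / (2 * \<kappa>)" for a b c' d
        unfolding comb_def by (simp add: add_divide_distrib diff_divide_distrib algebra_simps)
      have ar: "(a + c' / \<kappa>) / 2 - e / 2 + ((b - d / \<kappa>) / 2 - e / 2) = (a + b) / 2 + (c' - d) / (2 * \<kappa>) - e"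
        for a b c' d e by (simp add: add_divide_distrib diff_divide_distrib mult.commute)
      have "ng.f k (emb q) = P k ?x + Q k ?y" by (simp only: ng.f_def)
      also have "\<dots> = (A k ?x + A k ?y) / 2 + (B k ?x - B k ?y) / (2 * \<kappa>) - A k 0"
        unfolding P_def Q_def C_def by (rule ar)
      also have "\<dots> = comb k (\<chi> j. of_real (X q $ j)) - comb k (F T)"
        unfolding Xk lin A_def B_def by simp
      also have "comb k (F T) = comb k (\<chi> j. of_real (X0 $ j))"
        by (simp add: X0_def FT)
      finally show ?thesis .
    qed
    show ?case
      unfolding f by (simp add: Y_def rot_def comb_def)
  qed
  have lam00: "lam0 0 = of_real l0" using l0 by (simp add: lam0_def T_def)
  show "\<exists>N. open N \<and> 0 \<in> N \<and> inj_on X N" if "l0 \<noteq> 0"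
  proof -
    have "lam0 0 \<noteq> 0" using that lam00 by simp
    then obtain N where N: "open N" "0 \<in> N" "inj_on Y N"
      by (rule ng.surface_germ_locally_injective[OF Yf])
    have "inj_on X N" using N(3) by (auto simp: inj_on_def Y_def)
    then show ?thesis using N by blast
  qed
  show "cuspidal_crosscap_at X 0" if "l0 = 0" "deriv lam (of_real t0) \<noteq> 0"
  proof -
    have "(lam0 has_field_derivative deriv lam T) (at 0)"
      unfolding lam0_def by (rule chain) (use holomorphic_derivI[OF lam W(1) TW] in simp)
    then have "deriv lam0 0 = deriv lam T" by (rule DERIV_imp_deriv)
    then have "deriv lam0 0 \<noteq> 0" "lam0 0 = 0" using that lam00 by (simp_all add: T_def)
    then have "cuspidal_crosscap_at Y 0" by (intro ng.surface_germ_crosscap[OF Yf])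
    then have "cuspidal_crosscap_at (\<lambda>q. - rot c s \<sigma> X0 + rot c s \<sigma> (X q)) 0" by (simp only: Y_def)
    then show ?thesis
      by (rule cuspidal_crosscap_postcomp[OF bounded_linear_rot(1)[of c s \<sigma>] bounded_linear_rot(2)[of c s \<sigma>]
            rot_inverse(1)[OF cs \<sigma>(1)] rot_inverse(2)[OF cs \<sigma>(1)]])
  qed
qed

end

section \<open>Real analytic curves\<close>

text \<open>Real analyticity in terms of local holomorphic extensions, for which derivatives and
  products with entire factors need no manipulation of power series.\<close>

definition locally_hol :: "(real \<Rightarrow> real ^ 3) \<Rightarrow> real set \<Rightarrow> bool" where
  "locally_hol f J \<longleftrightarrow> (\<forall>t\<in>J. \<exists>r>0. \<exists>G :: 3 \<Rightarrow> complex \<Rightarrow> complex.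
     (\<forall>k. G k holomorphic_on ball (of_real t) r) \<and>
     (\<forall>s. \<bar>s - t\<bar> < r \<longrightarrow> s \<in> J \<and> (\<forall>k. G k (of_real s) = of_real (f s $ k))))"

lemma locally_holE:
  fixes f :: "real \<Rightarrow> real ^ 3"
  assumes "locally_hol f J" "t \<in> J"
  obtains r G where "r > 0" "\<And>k. G k holomorphic_on ball (of_real t) r"
    "\<And>s. \<bar>s - t\<bar> < r \<Longrightarrow> s \<in> J" "\<And>s k. \<bar>s - t\<bar> < r \<Longrightarrow> G k (of_real s) = of_real (f s $ k)"
  using bspec[OF assms(1)[unfolded locally_hol_def] assms(2)] by metis

lemma real_analytic_imp_locally_hol:
  fixes f :: "real \<Rightarrow> real ^ 3"
  assumes "open J" "real_analytic_on f J"
  shows "locally_hol f J"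
  unfolding locally_hol_def
proof
  fix t assume t: "t \<in> J"
  obtain r c where r: "r > 0" and c: "\<And>s. s \<in> J \<Longrightarrow> \<bar>s - t\<bar> < r \<Longrightarrow> (\<lambda>n. (s - t) ^ n *\<^sub>R c n) sums f s"
    using bspec[OF assms(2)[unfolded real_analytic_on_def] t] by metis
  obtain d where d: "d > 0" "ball t d \<subseteq> J" using assms(1) t by (meson open_contains_ball)
  define R where "R = min r d"
  have R: "R > 0" using r d by (simp add: R_def)
  have inJ: "s \<in> J" if "\<bar>s - t\<bar> < R" for s
    using d(2) that by (auto simp: R_def dist_real_def abs_minus_commute subset_eq)
  have ck: "(\<lambda>n. c n $ k * (s - t) ^ n) sums (f s $ k)" if "\<bar>s - t\<bar> < R" for s k
  proof -
    have "(\<lambda>n. (s - t) ^ n *\<^sub>R c n) sums f s" using c inJ[OF that] that by (simp add: R_def)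
    from sums_vec_nth[OF this, of k] show ?thesis by (simp add: mult.commute)
  qed
  define G where "G = (\<lambda>k z. \<Sum>n. complex_of_real (c n $ k) * (z - of_real t) ^ n)"
  have hol: "G k holomorphic_on ball (of_real t) R" for k
  proof (rule power_series_holomorphic)
    fix w :: complex assume w: "w \<in> ball (of_real t) R"
    then obtain \<rho> where \<rho>: "cmod (w - of_real t) < \<rho>" "\<rho> < R"
      using dense by (metis dist_commute dist_norm mem_ball)
    have p: "\<rho> > 0" using \<rho>(1) norm_ge_zero[of "w - of_real t"] by linarith
    \<comment> \<open>Convergence is known at real points only; convergence at
      \<open>t + \<rho>\<close> with \<open>\<rho>\<close> larger than the distance of
      \<open>w\<close> from \<open>t\<close> gives it at the complex point \<open>w\<close>.\<close>
    have "summable (\<lambda>n. c n $ k * ((t + \<rho>) - t) ^ n)"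
      using ck[of "t + \<rho>" k] \<rho> p by (intro sums_summable) auto
    then have "summable (\<lambda>n. complex_of_real (c n $ k * \<rho> ^ n))"
      by (subst summable_complex_of_real) simp
    then have "summable (\<lambda>n. complex_of_real (c n $ k) * (of_real \<rho>) ^ n)" by simp
    then have "summable (\<lambda>n. complex_of_real (c n $ k) * (w - of_real t) ^ n)"
      by (rule powser_inside) (use \<rho> p in simp)
    then show "(\<lambda>n. complex_of_real (c n $ k) * (w - of_real t) ^ n) sums G k w"
      unfolding G_def by (rule summable_sums)
  qed
  have val: "G k (of_real s) = of_real (f s $ k)" if "\<bar>s - t\<bar> < R" for s k
  proof -
    have "(\<lambda>n. complex_of_real (c n $ k * (s - t) ^ n)) sums of_real (f s $ k)"
      using ck[OF that] by (simp only: sums_of_real_iff)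
    then show ?thesis unfolding G_def by (simp add: sums_iff)
  qed
  show "\<exists>r>0. \<exists>G :: 3 \<Rightarrow> complex \<Rightarrow> complex. (\<forall>k. G k holomorphic_on ball (of_real t) r) \<and>
     (\<forall>s. \<bar>s - t\<bar> < r \<longrightarrow> s \<in> J \<and> (\<forall>k. G k (of_real s) = of_real (f s $ k)))"
    using R hol inJ val by (intro exI[of _ R] conjI exI[of _ G]) auto
qed

lemma locally_hol_imp_real_analytic:
  fixes f :: "real \<Rightarrow> real ^ 3"
  assumes "locally_hol f J"
  shows "real_analytic_on f J"
  unfolding real_analytic_on_def
proof
  fix t assume "t \<in> J"
  then obtain r G where r: "r > 0" and G: "\<And>k. G k holomorphic_on ball (of_real t) r"
    and val: "\<And>s k. \<bar>s - t\<bar> < r \<Longrightarrow> G k (of_real s) = of_real (f s $ k)"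
    using locally_holE[OF assms] by metis
  \<comment> \<open>Passing to real parts of the Taylor coefficients costs nothing, since the powers
    \<open>(s - t) ^ n\<close> and the values at real points are real.\<close>
  define c where "c = (\<lambda>n. \<chi> k. Re ((deriv ^^ n) (G k) (of_real t) / fact n))"
  have "(\<lambda>n. (s - t) ^ n *\<^sub>R c n) sums f s" if s: "\<bar>s - t\<bar> < r" for s
    unfolding sums_def
  proof (rule vec_tendstoI)
    fix k
    have sb: "complex_of_real s \<in> ball (of_real t) r"
      using s by (simp add: dist_norm norm_minus_commute flip: of_real_diff)
    have "(\<lambda>n. Re ((deriv ^^ n) (G k) (of_real t) / fact n * (of_real s - of_real t) ^ n)) sums Re (G k (of_real s))"
      by (rule sums_Re[OF holomorphic_power_series[OF G sb]])
    moreover have "Re (x * (complex_of_real s - of_real t) ^ n) = Re x * (s - t) ^ n" for x n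
      by (simp flip: of_real_diff of_real_power)
    ultimately have "(\<lambda>n. Re ((deriv ^^ n) (G k) (of_real t) / fact n) * (s - t) ^ n) sums (f s $ k)"
      by (simp only: val[OF s] Re_complex_of_real)
    then show "(\<lambda>n. (\<Sum>i<n. (s - t) ^ i *\<^sub>R c i) $ k) \<longlonglongrightarrow> f s $ k"
      by (simp add: sums_def c_def mult.commute)
  qed
  then show "\<exists>r>0. \<exists>c. \<forall>s\<in>J. \<bar>s - t\<bar> < r \<longrightarrow> (\<lambda>n. (s - t) ^ n *\<^sub>R c n) sums f s"
    using r by blast
qed

lemma DERIV_real_on_reals:
  assumes "(g has_field_derivative D) (at (of_real s))" "\<forall>\<^sub>F x in nhds s. g (of_real x) = of_real (h x)"
  shows "(h has_real_derivative Re D) (at s)" "Im D = 0"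
proof -
  have "((\<lambda>x. g (of_real x)) has_vector_derivative D) (at s)"
    by (rule has_vector_derivative_real_field[OF assms(1)])
  moreover obtain S where "open S" "s \<in> S" "\<And>x. x \<in> S \<Longrightarrow> g (of_real x) = of_real (h x)"
    using assms(2) unfolding eventually_nhds by blast
  ultimately have d: "((\<lambda>x. complex_of_real (h x)) has_vector_derivative D) (at s)"
    by (rule has_vector_derivative_transform_within_open)
  from bounded_linear.has_vector_derivative[OF bounded_linear_Re d]
  show "(h has_real_derivative Re D) (at s)"
    by (simp add: has_real_derivative_iff_has_vector_derivative)
  from bounded_linear.has_vector_derivative[OF bounded_linear_Im d]
  have "((\<lambda>x. 0) has_vector_derivative Im D) (at s)" by simp
  from vector_derivative_unique_at[OF this has_vector_derivative_const] show "Im D = 0" .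
qed

lemma has_vector_derivative_vec3I:
  fixes f :: "real \<Rightarrow> real ^ 3"
  assumes "\<And>k. ((\<lambda>x. f x $ k) has_real_derivative D $ k) (at s)"
  shows "(f has_vector_derivative D) (at s)"
  unfolding has_vector_derivative_def
proof (subst has_derivative_componentwise_within, rule ballI)
  fix b :: "real ^ 3" assume "b \<in> Basis"
  then obtain i where "b = axis i 1" by (auto simp: Basis_vec_def)
  then show "((\<lambda>x. f x \<bullet> b) has_derivative (\<lambda>x. (x *\<^sub>R D) \<bullet> b)) (at s)"
    using assms[of i] by (simp add: inner_axis has_field_derivative_def mult_commute_abs)
qed

lemma eventually_abs_less: "\<bar>s - t\<bar> < r \<Longrightarrow> \<forall>\<^sub>F x in nhds s. \<bar>x - t\<bar> < (r :: real)"
  using eventually_nhds_in_open[of "ball t r" s] by (simp add: dist_real_def abs_minus_commute)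

lemma hol_ext_velocity:
  fixes f :: "real \<Rightarrow> real ^ 3"
  assumes G: "\<And>k. G k holomorphic_on S" "open S" "of_real s \<in> S"
    and val: "\<forall>\<^sub>F x in nhds s. \<forall>k. G k (of_real x) = of_real (f x $ k)"
  shows "(f has_vector_derivative velocity f s) (at s)"
    "deriv (G k) (of_real s) = of_real (velocity f s $ k)"
proof -
  have D: "(G k has_field_derivative deriv (G k) (of_real s)) (at (of_real s))" for k
    by (rule holomorphic_derivI[OF G(1,2,3)])
  have v: "\<forall>\<^sub>F x in nhds s. G k (of_real x) = of_real (f x $ k)" for k
    using val by eventually_elim blast
  have "(f has_vector_derivative (\<chi> k. Re (deriv (G k) (of_real s)))) (at s)"
    by (rule has_vector_derivative_vec3I) (use DERIV_real_on_reals(1)[OF D v] in simp)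
  moreover from this have vel: "velocity f s = (\<chi> k. Re (deriv (G k) (of_real s)))"
    by (rule vector_derivative_at)
  ultimately show "(f has_vector_derivative velocity f s) (at s)" by simp
  show "deriv (G k) (of_real s) = of_real (velocity f s $ k)"
    using DERIV_real_on_reals(2)[OF D v] by (simp add: vel complex_eq_iff)
qed

lemma locally_hol_velocity:
  fixes f :: "real \<Rightarrow> real ^ 3"
  assumes "locally_hol f J"
  shows "t \<in> J \<Longrightarrow> (f has_vector_derivative velocity f t) (at t)" "locally_hol (velocity f) J"
proof -
  have *: "(f has_vector_derivative velocity f s) (at s) \<and> deriv (G k) (of_real s) = of_real (velocity f s $ k)"
    if G: "\<And>k. G k holomorphic_on ball (of_real t) r"
      and val: "\<And>s k. \<bar>s - t\<bar> < r \<Longrightarrow> G k (of_real s) = of_real (f s $ k)" and s: "\<bar>s - t\<bar> < r"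
    for G t r s k
  proof -
    have "complex_of_real s \<in> ball (of_real t) r"
      using s by (simp add: dist_norm norm_minus_commute flip: of_real_diff)
    moreover have "\<forall>\<^sub>F x in nhds s. \<forall>k. G k (of_real x) = of_real (f x $ k)"
      using eventually_abs_less[OF s] by eventually_elim (use val in blast)
    ultimately show ?thesis using hol_ext_velocity(1)[where G = G and f = f and s = s, OF G open_ball]
        hol_ext_velocity(2)[where G = G and f = f and s = s and k = k, OF G open_ball] by simp
  qed
  show "(f has_vector_derivative velocity f t) (at t)" if "t \<in> J"
  proof -
    obtain r G where "r > 0" "\<And>k. G k holomorphic_on ball (of_real t) r"
      "\<And>s k. \<bar>s - t\<bar> < r \<Longrightarrow> G k (of_real s) = of_real (f s $ k)"
      using locally_holE[OF assms \<open>t \<in> J\<close>] by metis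
    then show ?thesis using *[of G t r t] by simp
  qed
  show "locally_hol (velocity f) J"
    unfolding locally_hol_def
  proof
    fix t assume "t \<in> J"
    then obtain r G where r: "r > 0" and G: "\<And>k. G k holomorphic_on ball (of_real t) r"
      and J: "\<And>s. \<bar>s - t\<bar> < r \<Longrightarrow> s \<in> J"
      and val: "\<And>s k. \<bar>s - t\<bar> < r \<Longrightarrow> G k (of_real s) = of_real (f s $ k)"
      using locally_holE[OF assms] by metis
    then show "\<exists>r>0. \<exists>G :: 3 \<Rightarrow> complex \<Rightarrow> complex. (\<forall>k. G k holomorphic_on ball (of_real t) r) \<and>
       (\<forall>s. \<bar>s - t\<bar> < r \<longrightarrow> s \<in> J \<and> (\<forall>k. G k (of_real s) = of_real (velocity f s $ k)))"
      using *[OF G val] by (intro exI[of _ r] conjI exI[of _ "\<lambda>k. deriv (G k)"]) (auto intro: holomorphic_deriv)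
  qed
qed

lemma locally_hol_scaleR:
  fixes f :: "real \<Rightarrow> real ^ 3"
  assumes f: "locally_hol f J" and P: "P holomorphic_on UNIV" "\<And>t. P (of_real t) = of_real (p t)"
  shows "locally_hol (\<lambda>t. p t *\<^sub>R f t) J"
  unfolding locally_hol_def
proof
  fix t assume "t \<in> J"
  then obtain r G where r: "r > 0" and G: "\<And>k. G k holomorphic_on ball (of_real t) r"
    and J: "\<And>s. \<bar>s - t\<bar> < r \<Longrightarrow> s \<in> J"
    and val: "\<And>s k. \<bar>s - t\<bar> < r \<Longrightarrow> G k (of_real s) = of_real (f s $ k)"
    using locally_holE[OF f] by metis
  have "(\<lambda>z. P z * G k z) holomorphic_on ball (of_real t) r" for k
    by (intro holomorphic_on_mult G holomorphic_on_subset[OF P(1)]) simp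
  then show "\<exists>r>0. \<exists>G :: 3 \<Rightarrow> complex \<Rightarrow> complex. (\<forall>k. G k holomorphic_on ball (of_real t) r) \<and>
     (\<forall>s. \<bar>s - t\<bar> < r \<longrightarrow> s \<in> J \<and> (\<forall>k. G k (of_real s) = of_real ((p s *\<^sub>R f s) $ k)))"
    using r J val P(2) by (intro exI[of _ r] conjI exI[of _ "\<lambda>k z. P z * G k z"]) auto
qed

text \<open>A local extension is viewed as a function of two complex variables that ignores the
  second one, so smoothness follows from the case already treated.\<close>

lemma smooth_on_locally_hol:
  fixes f :: "real \<Rightarrow> real ^ 3"
  assumes f: "locally_hol f J" and J: "open J"
  shows "smooth_on f J"
proof (rule smooth_on_componentwise[OF J])
  fix b :: "real ^ 3" assume "b \<in> Basis"
  then obtain i where b: "b = axis i 1" by (auto simp: Basis_vec_def)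
  show "smooth_on (\<lambda>x. f x \<bullet> b) J"
  proof (rule smooth_on_local[OF _ J])
    fix t assume "t \<in> J"
    then obtain r G where r: "r > 0" and G: "\<And>k. G k holomorphic_on ball (of_real t) r"
      and val: "\<And>s k. \<bar>s - t\<bar> < r \<Longrightarrow> G k (of_real s) = of_real (f s $ k)"
      using locally_holE[OF f] by metis
    have h: "hol2_on (\<lambda>p. G i (fst p)) (ball (of_real t) r \<times> UNIV)"
      unfolding hol2_on_def
    proof (intro conjI ballI)
      show "open (ball (complex_of_real t) r \<times> (UNIV :: complex set))" by (intro open_Times) auto
      fix p assume "p \<in> ball (complex_of_real t) r \<times> (UNIV :: complex set)"
      then have "(G i has_field_derivative deriv (G i) (fst p)) (at (fst p))"
        by (intro holomorphic_derivI[OF G]) auto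
      then show "cdiff2 (\<lambda>p. G i (fst p)) p" by (rule cdiff2_compose1) simp
    qed
    have l: "bounded_linear (\<lambda>s :: real. (complex_of_real s, 0 :: complex))"
      by (intro bounded_linear_Pair bounded_linear_of_real bounded_linear_zero)
    have "smooth_on (\<lambda>s. Re (G i (fst (0 + (complex_of_real s, 0 :: complex))))) (ball t r)"
      by (rule smooth_on_hol2[OF open_ball l _ h]) (simp add: dist_norm flip: of_real_diff)
    moreover have "Re (G i (fst (0 + (complex_of_real s, 0 :: complex)))) = f s \<bullet> b" if "s \<in> ball t r" for s
      using val[of s i] that by (simp add: b inner_axis dist_real_def abs_minus_commute)
    ultimately have "smooth_on (\<lambda>x. f x \<bullet> b) (ball t r)"
      using smooth_on_cong[of "ball t r" "\<lambda>s. Re (G i (fst (0 + (complex_of_real s, 0 :: complex))))" "\<lambda>x. f x \<bullet> b"]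
      by simp
    then show "\<exists>T. t \<in> T \<and> smooth_on (\<lambda>x. f x \<bullet> b) T" using r by (intro exI[of _ "ball t r"]) simp
  qed
qed

lemma smooth_on_primitive:
  fixes f :: "real \<Rightarrow> 'a::euclidean_space"
  assumes d: "\<And>x. x \<in> S \<Longrightarrow> (f has_vector_derivative f' x) (at x)" and f': "smooth_on f' S"
  shows "smooth_on f S"
proof -
  have S: "open S" using f' by (simp add: smooth_on_def)
  have "Ck_on (Suc n) f S" for n
  proof (rule Ck_on_derivative[OF S])
    show "(f has_derivative (\<lambda>v. v *\<^sub>R f' x)) (at x)" if "x \<in> S" for x
      using d[OF that] by (simp add: has_vector_derivative_def)
    show "Ck_on n (\<lambda>x. v *\<^sub>R f' x) S" for v
      using f' by (intro Ck_on_bounded_linear_comp[OF S bounded_linear_scaleR_right]) (simp add: smooth_on_def)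
  qed
  moreover have "Ck_on 0 f S"
    unfolding Ck_on.simps
    by (rule continuous_at_imp_continuous_on) (use has_vector_derivative_continuous[OF d] in simp)
  ultimately show ?thesis unfolding smooth_on_def using S not0_implies_Suc by metis
qed

section \<open>Minfaces\<close>

lemma has_derivative_null_sum:
  assumes "(\<alpha> has_vector_derivative a) (at (fst q + snd q))" "(\<beta> has_vector_derivative b) (at (fst q - snd q))"
  shows "((\<lambda>q :: real \<times> real. \<alpha> (fst q + snd q) + \<beta> (fst q - snd q)) has_derivative
     (\<lambda>w. (fst w + snd w) *\<^sub>R a + (fst w - snd w) *\<^sub>R b)) (at q)"
proof -
  have "((\<lambda>q :: real \<times> real. fst q + snd q) has_derivative (\<lambda>w. fst w + snd w)) (at q)"
    "((\<lambda>q :: real \<times> real. fst q - snd q) has_derivative (\<lambda>w. fst w - snd w)) (at q)"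
    by (auto intro!: derivative_eq_intros)
  from has_derivative_compose[OF this(1) assms(1)[unfolded has_vector_derivative_def]]
    has_derivative_compose[OF this(2) assms(2)[unfolded has_vector_derivative_def]]
  show ?thesis by (rule has_derivative_add)
qed

lemma null_vector_scaleR: "null_vector v \<Longrightarrow> null_vector (c *\<^sub>R v)"
proof -
  have "lorentz (c *\<^sub>R v) (c *\<^sub>R v) = c\<^sup>2 * lorentz v v"
    by (simp add: lorentz_def power2_eq_square algebra_simps)
  then show "null_vector v \<Longrightarrow> null_vector (c *\<^sub>R v)" by (simp add: null_vector_def)
qed

text \<open>The combination \<open>w\<close> is null and has time component 0; there the Lorentz
  form is Euclidean, which forces \<open>w = 0\<close>. If already the time component of
  \<open>a\<close> is 0, the same argument gives \<open>a = 0\<close>.\<close>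

lemma null_orthogonal_dependent:
  assumes "null_vector a" "null_vector b" "lorentz a b = 0"
  shows "\<exists>x y. (x, y) \<noteq> (0, 0) \<and> x *\<^sub>R a + y *\<^sub>R b = 0"
proof (cases "a $ 3 = 0")
  case True
  then have "(a $ 1)\<^sup>2 + (a $ 2)\<^sup>2 = 0" using assms(1) by (simp add: null_vector_def lorentz_def power2_eq_square)
  then have "a = 0" using True by (simp add: vec_eq_iff forall_3 sum_power2_eq_zero_iff)
  then show ?thesis by (intro exI[of _ 1] exI[of _ 0]) simp
next
  case False
  define w where "w = b $ 3 *\<^sub>R a + (- (a $ 3)) *\<^sub>R b"
  have "(w $ 1)\<^sup>2 + (w $ 2)\<^sup>2 = (b $ 3)\<^sup>2 * lorentz a a - 2 * (a $ 3) * (b $ 3) * lorentz a b + (a $ 3)\<^sup>2 * lorentz b b"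
    by (simp add: w_def lorentz_def power2_eq_square algebra_simps)
  then have "(w $ 1)\<^sup>2 + (w $ 2)\<^sup>2 = 0" using assms by (simp add: null_vector_def)
  moreover have "w $ 3 = 0" by (simp add: w_def)
  ultimately have "w = 0" by (simp add: vec_eq_iff forall_3 sum_power2_eq_zero_iff)
  then show ?thesis using False unfolding w_def by (intro exI[of _ "b $ 3"] exI[of _ "- (a $ 3)"]) simp
qed

lemma lorentz_combination:
  assumes "null_vector A" "null_vector B"
  shows "lorentz (x *\<^sub>R A + y *\<^sub>R B) (x' *\<^sub>R A + y' *\<^sub>R B) = (x * y' + y * x') * lorentz A B"
proof -
  have "lorentz (x *\<^sub>R A + y *\<^sub>R B) (x' *\<^sub>R A + y' *\<^sub>R B) =
      x * x' * lorentz A A + y * y' * lorentz B B + (x * y' + y * x') * lorentz A B"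
    by (simp add: lorentz_def algebra_simps)
  then show ?thesis using assms by (simp add: null_vector_def)
qed

text \<open>
  On the dense set of regular points the two null directions of the tangent plane determine the
  characteristic coordinates up to order; in the limit every point of a minface has regular
  characteristics.
\<close>

lemma minface_regular:
  assumes mf: "minface X \<Omega>" and \<Omega>: "\<Omega> \<subseteq> diamond J"
    and X: "X = (\<lambda>q. (1 / 2) *\<^sub>R \<gamma> (fst q + snd q) + (1 / 2) *\<^sub>R \<gamma> (fst q - snd q))"
    and \<gamma>: "\<And>t. t \<in> J \<Longrightarrow> (\<gamma> has_vector_derivative velocity \<gamma> t) (at t)" "null_curve_on \<gamma> J"
    and p: "p \<in> \<Omega>"
  shows "velocity \<gamma> (fst p + snd p) \<noteq> 0 \<and> velocity \<gamma> (fst p - snd p) \<noteq> 0"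
proof -
  let ?v = "velocity \<gamma>"
  have inJ: "fst q + snd q \<in> J" "fst q - snd q \<in> J" if "q \<in> \<Omega>" for q
    using \<Omega> that by (auto simp: diamond_def)
  have dX: "(X has_derivative (\<lambda>w. ((fst w + snd w) / 2) *\<^sub>R ?v (fst q + snd q) + ((fst w - snd w) / 2) *\<^sub>R ?v (fst q - snd q))) (at q)"
    if q: "q \<in> \<Omega>" for q
  proof -
    have "((\<lambda>t. (1 / 2) *\<^sub>R \<gamma> t) has_vector_derivative (1 / 2) *\<^sub>R ?v t) (at t)" if "t \<in> J" for t
      by (rule bounded_linear.has_vector_derivative[OF bounded_linear_scaleR_right \<gamma>(1)[OF that]])
    from has_derivative_null_sum[OF this[OF inJ(1)[OF q]] this[OF inJ(2)[OF q]]]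
    show ?thesis unfolding X by simp
  qed
  obtain U \<phi> A B \<alpha> \<beta> where U: "p \<in> U" "U \<subseteq> \<Omega>" and \<phi>: "diffeo_between \<phi> U (A \<times> B)"
    and \<alpha>: "regular_null_curve_on \<alpha> A" and \<beta>: "regular_null_curve_on \<beta> B"
    and Xf: "\<And>q. q \<in> U \<Longrightarrow> X q = \<alpha> (fst (\<phi> q)) + \<beta> (snd (\<phi> q))"
    using mf p unfolding minface_def by meson
  obtain D where D: "D \<subseteq> \<Omega>" "open D" "\<Omega> \<subseteq> closure D" "\<And>q. q \<in> D \<Longrightarrow> inj (frechet_derivative X (at q))"
    using mf unfolding minface_def by meson
  obtain \<theta> where \<theta>: "smooth_on \<phi> U" "smooth_on \<theta> (A \<times> B)"
    "\<And>x. x \<in> U \<Longrightarrow> \<phi> x \<in> A \<times> B \<and> \<theta> (\<phi> x) = x" "\<And>y. y \<in> A \<times> B \<Longrightarrow> \<theta> y \<in> U \<and> \<phi> (\<theta> y) = y"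
    using \<phi> by (rule diffeo_betweenE) blast
  have oU: "open U" using \<theta>(1) by (simp add: smooth_on_def)
  define \<phi>' where "\<phi>' = (\<lambda>q. frechet_derivative \<phi> (at q))"
  have C1: "Ck_on (Suc 0) \<phi> U" using \<theta>(1) unfolding smooth_on_def by blast
  have d\<phi>: "(\<phi> has_derivative \<phi>' q) (at q)" if "q \<in> U" for q
    unfolding \<phi>'_def by (rule Ck_on_SucD[OF C1 that])
  have c\<phi>: "continuous_on U (\<lambda>q. \<phi>' q w)" for w
    using C1 unfolding Ck_on.simps \<phi>'_def by blast
  have smd: "(\<alpha> has_vector_derivative velocity \<alpha> t) (at t)" if "regular_null_curve_on \<alpha> A" "t \<in> A" for \<alpha> A t
  proof -
    have "Ck_on (Suc 0) \<alpha> A" using that(1) unfolding regular_null_curve_on_def smooth_on_def by blast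
    then have "\<alpha> differentiable (at t)" using that(2) by simp
    then show ?thesis by (simp add: vector_derivative_works)
  qed
  have tA: "fst (\<phi> q) \<in> A" "snd (\<phi> q) \<in> B" if "q \<in> U" for q
    using \<theta>(3)[OF that] by (auto simp: mem_Times_iff)
  define a where "a = (\<lambda>q. velocity \<alpha> (fst (\<phi> q)))"
  define b where "b = (\<lambda>q. velocity \<beta> (snd (\<phi> q)))"
  have ab: "null_vector (a q)" "a q \<noteq> 0" "null_vector (b q)" "b q \<noteq> 0" if "q \<in> U" for q
    using \<alpha> \<beta> tA[OF that] by (auto simp: regular_null_curve_on_def null_curve_on_def a_def b_def)
  have dX': "(X has_derivative (\<lambda>w. fst (\<phi>' q w) *\<^sub>R a q + snd (\<phi>' q w) *\<^sub>R b q)) (at q)" if q: "q \<in> U" for q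
  proof -
    have "((\<lambda>q. \<alpha> (fst (\<phi> q))) has_derivative (\<lambda>w. fst (\<phi>' q w) *\<^sub>R a q)) (at q)"
      using has_derivative_compose[OF has_derivative_fst[OF d\<phi>[OF q]] smd[OF \<alpha> tA(1)[OF q], unfolded has_vector_derivative_def]]
      by (simp add: a_def)
    moreover have "((\<lambda>q. \<beta> (snd (\<phi> q))) has_derivative (\<lambda>w. snd (\<phi>' q w) *\<^sub>R b q)) (at q)"
      using has_derivative_compose[OF has_derivative_snd[OF d\<phi>[OF q]] smd[OF \<beta> tA(2)[OF q], unfolded has_vector_derivative_def]]
      by (simp add: b_def)
    ultimately have "((\<lambda>q. \<alpha> (fst (\<phi> q)) + \<beta> (snd (\<phi> q))) has_derivative
        (\<lambda>w. fst (\<phi>' q w) *\<^sub>R a q + snd (\<phi>' q w) *\<^sub>R b q)) (at q)"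
      by (rule has_derivative_add)
    then show ?thesis
      by (rule has_derivative_transform_within_open[OF _ oU q]) (rule Xf[symmetric])
  qed
  have eq: "((fst w + snd w) / 2) *\<^sub>R ?v (fst q + snd q) + ((fst w - snd w) / 2) *\<^sub>R ?v (fst q - snd q) =
      fst (\<phi>' q w) *\<^sub>R a q + snd (\<phi>' q w) *\<^sub>R b q" if "q \<in> U" for q w
    using fun_cong[OF has_derivative_unique[OF dX[OF subsetD[OF U(2) that]] dX'[OF that]], of w] .
  \<comment> \<open>The directions \<open>(1, 1)\<close> and \<open>(1, -1)\<close> single out one
    characteristic parameter each.\<close>
  have e1: "?v (fst q + snd q) = fst (\<phi>' q (1, 1)) *\<^sub>R a q + snd (\<phi>' q (1, 1)) *\<^sub>R b q"
    and e2: "?v (fst q - snd q) = fst (\<phi>' q (1, -1)) *\<^sub>R a q + snd (\<phi>' q (1, -1)) *\<^sub>R b q" if "q \<in> U" for q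
    using eq[OF that, of "(1, 1)"] eq[OF that, of "(1, -1)"] by simp_all
  \<comment> \<open>At a point of immersion the two velocities are independent null vectors, hence
    not orthogonal, and then neither are \<open>a q\<close> and \<open>b q\<close>. A combination of
    these two is null only if one of its coefficients vanishes.\<close>
  have prod0: "fst (\<phi>' q (1, 1)) * snd (\<phi>' q (1, 1)) = 0 \<and> fst (\<phi>' q (1, -1)) * snd (\<phi>' q (1, -1)) = 0"
    if q: "q \<in> U" "q \<in> D" for q
  proof -
    have q\<Omega>: "q \<in> \<Omega>" using D(1) q by blast
    have n: "null_vector (?v (fst q + snd q))" "null_vector (?v (fst q - snd q))"
      using \<gamma>(2) inJ[OF q\<Omega>] by (auto simp: null_curve_on_def)
    have fd: "frechet_derivative X (at q) = (\<lambda>w. ((fst w + snd w) / 2) *\<^sub>R ?v (fst q + snd q) + ((fst w - snd w) / 2) *\<^sub>R ?v (fst q - snd q))"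
      using frechet_derivative_at[OF dX[OF q\<Omega>]] by simp
    have "lorentz (?v (fst q + snd q)) (?v (fst q - snd q)) \<noteq> 0"
    proof
      assume "lorentz (?v (fst q + snd q)) (?v (fst q - snd q)) = 0"
      then obtain x y where xy: "(x, y) \<noteq> (0, 0)" "x *\<^sub>R ?v (fst q + snd q) + y *\<^sub>R ?v (fst q - snd q) = 0"
        using null_orthogonal_dependent[OF n] by blast
      have "frechet_derivative X (at q) (x + y, x - y) = frechet_derivative X (at q) (0, 0)"
        unfolding fd using xy(2) by simp
      then have "(x + y, x - y) = (0 :: real, 0 :: real)" using D(4)[OF q(2)] by (rule injD[rotated])
      then show False using xy(1) by simp
    qed
    then have "lorentz (a q) (b q) \<noteq> 0"
      unfolding e1[OF q(1)] e2[OF q(1)] lorentz_combination[OF ab(1,3)[OF q(1)]] by auto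
    moreover have "(2 * (fst (\<phi>' q w) * snd (\<phi>' q w))) * lorentz (a q) (b q) = 0"
      if "null_vector (fst (\<phi>' q w) *\<^sub>R a q + snd (\<phi>' q w) *\<^sub>R b q)" for w
      using that unfolding null_vector_def lorentz_combination[OF ab(1,3)[OF q(1)]] by (simp add: mult.commute)
    ultimately show ?thesis using n unfolding e1[OF q(1)] e2[OF q(1)] by auto
  qed
  \<comment> \<open>The product of the coefficients is continuous and vanishes on a dense set, so it
    vanishes also where the surface is singular.\<close>
  have lim: "fst (\<phi>' p w) * snd (\<phi>' p w) = 0" if w: "w = (1, 1) \<or> w = (1, -1)" for w
  proof (rule ccontr)
    assume ne: "fst (\<phi>' p w) * snd (\<phi>' p w) \<noteq> 0"
    have "continuous_on U (\<lambda>q. fst (\<phi>' q w) * snd (\<phi>' q w))"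
      by (intro continuous_intros c\<phi>)
    then have "open (U \<inter> (\<lambda>q. fst (\<phi>' q w) * snd (\<phi>' q w)) -` (- {0}))"
      using oU by (intro continuous_open_preimage) auto
    moreover have "p \<in> U \<inter> (\<lambda>q. fst (\<phi>' q w) * snd (\<phi>' q w)) -` (- {0})" using ne U(1) by simp
    moreover have "p \<in> closure D" using D(3) p by blast
    ultimately obtain q where "q \<in> D" "q \<in> U \<inter> (\<lambda>q. fst (\<phi>' q w) * snd (\<phi>' q w)) -` (- {0})"
      by (meson closure_iff_nhds_not_empty disjoint_iff order_refl)
    then show False using prod0[of q] w by auto
  qed
  have nz: "\<phi>' p w \<noteq> 0" if "w \<noteq> 0" for w
  proof
    assume z: "\<phi>' p w = 0"
    have oAB: "open (A \<times> B)" using \<theta>(2) by (simp add: smooth_on_def)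
    have "Ck_on (Suc 0) \<theta> (A \<times> B)" using \<theta>(2) unfolding smooth_on_def by blast
    then have d\<theta>: "(\<theta> has_derivative frechet_derivative \<theta> (at (\<phi> p))) (at (\<phi> p))"
      by (rule Ck_on_SucD) (use \<theta>(3)[OF U(1)] in blast)
    have "((\<lambda>q. \<theta> (\<phi> q)) has_derivative (\<lambda>w. frechet_derivative \<theta> (at (\<phi> p)) (\<phi>' p w))) (at p)"
      by (rule has_derivative_compose[OF d\<phi>[OF U(1)] d\<theta>])
    then have "((\<lambda>q. q) has_derivative (\<lambda>w. frechet_derivative \<theta> (at (\<phi> p)) (\<phi>' p w))) (at p)"
      by (rule has_derivative_transform_within_open[OF _ oU U(1)]) (use \<theta>(3) in blast)
    from has_derivative_unique[OF this has_derivative_ident]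
    have "w = frechet_derivative \<theta> (at (\<phi> p)) (\<phi>' p w)" by metis
    also have "\<dots> = 0" unfolding z using linear_0[OF has_derivative_linear[OF d\<theta>]] .
    finally show False using that by simp
  qed
  \<comment> \<open>Because \<open>\<phi>\<close> is a diffeomorphism the two coefficients do not
    both vanish; exactly one survives, multiplying a nonzero vector.\<close>
  have fin: "fst (\<phi>' p w) *\<^sub>R a p + snd (\<phi>' p w) *\<^sub>R b p \<noteq> 0" if "w = (1, 1) \<or> w = (1, -1)" for w
  proof -
    have "\<phi>' p w \<noteq> 0" by (rule nz) (use that in \<open>auto simp: prod_eq_iff\<close>)
    then show ?thesis using lim[OF that] ab(2,4)[OF U(1)] by (auto simp: prod_eq_iff)
  qed
  show ?thesis unfolding e1[OF U(1)] e2[OF U(1)] using fin by blast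
qed

text \<open>The velocity is nonzero at both characteristic parameters of every point, so multiplying
  it by the nonvanishing factors \<open>m\<close> and \<open>n\<close> gives regular null curves
  again. The tangent vectors only change by nonzero factors, hence the surface is immersed on the
  same dense set \<open>D\<close> as before.\<close>

lemma minface_scaled:
  assumes mf: "minface X \<Omega>" and \<Omega>: "\<Omega> \<subseteq> diamond J" "open \<Omega>" and J: "open J"
    and X: "X = (\<lambda>q. (1 / 2) *\<^sub>R \<gamma> (fst q + snd q) + (1 / 2) *\<^sub>R \<gamma> (fst q - snd q))"
    and \<gamma>: "\<And>t. t \<in> J \<Longrightarrow> (\<gamma> has_vector_derivative velocity \<gamma> t) (at t)" "null_curve_on \<gamma> J"
    and S: "open S" "S \<subseteq> J" "\<And>q. q \<in> \<Omega> \<Longrightarrow> fst q + snd q \<in> S \<and> fst q - snd q \<in> S"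
    and \<alpha>: "\<And>t. t \<in> S \<Longrightarrow> (\<alpha> has_vector_derivative m t *\<^sub>R velocity \<gamma> t) (at t)"
    and \<beta>: "\<And>t. t \<in> S \<Longrightarrow> (\<beta> has_vector_derivative n t *\<^sub>R velocity \<gamma> t) (at t)"
    and sm: "smooth_on \<alpha> S" "smooth_on \<beta> S"
    and mn: "\<And>q. q \<in> \<Omega> \<Longrightarrow> m (fst q + snd q) \<noteq> 0 \<and> n (fst q - snd q) \<noteq> 0"
    and Y: "\<And>q. q \<in> \<Omega> \<Longrightarrow> Y q = \<alpha> (fst q + snd q) + \<beta> (fst q - snd q)"
  shows "minface Y \<Omega>"
  unfolding minface_def
proof (intro conjI ballI)
  have reg: "velocity \<gamma> (fst p + snd p) \<noteq> 0 \<and> velocity \<gamma> (fst p - snd p) \<noteq> 0" if "p \<in> \<Omega>" for p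
    by (rule minface_regular[OF mf \<Omega>(1) X \<gamma>(1) \<gamma>(2) that])
  let ?Z = "\<lambda>q :: real \<times> real. \<alpha> (fst q + snd q) + \<beta> (fst q - snd q)"
  have bl: "bounded_linear (\<lambda>q :: real \<times> real. fst q + snd q)" "bounded_linear (\<lambda>q :: real \<times> real. fst q - snd q)"
    by (intro bounded_linear_add bounded_linear_sub bounded_linear_fst bounded_linear_snd)+
  have "smooth_on (\<lambda>q. \<alpha> (0 + (fst q + snd q))) \<Omega>" "smooth_on (\<lambda>q. \<beta> (0 + (fst q - snd q))) \<Omega>"
    by (rule smooth_on_affine_precomp[OF \<Omega>(2) bl(1) _ sm(1)] smooth_on_affine_precomp[OF \<Omega>(2) bl(2) _ sm(2)];
        use S(3) in simp)+
  then have "smooth_on ?Z \<Omega>" using smooth_on_add by fastforce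
  then show "smooth_on Y \<Omega>" using smooth_on_cong[of \<Omega> Y ?Z] Y by blast
  have dY: "(Y has_derivative (\<lambda>w. (fst w + snd w) *\<^sub>R (m (fst q + snd q) *\<^sub>R velocity \<gamma> (fst q + snd q)) +
      (fst w - snd w) *\<^sub>R (n (fst q - snd q) *\<^sub>R velocity \<gamma> (fst q - snd q)))) (at q)" if q: "q \<in> \<Omega>" for q
  proof -
    have "(?Z has_derivative (\<lambda>w. (fst w + snd w) *\<^sub>R (m (fst q + snd q) *\<^sub>R velocity \<gamma> (fst q + snd q)) +
      (fst w - snd w) *\<^sub>R (n (fst q - snd q) *\<^sub>R velocity \<gamma> (fst q - snd q)))) (at q)"
      by (rule has_derivative_null_sum) (use S(3)[OF q] \<alpha> \<beta> in auto)
    then show ?thesis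
      by (rule has_derivative_transform_within_open[OF _ \<Omega>(2) q]) (simp add: Y)
  qed
  obtain D where D: "D \<subseteq> \<Omega>" "open D" "\<Omega> \<subseteq> closure D" "\<And>q. q \<in> D \<Longrightarrow> inj (frechet_derivative X (at q))"
    using mf unfolding minface_def by meson
  show "\<exists>D\<subseteq>\<Omega>. open D \<and> \<Omega> \<subseteq> closure D \<and> (\<forall>p\<in>D. inj (frechet_derivative Y (at p)))"
  proof (intro exI[of _ D] conjI ballI D)
    fix q assume q: "q \<in> D"
    then have q\<Omega>: "q \<in> \<Omega>" using D(1) by blast
    then have J': "fst q + snd q \<in> J" "fst q - snd q \<in> J" using \<Omega>(1) by (auto simp: diamond_def)
    have h: "((\<lambda>t. (1 / 2) *\<^sub>R \<gamma> t) has_vector_derivative (1 / 2) *\<^sub>R velocity \<gamma> t) (at t)" if "t \<in> J" for t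
      by (rule bounded_linear.has_vector_derivative[OF bounded_linear_scaleR_right \<gamma>(1)[OF that]])
    have dX: "(X has_derivative (\<lambda>w. (fst w + snd w) *\<^sub>R ((1 / 2) *\<^sub>R velocity \<gamma> (fst q + snd q)) +
        (fst w - snd w) *\<^sub>R ((1 / 2) *\<^sub>R velocity \<gamma> (fst q - snd q)))) (at q)"
      unfolding X by (rule has_derivative_null_sum[OF h[OF J'(1)] h[OF J'(2)]])
    have fY: "frechet_derivative Y (at q) = (\<lambda>w. (fst w + snd w) *\<^sub>R (m (fst q + snd q) *\<^sub>R velocity \<gamma> (fst q + snd q)) +
      (fst w - snd w) *\<^sub>R (n (fst q - snd q) *\<^sub>R velocity \<gamma> (fst q - snd q)))"
      using frechet_derivative_at[OF dY[OF q\<Omega>]] by simp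
    have fX: "frechet_derivative X (at q) = (\<lambda>w. (fst w + snd w) *\<^sub>R ((1 / 2) *\<^sub>R velocity \<gamma> (fst q + snd q)) +
        (fst w - snd w) *\<^sub>R ((1 / 2) *\<^sub>R velocity \<gamma> (fst q - snd q)))"
      using frechet_derivative_at[OF dX] by simp
    have lin: "linear (frechet_derivative Y (at q))"
      unfolding fY by (rule has_derivative_linear[OF dY[OF q\<Omega>]])
    show "inj (frechet_derivative Y (at q))"
      unfolding linear_injective_0[OF lin]
    proof (intro allI impI)
      fix w assume w: "frechet_derivative Y (at q) w = 0"
      \<comment> \<open>Rescaling the characteristic components by \<open>m\<close> and
        \<open>n\<close> carries the kernel of the new derivative into that of the old one, which is
        trivial.\<close>
      define x where "x = (fst w + snd w) * m (fst q + snd q)"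
      define y where "y = (fst w - snd w) * n (fst q - snd q)"
      have "frechet_derivative X (at q) (x + y, x - y) = frechet_derivative X (at q) (0, 0)"
        using w unfolding fX fY by (simp add: x_def y_def)
      then have "(x + y, x - y) = (0 :: real, 0 :: real)" using D(4)[OF q] by (rule injD[rotated])
      then have "x = 0" "y = 0" by auto
      then have "fst w + snd w = 0" "fst w - snd w = 0" using mn[OF q\<Omega>] by (auto simp: x_def y_def)
      then show "w = 0" by (simp add: prod_eq_iff)
    qed
  qed
  fix p assume p: "p \<in> \<Omega>"
  define \<phi> where "\<phi> = (\<lambda>q :: real \<times> real. (fst q + snd q, fst q - snd q))"
  define \<theta> where "\<theta> = (\<lambda>z :: real \<times> real. ((fst z + snd z) / 2, (fst z - snd z) / 2))"
  have inv: "\<theta> (\<phi> q) = q" "\<phi> (\<theta> q) = q" for q by (simp_all add: \<phi>_def \<theta>_def prod_eq_iff field_simps)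
  have bl\<phi>: "bounded_linear \<phi>" unfolding \<phi>_def by (intro bounded_linear_Pair bl)
  have bl\<theta>: "bounded_linear \<theta>" unfolding \<theta>_def
    by (intro bounded_linear_Pair bounded_linear_compose[OF bounded_linear_divide bl(1)] bounded_linear_compose[OF bounded_linear_divide bl(2)])
  have "open (\<theta> -` \<Omega>)" by (intro open_vimage \<Omega>(2) linear_continuous_on bl\<theta>)
  moreover have "\<phi> p \<in> \<theta> -` \<Omega>" using p inv by simp
  ultimately obtain A0 B0 where AB0: "open A0" "open B0" "\<phi> p \<in> A0 \<times> B0" "A0 \<times> B0 \<subseteq> \<theta> -` \<Omega>"
    by (rule open_prod_elim)
  obtain e where e: "e > 0" "ball (fst (\<phi> p)) e \<subseteq> A0" using AB0(1,3) by (metis open_contains_ball mem_Times_iff)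
  obtain d where d: "d > 0" "ball (snd (\<phi> p)) d \<subseteq> B0" using AB0(2,3) by (metis open_contains_ball mem_Times_iff)
  define A where "A = ball (fst (\<phi> p)) e"
  define B where "B = ball (snd (\<phi> p)) d"
  have AB: "A \<times> B \<subseteq> \<theta> -` \<Omega>" "fst (\<phi> p) \<in> A" "snd (\<phi> p) \<in> B" "open A" "open B"
    using AB0(4) e d by (auto simp: A_def B_def)
  \<comment> \<open>A product box inside the domain: each parameter in \<open>A\<close> or
    \<open>B\<close> is completed to a point of the domain, where the hypotheses on velocities and
    factors can be evaluated.\<close>
  have t\<Omega>: "\<theta> (t, s) \<in> \<Omega>" if "t \<in> A" "s \<in> B" for t s using AB(1) that by auto
  have reg\<alpha>: "regular_null_curve_on \<alpha> A"
  proof -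
    have tS: "t \<in> S \<and> m t *\<^sub>R velocity \<gamma> t \<noteq> 0 \<and> velocity \<alpha> t = m t *\<^sub>R velocity \<gamma> t" if "t \<in> A" for t
    proof -
      have q: "\<theta> (t, snd (\<phi> p)) \<in> \<Omega>" by (rule t\<Omega>[OF that AB(3)])
      have f: "fst (\<theta> (t, snd (\<phi> p))) + snd (\<theta> (t, snd (\<phi> p))) = t" by (simp add: \<theta>_def field_simps)
      have "t \<in> S" using S(3)[OF q] f by simp
      then show ?thesis using mn[OF q] reg[OF q] f vector_derivative_at[OF \<alpha>] by simp
    qed
    then have "A \<subseteq> S" by blast
    moreover have "null_vector (m t *\<^sub>R velocity \<gamma> t)" if "t \<in> A" for t
      using \<gamma>(2) S(2) tS[OF that] by (intro null_vector_scaleR) (auto simp: null_curve_on_def)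
    ultimately show ?thesis
      unfolding regular_null_curve_on_def null_curve_on_def
      using tS smooth_on_subset[OF sm(1) AB(4)] by (auto simp: A_def is_interval_ball_real)
  qed
  have reg\<beta>: "regular_null_curve_on \<beta> B"
  proof -
    have tS: "t \<in> S \<and> n t *\<^sub>R velocity \<gamma> t \<noteq> 0 \<and> velocity \<beta> t = n t *\<^sub>R velocity \<gamma> t" if "t \<in> B" for t
    proof -
      have q: "\<theta> (fst (\<phi> p), t) \<in> \<Omega>" by (rule t\<Omega>[OF AB(2) that])
      have f: "fst (\<theta> (fst (\<phi> p), t)) - snd (\<theta> (fst (\<phi> p), t)) = t" by (simp add: \<theta>_def field_simps)
      have "t \<in> S" using S(3)[OF q] f by simp
      then show ?thesis using mn[OF q] reg[OF q] f vector_derivative_at[OF \<beta>] by simp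
    qed
    then have "B \<subseteq> S" by blast
    moreover have "null_vector (n t *\<^sub>R velocity \<gamma> t)" if "t \<in> B" for t
      using \<gamma>(2) S(2) tS[OF that] by (intro null_vector_scaleR) (auto simp: null_curve_on_def)
    ultimately show ?thesis
      unfolding regular_null_curve_on_def null_curve_on_def
      using tS smooth_on_subset[OF sm(2) AB(5)] by (auto simp: B_def is_interval_ball_real)
  qed
  have "diffeo_between \<phi> (\<phi> -` (A \<times> B)) (A \<times> B)"
  proof (rule diffeo_betweenI[where g = \<theta>])
    have o: "open (A \<times> B)" by (intro open_Times AB)
    then have "open (\<phi> -` (A \<times> B))" by (intro open_vimage linear_continuous_on bl\<phi>)
    from smooth_on_affine[OF this bl\<phi>, of 0] smooth_on_affine[OF o bl\<theta>, of 0]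
    show "smooth_on \<phi> (\<phi> -` (A \<times> B))" "smooth_on \<theta> (A \<times> B)" by simp_all
  qed (simp_all add: inv)
  moreover have "\<phi> -` (A \<times> B) \<subseteq> \<Omega>" using AB(1) inv by (metis subsetD subsetI vimageE vimageI2)
  moreover have "p \<in> \<phi> -` (A \<times> B)" using AB by (simp add: mem_Times_iff)
  moreover have "\<forall>q\<in>\<phi> -` (A \<times> B). Y q = \<alpha> (fst (\<phi> q)) + \<beta> (snd (\<phi> q))"
  proof
    fix q assume "q \<in> \<phi> -` (A \<times> B)"
    then have "q \<in> \<Omega>" using \<open>\<phi> -` (A \<times> B) \<subseteq> \<Omega>\<close> by blast
    from Y[OF this] show "Y q = \<alpha> (fst (\<phi> q)) + \<beta> (snd (\<phi> q))" by (simp add: \<phi>_def)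
  qed
  ultimately have main: "p \<in> \<phi> -` (A \<times> B) \<and> \<phi> -` (A \<times> B) \<subseteq> \<Omega> \<and> diffeo_between \<phi> (\<phi> -` (A \<times> B)) (A \<times> B) \<and>
      regular_null_curve_on \<alpha> A \<and> regular_null_curve_on \<beta> B \<and>
      (\<forall>q\<in>\<phi> -` (A \<times> B). Y q = \<alpha> (fst (\<phi> q)) + \<beta> (snd (\<phi> q)))"
    using reg\<alpha> reg\<beta> by (intro conjI)
  show "\<exists>U \<phi> A B \<alpha> \<beta>. p \<in> U \<and> U \<subseteq> \<Omega> \<and> diffeo_between \<phi> U (A \<times> B) \<and>
        regular_null_curve_on \<alpha> A \<and> regular_null_curve_on \<beta> B \<and> (\<forall>q\<in>U. Y q = \<alpha> (fst (\<phi> q)) + \<beta> (snd (\<phi> q)))"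
    by (rule exI[of _ "\<phi> -` (A \<times> B)"], rule exI[of _ \<phi>], rule exI[of _ A], rule exI[of _ B],
        rule exI[of _ \<alpha>], rule exI[of _ \<beta>], rule main)
qed

section \<open>The approximating surfaces\<close>

lemma affine_germ_crosscap:
  fixes f :: "'a::euclidean_space \<Rightarrow> real ^ 3" and l :: "'b::euclidean_space \<Rightarrow> 'a"
  assumes l: "bounded_linear l" "bounded_linear l'" "\<And>x. l' (l x) = x" "\<And>x. l (l' x) = x"
    and cc: "cuspidal_crosscap_at (\<lambda>q. f (c + l q)) 0"
  shows "cuspidal_crosscap_at f c"
proof -
  have z: "- l' c + l' x = l' (x - c)" for x
    using linear_diff[OF bounded_linear.linear[OF l(2)]] by simp
  have "cuspidal_crosscap_at (\<lambda>x. (\<lambda>q. f (c + l q)) (- l' c + l' x)) c"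
    by (rule cuspidal_crosscap_precomp[OF l(2,1,4,3)]) (use cc in simp)
  moreover have "(\<lambda>x. (\<lambda>q. f (c + l q)) (- l' c + l' x)) = f" by (rule ext) (simp only: z l(4), simp)
  ultimately show ?thesis by simp
qed

lemma affine_germ_injective:
  fixes f :: "'a::euclidean_space \<Rightarrow> real ^ 3" and l :: "'b::euclidean_space \<Rightarrow> 'a"
  assumes l: "bounded_linear l" "bounded_linear l'" "\<And>x. l' (l x) = x" "\<And>x. l (l' x) = x"
    and N: "open N" "0 \<in> N" "inj_on (\<lambda>q. f (c + l q)) N"
  shows "\<not> cuspidal_crosscap_at f c"
proof -
  define N' where "N' = (\<lambda>x. l' (x - c)) -` N"
  have "open N'" unfolding N'_def
    by (intro open_vimage N(1) bounded_linear.continuous_on[OF l(2)] continuous_intros)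
  moreover have "c \<in> N'" using N(2) linear_0[OF bounded_linear.linear[OF l(2)]] by (simp add: N'_def)
  moreover have "inj_on f N'"
  proof (rule inj_onI)
    fix x y assume xy: "x \<in> N'" "y \<in> N'" "f x = f y"
    have "f (c + l (l' (x - c))) = f (c + l (l' (y - c)))" using xy(3) by (simp add: l(4))
    then have "l' (x - c) = l' (y - c)" using inj_onD[OF N(3)] xy(1,2) unfolding N'_def by blast
    then have "l (l' (x - c)) = l (l' (y - c))" by simp
    then show "x = y" by (simp add: l(4))
  qed
  ultimately show ?thesis using cuspidal_crosscap_not_locally_injective by blast
qed

lemma deriv_zero_of_Re_zero:
  assumes "open U" "z \<in> U" "(G has_field_derivative G') (at z)" "\<And>w. w \<in> U \<Longrightarrow> Re (G w) = 0"
  shows "G' = 0"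
proof -
  have "((\<lambda>w. Re (G w)) has_derivative (\<lambda>h. Re (G' * h))) (at z)"
    using bounded_linear.has_derivative[OF bounded_linear_Re assms(3)[unfolded has_field_derivative_def]] .
  then have "((\<lambda>w. 0) has_derivative (\<lambda>h. Re (G' * h))) (at z)"
    by (rule has_derivative_transform_within_open[OF _ assms(1,2)]) (rule assms(4))
  from has_derivative_unique[OF this has_derivative_const] have h: "Re (G' * h) = 0" for h by meson
  from h[of 1] h[of "- \<i>"] show ?thesis by (simp add: complex_eq_iff)
qed

text \<open>The real part is half the sum of \<open>G\<close> and its conjugate, and only the
  holomorphic half contributes to the form.\<close>

lemma wirtinger_Re:
  fixes X :: "complex \<Rightarrow> real ^ 3" and G :: "3 \<Rightarrow> complex \<Rightarrow> complex"
  assumes S: "open S" "z \<in> S" and X: "\<And>w k. w \<in> S \<Longrightarrow> X w $ k = Re (G k w)"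
    and G: "\<And>k. (G k has_field_derivative G' k) (at z)"
  shows "wirtinger X z = (\<chi> k. G' k / 2)"
proof -
  have "((\<lambda>w. \<chi> k. Re (G k w)) has_derivative (\<lambda>h. \<chi> k. Re (G' k * h))) (at z)"
  proof (subst has_derivative_componentwise_within, rule ballI)
    fix b :: "real ^ 3" assume "b \<in> Basis"
    then obtain i where "b = axis i 1" by (auto simp: Basis_vec_def)
    then show "((\<lambda>x. (\<chi> k. Re (G k x)) \<bullet> b) has_derivative (\<lambda>x. (\<chi> k. Re (G' k * x)) \<bullet> b)) (at z)"
      using bounded_linear.has_derivative[OF bounded_linear_Re G[unfolded has_field_derivative_def], of i]
      by (simp add: inner_axis)
  qed
  then have "(X has_derivative (\<lambda>h. \<chi> k. Re (G' k * h))) (at z)"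
    by (rule has_derivative_transform_within_open[OF _ S]) (simp add: X vec_eq_iff)
  then have "frechet_derivative X (at z) = (\<lambda>h. \<chi> k. Re (G' k * h))"
    by (simp add: frechet_derivative_at[symmetric])
  then show ?thesis
    unfolding wirtinger_def by (simp add: vec_eq_iff complex_eq_iff)
qed

lemma sup_norm_on_bound:
  fixes X :: "'a::topological_space \<Rightarrow> real ^ 3"
  assumes "S \<noteq> {}" "\<And>z k. z \<in> closure S \<Longrightarrow> \<bar>X z $ k\<bar> \<le> B"
  shows "\<bar>sup_norm_on S X\<bar> \<le> B"
proof -
  let ?f = "\<lambda>z. max \<bar>X z $ 1\<bar> (max \<bar>X z $ 2\<bar> \<bar>X z $ 3\<bar>)"
  have le: "?f z \<le> B" if "z \<in> closure S" for z using assms(2)[OF that] by simp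
  obtain z where z: "z \<in> closure S" using assms(1) closure_subset by blast
  have "(SUP z\<in>closure S. ?f z) \<le> B" by (rule cSUP_least) (use z le in auto)
  moreover have "bdd_above (?f ` closure S)" using le by (intro bdd_aboveI2)
  then have "?f z \<le> (SUP z\<in>closure S. ?f z)" by (rule cSUP_upper[OF z])
  moreover have "0 \<le> ?f z" by (simp add: le_max_iff_disj)
  ultimately show ?thesis unfolding sup_norm_on_def by linarith
qed

text \<open>For a null velocity \<open>v\<close> and an orthogonal acceleration \<open>w\<close> the
  two minors are linked by \<open>v\<^sub>3 (v\<^sub>2 w\<^sub>3 - v\<^sub>3 w\<^sub>2) = -
  v\<^sub>1 (v\<^sub>1 w\<^sub>2 - v\<^sub>2 w\<^sub>1)\<close>, so the disjunction collapses to its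
  second half; a vanishing \<open>v\<^sub>3\<close> would annihilate \<open>v\<close>
  altogether.\<close>

lemma nondegenerate_null:
  fixes v w :: "real ^ 3"
  assumes "(v $ 1)\<^sup>2 + (v $ 2)\<^sup>2 = (v $ 3)\<^sup>2" "v $ 1 * w $ 1 + v $ 2 * w $ 2 = v $ 3 * w $ 3"
    and nd: "v $ 2 * w $ 3 - v $ 3 * w $ 2 \<noteq> 0 \<or> v $ 1 * w $ 2 - v $ 2 * w $ 1 \<noteq> 0"
  shows "v $ 3 \<noteq> 0" "v $ 1 * w $ 2 - v $ 2 * w $ 1 \<noteq> 0"
proof -
  show v3: "v $ 3 \<noteq> 0"
  proof
    assume z: "v $ 3 = 0"
    then have "v $ 1 = 0" "v $ 2 = 0" using assms(1) by (simp_all add: sum_power2_eq_zero_iff)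
    then show False using nd z by simp
  qed
  have "v $ 3 * (v $ 2 * w $ 3 - v $ 3 * w $ 2) = - (v $ 1) * (v $ 1 * w $ 2 - v $ 2 * w $ 1)"
    using assms(1,2) by algebra
  then show "v $ 1 * w $ 2 - v $ 2 * w $ 1 \<noteq> 0" using nd v3 by auto
qed

section \<open>The fixed null curve, its complexification, the fields and the maximal
  surfaces\<close>

locale null_curve_setting =
  fixes \<gamma> :: "real \<Rightarrow> real ^ 3" and J :: "real set" and c d :: real and W :: "complex set"
  assumes J: "open J" "is_interval J"
    and I: "c < d" "{c..d} \<subseteq> J"
    and \<gamma>: "real_analytic_on \<gamma> J" "null_curve_on \<gamma> J"
    and W: "symmetric_sc_domain {c..d} W" "extends_hol J W \<gamma>"
    and nondeg: "nondegenerate_on \<gamma> {c..d}"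
begin

definition F :: "complex \<Rightarrow> complex ^ 3" where "F = complexify J W \<gamma>"

abbreviation "D k \<equiv> deriv (\<lambda>z. F z $ k)"

abbreviation "v \<equiv> velocity \<gamma>"

lemma W_open: "open W" and W_cnj: "cnj ` W = W" and W_sc: "simply_connected W"
  and W_conn: "connected W" and I_W: "t \<in> {c..d} \<Longrightarrow> of_real t \<in> W"
  using W(1) simply_connected_imp_connected unfolding symmetric_sc_domain_def by blast+

lemma cnj_W: "z \<in> W \<Longrightarrow> cnj z \<in> W"
  using W_cnj by blast

lemma F_ext: "hol_extension J W \<gamma> F"
  using W(2) unfolding F_def extends_hol_def complexify_def by (rule someI_ex)

lemma F_hol: "(\<lambda>z. F z $ k) holomorphic_on W"
  using F_ext unfolding hol_extension_def by blast

lemma F_val: "t \<in> J \<Longrightarrow> of_real t \<in> W \<Longrightarrow> F (of_real t) $ k = of_real (\<gamma> t $ k)"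
  using F_ext unfolding hol_extension_def by blast

text \<open>Since \<open>c < d\<close>, the interval accumulates at \<open>c\<close> inside the
  domain \<open>W\<close>. All relations between complexified data are checked on the interval and
  spread to \<open>W\<close> in this way.\<close>

lemma identity:
  assumes "g holomorphic_on W" "\<And>t. t \<in> {c..d} \<Longrightarrow> g (of_real t) = 0" "z \<in> W"
  shows "g z = 0"
proof (rule analytic_continuation[OF assms(1) W_open W_conn, of "complex_of_real ` {c..d}" "of_real c"])
  show "complex_of_real ` {c..d} \<subseteq> W" using I_W by blast
  show "of_real c \<in> W" using I_W I by simp
  have "connected (complex_of_real ` {c..d})" by (intro connected_continuous_image continuous_intros) simp
  moreover have "complex_of_real ` {c..d} \<noteq> {x}" for x
  proof
    assume "complex_of_real ` {c..d} = {x}"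
    then have "complex_of_real c \<in> {x}" "complex_of_real d \<in> {x}" using I(1) by auto
    then show False using I(1) by auto
  qed
  ultimately show "of_real c islimpt complex_of_real ` {c..d}"
    using I(1) by (intro connected_imp_perfect) auto
qed (use assms in auto)

lemma hol_cnj_cnj: "g holomorphic_on W \<Longrightarrow> (\<lambda>z. cnj (g (cnj z))) holomorphic_on W"
  using holomorphic_on_compose_cnj_cnj[of g W] W_cnj W_open by (simp add: o_def)

text \<open>Schwarz reflection: conjugating argument and value of \<open>g\<close> gives another
  holomorphic function on the symmetric domain, with the same values on the interval.\<close>

lemma cnj_symmetric:
  assumes g: "g holomorphic_on W" and r: "\<And>t. t \<in> {c..d} \<Longrightarrow> Im (g (of_real t)) = 0" and z: "z \<in> W"
  shows "g (cnj z) = cnj (g z)"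
proof -
  have "cnj (g (cnj (cnj z))) - g (cnj z) = 0"
    by (rule identity[where g = "\<lambda>z. cnj (g (cnj z)) - g z"])
      (use r in \<open>auto intro!: holomorphic_on_diff hol_cnj_cnj g cnj_W z simp: complex_eq_iff\<close>)
  then show ?thesis by simp
qed

lemma F_cnj: "z \<in> W \<Longrightarrow> F (cnj z) $ k = cnj (F z $ k)"
  by (rule cnj_symmetric[OF F_hol]) (use F_val I(2) I_W in auto)

lemma near_J: "t \<in> J \<Longrightarrow> of_real t \<in> W \<Longrightarrow> \<forall>\<^sub>F x in nhds t. x \<in> J \<and> complex_of_real x \<in> W"
proof -
  assume t: "t \<in> J" "of_real t \<in> W"
  have "open (J \<inter> complex_of_real -` W)"
    by (intro open_Int J open_vimage W_open continuous_intros)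
  then show ?thesis using eventually_nhds_in_open[of "J \<inter> complex_of_real -` W" t] t by simp
qed

lemma D_hol: "D k holomorphic_on W"
  by (rule holomorphic_deriv[OF F_hol W_open])

lemma D_val: "t \<in> J \<Longrightarrow> of_real t \<in> W \<Longrightarrow> D k (of_real t) = of_real (v t $ k)"
proof -
  assume t: "t \<in> J" "of_real t \<in> W"
  have "\<forall>\<^sub>F x in nhds t. \<forall>k. F (of_real x) $ k = of_real (\<gamma> x $ k)"
    using near_J[OF t] by eventually_elim (use F_val in blast)
  from hol_ext_velocity(2)[where G = "\<lambda>k z. F z $ k", OF F_hol W_open t(2) this] show ?thesis .
qed

lemma DD_val: "t \<in> J \<Longrightarrow> of_real t \<in> W \<Longrightarrow> deriv (D k) (of_real t) = of_real (velocity v t $ k)"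
proof -
  assume t: "t \<in> J" "of_real t \<in> W"
  have "\<forall>\<^sub>F x in nhds t. \<forall>k. D k (of_real x) = of_real (v x $ k)"
    using near_J[OF t] by eventually_elim (use D_val in blast)
  from hol_ext_velocity(2)[where G = "\<lambda>k. D k", OF D_hol W_open t(2) this] show ?thesis .
qed

lemma v_null: "t \<in> J \<Longrightarrow> (v t $ 1)\<^sup>2 + (v t $ 2)\<^sup>2 = (v t $ 3)\<^sup>2"
  using \<gamma>(2) unfolding null_curve_on_def null_vector_def lorentz_def by (simp add: power2_eq_square)

lemma D_null: "z \<in> W \<Longrightarrow> (D 1 z)\<^sup>2 + (D 2 z)\<^sup>2 = (D 3 z)\<^sup>2"
proof -
  assume z: "z \<in> W"
  have "(D 1 z)\<^sup>2 + (D 2 z)\<^sup>2 - (D 3 z)\<^sup>2 = 0"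
  proof (rule identity[where g = "\<lambda>z. (D 1 z)\<^sup>2 + (D 2 z)\<^sup>2 - (D 3 z)\<^sup>2", OF _ _ z])
    show "(\<lambda>z. (D 1 z)\<^sup>2 + (D 2 z)\<^sup>2 - (D 3 z)\<^sup>2) holomorphic_on W"
      by (intro holomorphic_on_add holomorphic_on_diff holomorphic_on_power D_hol)
    fix t assume t: "t \<in> {c..d}"
    then have tJ: "t \<in> J" "of_real t \<in> W" using I(2) I_W by auto
    have "complex_of_real ((v t $ 1)\<^sup>2 + (v t $ 2)\<^sup>2 - (v t $ 3)\<^sup>2) = 0" using v_null[OF tJ(1)] by simp
    then show "(D 1 (of_real t))\<^sup>2 + (D 2 (of_real t))\<^sup>2 - (D 3 (of_real t))\<^sup>2 = 0"
      by (simp add: D_val[OF tJ])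
  qed
  then show ?thesis by simp
qed

text \<open>Differentiating the complexified null identity gives orthogonality of velocity and
  acceleration, the missing ingredient for reducing nondegeneracy to a single minor.\<close>

lemma v_nondeg:
  assumes t: "t \<in> {c..d}"
  shows "v t $ 3 \<noteq> 0" "v t $ 1 * velocity v t $ 2 - v t $ 2 * velocity v t $ 1 \<noteq> 0"
proof -
  have tJ: "t \<in> J" "of_real t \<in> W" using t I(2) I_W by auto
  have d: "(D k has_field_derivative deriv (D k) z) (at z)" if "z \<in> W" for k z
    by (rule holomorphic_derivI[OF D_hol W_open that])
  let ?T = "complex_of_real t"
  have "((\<lambda>z. D 1 z * D 1 z + D 2 z * D 2 z - D 3 z * D 3 z) has_field_derivative
      (deriv (D 1) ?T * D 1 ?T + deriv (D 1) ?T * D 1 ?T) + (deriv (D 2) ?T * D 2 ?T + deriv (D 2) ?T * D 2 ?T) -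
      (deriv (D 3) ?T * D 3 ?T + deriv (D 3) ?T * D 3 ?T)) (at ?T)"
    by (intro DERIV_add DERIV_diff DERIV_mult d tJ)
  moreover have "((\<lambda>z. D 1 z * D 1 z + D 2 z * D 2 z - D 3 z * D 3 z) has_field_derivative 0) (at ?T)"
    by (rule has_field_derivative_transform_within_open[OF DERIV_const W_open tJ(2)])
      (use D_null in \<open>simp add: power2_eq_square\<close>)
  ultimately have "2 * (D 1 ?T * deriv (D 1) ?T + D 2 ?T * deriv (D 2) ?T) = 2 * (D 3 ?T * deriv (D 3) ?T)"
    using DERIV_unique by (fastforce simp: algebra_simps)
  then have "D 1 ?T * deriv (D 1) ?T + D 2 ?T * deriv (D 2) ?T = D 3 ?T * deriv (D 3) ?T"
    unfolding mult_cancel_left by simp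
  then have "complex_of_real (v t $ 1 * velocity v t $ 1 + v t $ 2 * velocity v t $ 2) = of_real (v t $ 3 * velocity v t $ 3)"
    by (simp add: D_val[OF tJ] DD_val[OF tJ])
  then have "v t $ 1 * velocity v t $ 1 + v t $ 2 * velocity v t $ 2 = v t $ 3 * velocity v t $ 3"
    by (simp only: of_real_eq_iff)
  from nondegenerate_null[OF v_null[OF tJ(1)] this] nondeg t
  show "v t $ 3 \<noteq> 0" "v t $ 1 * velocity v t $ 2 - v t $ 2 * velocity v t $ 1 \<noteq> 0"
    unfolding nondegenerate_on_def Let_def by blast+
qed

text \<open>Distinct interior points running from the midpoint of the interval down towards
  \<open>c\<close>. They do not depend on the number of factors, so the zeros of one field persist
  in all later ones.\<close>

definition node :: "nat \<Rightarrow> real" where "node i = c + (d - c) / (real i + 2)"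

definition p :: "nat \<Rightarrow> real \<Rightarrow> real" where "p n t = (\<Prod>i<n. t - node i)"

definition P :: "nat \<Rightarrow> complex \<Rightarrow> complex" where "P n z = (\<Prod>i<n. z - of_real (node i))"

definition L :: "real \<Rightarrow> nat \<Rightarrow> real \<Rightarrow> real ^ 3" where "L \<epsilon> n t = (\<epsilon> * p n t) *\<^sub>R v t"

lemma P_hol: "P n holomorphic_on S"
  unfolding P_def by (intro holomorphic_intros)

lemma P_val: "P n (of_real t) = of_real (p n t)"
  by (simp add: P_def p_def)

lemma node_mem: "node i \<in> {c..d}" and node_inj: "inj node"
proof -
  have "(d - c) / (real i + 2) \<le> d - c"
  proof (rule iffD2[OF pos_divide_le_eq])
    have "1 \<le> real i + 2" "0 \<le> d - c" using I(1) by simp_all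
    from mult_left_mono[OF this] show "d - c \<le> (d - c) * (real i + 2)" by (simp only: mult_1_right)
  qed simp
  moreover have "0 \<le> (d - c) / (real i + 2)" using I(1) by simp
  ultimately show "node i \<in> {c..d}" by (simp add: node_def)
  show "inj node" using I(1) by (auto simp: inj_on_def node_def)
qed

lemma p_zero_iff: "p n t = 0 \<longleftrightarrow> t \<in> node ` {..<n}"
  by (auto simp: p_def)

text \<open>Splitting off one factor leaves the product over the other nodes as the derivative,
  nonzero because the nodes are distinct.\<close>

lemma deriv_P_node: "i < n \<Longrightarrow> deriv (P n) (of_real (node i)) \<noteq> 0"
proof -
  assume i: "i < n"
  define Q where "Q = (\<lambda>z. \<Prod>j\<in>{..<n} - {i}. z - complex_of_real (node j))"
  have P: "P n = (\<lambda>z. (z - of_real (node i)) * Q z)"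
    unfolding P_def Q_def using i by (intro ext prod.remove) auto
  have "isCont Q (of_real (node i))" unfolding Q_def by (intro continuous_intros)
  moreover have "((\<lambda>z. z - complex_of_real (node i)) has_field_derivative 1) (at (of_real (node i)))"
    by (auto intro!: derivative_eq_intros)
  ultimately have "(P n has_field_derivative 1 * Q (of_real (node i))) (at (of_real (node i)))"
    unfolding P by (intro DERIV_mult_at_zero) auto
  then have "deriv (P n) (of_real (node i)) = Q (of_real (node i))" by (simp add: DERIV_imp_deriv)
  moreover have "Q (of_real (node i)) \<noteq> 0"
    unfolding Q_def using inj_eq[OF node_inj] by (auto simp flip: of_real_diff)
  ultimately show ?thesis by simp
qed

lemma L_ext: "hol_extension J W (L \<epsilon> n) (\<lambda>z. \<chi> k. of_real \<epsilon> * P n z * D k z)"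
  unfolding hol_extension_def
  by (auto simp: L_def P_val D_val intro!: holomorphic_on_mult holomorphic_on_const P_hol D_hol)

text \<open>\<open>complexify\<close> is an arbitrary choice among extensions; the identity theorem
  pins its values down on \<open>W\<close>.\<close>

lemma complexify_L: "z \<in> W \<Longrightarrow> complexify J W (L \<epsilon> n) z $ k = of_real \<epsilon> * P n z * D k z"
proof -
  assume z: "z \<in> W"
  have e: "hol_extension J W (L \<epsilon> n) (complexify J W (L \<epsilon> n))"
    unfolding complexify_def by (rule someI[of "hol_extension J W (L \<epsilon> n)", OF L_ext])
  have "complexify J W (L \<epsilon> n) z $ k - of_real \<epsilon> * P n z * D k z = 0"
  proof (rule identity[where g = "\<lambda>z. complexify J W (L \<epsilon> n) z $ k - of_real \<epsilon> * P n z * D k z", OF _ _ z])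
    show "(\<lambda>z. complexify J W (L \<epsilon> n) z $ k - of_real \<epsilon> * P n z * D k z) holomorphic_on W"
      using e unfolding hol_extension_def
      by (intro holomorphic_on_diff holomorphic_on_mult holomorphic_on_const P_hol D_hol) blast
    fix t assume t: "t \<in> {c..d}"
    then have tJ: "t \<in> J" "of_real t \<in> W" using I(2) I_W by auto
    have "complexify J W (L \<epsilon> n) (of_real t) $ k = of_real (L \<epsilon> n t $ k)"
      using e tJ unfolding hol_extension_def by blast
    then show "complexify J W (L \<epsilon> n) (of_real t) $ k - of_real \<epsilon> * P n (of_real t) * D k (of_real t) = 0"
      by (simp add: L_def P_val D_val[OF tJ])
  qed
  then show ?thesis by simp
qed

text \<open>A primitive of the field without the factor \<open>\<epsilon>\<close>, so that it can be
  bounded before \<open>\<epsilon>\<close> is chosen. Vanishing at \<open>c\<close> makes it real on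
  the interval.\<close>

definition H :: "nat \<Rightarrow> 3 \<Rightarrow> complex \<Rightarrow> complex" where
  "H n k = (SOME h. (\<forall>z\<in>W. (h has_field_derivative P n z * D k z) (at z)) \<and> h (of_real c) = 0)"

lemma H_deriv: "z \<in> W \<Longrightarrow> (H n k has_field_derivative P n z * D k z) (at z)" and H_c: "H n k (of_real c) = 0"
proof -
  have "(\<lambda>z. P n z * D k z) holomorphic_on W" by (intro holomorphic_on_mult P_hol D_hol)
  then obtain h where h: "\<And>z. z \<in> W \<Longrightarrow> (h has_field_derivative P n z * D k z) (at z)"
    using W_sc simply_connected_eq_global_primitive[OF W_open] by metis
  have "((\<lambda>z. h z - h (of_real c)) has_field_derivative P n z * D k z - 0) (at z)" if "z \<in> W" for z
    by (intro DERIV_diff DERIV_const h that)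
  then have ex: "\<exists>h. (\<forall>z\<in>W. (h has_field_derivative P n z * D k z) (at z)) \<and> h (of_real c) = 0"
    by (intro exI[of _ "\<lambda>z. h z - h (of_real c)"]) simp
  from someI_ex[OF ex]
  show "z \<in> W \<Longrightarrow> (H n k has_field_derivative P n z * D k z) (at z)" "H n k (of_real c) = 0"
    unfolding H_def by blast+
qed

lemma H_hol: "H n k holomorphic_on W"
  using H_deriv W_open by (auto simp: holomorphic_on_open)

text \<open>On the interval the derivative of \<open>H\<close> is real, so its imaginary part is
  constant there, and it vanishes at \<open>c\<close>; Schwarz reflection does the rest.\<close>

lemma H_cnj: "z \<in> W \<Longrightarrow> H n k (cnj z) = cnj (H n k z)"
proof (rule cnj_symmetric[OF H_hol])
  fix t assume t: "t \<in> {c..d}"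
  have "((\<lambda>s. Im (H n k (of_real s))) has_derivative (\<lambda>h. 0)) (at s within {c..d})" if s: "s \<in> {c..d}" for s
  proof -
    have sJ: "s \<in> J" "of_real s \<in> W" using s I(2) I_W by auto
    have "((\<lambda>x. H n k (of_real x)) has_vector_derivative P n (of_real s) * D k (of_real s)) (at s within {c..d})"
      by (rule has_vector_derivative_real_field[OF H_deriv[OF sJ(2)]])
    from bounded_linear.has_vector_derivative[OF bounded_linear_Im this]
    show ?thesis by (simp add: P_val D_val[OF sJ] has_vector_derivative_def)
  qed
  then obtain a where a: "\<forall>s\<in>{c..d}. Im (H n k (of_real s)) = a"
    using has_derivative_zero_constant[of "{c..d}" "\<lambda>s. Im (H n k (of_real s))"] by (auto simp: convex_real_interval)
  have "c \<in> {c..d}" using I(1) by simp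
  then have "a = 0" using a H_c by fastforce
  then show "Im (H n k (of_real t)) = 0" using a t by blast
qed

text \<open>The chosen path is irrelevant since \<open>H\<close> is a primitive. By symmetry the
  integral from \<open>cnj z\<close> to \<open>z\<close> is \<open>\<epsilon>\<close> times
  \<open>2 * \<i> * Im (H n k z)\<close>, which the factor \<open>- \<i> / 2\<close> turns into the
  real correction.\<close>

lemma X_max_eq:
  assumes z: "z \<in> W"
  shows "X_max J W \<gamma> (L \<epsilon> n) z $ k = Re (F z $ k) + \<epsilon> * Im (H n k z)"
proof -
  define g where "g = (SOME p. valid_path p \<and> path_image p \<subseteq> W \<and> pathstart p = cnj z \<and> pathfinish p = z)"
  have "\<exists>g. polynomial_function g \<and> path_image g \<subseteq> W \<and> pathstart g = cnj z \<and> pathfinish g = z"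
    by (rule connected_open_polynomial_connected[OF W_open W_conn cnj_W[OF z] z])
  then have "\<exists>p. valid_path p \<and> path_image p \<subseteq> W \<and> pathstart p = cnj z \<and> pathfinish p = z"
    using valid_path_polynomial_function by blast
  from someI_ex[OF this] have g: "valid_path g" "path_image g \<subseteq> W" "pathstart g = cnj z" "pathfinish g = z"
    unfolding g_def by blast+
  have "((\<lambda>z. of_real \<epsilon> * (P n z * D k z)) has_contour_integral
      of_real \<epsilon> * H n k (pathfinish g) - of_real \<epsilon> * H n k (pathstart g)) g"
    by (rule contour_integral_primitive[OF _ g(1,2)])
      (rule has_field_derivative_at_within, rule DERIV_cmult, erule H_deriv)
  then have "contour_integral g (\<lambda>z. of_real \<epsilon> * (P n z * D k z)) = of_real \<epsilon> * H n k z - of_real \<epsilon> * cnj (H n k z)"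
    using H_cnj[OF z] by (simp add: g contour_integral_unique)
  moreover have "contour_integral g (\<lambda>w. complexify J W (L \<epsilon> n) w $ k) = contour_integral g (\<lambda>z. of_real \<epsilon> * (P n z * D k z))"
    by (rule contour_integral_cong[OF refl]) (use g(2) complexify_L in \<open>auto simp: mult.assoc\<close>)
  ultimately have i: "integral_in W (cnj z) z (\<lambda>w. complexify J W (L \<epsilon> n) w $ k) =
      of_real \<epsilon> * H n k z - of_real \<epsilon> * cnj (H n k z)"
    unfolding integral_in_def g_def by simp
  show ?thesis
    unfolding X_max_def vec_lambda_beta i F_def[symmetric] using F_cnj[OF z] by simp
qed

lemma L_0: "L 0 n = (\<lambda>_. 0)"
  by (simp add: L_def fun_eq_iff)

text \<open>The surface is the real part of \<open>G = F - \<i> \<epsilon> H\<close>, whose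
  derivative is that of \<open>F\<close> times \<open>m = 1 - \<i> \<epsilon> P\<close>. Hence the
  Gauss map stays the same and only the density of the holomorphic form is multiplied by
  \<open>m\<close>; the bound on \<open>\<epsilon> P\<close> excludes zeros of \<open>m\<close>, so
  no new branch points arise.\<close>

lemma maxface_L:
  assumes mf: "maxface (X_max J W \<gamma> (\<lambda>_. 0)) \<Omega>" and \<Omega>: "\<Omega> \<subseteq> W"
    and small: "\<And>z. z \<in> \<Omega> \<Longrightarrow> cmod (of_real \<epsilon> * P n z) < 1"
  shows "maxface (X_max J W \<gamma> (L \<epsilon> n)) \<Omega>"
proof -
  define G where "G = (\<lambda>k z. F z $ k - \<i> * of_real \<epsilon> * H n k z)"
  define m where "m = (\<lambda>z. 1 - \<i> * (of_real \<epsilon> * P n z))"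
  have gms: "generalized_maximal_surface (X_max J W \<gamma> (\<lambda>_. 0)) \<Omega>" and wz: "\<And>z. z \<in> \<Omega> \<Longrightarrow> wirtinger (X_max J W \<gamma> (\<lambda>_. 0)) z \<noteq> 0"
    using mf by (auto simp: maxface_def)
  have o\<Omega>: "open \<Omega>" using gms by (simp add: generalized_maximal_surface_def)
  have dF: "((\<lambda>z. F z $ k) has_field_derivative D k z) (at z)" if "z \<in> W" for k z
    by (rule holomorphic_derivI[OF F_hol W_open that])
  have dG: "(G k has_field_derivative m z * D k z) (at z)" if "z \<in> W" for k z
  proof -
    have "(G k has_field_derivative D k z - \<i> * of_real \<epsilon> * (P n z * D k z)) (at z)"
      unfolding G_def by (intro DERIV_diff DERIV_cmult dF H_deriv that)
    then show ?thesis by (rule DERIV_cong) (simp add: m_def algebra_simps)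
  qed
  have X0: "X_max J W \<gamma> (\<lambda>_. 0) z $ k = Re (F z $ k)" if "z \<in> W" for z k
    using X_max_eq[OF that, of 0 0 k] by (simp add: L_0)
  have XL: "X_max J W \<gamma> (L \<epsilon> n) z $ k = Re (G k z)" if "z \<in> W" for z k
    using X_max_eq[OF that] by (simp add: G_def)
  have m0: "m z \<noteq> 0" if "z \<in> \<Omega>" for z
  proof
    assume "m z = 0"
    then have "\<i> * (of_real \<epsilon> * P n z) = 1" by (simp add: m_def)
    then have "cmod (of_real \<epsilon> * P n z) = 1" by (metis norm_ii norm_mult norm_one mult_1)
    then show False using small[OF that] by simp
  qed
  have "wirtinger (X_max J W \<gamma> (L \<epsilon> n)) z \<noteq> 0" if z: "z \<in> \<Omega>" for z
  proof -
    have zW: "z \<in> W" using z \<Omega> by blast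
    have "wirtinger (X_max J W \<gamma> (\<lambda>_. 0)) z = (\<chi> k. D k z / 2)"
      by (rule wirtinger_Re[OF W_open zW X0 dF[OF zW]])
    then have "\<not> (\<forall>k. D k z = 0)" using wz[OF z] by (metis (no_types) div_0 vec_eq_iff vec_lambda_beta zero_index)
    then obtain k where "D k z \<noteq> 0" by blast
    have w: "wirtinger (X_max J W \<gamma> (L \<epsilon> n)) z = (\<chi> k. m z * D k z / 2)"
      by (rule wirtinger_Re[OF W_open zW XL dG[OF zW]])
    have "wirtinger (X_max J W \<gamma> (L \<epsilon> n)) z $ k \<noteq> 0"
      unfolding w vec_lambda_beta using m0[OF z] \<open>D k z \<noteq> 0\<close> by simp
    then show ?thesis by (rule contrapos_nn) simp
  qed
  moreover have "generalized_maximal_surface (X_max J W \<gamma> (L \<epsilon> n)) \<Omega>"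
    unfolding generalized_maximal_surface_def
  proof (intro conjI ballI o\<Omega>)
    fix x assume "x \<in> \<Omega>"
    then have "\<exists>U g f (F0 :: complex \<Rightarrow> complex ^ 3). open U \<and> connected U \<and> x \<in> U \<and> U \<subseteq> \<Omega> \<and>
        g meromorphic_on U \<and> f holomorphic_on U \<and> not_unimodular_on g U \<and>
        (\<forall>k. (\<lambda>z. F0 z $ k) holomorphic_on U) \<and>
        (\<forall>z\<in>U. g analytic_on {z} \<longrightarrow> (\<forall>k. deriv (\<lambda>w. F0 w $ k) z = weierstrass_density (g z) (f z) $ k)) \<and>
        (\<forall>z\<in>U. \<forall>k. X_max J W \<gamma> (\<lambda>_. 0) z $ k = Re (F0 z $ k))"
      by (rule bspec[OF conjunct2[OF gms[unfolded generalized_maximal_surface_def]]])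
    then obtain U g f and F0 :: "complex \<Rightarrow> complex ^ 3" where C: "open U \<and> connected U \<and> x \<in> U \<and> U \<subseteq> \<Omega> \<and>
        g meromorphic_on U \<and> f holomorphic_on U \<and> not_unimodular_on g U \<and>
        (\<forall>k. (\<lambda>z. F0 z $ k) holomorphic_on U) \<and>
        (\<forall>z\<in>U. g analytic_on {z} \<longrightarrow> (\<forall>k. deriv (\<lambda>w. F0 w $ k) z = weierstrass_density (g z) (f z) $ k)) \<and>
        (\<forall>z\<in>U. \<forall>k. X_max J W \<gamma> (\<lambda>_. 0) z $ k = Re (F0 z $ k))"
      by (elim exE) (rule that)
    have U: "open U" "connected U" "x \<in> U" "U \<subseteq> \<Omega>" and g: "g meromorphic_on U"
      and f: "f holomorphic_on U" and nu: "not_unimodular_on g U"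
      using C by blast+
    have dens: "deriv (\<lambda>w. F0 w $ k) z = weierstrass_density (g z) (f z) $ k" if "z \<in> U" "g analytic_on {z}" for z k
      using C that by simp
    have F0: "(\<lambda>z. F0 z $ k) holomorphic_on U" for k using C by (elim conjE) (erule spec)
    have X: "X_max J W \<gamma> (\<lambda>_. 0) z $ k = Re (F0 z $ k)" if "z \<in> U" for z k using C that by simp
    have UW: "U \<subseteq> W" using U \<Omega> by blast
    \<comment> \<open>The primitive supplied by the Weierstrass representation and \<open>F\<close>
      have the same real part, so their derivatives agree; this transfers the representation to
      \<open>F\<close>.\<close>
    have DF0: "D k z = deriv (\<lambda>w. F0 w $ k) z" if z: "z \<in> U" for k z
    proof -
      have "((\<lambda>w. F w $ k - F0 w $ k) has_field_derivative D k z - deriv (\<lambda>w. F0 w $ k) z) (at z)"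
        by (intro DERIV_diff dF holomorphic_derivI[OF F0 U(1) z]) (use z UW in blast)
      from deriv_zero_of_Re_zero[OF U(1) z this] show ?thesis
        using X X0 UW by fastforce
    qed
    have ws: "weierstrass_density a (b * e) $ k = b * weierstrass_density a e $ k" for a b e k
      using exhaust_3[of k] by (auto simp: weierstrass_density_def)
    have mh: "m holomorphic_on U" unfolding m_def by (intro holomorphic_intros P_hol)
    show "\<exists>U g f (F :: complex \<Rightarrow> complex ^ 3).
        open U \<and> connected U \<and> x \<in> U \<and> U \<subseteq> \<Omega> \<and> g meromorphic_on U \<and> f holomorphic_on U \<and> not_unimodular_on g U \<and>
        (\<forall>k. (\<lambda>z. F z $ k) holomorphic_on U) \<and>
        (\<forall>z\<in>U. g analytic_on {z} \<longrightarrow> (\<forall>k. deriv (\<lambda>w. F w $ k) z = weierstrass_density (g z) (f z) $ k)) \<and>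
        (\<forall>z\<in>U. \<forall>k. X_max J W \<gamma> (L \<epsilon> n) z $ k = Re (F z $ k))"
    proof (rule exI[of _ U], rule exI[of _ g], rule exI[of _ "\<lambda>z. m z * f z"], rule exI[of _ "\<lambda>z. \<chi> k. G k z"],
        intro conjI ballI allI impI)
      show "(\<lambda>z. m z * f z) holomorphic_on U" by (intro holomorphic_on_mult mh f)
      show "(\<lambda>z. (\<chi> k. G k z) $ k) holomorphic_on U" for k
        using dG UW U(1) by (auto simp: holomorphic_on_open)
      show "deriv (\<lambda>w. (\<chi> k. G k w) $ k) z = weierstrass_density (g z) (m z * f z) $ k"
        if "z \<in> U" "g analytic_on {z}" for z k
        using DERIV_imp_deriv[OF dG[of z k]] that UW by (auto simp: ws DF0 dens)
      show "X_max J W \<gamma> (L \<epsilon> n) z $ k = Re ((\<chi> k. G k z) $ k)" if "z \<in> U" for z k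
        using XL that UW by auto
    qed (use U g nu in auto)
  qed
  ultimately show ?thesis by (simp add: maxface_def)
qed

lemma \<gamma>_locally_hol: "locally_hol \<gamma> J" and v_locally_hol: "locally_hol v J"
  and \<gamma>_deriv: "t \<in> J \<Longrightarrow> (\<gamma> has_vector_derivative v t) (at t)"
proof -
  show *: "locally_hol \<gamma> J" by (rule real_analytic_imp_locally_hol[OF J(1) \<gamma>(1)])
  show "locally_hol v J" by (rule locally_hol_velocity(2)[OF *])
  show "t \<in> J \<Longrightarrow> (\<gamma> has_vector_derivative v t) (at t)" by (rule locally_hol_velocity(1)[OF *])
qed

text \<open>The field is a multiple of the velocity, so its nullity and its orthogonality to the
  velocity both reduce to nullity of the curve. Analyticity is inherited through local extensions,
  the factor being an entire function.\<close>

lemma singular_data: "singular_bjorling_data J \<gamma> (L \<epsilon> n)"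
  unfolding singular_bjorling_data_def
proof (intro conjI)
  have "(\<lambda>z. of_real \<epsilon> * P n z) holomorphic_on UNIV" by (intro holomorphic_on_mult holomorphic_on_const P_hol)
  then have "locally_hol (\<lambda>t. (\<epsilon> * p n t) *\<^sub>R v t) J"
    by (rule locally_hol_scaleR[OF v_locally_hol]) (simp add: P_val)
  then show "real_analytic_on (L \<epsilon> n) J"
    using locally_hol_imp_real_analytic unfolding L_def by (simp add: L_def[abs_def])
  have n: "null_vector (v t)" if "t \<in> J" for t using \<gamma>(2) that by (simp add: null_curve_on_def)
  then show "null_field_on (L \<epsilon> n) J"
    by (simp add: null_field_on_def L_def null_vector_scaleR)
  show "\<forall>t\<in>J. lorentz (v t) (L \<epsilon> n t) = 0"
  proof
    fix t assume "t \<in> J"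
    have "lorentz (v t) (L \<epsilon> n t) = \<epsilon> * p n t * lorentz (v t) (v t)"
      by (simp add: L_def lorentz_def algebra_simps)
    then show "lorentz (v t) (L \<epsilon> n t) = 0" using n[OF \<open>t \<in> J\<close>] by (simp add: null_vector_def)
  qed
  have "v c \<noteq> 0" using v_nondeg(1)[of c] I(1) by auto
  then show "(\<exists>t\<in>J. v t \<noteq> 0) \<or> (\<exists>t\<in>J. L \<epsilon> n t \<noteq> 0)" using I by (meson atLeastAtMost_iff less_eq_real_def subsetD)
qed (use \<gamma> in auto)

text \<open>The scalar factor of the field cancels, so velocity and field have the same quotient. If
  this quotient were unimodular wherever analytic, its modulus would be 1 on a disc around
  \<open>c\<close>, which forces its derivative at \<open>c\<close> to vanish; but then velocity and
  acceleration at \<open>c\<close> would be parallel, against nondegeneracy.\<close>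

lemma gauss_map:
  shows "bjorling_gauss_map J W \<gamma> (L \<epsilon> n) (\<lambda>z. (D 1 z + \<i> * D 2 z) / D 3 z)"
    and "not_unimodular_on (\<lambda>z. (D 1 z + \<i> * D 2 z) / D 3 z) W"
proof -
  let ?g = "\<lambda>z. (D 1 z + \<i> * D 2 z) / D 3 z"
  have "(\<lambda>z. D 1 z + \<i> * D 2 z) holomorphic_on W" by (intro holomorphic_on_add holomorphic_on_mult holomorphic_on_const D_hol)
  then have "?g meromorphic_on W"
    using D_hol[of 3] W_open by (intro meromorphic_on_divide analytic_on_imp_meromorphic_on) (simp_all add: analytic_on_open)
  moreover have "?g (of_real t) = Complex (v t $ 1) (v t $ 2) / of_real (v t $ 3)" if "t \<in> J" "of_real t \<in> W" for t
    by (simp add: D_val[OF that] Complex_eq)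
  moreover have "Complex (L \<epsilon> n t $ 1) (L \<epsilon> n t $ 2) / of_real (L \<epsilon> n t $ 3) = Complex (v t $ 1) (v t $ 2) / of_real (v t $ 3)"
    if "L \<epsilon> n t $ 3 \<noteq> 0" for t
  proof -
    have "Complex (L \<epsilon> n t $ 1) (L \<epsilon> n t $ 2) = of_real (\<epsilon> * p n t) * Complex (v t $ 1) (v t $ 2)"
      by (simp add: L_def complex_eq_iff)
    moreover have "\<epsilon> * p n t \<noteq> 0" using that by (auto simp: L_def)
    then have "complex_of_real (\<epsilon> * p n t) \<noteq> 0" by (simp only: of_real_eq_0_iff not_False_eq_True)
    moreover have "complex_of_real (L \<epsilon> n t $ 3) = of_real (\<epsilon> * p n t) * of_real (v t $ 3)" by (simp add: L_def)
    ultimately show ?thesis by (simp only: mult_divide_mult_cancel_left not_False_eq_True)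
  qed
  ultimately show "bjorling_gauss_map J W \<gamma> (L \<epsilon> n) ?g"
    unfolding bjorling_gauss_map_def by simp
  have cI: "c \<in> {c..d}" using I(1) by simp
  then have cJ: "c \<in> J" "of_real c \<in> W" using I(2) I_W by auto
  let ?c = "complex_of_real c"
  have D3: "D 3 ?c \<noteq> 0" using v_nondeg(1)[OF cI] by (simp add: D_val[OF cJ])
  have "isCont (D 3) ?c"
    using holomorphic_on_imp_continuous_on[OF D_hol] W_open cJ(2) by (simp add: continuous_on_eq_continuous_at)
  then have "\<forall>\<^sub>F z in nhds ?c. D 3 z \<noteq> 0"
    by (intro isCont_eventually[where f = "D 3" and P = "\<lambda>x. x \<noteq> 0"] t1_space_nhds D3)
  moreover have "\<forall>\<^sub>F z in nhds ?c. z \<in> W" by (rule eventually_nhds_in_open[OF W_open cJ(2)])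
  ultimately have "\<forall>\<^sub>F z in nhds ?c. z \<in> W \<and> D 3 z \<noteq> 0" by eventually_elim simp
  then obtain r where r: "r > 0" "\<And>z. z \<in> ball ?c r \<Longrightarrow> z \<in> W \<and> D 3 z \<noteq> 0"
    unfolding eventually_nhds_metric by (auto simp: dist_commute)
  have gh: "?g holomorphic_on ball ?c r"
    using r(2) by (intro holomorphic_on_divide holomorphic_on_add holomorphic_on_mult holomorphic_on_const
        holomorphic_on_subset[OF D_hol]) auto
  show "not_unimodular_on ?g W"
  proof (rule ccontr)
    assume nu: "\<not> not_unimodular_on ?g W"
    have an: "?g analytic_on {z}" if "z \<in> ball ?c r" for z
      using gh that by (meson analytic_on_holomorphic empty_subsetI insert_subset open_ball)
    then have uni: "cmod (?g z) = 1" if "z \<in> ball ?c r" for z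
      using nu r(2)[OF that] an[OF that] that unfolding not_unimodular_on_def by blast
    have dg: "(?g has_field_derivative ((deriv (D 1) ?c + \<i> * deriv (D 2) ?c) * D 3 ?c - (D 1 ?c + \<i> * D 2 ?c) * deriv (D 3) ?c) /
        (D 3 ?c * D 3 ?c)) (at ?c)" (is "(_ has_field_derivative ?g') _")
      by (intro DERIV_divide DERIV_add DERIV_cmult holomorphic_derivI[OF D_hol W_open cJ(2)] D3)
    \<comment> \<open>The squared modulus is constant on the disc; its derivative in every complex
      direction vanishes, and testing with two directions isolates the derivative of the
      quotient.\<close>
    have "((\<lambda>z. Re (?g z * cnj (?g z))) has_derivative (\<lambda>h. Re (?g ?c * cnj (?g' * h) + ?g' * h * cnj (?g ?c)))) (at ?c)"
      using dg unfolding has_field_derivative_def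
      by (intro bounded_linear.has_derivative[OF bounded_linear_Re] has_derivative_mult has_derivative_cnj)
    then have "((\<lambda>z. 1) has_derivative (\<lambda>h. Re (?g ?c * cnj (?g' * h) + ?g' * h * cnj (?g ?c)))) (at ?c)"
    proof (rule has_derivative_transform_within_open[of _ _ _ _ "ball ?c r"])
      show "Re (?g z * cnj (?g z)) = 1" if "z \<in> ball ?c r" for z
        using uni[OF that] by (simp only: complex_norm_square[symmetric] Re_complex_of_real, simp)
    qed (use r in auto)
    from has_derivative_unique[OF this has_derivative_const]
    have z: "Re (?g ?c * cnj (?g' * h) + ?g' * h * cnj (?g ?c)) = 0" for h by meson
    have orth: "x * cnj a = 0" if "\<And>h. Re (a * cnj (x * h) + x * h * cnj a) = 0" for a x :: complex
    proof -
      have r: "Re (a * cnj b + b * cnj a) = 2 * Re (b * cnj a)" for b by simp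
      have "Re (x * h * cnj a) = 0" for h using that[of h] r[of "x * h"] by linarith
      then have "Re (x * cnj a * h) = 0" for h by (simp only: mult_ac)
      from this[of 1] this[of "- \<i>"] show ?thesis by (simp add: complex_eq_iff)
    qed
    have "?g' * cnj (?g ?c) = 0" by (rule orth) (rule z)
    moreover have "?g ?c \<noteq> 0" using uni[of ?c] r(1) by auto
    ultimately have g'0: "?g' = 0" unfolding mult_eq_0_iff complex_cnj_zero_iff by blast
    define w where "w = velocity v c"
    have e: "(deriv (D 1) ?c + \<i> * deriv (D 2) ?c) * D 3 ?c - (D 1 ?c + \<i> * D 2 ?c) * deriv (D 3) ?c = 0"
      using g'0 D3 by simp
    have "Re ((deriv (D 1) ?c + \<i> * deriv (D 2) ?c) * D 3 ?c - (D 1 ?c + \<i> * D 2 ?c) * deriv (D 3) ?c) = w $ 1 * v c $ 3 - v c $ 1 * w $ 3"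
      "Im ((deriv (D 1) ?c + \<i> * deriv (D 2) ?c) * D 3 ?c - (D 1 ?c + \<i> * D 2 ?c) * deriv (D 3) ?c) = w $ 2 * v c $ 3 - v c $ 2 * w $ 3"
      unfolding D_val[OF cJ] DD_val[OF cJ] w_def by simp_all
    then have "w $ 1 * v c $ 3 = v c $ 1 * w $ 3" "w $ 2 * v c $ 3 = v c $ 2 * w $ 3"
      unfolding e by simp_all
    then have "v c $ 3 * (v c $ 1 * w $ 2 - v c $ 2 * w $ 1) = 0" by algebra
    then show False using v_nondeg[OF cI] unfolding w_def by simp
  qed
qed

lemma data_max: "bjorling_data_max {c..d} J W \<gamma> (L \<epsilon> n)"
  unfolding bjorling_data_max_def extends_hol_def
  using singular_data W F_ext L_ext gauss_map by blast

text \<open>A single parameter suffices to distinguish the field from both signs of the velocity: at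
  \<open>c\<close> the velocity is nonzero and the factor has modulus below 1.\<close>

lemma data_min:
  assumes "\<bar>\<epsilon> * p n c\<bar> < 1"
  shows "bjorling_data_min J \<gamma> (L \<epsilon> n)"
proof -
  have cI: "c \<in> {c..d}" "c \<in> J" using I by auto
  have "v c \<noteq> 0" using v_nondeg(1)[OF cI(1)] by auto
  then have "(1 - \<epsilon> * p n c) *\<^sub>R v c \<noteq> 0" "(1 + \<epsilon> * p n c) *\<^sub>R v c \<noteq> 0" using assms by auto
  then have "v c \<noteq> L \<epsilon> n c" "v c \<noteq> - L \<epsilon> n c"
    by (auto simp: L_def scaleR_left_diff_distrib scaleR_left_distrib eq_neg_iff_add_eq_0)
  then show ?thesis using singular_data cI(2) unfolding bjorling_data_min_def by blast
qed

lemma bjorling: "bjorling_hol W F (\<lambda>z. \<chi> k. of_real \<epsilon> * H n k z) (\<lambda>z. of_real \<epsilon> * P n z)"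
proof
  show "((\<lambda>z. (\<chi> k. of_real \<epsilon> * H n k z) $ k) has_field_derivative of_real \<epsilon> * P n z * D k z) (at z)" if "z \<in> W" for k z
    using DERIV_cmult[OF H_deriv[OF that], of "of_real \<epsilon>"] by (simp add: mult.assoc)
qed (use W_open W_cnj F_hol F_cnj H_cnj D_null in \<open>auto intro!: holomorphic_on_mult holomorphic_on_const P_hol\<close>)

text \<open>The case \<open>\<kappa> = \<i>\<close>, in which \<open>\<kappa>\<^sup>2\<close> minus
  the square of the real factor is at most -1, so the classification applies for every positive
  \<open>\<epsilon>\<close>. The map \<open>l\<close> identifies the real plane with the complex
  one; there \<open>u - \<kappa> v\<close> becomes the conjugate of
  \<open>u + \<kappa> v\<close>.\<close>

lemma crosscap_max:
  assumes t: "t \<in> {c..d}" and \<epsilon>: "\<epsilon> > 0"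
  shows "cuspidal_crosscap_at (X_max J W \<gamma> (L \<epsilon> n)) (of_real t) \<longleftrightarrow> t \<in> node ` {..<n}"
proof -
  interpret B: bjorling_hol W F "\<lambda>z. \<chi> k. of_real \<epsilon> * H n k z" "\<lambda>z. of_real \<epsilon> * P n z" by (rule bjorling)
  have tJ: "t \<in> J" "of_real t \<in> W" using t I(2) I_W by auto
  define l where "l = (\<lambda>q :: real \<times> real. Complex (fst q) (snd q))"
  define l' where "l' = (\<lambda>z. (Re z, Im z))"
  have "l = (\<lambda>q. of_real (fst q) + \<i> * of_real (snd q))" by (simp add: l_def fun_eq_iff Complex_eq)
  then have bl: "bounded_linear l"
    by (simp add: bounded_linear_add bounded_linear_const_mult bounded_linear_compose[OF bounded_linear_of_real bounded_linear_fst]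
        bounded_linear_compose[OF bounded_linear_of_real bounded_linear_snd])
  have bl': "bounded_linear l'" unfolding l'_def by (intro bounded_linear_Pair bounded_linear_Re bounded_linear_Im)
  have inv: "l' (l q) = q" "l (l' z) = z" for q z by (simp_all add: l_def l'_def)
  let ?X = "\<lambda>q. X_max J W \<gamma> (L \<epsilon> n) (of_real t + l q)"
  have "isCont (\<lambda>q. complex_of_real t + l q) 0" by (intro continuous_intros isCont_bounded_linear bl)
  moreover have "l 0 = 0" by (simp add: l_def complex_eq_iff)
  ultimately have "\<forall>\<^sub>F q in nhds 0. of_real t + l q \<in> W"
    using isCont_eventually[where f = "\<lambda>q. complex_of_real t + l q" and a = 0 and P = "\<lambda>z. z \<in> W"]
      eventually_nhds_in_open[OF W_open tJ(2)] by simp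
  then have X: "\<forall>\<^sub>F q in nhds 0. \<forall>k. of_real (?X q $ k) =
      (F (of_real t + fst (emb q) + \<i> * snd (emb q)) $ k + F (of_real t + fst (emb q) - \<i> * snd (emb q)) $ k) / 2 +
      ((\<chi> k. of_real \<epsilon> * H n k (of_real t + fst (emb q) + \<i> * snd (emb q))) $ k - (\<chi> k. of_real \<epsilon> * H n k (of_real t + fst (emb q) - \<i> * snd (emb q))) $ k) / (2 * \<i>)"
  proof eventually_elim
    case (elim q)
    let ?z = "of_real t + l q"
    have z: "of_real t + fst (emb q) + \<i> * snd (emb q) = ?z" "of_real t + fst (emb q) - \<i> * snd (emb q) = cnj ?z"
      by (simp_all add: emb_def l_def complex_eq_iff)
    have "complex_of_real (Re a + \<epsilon> * Im b) = (a + cnj a) / 2 + (of_real \<epsilon> * b - of_real \<epsilon> * cnj b) / (2 * \<i>)" for a b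
      by (simp add: complex_eq_iff)
    then show ?case
      unfolding z using X_max_eq[OF elim] F_cnj[OF elim] H_cnj[OF elim] by simp
  qed
  have lam: "of_real \<epsilon> * P n (of_real t) = of_real (\<epsilon> * p n t)" by (simp add: P_val)
  have "Re (\<i>\<^sup>2) = - 1" by simp
  then have ne: "Re (\<i>\<^sup>2) - (\<epsilon> * p n t)\<^sup>2 \<noteq> 0" using zero_le_power2[of "\<epsilon> * p n t"] by linarith
  note cl = B.germ_classification[where \<kappa> = \<i> and v = "v t" and w = "velocity v t", OF _ tJ(2) D_val[OF tJ] DD_val[OF tJ]
      v_nondeg[OF t] lam ne X]
  show ?thesis
  proof (cases "p n t = 0")
    case False
    then have "\<epsilon> * p n t \<noteq> 0" using \<epsilon> by simp
    then obtain N where "open N" "0 \<in> N" "inj_on ?X N" using cl(1) by blast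
    from affine_germ_injective[OF bl bl' inv this] show ?thesis using False p_zero_iff by blast
  next
    case True
    then obtain i where i: "i < n" "t = node i" using p_zero_iff by blast
    have "deriv (\<lambda>z. of_real \<epsilon> * P n z) (of_real t) = of_real \<epsilon> * deriv (P n) (of_real t)"
      by (intro DERIV_imp_deriv DERIV_cmult holomorphic_derivI[OF P_hol open_UNIV UNIV_I])
    then have "deriv (\<lambda>z. of_real \<epsilon> * P n z) (of_real t) \<noteq> 0" using deriv_P_node[OF i(1)] \<epsilon> i(2) by simp
    then have "cuspidal_crosscap_at ?X 0" using cl(2) True by simp
    from affine_germ_crosscap[OF bl bl' inv this] show ?thesis using True p_zero_iff by blast
  qed
qed

end

text \<open>The time-like side. The parameters \<open>u + v\<close> and \<open>u - v\<close> may
  leave \<open>W\<close>, so the field is integrated by a real primitive on a compact subinterval of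
  \<open>J\<close> that contains the given interval in its interior.\<close>

locale null_curve_setting2 = null_curve_setting +
  fixes A B :: real
  assumes AB: "{A..B} \<subseteq> J" "A < c" "d < B"
begin

definition \<Lambda> :: "nat \<Rightarrow> real \<Rightarrow> real ^ 3" where "\<Lambda> n t = integral {A..t} (\<lambda>s. p n s *\<^sub>R v s)"

lemma pv_continuous: "continuous_on {A..B} (\<lambda>s. p n s *\<^sub>R v s)"
proof -
  have "continuous_on {A..B} v"
    by (rule continuous_on_subset[OF continuous_on_smooth[OF smooth_on_locally_hol[OF v_locally_hol J(1)]] AB(1)])
  then show ?thesis unfolding p_def by (intro continuous_intros)
qed

lemma \<Lambda>_within: "t \<in> {A..B} \<Longrightarrow> (\<Lambda> n has_vector_derivative p n t *\<^sub>R v t) (at t within {A..B})"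
  unfolding \<Lambda>_def[abs_def] by (rule integral_has_vector_derivative[OF pv_continuous])

lemma \<Lambda>_deriv: "t \<in> {A<..<B} \<Longrightarrow> (\<Lambda> n has_vector_derivative p n t *\<^sub>R v t) (at t)"
  using \<Lambda>_within[of t n] at_within_interior[of t "{A..B}"] by (simp add: interior_atLeastAtMost_real)

lemma X_min_eq:
  assumes "a + b \<in> {A<..<B}" "a - b \<in> {A<..<B}"
  shows "X_min \<gamma> (L \<epsilon> n) (a, b) = (1 / 2) *\<^sub>R (\<gamma> (a + b) + \<epsilon> *\<^sub>R \<Lambda> n (a + b)) + (1 / 2) *\<^sub>R (\<gamma> (a - b) - \<epsilon> *\<^sub>R \<Lambda> n (a - b))"
proof -
  \<comment> \<open>The integral is oriented and \<open>b\<close> may be negative, hence the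
    symmetric description of the segment.\<close>
  have sub: "{min (a - b) (a + b)..max (a - b) (a + b)} \<subseteq> {A..B}" using assms by auto
  have "continuous_on {A..B} (L \<epsilon> n)"
    using continuous_on_scaleR[OF continuous_on_const pv_continuous, of \<epsilon> n] by (simp add: L_def[abs_def])
  then have c: "continuous_on {min (a - b) (a + b)..max (a - b) (a + b)} (L \<epsilon> n)"
    by (rule continuous_on_subset[OF _ sub])
  have i: "(LBINT s=a - b..a + b. L \<epsilon> n s) = \<epsilon> *\<^sub>R \<Lambda> n (a + b) - \<epsilon> *\<^sub>R \<Lambda> n (a - b)"
  proof (rule interval_integral_FTC_finite[OF c])
    fix x assume "min (a - b) (a + b) \<le> x" "x \<le> max (a - b) (a + b)"
    then have "x \<in> {A<..<B}" using assms by auto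
    from bounded_linear.has_vector_derivative[OF bounded_linear_scaleR_right \<Lambda>_deriv[OF this], of \<epsilon> n]
    show "((\<lambda>t. \<epsilon> *\<^sub>R \<Lambda> n t) has_vector_derivative L \<epsilon> n x) (at x within {min (a - b) (a + b)..max (a - b) (a + b)})"
      by (simp add: L_def has_vector_derivative_at_within)
  qed
  show ?thesis
    unfolding X_min_def prod.case i by (simp add: algebra_simps)
qed

lemma X_min_zero: "X_min \<gamma> (\<lambda>_. 0) = (\<lambda>q. (1 / 2) *\<^sub>R \<gamma> (fst q + snd q) + (1 / 2) *\<^sub>R \<gamma> (fst q - snd q))"
  by (simp add: X_min_def fun_eq_iff scaleR_add_right)

text \<open>The two null curves of the new surface have velocities
  \<open>(1 + \<epsilon> p) / 2\<close> and \<open>(1 - \<epsilon> p) / 2\<close> times that of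
  \<open>\<gamma>\<close>; the bound keeps both factors nonzero on the whole parameter
  range.\<close>

lemma minface_L:
  assumes mf: "minface (X_min \<gamma> (\<lambda>_. 0)) \<Omega>" and \<Omega>: "\<Omega> \<subseteq> diamond J" "open \<Omega>"
    and S: "\<And>q. q \<in> \<Omega> \<Longrightarrow> fst q + snd q \<in> {A<..<B} \<and> fst q - snd q \<in> {A<..<B}"
    and small: "\<And>t. t \<in> {A..B} \<Longrightarrow> \<bar>\<epsilon> * p n t\<bar> < 1"
  shows "minface (X_min \<gamma> (L \<epsilon> n)) \<Omega>"
proof -
  let ?\<alpha> = "\<lambda>t. (1 / 2) *\<^sub>R (\<gamma> t + \<epsilon> *\<^sub>R \<Lambda> n t)" and ?\<beta> = "\<lambda>t. (1 / 2) *\<^sub>R (\<gamma> t - \<epsilon> *\<^sub>R \<Lambda> n t)"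
  have SJ: "{A<..<B} \<subseteq> J" using AB(1) by auto
  have d: "(?\<alpha> has_vector_derivative ((1 + \<epsilon> * p n t) / 2) *\<^sub>R v t) (at t)"
    "(?\<beta> has_vector_derivative ((1 - \<epsilon> * p n t) / 2) *\<^sub>R v t) (at t)" if t: "t \<in> {A<..<B}" for t
  proof -
    have l: "((\<lambda>t. \<epsilon> *\<^sub>R \<Lambda> n t) has_vector_derivative \<epsilon> *\<^sub>R (p n t *\<^sub>R v t)) (at t)"
      by (rule bounded_linear.has_vector_derivative[OF bounded_linear_scaleR_right \<Lambda>_deriv[OF t]])
    have g: "(\<gamma> has_vector_derivative v t) (at t)" using \<gamma>_deriv SJ t by blast
    have "(?\<alpha> has_vector_derivative (1 / 2) *\<^sub>R (v t + \<epsilon> *\<^sub>R (p n t *\<^sub>R v t))) (at t)"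
      by (rule bounded_linear.has_vector_derivative[OF bounded_linear_scaleR_right has_vector_derivative_add[OF g l]])
    moreover have "(?\<beta> has_vector_derivative (1 / 2) *\<^sub>R (v t - \<epsilon> *\<^sub>R (p n t *\<^sub>R v t))) (at t)"
      by (rule bounded_linear.has_vector_derivative[OF bounded_linear_scaleR_right has_vector_derivative_diff[OF g l]])
    moreover have "(1 / 2) *\<^sub>R (v t + \<epsilon> *\<^sub>R (p n t *\<^sub>R v t)) = ((1 + \<epsilon> * p n t) / 2) *\<^sub>R v t"
      "(1 / 2) *\<^sub>R (v t - \<epsilon> *\<^sub>R (p n t *\<^sub>R v t)) = ((1 - \<epsilon> * p n t) / 2) *\<^sub>R v t"
      by (simp_all add: vec_eq_iff field_simps)
    ultimately show "(?\<alpha> has_vector_derivative ((1 + \<epsilon> * p n t) / 2) *\<^sub>R v t) (at t)"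
      "(?\<beta> has_vector_derivative ((1 - \<epsilon> * p n t) / 2) *\<^sub>R v t) (at t)" by simp_all
  qed
  have smJ: "smooth_on (\<lambda>t. ((1 + e * p n t) / 2) *\<^sub>R v t) J" for e
  proof (rule smooth_on_locally_hol[OF _ J(1)])
    have "(\<lambda>z. (1 + of_real e * P n z) / 2) holomorphic_on UNIV"
      by (intro holomorphic_on_divide holomorphic_on_add holomorphic_on_mult holomorphic_on_const P_hol) simp
    then show "locally_hol (\<lambda>t. ((1 + e * p n t) / 2) *\<^sub>R v t) J"
      by (rule locally_hol_scaleR[OF v_locally_hol]) (simp add: P_val)
  qed
  have smJ': "smooth_on (\<lambda>t. ((1 - \<epsilon> * p n t) / 2) *\<^sub>R v t) J" using smJ[of "- \<epsilon>"] by simp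
  have sm: "smooth_on ?\<alpha> {A<..<B}"
    by (rule smooth_on_primitive[where f' = "\<lambda>t. ((1 + \<epsilon> * p n t) / 2) *\<^sub>R v t"], erule d(1),
        rule smooth_on_subset[OF smJ open_greaterThanLessThan SJ])
  have sm': "smooth_on ?\<beta> {A<..<B}"
    by (rule smooth_on_primitive[where f' = "\<lambda>t. ((1 - \<epsilon> * p n t) / 2) *\<^sub>R v t"], erule d(2),
        rule smooth_on_subset[OF smJ' open_greaterThanLessThan SJ])
  show ?thesis
  proof (rule minface_scaled[OF mf \<Omega> J(1) X_min_zero \<gamma>_deriv \<gamma>(2) open_greaterThanLessThan SJ S d sm sm'])
    fix q assume q: "q \<in> \<Omega>"
    have "\<bar>\<epsilon> * p n (fst q + snd q)\<bar> < 1" "\<bar>\<epsilon> * p n (fst q - snd q)\<bar> < 1"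
      using S[OF q] by (auto intro!: small)
    then show "(1 + \<epsilon> * p n (fst q + snd q)) / 2 \<noteq> 0 \<and> (1 - \<epsilon> * p n (fst q - snd q)) / 2 \<noteq> 0" by auto
    show "X_min \<gamma> (L \<epsilon> n) q = ?\<alpha> (fst q + snd q) + ?\<beta> (fst q - snd q)"
      using X_min_eq[of "fst q" "snd q"] S[OF q] by simp
  qed
qed

text \<open>On a real interval around \<open>t\<close> both are primitives of the same function, so
  they differ by a constant. This links the real time-like surface with the complex data to which
  the classification applies.\<close>

lemma H_\<Lambda>:
  assumes t: "t \<in> {c..d}"
  obtains r a where "r > 0" "\<And>s. \<bar>s - t\<bar> < r \<Longrightarrow> s \<in> {A<..<B} \<and> s \<in> J \<and> complex_of_real s \<in> W"
    "\<And>s k. \<bar>s - t\<bar> < r \<Longrightarrow> H n k (of_real s) = of_real (\<Lambda> n s $ k) + a k"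
proof -
  have tJ: "t \<in> J" "of_real t \<in> W" using t I(2) I_W by auto
  have "\<forall>\<^sub>F s in nhds t. s \<in> {A<..<B}" by (rule eventually_nhds_in_open) (use t AB in auto)
  then have "\<forall>\<^sub>F s in nhds t. s \<in> {A<..<B} \<and> s \<in> J \<and> complex_of_real s \<in> W"
    using near_J[OF tJ] by eventually_elim simp
  then obtain r where r: "r > 0" "\<And>s. \<bar>s - t\<bar> < r \<Longrightarrow> s \<in> {A<..<B} \<and> s \<in> J \<and> complex_of_real s \<in> W"
    unfolding eventually_nhds_metric by (auto simp: dist_real_def)
  have "\<exists>a. \<forall>s\<in>ball t r. H n k (of_real s) - of_real (\<Lambda> n s $ k) = a" for k
  proof (rule has_derivative_zero_constant)
    fix s assume "s \<in> ball t r"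
    then have s: "s \<in> {A<..<B}" "s \<in> J" "complex_of_real s \<in> W"
      using r(2)[of s] by (auto simp: dist_real_def abs_minus_commute)
    have "((\<lambda>x. H n k (of_real x)) has_vector_derivative P n (of_real s) * D k (of_real s)) (at s within ball t r)"
      by (rule has_vector_derivative_real_field[OF H_deriv[OF s(3)]])
    moreover have "((\<lambda>x. complex_of_real (\<Lambda> n x $ k)) has_vector_derivative of_real ((p n s *\<^sub>R v s) $ k)) (at s within ball t r)"
      by (rule bounded_linear.has_vector_derivative[OF bounded_linear_compose[OF bounded_linear_of_real bounded_linear_vec_nth]])
        (rule has_vector_derivative_at_within[OF \<Lambda>_deriv[OF s(1)]])
    ultimately have "((\<lambda>x. H n k (of_real x) - of_real (\<Lambda> n x $ k)) has_vector_derivative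
        P n (of_real s) * D k (of_real s) - of_real ((p n s *\<^sub>R v s) $ k)) (at s within ball t r)"
      by (rule has_vector_derivative_diff)
    then show "((\<lambda>s. H n k (of_real s) - of_real (\<Lambda> n s $ k)) has_derivative (\<lambda>h. 0)) (at s within ball t r)"
      by (simp add: P_val D_val[OF s(2,3)] has_vector_derivative_def)
  qed simp
  then obtain a where a: "\<And>k s. s \<in> ball t r \<Longrightarrow> H n k (of_real s) - of_real (\<Lambda> n s $ k) = a k" by metis
  show thesis
  proof (rule that[OF r(1)])
    show "s \<in> {A<..<B} \<and> s \<in> J \<and> complex_of_real s \<in> W" if "\<bar>s - t\<bar> < r" for s by (rule r(2)[OF that])
    show "H n k (of_real s) = of_real (\<Lambda> n s $ k) + a k" if "\<bar>s - t\<bar> < r" for s k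
      using a[of s k] that by (simp add: dist_real_def abs_minus_commute algebra_simps)
  qed
qed

text \<open>The case \<open>\<kappa> = 1\<close>. Here the classification needs the factor to stay
  off 1 and -1, which the bound on \<open>\<epsilon> p\<close> ensures. The constants by which
  \<open>H\<close> and \<open>\<Lambda>\<close> differ cancel, since only differences of primitives
  enter the surface.\<close>

lemma crosscap_min:
  assumes t: "t \<in> {c..d}" and \<epsilon>: "\<epsilon> > 0" "\<bar>\<epsilon> * p n t\<bar> < 1"
  shows "cuspidal_crosscap_at (X_min \<gamma> (L \<epsilon> n)) (t, 0) \<longleftrightarrow> t \<in> node ` {..<n}"
proof -
  interpret B: bjorling_hol W F "\<lambda>z. \<chi> k. of_real \<epsilon> * H n k z" "\<lambda>z. of_real \<epsilon> * P n z" by (rule bjorling)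
  have tJ: "t \<in> J" "of_real t \<in> W" using t I(2) I_W by auto
  obtain r a where r: "r > 0" "\<And>s. \<bar>s - t\<bar> < r \<Longrightarrow> s \<in> {A<..<B} \<and> s \<in> J \<and> complex_of_real s \<in> W"
    and a: "\<And>s k. \<bar>s - t\<bar> < r \<Longrightarrow> H n k (of_real s) = of_real (\<Lambda> n s $ k) + a k"
    by (rule H_\<Lambda>[OF t, where n = n]) blast
  let ?X = "\<lambda>q. X_min \<gamma> (L \<epsilon> n) ((t, 0) + q)"
  have "isCont (\<lambda>q :: real \<times> real. t + fst q + snd q) 0" "isCont (\<lambda>q :: real \<times> real. t + fst q - snd q) 0"
    by (intro continuous_intros)+
  note ev = isCont_eventually[OF this(1), of "\<lambda>s. \<bar>s - t\<bar> < r"] isCont_eventually[OF this(2), of "\<lambda>s. \<bar>s - t\<bar> < r"]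
  have "\<forall>\<^sub>F s in nhds t. \<bar>s - t\<bar> < r" using eventually_abs_less[of t t r] r(1) by simp
  then have "\<forall>\<^sub>F q in nhds (0 :: real \<times> real). \<bar>(t + fst q + snd q) - t\<bar> < r" "\<forall>\<^sub>F q in nhds (0 :: real \<times> real). \<bar>(t + fst q - snd q) - t\<bar> < r"
    using ev by simp_all
  then have X: "\<forall>\<^sub>F q in nhds 0. \<forall>k. of_real (?X q $ k) =
      (F (of_real t + fst (emb q) + 1 * snd (emb q)) $ k + F (of_real t + fst (emb q) - 1 * snd (emb q)) $ k) / 2 +
      ((\<chi> k. of_real \<epsilon> * H n k (of_real t + fst (emb q) + 1 * snd (emb q))) $ k - (\<chi> k. of_real \<epsilon> * H n k (of_real t + fst (emb q) - 1 * snd (emb q))) $ k) / (2 * 1)"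
  proof eventually_elim
    case (elim q)
    have z: "of_real t + fst (emb q) + 1 * snd (emb q) = of_real (t + fst q + snd q)"
      "of_real t + fst (emb q) - 1 * snd (emb q) = of_real (t + fst q - snd q)"
      by (simp_all add: emb_def)
    have q: "(t, 0) + q = (t + fst q, snd q)" by (simp add: prod_eq_iff)
    have Xq: "?X q = (1 / 2) *\<^sub>R (\<gamma> (t + fst q + snd q) + \<epsilon> *\<^sub>R \<Lambda> n (t + fst q + snd q)) +
        (1 / 2) *\<^sub>R (\<gamma> (t + fst q - snd q) - \<epsilon> *\<^sub>R \<Lambda> n (t + fst q - snd q))"
      unfolding q by (rule X_min_eq) (use r(2) elim in blast)+
    have Fq: "F (of_real (t + fst q + snd q)) $ k = of_real (\<gamma> (t + fst q + snd q) $ k)"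
      "F (of_real (t + fst q - snd q)) $ k = of_real (\<gamma> (t + fst q - snd q) $ k)" for k
      by (rule F_val; use r(2) elim in blast)+
    show ?case
      unfolding z Xq vec_lambda_beta Fq a[OF elim(1)] a[OF elim(2)]
      by (simp add: algebra_simps add_divide_distrib diff_divide_distrib)
  qed
  have lam: "of_real \<epsilon> * P n (of_real t) = of_real (\<epsilon> * p n t)" by (simp add: P_val)
  have "(\<epsilon> * p n t)\<^sup>2 < 1" using \<epsilon>(2) by (simp add: abs_square_less_1)
  then have ne: "Re (1\<^sup>2) - (\<epsilon> * p n t)\<^sup>2 \<noteq> 0" by simp
  note cl = B.germ_classification[where \<kappa> = 1 and v = "v t" and w = "velocity v t", OF _ tJ(2) D_val[OF tJ] DD_val[OF tJ]
      v_nondeg[OF t] lam ne X]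
  note id = bounded_linear_ident[where ?'a = "real \<times> real"]
  show ?thesis
  proof (cases "p n t = 0")
    case False
    then have "\<epsilon> * p n t \<noteq> 0" using \<epsilon> by simp
    then obtain N where "open N" "0 \<in> N" "inj_on ?X N" using cl(1) by blast
    from affine_germ_injective[OF id id refl refl this] show ?thesis using False p_zero_iff by blast
  next
    case True
    then obtain i where i: "i < n" "t = node i" using p_zero_iff by blast
    have "deriv (\<lambda>z. of_real \<epsilon> * P n z) (of_real t) = of_real \<epsilon> * deriv (P n) (of_real t)"
      by (intro DERIV_imp_deriv DERIV_cmult holomorphic_derivI[OF P_hol open_UNIV UNIV_I])
    then have "deriv (\<lambda>z. of_real \<epsilon> * P n z) (of_real t) \<noteq> 0" using deriv_P_node[OF i(1)] \<epsilon>(1) i(2) by simp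
    then have "cuspidal_crosscap_at ?X 0" using cl(2) True by simp
    from affine_germ_crosscap[OF id id refl refl this] show ?thesis using True p_zero_iff by blast
  qed
qed

end

theorem theorem4p1:
  fixes \<gamma> :: "real \<Rightarrow> real ^ 3" and J :: "real set" and c d :: real
    and W \<Omega>1 :: "complex set" and \<Omega>2 :: "(real \<times> real) set"
  assumes J: "open J" "is_interval J"
    and I: "c < d" "{c..d} \<subseteq> J"
    and \<gamma>: "real_analytic_on \<gamma> J" "null_curve_on \<gamma> J"
    and W: "symmetric_sc_domain {c..d} W" "extends_hol J W \<gamma>"
    and \<Omega>1: "symmetric_sc_domain {c..d} \<Omega>1" "bounded \<Omega>1" "closure \<Omega>1 \<subseteq> W"
    and \<Omega>2: "open \<Omega>2" "simply_connected \<Omega>2" "bounded \<Omega>2"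
      "{c..d} \<times> {0} \<subseteq> \<Omega>2" "closure \<Omega>2 \<subseteq> diamond J"
    and X_max: "maxface (X_max J W \<gamma> (\<lambda>_. 0)) \<Omega>1"
    and X_min: "minface (X_min \<gamma> (\<lambda>_. 0)) \<Omega>2"
    and folded: "folded_singularity_along {c..d} J \<gamma> (\<lambda>_. 0)"
  shows "\<exists>L :: nat \<Rightarrow> real \<Rightarrow> real ^ 3.
    (\<forall>n\<ge>1.
       bjorling_data_max {c..d} J W \<gamma> (L n) \<and> bjorling_data_min J \<gamma> (L n) \<and>
       maxface (X_max J W \<gamma> (L n)) \<Omega>1 \<and> minface (X_min \<gamma> (L n)) \<Omega>2 \<and>
       finite {u \<in> {c..d}. cuspidal_crosscap_at (X_max J W \<gamma> (L n)) (complex_of_real u)} \<and>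
       {u \<in> {c..d}. cuspidal_crosscap_at (X_max J W \<gamma> (L n)) (complex_of_real u)} =
       {u \<in> {c..d}. cuspidal_crosscap_at (X_min \<gamma> (L n)) (u, 0)}) \<and>
    strict_mono_on {1..}
      (\<lambda>n. card {u \<in> {c..d}. cuspidal_crosscap_at (X_max J W \<gamma> (L n)) (complex_of_real u)}) \<and>
    (\<lambda>n. sup_norm_on \<Omega>1 (\<lambda>z. X_max J W \<gamma> (L n) z - X_max J W \<gamma> (\<lambda>_. 0) z)) \<longlonglongrightarrow> 0 \<and>
    (\<lambda>n. sup_norm_on \<Omega>2 (\<lambda>p. X_min \<gamma> (L n) p - X_min \<gamma> (\<lambda>_. 0) p)) \<longlonglongrightarrow> 0"
proof -
  have bdd: "\<exists>r. \<forall>x\<in>S. norm (f x) \<le> r" if "compact S" "continuous_on S f"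
    for S :: "'x::topological_space set" and f :: "'x \<Rightarrow> 'y::real_normed_vector"
    using compact_imp_bounded[OF compact_continuous_image[OF that(2,1)]] unfolding bounded_iff by blast
  have nd: "nondegenerate_on \<gamma> {c..d}" using folded by (simp add: folded_singularity_along_def)
  \<comment> \<open>All parameters that the time-like surface evaluates on the closed domain, a
    compact subset of \<open>J\<close>.\<close>
  define K where "K = {c..d} \<union> ((\<lambda>q. fst q + snd q) ` closure \<Omega>2 \<union> (\<lambda>q. fst q - snd q) ` closure \<Omega>2)"
  have "compact (closure \<Omega>2)" using \<Omega>2(3) by (simp add: compact_closure)
  then have K: "compact K"
    unfolding K_def by (intro compact_Un compact_Icc compact_continuous_image continuous_intros)
  have KJ: "K \<subseteq> J" using \<Omega>2(5) I(2) unfolding K_def diamond_def by auto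
  have cd: "c \<in> K" "d \<in> K" using I(1) by (auto simp: K_def)
  obtain m where m: "m \<in> K" "\<And>x. x \<in> K \<Longrightarrow> m \<le> x" using compact_attains_inf[OF K] cd by blast
  obtain M where M: "M \<in> K" "\<And>x. x \<in> K \<Longrightarrow> x \<le> M" using compact_attains_sup[OF K] cd by blast
  obtain e where e: "e > 0" "ball m e \<subseteq> J" using openE[OF J(1)] m(1) KJ by blast
  obtain e' where e': "e' > 0" "ball M e' \<subseteq> J" using openE[OF J(1)] M(1) KJ by blast
  \<comment> \<open>Enlarging the extremes of \<open>K\<close> within the open set \<open>J\<close>
    puts \<open>K\<close> into the open interval from \<open>A\<close> to \<open>B\<close>.\<close>
  define A where "A = m - e / 2"
  define B where "B = M + e' / 2"
  have "A \<in> ball m e" "B \<in> ball M e'" using e(1) e'(1) by (simp_all add: A_def B_def dist_real_def)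
  then have "A \<in> J" "B \<in> J" using e(2) e'(2) by blast+
  then have AB: "{A..B} \<subseteq> J" using J(2) unfolding is_interval_1 by (meson atLeastAtMost_iff subsetI)
  have KAB: "x \<in> {A<..<B}" if "x \<in> K" for x using m(2)[OF that] M(2)[OF that] e(1) e'(1) by (simp add: A_def B_def)
  then have AcdB: "A < c" "d < B" using cd by auto
  interpret N: null_curve_setting2 \<gamma> J c d W A B
    by (intro null_curve_setting2.intro null_curve_setting.intro null_curve_setting2_axioms.intro J I \<gamma> W nd AB AcdB)
  have S: "fst q + snd q \<in> {A<..<B} \<and> fst q - snd q \<in> {A<..<B}" if "q \<in> closure \<Omega>2" for q
    using that by (intro conjI KAB) (auto simp: K_def)
  \<comment> \<open>One bound per \<open>n\<close> for the polynomial and for both primitives, on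
    compact sets and independent of \<open>\<epsilon>\<close>. The polynomial bounds keep the
    surfaces regular, those for the primitives control their distance.\<close>
  have "\<exists>r. (\<forall>z\<in>closure \<Omega>1. cmod (N.P n z) \<le> r \<and> (\<forall>k. \<bar>Im (N.H n k z)\<bar> \<le> r)) \<and>
      (\<forall>t\<in>{A..B}. \<bar>N.p n t\<bar> \<le> r \<and> (\<forall>k. \<bar>N.\<Lambda> n t $ k\<bar> \<le> r))" for n
  proof -
    have c1: "compact (closure \<Omega>1)" using \<Omega>1(2) by (simp add: compact_closure)
    obtain b1 where b1: "\<forall>z\<in>closure \<Omega>1. cmod (N.P n z) \<le> b1"
      using bdd[OF c1 holomorphic_on_imp_continuous_on[OF N.P_hol]] by blast
    have "\<exists>b. \<forall>z\<in>closure \<Omega>1. cmod (N.H n k z) \<le> b" for k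
      by (rule bdd[OF c1 continuous_on_subset[OF holomorphic_on_imp_continuous_on[OF N.H_hol] \<Omega>1(3)]])
    then obtain b2 where b2: "\<And>k. \<forall>z\<in>closure \<Omega>1. cmod (N.H n k z) \<le> b2 k" by metis
    have "continuous_on {A..B} (N.p n)" unfolding N.p_def by (intro continuous_intros)
    then obtain b3 where b3: "\<forall>t\<in>{A..B}. norm (N.p n t) \<le> b3" using bdd[OF compact_Icc] by blast
    have "continuous_on {A..B} (N.\<Lambda> n)"
      unfolding continuous_on_eq_continuous_within
      using has_vector_derivative_continuous[OF N.\<Lambda>_within] by blast
    then obtain b4 where b4: "\<forall>t\<in>{A..B}. norm (N.\<Lambda> n t) \<le> b4" using bdd[OF compact_Icc] by blast
    define r where "r = \<bar>b1\<bar> + (\<Sum>k\<in>UNIV. \<bar>b2 k\<bar>) + \<bar>b3\<bar> + \<bar>b4\<bar>"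
    have s: "\<bar>b2 k\<bar> \<le> (\<Sum>k\<in>UNIV. \<bar>b2 k\<bar>)" for k by (rule member_le_sum) auto
    have s0: "0 \<le> (\<Sum>k\<in>UNIV. \<bar>b2 k\<bar>)" by (simp add: sum_nonneg)
    have r1: "b1 \<le> r" "b3 \<le> r" "b4 \<le> r" using s0 unfolding r_def by linarith+
    have r2: "b2 k \<le> r" for k using s[of k] unfolding r_def by linarith
    show ?thesis
    proof (intro exI[of _ r] conjI ballI allI)
      show "cmod (N.P n z) \<le> r" if "z \<in> closure \<Omega>1" for z
        by (rule order_trans[OF bspec[OF b1 that] r1(1)])
      show "\<bar>Im (N.H n k z)\<bar> \<le> r" if "z \<in> closure \<Omega>1" for k z
        by (rule order_trans[OF abs_Im_le_cmod order_trans[OF bspec[OF b2 that] r2]])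
      show "\<bar>N.p n t\<bar> \<le> r" if "t \<in> {A..B}" for t
        using bspec[OF b3 that] r1(2) by simp
      show "\<bar>N.\<Lambda> n t $ k\<bar> \<le> r" if "t \<in> {A..B}" for k t
        by (rule order_trans[OF component_le_norm_cart order_trans[OF bspec[OF b4 that] r1(3)]])
    qed
  qed
  then obtain b where b: "\<And>n z. z \<in> closure \<Omega>1 \<Longrightarrow> cmod (N.P n z) \<le> b n"
    "\<And>n z k. z \<in> closure \<Omega>1 \<Longrightarrow> \<bar>Im (N.H n k z)\<bar> \<le> b n"
    "\<And>n t. t \<in> {A..B} \<Longrightarrow> \<bar>N.p n t\<bar> \<le> b n" "\<And>n t k. t \<in> {A..B} \<Longrightarrow> \<bar>N.\<Lambda> n t $ k\<bar> \<le> b n"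
    by metis
  have b0: "0 \<le> b n" for n using b(3)[of c n] AcdB I(1) by fastforce
  \<comment> \<open>Makes every scaled quantity at most \<open>1 / (2 * Suc n)\<close>. The summand
    1 keeps the denominator positive if \<open>b n\<close> is 0, and the factor 2 makes the bound
    strictly smaller than 1 already for \<open>n = 0\<close>.\<close>
  define \<epsilon> where "\<epsilon> n = 1 / (2 * real (Suc n) * (b n + 1))" for n
  have pos: "\<epsilon> n > 0" for n using b0[of n] by (simp add: \<epsilon>_def)
  have small: "\<bar>\<epsilon> n * y\<bar> \<le> inverse (real (Suc n)) / 2" if "\<bar>y\<bar> \<le> b n" for n y
  proof -
    have "\<bar>\<epsilon> n * y\<bar> = \<epsilon> n * \<bar>y\<bar>" using pos[of n] by (simp add: abs_mult)
    also have "\<dots> \<le> \<epsilon> n * (b n + 1)" using pos[of n] that by (intro mult_left_mono) auto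
    also have "\<dots> = inverse (real (Suc n)) / 2" using b0[of n] by (simp add: \<epsilon>_def divide_simps)
    finally show ?thesis .
  qed
  have "inverse (real (Suc n)) \<le> 1" for n by (simp add: inverse_le_1_iff)
  then have small1: "\<bar>\<epsilon> n * y\<bar> < 1" if "\<bar>y\<bar> \<le> b n" for n y
    using small[OF that] by (smt (verit) field_sum_of_halves)
  define L where "L n = N.L (\<epsilon> n) n" for n
  have cIAB: "t \<in> {A..B}" if "t \<in> {c..d}" for t using that AcdB by auto
  have max_pts: "{u \<in> {c..d}. cuspidal_crosscap_at (X_max J W \<gamma> (L n)) (complex_of_real u)} = N.node ` {..<n}" for n
    using N.crosscap_max[OF _ pos, of _ n n] N.node_mem unfolding L_def by blast
  have "cuspidal_crosscap_at (X_min \<gamma> (L n)) (u, 0) \<longleftrightarrow> u \<in> N.node ` {..<n}" if "u \<in> {c..d}" for u n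
    unfolding L_def by (rule N.crosscap_min[OF that pos small1[OF b(3)[OF cIAB[OF that]]]])
  then have min_pts: "{u \<in> {c..d}. cuspidal_crosscap_at (X_min \<gamma> (L n)) (u, 0)} = N.node ` {..<n}" for n
    using N.node_mem by blast
  have card: "card (N.node ` {..<n}) = n" for n
    using card_image[OF inj_on_subset[OF N.node_inj subset_UNIV]] by simp
  have ne: "\<Omega>1 \<noteq> {}" "\<Omega>2 \<noteq> {}" using \<Omega>1(1) \<Omega>2(4) I(1) by (auto simp: symmetric_sc_domain_def)
  have sub: "\<Omega>1 \<subseteq> W" "\<Omega>2 \<subseteq> diamond J" using closure_subset \<Omega>1(3) \<Omega>2(5) by blast+
  have mx: "maxface (X_max J W \<gamma> (L n)) \<Omega>1" for n
    unfolding L_def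
  proof (rule N.maxface_L[OF X_max sub(1)])
    fix z assume "z \<in> \<Omega>1"
    then have "cmod (N.P n z) \<le> b n" using b(1) closure_subset by blast
    then show "cmod (of_real (\<epsilon> n) * N.P n z) < 1"
      using small1[of "cmod (N.P n z)" n] pos[of n] by (simp add: norm_mult)
  qed
  have mn: "minface (X_min \<gamma> (L n)) \<Omega>2" for n
    unfolding L_def
  proof (rule N.minface_L[OF X_min sub(2) \<Omega>2(1)])
    show "fst q + snd q \<in> {A<..<B} \<and> fst q - snd q \<in> {A<..<B}" if "q \<in> \<Omega>2" for q
      using S that closure_subset by blast
    show "\<bar>\<epsilon> n * N.p n t\<bar> < 1" if "t \<in> {A..B}" for t by (rule small1[OF b(3)[OF that]])
  qed
  have dmax: "bjorling_data_max {c..d} J W \<gamma> (L n)" for n unfolding L_def by (rule N.data_max)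
  have dmin: "bjorling_data_min J \<gamma> (L n)" for n
    unfolding L_def by (rule N.data_min[OF small1[OF b(3)]]) (use AcdB I(1) in auto)
  have "\<bar>sup_norm_on \<Omega>1 (\<lambda>z. X_max J W \<gamma> (L n) z - X_max J W \<gamma> (\<lambda>_. 0) z)\<bar> \<le> inverse (real (Suc n))" for n
  proof (rule sup_norm_on_bound[OF ne(1)])
    fix z k assume z: "z \<in> closure \<Omega>1"
    then have zW: "z \<in> W" using \<Omega>1(3) by blast
    \<comment> \<open>The unperturbed surface is the instance of the same formula with scaling
      factor 0, so only the correction term remains.\<close>
    have "X_max J W \<gamma> (L n) z $ k - X_max J W \<gamma> (\<lambda>_. 0) z $ k = \<epsilon> n * Im (N.H n k z)"
      using N.X_max_eq[OF zW, of "\<epsilon> n" n k] N.X_max_eq[OF zW, of 0 0 k] by (simp add: L_def N.L_0)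
    then show "\<bar>(X_max J W \<gamma> (L n) z - X_max J W \<gamma> (\<lambda>_. 0) z) $ k\<bar> \<le> inverse (real (Suc n))"
      using small[OF b(2)[OF z], of n k] by (simp add: field_simps)
  qed
  then have lim1: "(\<lambda>n. sup_norm_on \<Omega>1 (\<lambda>z. X_max J W \<gamma> (L n) z - X_max J W \<gamma> (\<lambda>_. 0) z)) \<longlonglongrightarrow> 0"
    by (intro Lim_null_comparison[OF always_eventually LIMSEQ_inverse_real_of_nat] allI) simp
  have half_diff: "\<bar>(x - y) / 2\<bar> \<le> r" if "\<bar>x\<bar> \<le> r / 2" "\<bar>y\<bar> \<le> r / 2" for x y r :: real
  proof -
    have half: "u / 2 \<le> r" if "u \<le> a + b" "0 \<le> a" "a \<le> r / 2" "b \<le> r / 2" for u a b :: real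
      using that by linarith
    have "\<bar>(x - y) / 2\<bar> = \<bar>x - y\<bar> / 2" by simp
    also have "\<dots> \<le> r" by (rule half[OF abs_triangle_ineq4 abs_ge_zero that])
    finally show ?thesis .
  qed
  have "\<bar>sup_norm_on \<Omega>2 (\<lambda>q. X_min \<gamma> (L n) q - X_min \<gamma> (\<lambda>_. 0) q)\<bar> \<le> inverse (real (Suc n))" for n
  proof (rule sup_norm_on_bound[OF ne(2)])
    fix q k assume q: "q \<in> closure \<Omega>2"
    let ?s = "fst q + snd q" and ?t = "fst q - snd q"
    note Sq = S[OF q]
    then have AB: "?s \<in> {A..B}" "?t \<in> {A..B}" by auto
    have Xq: "X_min \<gamma> (L n) q = (1 / 2) *\<^sub>R (\<gamma> ?s + \<epsilon> n *\<^sub>R N.\<Lambda> n ?s) + (1 / 2) *\<^sub>R (\<gamma> ?t - \<epsilon> n *\<^sub>R N.\<Lambda> n ?t)"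
      using N.X_min_eq[of "fst q" "snd q" "\<epsilon> n" n] Sq by (simp add: L_def)
    \<comment> \<open>The curve terms cancel, which leaves half the increment of the scaled
      primitive between the two characteristic parameters.\<close>
    have "(X_min \<gamma> (L n) q - X_min \<gamma> (\<lambda>_. 0) q) $ k = (\<epsilon> n * N.\<Lambda> n ?s $ k - \<epsilon> n * N.\<Lambda> n ?t $ k) / 2"
      unfolding Xq N.X_min_zero
      by (simp only: vector_add_component vector_minus_component vector_scaleR_component) (simp add: field_simps)
    also have "\<bar>\<dots>\<bar> \<le> inverse (real (Suc n))"
      by (rule half_diff[OF small[OF b(4)[OF AB(1)]] small[OF b(4)[OF AB(2)]]])
    finally show "\<bar>(X_min \<gamma> (L n) q - X_min \<gamma> (\<lambda>_. 0) q) $ k\<bar> \<le> inverse (real (Suc n))" .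
  qed
  then have lim2: "(\<lambda>n. sup_norm_on \<Omega>2 (\<lambda>q. X_min \<gamma> (L n) q - X_min \<gamma> (\<lambda>_. 0) q)) \<longlonglongrightarrow> 0"
    by (intro Lim_null_comparison[OF always_eventually LIMSEQ_inverse_real_of_nat] allI) simp
  show ?thesis
  proof (intro exI[of _ L] conjI allI impI)
    show "finite {u \<in> {c..d}. cuspidal_crosscap_at (X_max J W \<gamma> (L n)) (complex_of_real u)}" for n
      unfolding max_pts by simp
    show "{u \<in> {c..d}. cuspidal_crosscap_at (X_max J W \<gamma> (L n)) (complex_of_real u)} =
        {u \<in> {c..d}. cuspidal_crosscap_at (X_min \<gamma> (L n)) (u, 0)}" for n
      unfolding max_pts min_pts ..
    show "strict_mono_on {1..}
        (\<lambda>n. card {u \<in> {c..d}. cuspidal_crosscap_at (X_max J W \<gamma> (L n)) (complex_of_real u)})"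
      unfolding max_pts card by (simp add: strict_mono_on_def)
  qed (rule dmax dmin mx mn lim1 lim2)+
qed

end
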